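(* If $h\in\mathcal H$, then the extension $f:\mathbb D\to\mathbb D$ of $h:\mathbb T\to\mathbb T$ constructed cell by cell along the dual tree (as defined in the context) is quasiconformal.
   Context: Farey tessellation: $\mathbb D$ is the unit disk with its hyperbolic metric, $\mathbb T=\partial\mathbb D$, and $(a,b)$ denotes the unoriented hyperbolic geodesic with endpoints $a\ne b$. The Farey tessellation $\mathfrak F$ is the ideal triangulation of $\mathbb D$ obtained from the ideal triangle with vertices $1,\mathrm i,-1$ by repeated hyperbolic reflections across edges; $V$ is its vertex set, $E$ its edge set. For $e\in E$, $Q_e$ is the union of the two triangles of $\mathfrak F$ having $e$ as an edge, with vertices $(a,b,c,d)$ counterclockwise, $e=(a,c)$. For $v\in V$, $\mathrm{fan}(v)$ is the set of edges incident to $v$, indexed $(e_n)_{n\in\mathbb Z}$ so that under a Möbius map $\mathbb D\to\mathbb H$ sending $v$ to $\infty$ the $e_n$ become equally spaced vertical lines with $n$ increasing from left to right. Shears: all circle homeomorphisms are orientation preserving and fix $-1,\mathrm i,1$; $s_h(e)=\log\mathrm{cr}(h(a),h(b),h(c),h(d))$ where $Q_e=(a,b,c,d)$, $e=(a,c)$, $\mathrm{cr}(a,b,c,d)=\frac{(b-a)(d-c)}{(c-b)(d-a)}$. $\mathcal P$ is the set of $s:E\to\mathbb R$ such that for every $v\in V$, $\mathrm{fan}(v)=(e_n)$, both limits $\lim_n\sum_{k=-n}^{-1}s(e_k)$ and $\lim_n\sum_{k=0}^n s(e_k)$ exist in $\mathbb R$. For $s\in\mathcal P$ and $e\in\mathrm{fan}(v)$,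 $p_{s,v}(e\pm)$ is the sum of $s(e')$ over $e'\in\mathrm{fan}(v)$ of strictly larger ($+$) or strictly smaller ($-$) index than $e$. For $e=(a,b)\in E$, $\Psi(s)(e)=\frac14(p_{s,a}(e-)-p_{s,a}(e+)+p_{s,b}(e-)-p_{s,b}(e+))$. $h\in\mathcal H$ means $s_h\in\mathcal P$ and $\sum_{e\in E}\Psi(s_h)(e)^2<\infty$; this implies that $\sum_{n\in\mathbb Z}s_h(e_n)=0$ in every fan. Construction of $f$. Let $h(\mathfrak F)$ be the ideal tessellation with triangles $h(\tau)$ (vertices the $h$-images of the vertices of $\tau\in\mathfrak F$). Embed the dual tree $\mathfrak F^*$ in $\mathbb D$ with vertices at the hyperbolic centers of the triangles of $\mathfrak F$ and edges the geodesic segments joining centers of adjacent triangles; let $h(\mathfrak F^* )$ be the analogous embedded dual tree of $h(\mathfrak F)$. On $\mathfrak F^*$, $f$ is the hyperbolic stretching map $F_h:\mathfrak F^*\to h(\mathfrak F^* )$: it sends the center of $\tau$ to the center of $h(\tau)$ and each geodesic edge to the corresponding geodesic edge, linearly in hyperbolic length. Each component of $\mathbb D\smallsetminus\mathfrak F^*$ is a cell $C_v$ corresponding to exactly one $v\in V$ (the vertex on its boundary). Fix $v$ and $\mathrm{fan}(v)=(e_n)$. Let $\mathfrak c_1,\mathfrak c_2:\mathbb D\to\mathbb H$ be the Möbius maps with $\mathfrak c_1(v)=\infty$, $\mathfrak c_1(e_0)=(0,\infty)$, $\mathfrak c_1(e_{-1})=(-1,\infty)$ and $\mathfrak c_2(h(v))=\infty$,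 $\mathfrak c_2(h(e_0))=(0,\infty)$, $\mathfrak c_2(h(e_{-1}))=(-1,\infty)$, and let $M=\sum_{i=0}^\infty s_h(e_i)$. Then $\mathfrak c_1(C_v)$ is the region above the graph of $u$, where $u(x)=\sqrt{1-(x-n)^2}$ for $x\in[n-\frac12,n+\frac12]$, $n\in\mathbb Z$. Define $\alpha,\beta:\mathbb R\to\mathbb R$ by $e^{-M}\,\mathfrak c_2\circ F_h\circ\mathfrak c_1^{-1}(x+\mathrm iu(x))=\alpha(x)+\mathrm i\beta(x)$, set $\psi(x+\mathrm iy)=\alpha(x)+\mathrm i(\beta(x)-u(x)+y)$ for $y\ge u(x)$, and let $f=\mathfrak c_2^{-1}\circ(e^M\psi)\circ\mathfrak c_1$ on $C_v$. Doing this for all $v\in V$ defines $f:\mathbb D\to\mathbb D$, which extends $h$. *)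

theory Defs
  imports "HOL-Complex_Analysis.Complex_Analysis"
begin

section \<open>The Farey tessellation\<close>

text \<open>
  Ideal triangles are represented by their sets of ideal vertices, and an unoriented geodesic
  \<open>(a,b)\<close> by the set \<open>{a,b}\<close> of its endpoints on the unit circle.

  The reflection in the geodesic \<open>(a,b)\<close>: the anti-Moebius map of the disk fixing \<open>a\<close> and \<open>b\<close>.
  If \<open>a + b \<noteq> 0\<close> it is the inversion in the circle with centre \<open>2ab/(a+b)\<close> orthogonal to the
  unit circle; if \<open>b = -a\<close> it is \<open>z \<mapsto> a\<^sup>2 cnj z\<close>, the reflection in the line through \<open>a\<close>.
\<close>
definition hyp_reflection :: "complex \<Rightarrow> complex \<Rightarrow> complex \<Rightarrow> complex" where
  "hyp_reflection a b z = (2 * a * b * cnj z - (a + b)) / ((a + b) * cnj z - 2)"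

inductive_set farey_triangles :: "complex set set" where
  base: "{1, \<i>, -1} \<in> farey_triangles"
| reflect: "T \<in> farey_triangles \<Longrightarrow> a \<in> T \<Longrightarrow> b \<in> T \<Longrightarrow> a \<noteq> b \<Longrightarrow>
    hyp_reflection a b ` T \<in> farey_triangles"

definition farey_vertices :: "complex set" where
  "farey_vertices = \<Union>farey_triangles"

definition farey_edges :: "complex set set" where
  "farey_edges = {{a, b} |a b. a \<noteq> b \<and> (\<exists>T\<in>farey_triangles. a \<in> T \<and> b \<in> T)}"

definition fan :: "complex \<Rightarrow> complex set set" where
  "fan v = {e \<in> farey_edges. v \<in> e}"

text \<open>For points of the unit circle: \<open>a, b, c\<close> are distinct and in counterclockwise order.\<close>
definition ccw :: "complex \<Rightarrow> complex \<Rightarrow> complex \<Rightarrow> bool" where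
  "ccw a b c \<longleftrightarrow> Im (cnj (b - a) * (c - a)) > 0"

text \<open>\<open>Q\<^sub>e = (a,b,c,d)\<close>; for a given \<open>e\<close> the quadruple is unique up to \<open>(a,b,c,d) \<mapsto> (c,d,a,b)\<close>.\<close>
definition farey_quad :: "complex set \<Rightarrow> complex \<Rightarrow> complex \<Rightarrow> complex \<Rightarrow> complex \<Rightarrow> bool" where
  "farey_quad e a b c d \<longleftrightarrow> e = {a, c} \<and> {a, b, c} \<in> farey_triangles \<and>
     {a, c, d} \<in> farey_triangles \<and> ccw a b c \<and> ccw a c d"

text \<open>
  Moebius maps from the disk onto the upper half-plane with \<open>v \<mapsto> \<infinity>\<close>, i.e. with their pole at \<open>v\<close>.
  (As a total function such a map has the junk value \<open>0\<close> at \<open>v\<close>, which is never used.)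
\<close>
definition half_plane_moebius :: "complex \<Rightarrow> (complex \<Rightarrow> complex) \<Rightarrow> bool" where
  "half_plane_moebius v m \<longleftrightarrow>
     (\<exists>p q r s. p * s - q * r \<noteq> 0 \<and> m = moebius p q r s \<and> r * v + s = 0) \<and>
     m ` ball 0 1 = {z. Im z > 0}"

text \<open>
  \<open>w\<close> indexes the fan of \<open>v\<close> by \<open>e\<^sub>n = {v, w n}\<close>. Such a \<open>w\<close> is unique up to a shift of \<open>n\<close>.
\<close>
definition fan_indexing :: "complex \<Rightarrow> (int \<Rightarrow> complex) \<Rightarrow> bool" where
  "fan_indexing v w \<longleftrightarrow> bij_betw (\<lambda>n. {v, w n}) UNIV (fan v) \<and>
     (\<exists>m x d. half_plane_moebius v m \<and> d > 0 \<and>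
        (\<forall>n. m (w n) = complex_of_real (x + of_int n * d)))"


section \<open>Shears and the class of circle homeomorphisms\<close>

definition circle_homeo :: "(complex \<Rightarrow> complex) \<Rightarrow> bool" where
  "circle_homeo h \<longleftrightarrow>
     (\<exists>g. homeomorphism (sphere 0 1) (sphere 0 1) h g) \<and>
     (\<forall>a\<in>sphere 0 1. \<forall>b\<in>sphere 0 1. \<forall>c\<in>sphere 0 1. ccw a b c \<longrightarrow> ccw (h a) (h b) (h c)) \<and>
     h (-1) = -1 \<and> h \<i> = \<i> \<and> h 1 = 1"

definition cross_ratio :: "complex \<Rightarrow> complex \<Rightarrow> complex \<Rightarrow> complex \<Rightarrow> complex" where
  "cross_ratio a b c d = ((b - a) * (d - c)) / ((c - b) * (d - a))"

text \<open>
  The cross ratio of four points in counterclockwise order on the circle is a positive real, and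
  it is invariant under \<open>(a,b,c,d) \<mapsto> (c,d,a,b)\<close>, so the value does not depend on the quadruple.
\<close>
definition shear :: "(complex \<Rightarrow> complex) \<Rightarrow> complex set \<Rightarrow> real" where
  "shear h e = (THE r. \<exists>a b c d. farey_quad e a b c d \<and>
                  r = ln (Re (cross_ratio (h a) (h b) (h c) (h d))))"

definition shear_class_P :: "(complex set \<Rightarrow> real) set" where
  "shear_class_P = {s. \<forall>v\<in>farey_vertices. \<forall>w. fan_indexing v w \<longrightarrow>
      convergent (\<lambda>n::nat. \<Sum>k = - int n..-1. s {v, w k}) \<and>
      convergent (\<lambda>n::nat. \<Sum>k = 0..int n. s {v, w k})}"

text \<open>The unique indexing of the fan of \<open>v\<close> in which \<open>e\<close> has index \<open>0\<close>.\<close>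
definition fan_from :: "complex \<Rightarrow> complex set \<Rightarrow> int \<Rightarrow> complex" where
  "fan_from v e = (THE w. fan_indexing v w \<and> e = {v, w 0})"

definition p_plus :: "(complex set \<Rightarrow> real) \<Rightarrow> complex \<Rightarrow> complex set \<Rightarrow> real" where
  "p_plus s v e = lim (\<lambda>n::nat. \<Sum>k = 1..int n. s {v, fan_from v e k})"

definition p_minus :: "(complex set \<Rightarrow> real) \<Rightarrow> complex \<Rightarrow> complex set \<Rightarrow> real" where
  "p_minus s v e = lim (\<lambda>n::nat. \<Sum>k = - int n..-1. s {v, fan_from v e k})"

text \<open>The sum is over the two endpoints of the edge.\<close>
definition Psi :: "(complex set \<Rightarrow> real) \<Rightarrow> complex set \<Rightarrow> real" where
  "Psi s e = (\<Sum>v\<in>e. p_minus s v e - p_plus s v e) / 4"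

definition homeo_class_H :: "(complex \<Rightarrow> complex) set" where
  "homeo_class_H = {h. circle_homeo h \<and> shear h \<in> shear_class_P \<and>
      (\<lambda>e. (Psi (shear h) e)\<^sup>2) summable_on farey_edges}"


section \<open>Dual trees and the hyperbolic stretching map\<close>

text \<open>The hyperbolic distance of the disk (curvature \<open>-1\<close>).\<close>
definition hyp_dist :: "complex \<Rightarrow> complex \<Rightarrow> real" where
  "hyp_dist z w = 2 * artanh (norm (Moebius_function 0 w z))"

text \<open>The point dividing the geodesic segment from \<open>p\<close> to \<open>q\<close> in the ratio \<open>t : 1 - t\<close>.\<close>
definition hyp_point :: "complex \<Rightarrow> complex \<Rightarrow> real \<Rightarrow> complex" where
  "hyp_point p q t = (THE z. z \<in> ball 0 1 \<and> hyp_dist p z = t * hyp_dist p q \<and>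
                              hyp_dist z q = (1 - t) * hyp_dist p q)"

text \<open>
  The hyperbolic centre of an ideal triangle: the regular ideal triangle, whose vertices are the
  cube roots of unity, has centre \<open>0\<close>, and isometries of the disk preserve centres. The map
  \<open>Moebius_function t z\<close> is the disk automorphism sending \<open>z\<close> to \<open>0\<close>, up to a rotation.
\<close>
definition hyp_center :: "complex set \<Rightarrow> complex" where
  "hyp_center T = (THE z. z \<in> ball 0 1 \<and>
     (\<exists>t. Moebius_function t z ` T = {1, cis (2 * pi / 3), cis (4 * pi / 3)}))"

definition adjacent :: "complex set \<Rightarrow> complex set \<Rightarrow> bool" where
  "adjacent T T' \<longleftrightarrow> T \<in> farey_triangles \<and> T' \<in> farey_triangles \<and> T \<noteq> T' \<and> T \<inter> T' \<in> farey_edges"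

definition dual_tree :: "complex set" where
  "dual_tree = {hyp_point (hyp_center T) (hyp_center T') t |T T' t. adjacent T T' \<and> t \<in> {0..1}}"

definition stretch_map :: "(complex \<Rightarrow> complex) \<Rightarrow> complex \<Rightarrow> complex" where
  "stretch_map h z = (THE w. \<exists>T T' t. adjacent T T' \<and> t \<in> {0..1} \<and>
      z = hyp_point (hyp_center T) (hyp_center T') t \<and>
      w = hyp_point (hyp_center (h ` T)) (hyp_center (h ` T')) t)"


section \<open>The extension, cell by cell\<close>

definition cell :: "complex \<Rightarrow> complex set" where
  "cell v = (THE C. C \<in> components (ball 0 1 - dual_tree) \<and> v \<in> frontier C)"

text \<open>The Moebius map from the disk onto the upper half-plane with \<open>v \<mapsto> \<infinity>\<close>, \<open>p \<mapsto> 0\<close>, \<open>q \<mapsto> -1\<close>.\<close>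
definition chart :: "complex \<Rightarrow> complex \<Rightarrow> complex \<Rightarrow> complex \<Rightarrow> complex" where
  "chart v p q = (THE m. half_plane_moebius v m \<and> m p = 0 \<and> m q = -1)"

text \<open>At half-integers both nearest integers give the same value.\<close>
definition scallop :: "real \<Rightarrow> real" where
  "scallop x = sqrt (1 - (x - of_int (round x))\<^sup>2)"

text \<open>The extension on the cell of \<open>v\<close>, computed with the indexing \<open>w\<close> of the fan of \<open>v\<close>.\<close>
definition cell_map ::
  "(complex \<Rightarrow> complex) \<Rightarrow> complex \<Rightarrow> (int \<Rightarrow> complex) \<Rightarrow> complex \<Rightarrow> complex" where
  "cell_map h v w z =
    (let c1 = chart v (w 0) (w (-1));
         c2 = chart (h v) (h (w 0)) (h (w (-1)));
         M = lim (\<lambda>n::nat. \<Sum>k = 0..int n. shear h {v, w k});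
         u = scallop;
         \<gamma> = (\<lambda>x. complex_of_real (exp (- M)) *
                c2 (stretch_map h (inv_into (ball 0 1) c1 (Complex x (u x)))));
         \<alpha> = (\<lambda>x. Re (\<gamma> x));
         \<beta> = (\<lambda>x. Im (\<gamma> x));
         \<psi> = (\<lambda>\<zeta>. Complex (\<alpha> (Re \<zeta>)) (\<beta> (Re \<zeta>) - u (Re \<zeta>) + Im \<zeta>))
     in inv_into (ball 0 1) c2 (complex_of_real (exp M) * \<psi> (c1 z)))"

text \<open>
  Shifting the index of \<open>w\<close> does not change \<open>cell_map h v w\<close>, so the choice of \<open>w\<close> is immaterial.
\<close>
definition farey_extension :: "(complex \<Rightarrow> complex) \<Rightarrow> complex \<Rightarrow> complex" where
  "farey_extension h z =
    (if z \<in> dual_tree then stretch_map h z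
     else let v = (THE v. v \<in> farey_vertices \<and> z \<in> cell v)
          in cell_map h v (SOME w. fan_indexing v w) z)"


section \<open>Quasiconformal maps\<close>

definition absolutely_continuous_path :: "real \<Rightarrow> real \<Rightarrow> (real \<Rightarrow> complex) \<Rightarrow> bool" where
  "absolutely_continuous_path a b g \<longleftrightarrow>
     (\<forall>\<epsilon>>0. \<exists>\<delta>>0. \<forall>I. finite I \<and> (\<forall>(s, t)\<in>I. a \<le> s \<and> s \<le> t \<and> t \<le> b) \<and>
        disjoint_family_on (\<lambda>(s, t). {s<..<t}) I \<and> (\<Sum>(s, t)\<in>I. t - s) < \<delta> \<longrightarrow>
        (\<Sum>(s, t)\<in>I. norm (g t - g s)) < \<epsilon>)"

definition ACL_on :: "complex set \<Rightarrow> (complex \<Rightarrow> complex) \<Rightarrow> bool" where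
  "ACL_on U f \<longleftrightarrow> (\<forall>a b c d. cbox (Complex a c) (Complex b d) \<subseteq> U \<longrightarrow>
     (AE y in lebesgue. y \<in> {c..d} \<longrightarrow> absolutely_continuous_path a b (\<lambda>x. f (Complex x y))) \<and>
     (AE x in lebesgue. x \<in> {a..b} \<longrightarrow> absolutely_continuous_path c d (\<lambda>y. f (Complex x y))))"

text \<open>
  The analytic definition: a homeomorphism that is absolutely continuous on lines, with
  \<open>\<bar>f\<^sub>z\<^sub>b\<^sub>a\<^sub>r\<bar> \<le> k \<bar>f\<^sub>z\<bar>\<close> almost everywhere for some \<open>k < 1\<close>, where \<open>f\<^sub>z = (f\<^sub>x - \<i> f\<^sub>y) / 2\<close> and
  \<open>f\<^sub>z\<^sub>b\<^sub>a\<^sub>r = (f\<^sub>x + \<i> f\<^sub>y) / 2\<close>. The map is \<open>K\<close>-quasiconformal with \<open>K = (1 + k) / (1 - k)\<close>.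
\<close>
definition quasiconformal :: "complex set \<Rightarrow> complex set \<Rightarrow> (complex \<Rightarrow> complex) \<Rightarrow> bool" where
  "quasiconformal U W f \<longleftrightarrow>
     (\<exists>g. homeomorphism U W f g) \<and> ACL_on U f \<and>
     (\<exists>k. 0 \<le> k \<and> k < 1 \<and>
       (AE z in lebesgue. z \<in> U \<longrightarrow>
         (\<exists>fx fy. ((\<lambda>x. f (Complex x (Im z))) has_vector_derivative fx) (at (Re z)) \<and>
                  ((\<lambda>y. f (Complex (Re z) y)) has_vector_derivative fy) (at (Im z)) \<and>
                  norm ((fx + \<i> * fy) / 2) \<le> k * norm ((fx - \<i> * fy) / 2))))"

end

theory Submission
  imports Defs
begin

text \<open>
  Represent the circle by plane vectors via \<open>a \<mapsto> (a / \<bar>a\<bar>)\<^sup>2\<close>, so that the Farey vertices are the images of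
  the primitive Gaussian integers and the edges correspond to pairs of determinant \<open>1\<close>. The shear of
  an edge is an alternating sum of \<open>\<Psi>\<close> over the four sides of its quadrilateral; sums along a fan
  telescope, so boundedness of \<open>\<Psi>\<close> bounds the gaps of the image fans, normalised by \<open>exp (- M)\<close>,
  between \<open>exp (- K)\<close> and \<open>exp K\<close>. In half-plane charts the extension near an edge becomes the
  map \<open>x + \<i>y \<mapsto> \<gamma>(x) + \<i>(y - sqrt (1 - x\<^sup>2))\<close> on \<open>\<bar>x\<bar> \<le> 1/2\<close>, \<open>x\<^sup>2 + y\<^sup>2 \<ge> 1\<close>, where \<open>\<gamma>\<close> parametrises two
  geodesic arcs depending only on the gaps \<open>l\<close>, \<open>r\<close> next to the edge, so its dilatation is uniformly
  bounded. Finitely many such pieces cover each compact disk, so the extension is locally Lipschitz.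
  It is injective because, in terms of the horocyclic distances to the vertices of a triangle, each
  half of a piece stays in the corresponding sector of the image triangle. The image of a cell
  contains a horoball of definite size, is contained in another one, and the smaller horoballs are
  disjoint; so only finitely many images meet a compact set, the map is proper, and invariance of
  domain makes it a homeomorphism.
\<close>

section \<open>Half-plane charts\<close>

text \<open>For fixed z the map c \<mapsto> \<open>horo c z\<close> is a positive definite quadratic
  form of determinant 1, and the combinatorics is Gauss reduction of this form:
  \<open>hmap a b z\<close> lies in \<open>stdpiece\<close> exactly when the basis (a, b) is
  reduced, z lies in the cell of \<open>bpt a\<close> when a is up to sign the only shortest
  primitive vector, and on the dual tree at least two vectors tie. Cells, local finiteness and the
  exceptional null set all come from this. The obstacle is that a separate formula, in its own
  chart, is given for every vertex, so that global injectivity is not visible. It rests on two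
  features of the stretched dual edges. Each is bisected by the geodesic that it crosses
  (\<open>arc_mid\<close>), so no point changes its side of any edge, and points with the same image
  lie in one closed triangle. Within a triangle, an image arc has a linear equation in the three
  horocyclic distances; its coefficient, the exponential of plus or minus the shear
  (\<open>lamr\<close>), is inverted when the ends of the edge are exchanged, which makes the
  sectors on both sides of the arc complementary.\<close>

definition cdet :: "complex \<Rightarrow> complex \<Rightarrow> real" where
  "cdet a b = Re a * Im b - Im a * Re b"

text \<open>Points of the circle are represented by nonzero plane vectors up to real scaling. If
  \<open>cdet a b = 1\<close> then \<open>hmap a b\<close> is the isometry from the disk onto the half-plane sending
  \<open>bpt a\<close>, \<open>bpt b\<close>, \<open>bpt (b - n a)\<close> to \<open>\<infinity>\<close>, \<open>0\<close>, \<open>n\<close>.\<close>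
definition bpt :: "complex \<Rightarrow> complex" where
  "bpt a = a / cnj a"

definition hmap :: "complex \<Rightarrow> complex \<Rightarrow> complex \<Rightarrow> complex" where
  "hmap a b z = (b - cnj b * z) / (a - cnj a * z)"

definition hinv :: "complex \<Rightarrow> complex \<Rightarrow> complex \<Rightarrow> complex" where
  "hinv a b w = (b - a * w) / (cnj b - cnj a * w)"

text \<open>The horocyclic distance to \<open>bpt a\<close>, which is \<open>1 / Im (hmap a b z)\<close>.\<close>
definition horo :: "complex \<Rightarrow> complex \<Rightarrow> real" where
  "horo a z = (norm (a - cnj a * z))\<^sup>2 / (1 - (norm z)\<^sup>2)"

lemma cdet_commute: "cdet b a = - cdet a b"
  by (simp add: cdet_def)

lemma cdet_self [simp]: "cdet a a = 0"
  by (simp add: cdet_def)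

lemma cdet_zero [simp]: "cdet 0 a = 0" "cdet a 0 = 0"
  by (simp_all add: cdet_def)

lemma cdet_linear [simp]:
  "cdet (a + b) c = cdet a c + cdet b c" "cdet c (a + b) = cdet c a + cdet c b"
  "cdet (a - b) c = cdet a c - cdet b c" "cdet c (a - b) = cdet c a - cdet c b"
  "cdet (- a) c = - cdet a c" "cdet c (- a) = - cdet c a"
  "cdet (of_real x * a) c = x * cdet a c" "cdet c (of_real x * a) = x * cdet c a"
  "cdet (of_int k * a) c = of_int k * cdet a c" "cdet c (of_int k * a) = of_int k * cdet c a"
  by (simp_all add: cdet_def algebra_simps)

text \<open>Cramer's rule, kept free of division.\<close>

lemma cdet_expand: "of_real (cdet a b) * c = of_real (cdet c b) * a + of_real (cdet a c) * b"
  by (simp add: cdet_def complex_eq_iff algebra_simps)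

lemma cdet_expand1:
  assumes "cdet a b = 1" shows "c = of_real (cdet c b) * a + of_real (cdet a c) * b"
  using cdet_expand[of a b c] assms by simp

lemma cdet_complex: "cnj a * b - a * cnj b = 2 * \<i> * of_real (cdet a b)"
  by (simp add: cdet_def complex_eq_iff)

lemma cdet_nz: assumes "cdet a b \<noteq> 0" shows "a \<noteq> 0" "b \<noteq> 0" "a \<noteq> b"
  using assms by auto

lemma bpt_minus [simp]: "bpt (- a) = bpt a"
  by (simp add: bpt_def)

lemma bpt_scale [simp]: "x \<noteq> 0 \<Longrightarrow> bpt (of_real x * a) = bpt a"
  by (simp add: bpt_def)

lemma norm_bpt [simp]: "a \<noteq> 0 \<Longrightarrow> norm (bpt a) = 1"
  by (simp add: bpt_def norm_divide)

lemma bpt_eq_iff: assumes "a \<noteq> 0" "b \<noteq> 0" shows "bpt a = bpt b \<longleftrightarrow> cdet a b = 0"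
proof -
  have "bpt a = bpt b \<longleftrightarrow> cnj a * b - a * cnj b = 0"
    using assms by (auto simp: bpt_def field_simps)
  thus ?thesis unfolding cdet_complex by simp
qed

text \<open>On the unit circle \<open>bpt\<close> is squaring, so a square root serves as a
  lift.\<close>

lemma bpt_surj: assumes "norm u = 1" obtains a where "a \<noteq> 0" "bpt a = u"
proof
  have n: "norm (csqrt u) ^ 2 = 1" using assms by (simp flip: norm_power)
  show "csqrt u \<noteq> 0" using assms by auto
  have "cnj (csqrt u) * csqrt u = 1"
    using n by (simp add: mult.commute complex_norm_square[symmetric])
  hence "inverse (cnj (csqrt u)) = csqrt u" by (metis inverse_unique)
  thus "bpt (csqrt u) = u"
    by (simp add: bpt_def divide_inverse flip: power2_eq_square)
qed

lemma bpt_diff: assumes "a \<noteq> 0" "b \<noteq> 0"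
  shows "bpt b - bpt a = 2 * \<i> * of_real (cdet a b) / (cnj a * cnj b)"
proof -
  have "bpt b - bpt a = (cnj a * b - a * cnj b) / (cnj a * cnj b)"
    using assms by (simp add: bpt_def field_simps)
  thus ?thesis by (simp only: cdet_complex)
qed

text \<open>Up to squared norms, which are positive, both sides agree. The product of all three
  determinants is the expression whose sign survives rescaling a single lift by a negative number:
  two factors change sign.\<close>

lemma ccw_bpt: assumes "a \<noteq> 0" "b \<noteq> 0" "c \<noteq> 0"
  shows "ccw (bpt a) (bpt b) (bpt c) \<longleftrightarrow> cdet a b * cdet b c * cdet a c > 0"
proof -
  have "cnj (bpt b - bpt a) * (bpt c - bpt a) =
      4 * of_real (cdet a b * cdet a c) / (a * b * (cnj a * cnj c))"
    using assms by (simp add: bpt_diff ac_simps)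
  also have "\<dots> = of_real (4 * cdet a b * cdet a c / ((norm a)\<^sup>2 * (norm b)\<^sup>2 * (norm c)\<^sup>2)) * (cnj b * c)"
  proof -
    have "of_real (4 * cdet a b * cdet a c / ((norm a)\<^sup>2 * (norm b)\<^sup>2 * (norm c)\<^sup>2)) =
        4 * of_real (cdet a b * cdet a c) / ((a * cnj a) * (b * cnj b) * (c * cnj c))"
      by (simp flip: complex_norm_square)
    thus ?thesis using assms by (simp add: field_simps)
  qed
  finally have "Im (cnj (bpt b - bpt a) * (bpt c - bpt a)) =
      4 * cdet a b * cdet a c / ((norm a)\<^sup>2 * (norm b)\<^sup>2 * (norm c)\<^sup>2) * cdet b c"
    by (simp add: cdet_def)
  also have "\<dots> = (cdet a b * cdet b c * cdet a c) * (4 / ((norm a)\<^sup>2 * (norm b)\<^sup>2 * (norm c)\<^sup>2))"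
    by simp
  finally have eq: "Im (cnj (bpt b - bpt a) * (bpt c - bpt a)) = \<dots>" .
  have "4 / ((norm a)\<^sup>2 * (norm b)\<^sup>2 * (norm c)\<^sup>2) > 0" using assms by simp
  thus ?thesis unfolding ccw_def eq by (metis mult_pos_pos zero_less_mult_pos2)
qed

lemma sq_less_one: "z \<in> ball 0 1 \<Longrightarrow> (norm z)\<^sup>2 < 1"
  by (simp add: power_less_one_iff abs_square_less_1)

lemma horo_den: assumes "z \<in> ball 0 1" "a \<noteq> 0" shows "a - cnj a * z \<noteq> 0"
proof
  assume "a - cnj a * z = 0"
  hence "norm a = norm (cnj a * z)" by simp
  thus False using assms by (simp add: norm_mult)
qed

lemma horo_pos: "z \<in> ball 0 1 \<Longrightarrow> a \<noteq> 0 \<Longrightarrow> horo a z > 0"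
  using horo_den[of z a] sq_less_one[of z] by (simp add: horo_def)

lemma horo_minus [simp]: "horo (- a) z = horo a z"
  by (simp add: horo_def norm_minus_commute)

lemma hmap_Im: assumes "z \<in> ball 0 1" "a \<noteq> 0"
  shows "Im (hmap a b z) = cdet a b * (1 - (norm z)\<^sup>2) / (norm (a - cnj a * z))\<^sup>2"
proof -
  have "cnj (a - cnj a * z) \<noteq> 0" using horo_den[OF assms] complex_cnj_zero_iff by blast
  hence "hmap a b z = (b - cnj b * z) * cnj (a - cnj a * z) / of_real ((norm (a - cnj a * z))\<^sup>2)"
    unfolding hmap_def complex_norm_square by (rule nonzero_mult_divide_mult_cancel_right[symmetric])
  hence "Im (hmap a b z) = Im ((b - cnj b * z) * cnj (a - cnj a * z)) / (norm (a - cnj a * z))\<^sup>2"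
    by (simp only: Im_divide_of_real)
  also have "Im ((b - cnj b * z) * cnj (a - cnj a * z)) = cdet a b * (1 - (norm z)\<^sup>2)"
    unfolding cmod_power2 by (simp add: cdet_def algebra_simps power2_eq_square)
  finally show ?thesis .
qed

lemma horo_hmap: assumes "z \<in> ball 0 1" "cdet a b = 1"
  shows "horo a z = 1 / Im (hmap a b z)" "Im (hmap a b z) > 0"
proof -
  have a: "a \<noteq> 0" using assms(2) by auto
  show "horo a z = 1 / Im (hmap a b z)" 
    using hmap_Im[OF assms(1) a, of b] assms(2) by (simp add: horo_def)
  thus "Im (hmap a b z) > 0" using horo_pos[OF assms(1) a]
    by (simp add: zero_less_divide_iff)
qed

text \<open>The numerator for x a + y b is the one for a times x + y m, where m =
  \<open>hmap a b z\<close>. So \<open>horo\<close> is the binary quadratic form that belongs to the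
  point m of the half-plane, and comparing horocyclic distances means comparing values of this
  form.\<close>

lemma horo_comb: assumes "z \<in> ball 0 1" "cdet a b = 1"
  shows "horo (of_real x * a + of_real y * b) z = (norm (of_real x + of_real y * hmap a b z))\<^sup>2 / Im (hmap a b z)"
proof -
  have a: "a \<noteq> 0" using assms(2) by auto
  note d = horo_den[OF assms(1) a]
  have "(of_real x * a + of_real y * b) - cnj (of_real x * a + of_real y * b) * z =
     (of_real x + of_real y * hmap a b z) * (a - cnj a * z)"
    using d by (simp add: hmap_def field_simps)
  hence "horo (of_real x * a + of_real y * b) z = (norm (of_real x + of_real y * hmap a b z))\<^sup>2 * horo a z"
    by (simp add: horo_def norm_mult power_mult_distrib)
  thus ?thesis using horo_hmap[OF assms] by simp
qed

lemma hmap_shift: assumes "z \<in> ball 0 1" "a \<noteq> 0"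
  shows "hmap a (b + of_real x * a) z = hmap a b z + of_real x"
  using horo_den[OF assms] by (simp add: hmap_def field_simps)

lemma hmap_shift_diff: assumes "z \<in> ball 0 1" "a \<noteq> 0"
  shows "hmap a (b - of_real x * a) z = hmap a b z - of_real x"
  using hmap_shift[OF assms, of b "-x"] by simp

lemma hmap_minus [simp]: "hmap (- a) (- b) z = hmap a b z"
  by (simp add: hmap_def) (metis minus_diff_minus minus_divide_divide minus_diff_eq uminus_add_conv_diff)

lemma hmap_scale: "x \<noteq> 0 \<Longrightarrow> hmap (of_real x * a) (of_real y * b) z = of_real (y / x) * hmap a b z"
proof -
  assume "x \<noteq> 0"
  have "of_real y * b - cnj (of_real y * b) * z = of_real y * (b - cnj b * z)"
    "of_real x * a - cnj (of_real x * a) * z = of_real x * (a - cnj a * z)"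
    by (simp_all add: algebra_simps)
  thus ?thesis by (simp add: hmap_def)
qed

text \<open>Turning the edge around: (b, -a) is the chart at the other end, in which the two sides
  of the edge are exchanged.\<close>

lemma hmap_swap: "hmap b (- a) z = - 1 / hmap a b z"
proof -
  have "- a - cnj (- a) * z = - (a - cnj a * z)" by simp
  thus ?thesis unfolding hmap_def by (simp only: minus_divide_left divide_divide_eq_right) simp
qed

lemma hmap_bpt: assumes "c \<noteq> 0" 
  shows "hmap a b (bpt c) = of_real (cdet b c / cdet a c)"
proof -
  have *: "x - cnj x * bpt c = - (2 * \<i> * of_real (cdet x c)) / cnj c" for x
  proof -
    have "x - cnj x * bpt c = - (cnj x * c - x * cnj c) / cnj c"
      using assms by (simp add: bpt_def field_simps)
    thus ?thesis by (simp only: cdet_complex)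
  qed
  show ?thesis using assms unfolding hmap_def * by simp
qed

lemma hmap_bpt_diff: assumes "cdet a b = 1"
  shows "hmap a b (bpt (b - of_real x * a)) = of_real x"
proof -
  have "cdet a (b - of_real x * a) = 1" using assms by simp
  hence "b - of_real x * a \<noteq> 0" by auto
  thus ?thesis using assms by (simp add: hmap_bpt cdet_commute[of b a])
qed

text \<open>The imaginary part of a times the denominator is -(1 + |a|^2 Im w), so the denominator
  stays away from 0 up to the real line. This makes \<open>hinv\<close> Lipschitz on the closed
  half-plane.\<close>

lemma hinv_den: assumes "cdet a b = 1" "Im w \<ge> 0"
  shows "norm (cnj b - cnj a * w) * norm a \<ge> 1 + (norm a)\<^sup>2 * Im w" "cnj b - cnj a * w \<noteq> 0"
proof -
  have a: "a \<noteq> 0" using assms by auto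
  have "Im (a * (cnj b - cnj a * w)) = - (1 + (norm a)\<^sup>2 * Im w)"
    using assms unfolding cmod_power2 by (simp add: cdet_def algebra_simps power2_eq_square)
  hence "\<bar>1 + (norm a)\<^sup>2 * Im w\<bar> \<le> norm (a * (cnj b - cnj a * w))"
    using abs_Im_le_cmod[of "a * (cnj b - cnj a * w)"] by simp
  thus "norm (cnj b - cnj a * w) * norm a \<ge> 1 + (norm a)\<^sup>2 * Im w"
    by (simp add: norm_mult mult.commute)
  moreover have "1 + (norm a)\<^sup>2 * Im w > 0" using assms by (smt (verit) mult_nonneg_nonneg zero_le_power2)
  ultimately show "cnj b - cnj a * w \<noteq> 0" by auto
qed

lemma hinv_ball: assumes "cdet a b = 1" "Im w > 0" shows "hinv a b w \<in> ball 0 1"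
proof -
  have d: "cnj b - cnj a * w \<noteq> 0" using hinv_den assms by simp
  have "(norm (cnj b - cnj a * w))\<^sup>2 - (norm (b - a * w))\<^sup>2 = 4 * Im w * cdet a b"
    unfolding cmod_power2 by (simp add: cdet_def algebra_simps power2_eq_square)
  hence "(norm (b - a * w))\<^sup>2 < (norm (cnj b - cnj a * w))\<^sup>2" using assms by simp
  hence "norm (b - a * w) < norm (cnj b - cnj a * w)"
    by (simp add: power2_less_imp_less)
  thus ?thesis using d by (simp add: hinv_def norm_divide)
qed

lemma hinv_norm: "cdet a b = 1 \<Longrightarrow> Im w > 0 \<Longrightarrow> norm (hinv a b w) < 1"
  using hinv_ball by simp

lemma hmap_hinv: assumes "cdet a b = 1" "Im w \<ge> 0" shows "hmap a b (hinv a b w) = w"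

proof -
  have d: "cnj b - cnj a * w \<noteq> 0" using hinv_den assms by simp
  obtain u where u: "u = a * cnj b - cnj a * b" by simp
  have "b - cnj b * hinv a b w = w * u / (cnj b - cnj a * w)"
    using d by (simp add: hinv_def u field_simps)
  moreover have "a - cnj a * hinv a b w = u / (cnj b - cnj a * w)"
    using d by (simp add: hinv_def u field_simps)
  moreover have "u \<noteq> 0" using assms cdet_complex[of a b] by (auto simp: u)
  ultimately show ?thesis using d by (simp add: hmap_def)
qed

lemma hinv_hmap: assumes "cdet a b = 1" "z \<in> ball 0 1" shows "hinv a b (hmap a b z) = z"
proof -
  have a: "a \<noteq> 0" using assms by auto
  note d = horo_den[OF assms(2) a]
  obtain u where u: "u = a * cnj b - cnj a * b" by simp
  have "b - a * hmap a b z = z * u / (a - cnj a * z)"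
    using d by (simp add: hmap_def u field_simps)
  moreover have "cnj b - cnj a * hmap a b z = u / (a - cnj a * z)"
    using d by (simp add: hmap_def u field_simps)
  moreover have "u \<noteq> 0" using assms cdet_complex[of a b] by (auto simp: u)
  ultimately show ?thesis using d by (simp add: hinv_def)
qed

lemma hmap_bij: assumes "cdet a b = 1" shows "bij_betw (hmap a b) (ball 0 1) {z. Im z > 0}"
  by (rule bij_betw_byWitness[where f' = "hinv a b"])
     (use assms in \<open>auto simp: hmap_hinv hinv_hmap horo_hmap(2) hinv_norm\<close>)

lemma inv_into_hmap: assumes "cdet a b = 1" "Im w > 0"
  shows "inv_into (ball 0 1) (hmap a b) w = hinv a b w"
  using assms hmap_bij[OF assms(1)]
  by (intro inv_into_f_eq) (auto simp: bij_betw_def hinv_norm hmap_hinv)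

lemma hmap_diff: assumes "z \<in> ball 0 1" "z' \<in> ball 0 1" "cdet a b = 1"
  shows "hmap a b z - hmap a b z' = 2 * \<i> * (z - z') / ((a - cnj a * z) * (a - cnj a * z'))"
proof -
  have a: "a \<noteq> 0" using assms(3) by auto
  note d = horo_den[OF assms(1) a] horo_den[OF assms(2) a]
  have "hmap a b z - hmap a b z' = (cnj a * b - a * cnj b) * (z - z') / ((a - cnj a * z) * (a - cnj a * z'))"
    using d by (simp add: hmap_def field_simps)
  thus ?thesis using assms by (simp add: cdet_complex)
qed

lemma hinv_diff: assumes "Im w \<ge> 0" "Im w' \<ge> 0" "cdet a b = 1"
  shows "hinv a b w - hinv a b w' = 2 * \<i> * (w - w') / ((cnj b - cnj a * w) * (cnj b - cnj a * w'))"
proof -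
  note d = hinv_den(2)[OF assms(3,1)] hinv_den(2)[OF assms(3,2)]
  have "hinv a b w - hinv a b w' = (cnj a * b - a * cnj b) * (w - w') / ((cnj b - cnj a * w) * (cnj b - cnj a * w'))"
    using d by (simp add: hinv_def field_simps)
  thus ?thesis using assms by (simp add: cdet_complex)
qed

text \<open>Both sides are 2 (cosh d - 1), with d the hyperbolic distance, written in the half-plane
  and in the disk.\<close>

lemma hmap_dist: assumes "z \<in> ball 0 1" "z' \<in> ball 0 1" "cdet a b = 1"
  shows "(norm (hmap a b z - hmap a b z'))\<^sup>2 / (Im (hmap a b z) * Im (hmap a b z')) =
     4 * (norm (z - z'))\<^sup>2 / ((1 - (norm z)\<^sup>2) * (1 - (norm z')\<^sup>2))"
proof -
  have a: "a \<noteq> 0" using assms(3) by auto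
  note d = horo_den[OF assms(1) a] horo_den[OF assms(2) a] sq_less_one[OF assms(1)] sq_less_one[OF assms(2)]
  show ?thesis using d unfolding hmap_diff[OF assms] hmap_Im[OF assms(1) a] hmap_Im[OF assms(2) a]
    by (simp add: norm_mult norm_divide power_mult_distrib power_divide assms(3))
qed

section \<open>Uniqueness of half-plane charts with a given pole\<close>

lemma half_plane_moebius_hmap: assumes "cdet a b = 1" 
  shows "half_plane_moebius (bpt a) (hmap a b)"
proof -
  have a: "a \<noteq> 0" using assms by auto
  have "(- cnj b) * a - b * (- cnj a) = 2 * \<i>"
    using cdet_complex[of a b] assms by (simp add: algebra_simps)
  hence 1: "(- cnj b) * a - b * (- cnj a) \<noteq> 0" by simp
  have 2: "hmap a b = moebius (- cnj b) b (- cnj a) a"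
    by (simp add: fun_eq_iff hmap_def moebius_def algebra_simps)
  have 3: "(- cnj a) * bpt a + a = 0" using a by (simp add: bpt_def)
  show ?thesis unfolding half_plane_moebius_def
    by (intro conjI exI[of _ "- cnj b"] exI[of _ b] exI[of _ "- cnj a"] exI[of _ a] 1 2 3
        bij_betw_imp_surj_on[OF hmap_bij[OF assms]])
qed

text \<open>Points far to the side force k to be real, points high up exclude a negative k.\<close>

lemma half_plane_affine:
  assumes "\<And>w. Im w > 0 \<Longrightarrow> Im (k * w + t) > 0" "k \<noteq> 0"
  shows "Im k = 0" "Re k > 0"
proof -
  have *: "Im k * x + Re k * y + Im t > 0" if "y > 0" for x y
    using assms(1)[of "Complex x y"] that by (simp add: algebra_simps)
  show 1: "Im k = 0"
  proof (rule ccontr)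
    assume "Im k \<noteq> 0"
    with *[of 1 "(- 1 - Re k - Im t) / Im k"] show False by simp
  qed
  have "Re k \<ge> 0"
  proof (rule ccontr)
    assume n: "\<not> Re k \<ge> 0"
    have "Re k * ((\<bar>Im t\<bar> + 1) / - Re k) + Im t > 0"
      using *[of "(\<bar>Im t\<bar> + 1) / - Re k" 0] n 1 by (simp add: divide_pos_neg)
    thus False using n by simp
  qed
  thus "Re k > 0" using 1 assms(2) by (smt (verit) complex_eq_iff zero_complex.sel)
qed

text \<open>Two Moebius maps with the same pole differ by an affine map, and mapping the disk onto
  the half-plane makes its coefficients real. The junk value at the pole is recorded as well,
  because \<open>chart\<close> is a definite description among total functions.\<close>

lemma half_plane_moebius_affine:
  assumes "cdet a b = 1" "half_plane_moebius (bpt a) m"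
  obtains k x where "k > 0" "\<And>z. z \<noteq> bpt a \<Longrightarrow> m z = of_real k * hmap a b z + of_real x"
    "m (bpt a) = 0"
proof -
  have a: "a \<noteq> 0" using assms by auto
  obtain p q r s where pq: "p * s - q * r \<noteq> 0" "m = moebius p q r s" "r * bpt a + s = 0"
    and im: "m ` ball 0 1 = {z. Im z > 0}"
    using assms(2) unfolding half_plane_moebius_def by blast
  have r: "r \<noteq> 0" using pq by auto
  have s: "s = - r * bpt a" using pq(3) by (simp add: add_eq_0_iff2)
  \<comment> \<open>k is the quotient of the residues of both maps at the common pole; t then
    matches their values at infinity.\<close>
  define k t where "k = - cnj a / r * (p * bpt a + q) / (b - cnj b * bpt a)" 
    and "t = (p + k * (- cnj b * r / cnj a)) / r"
  have bb: "b - cnj b * bpt a \<noteq> 0" 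
  proof -
    have "b - cnj b * bpt a = (cnj a * b - a * cnj b) / cnj a" using a by (simp add: bpt_def field_simps)
    thus ?thesis using a assms(1) by (simp add: cdet_complex)
  qed
  have main: "m z = k * hmap a b z + t" if "z \<noteq> bpt a" for z
  proof -
    have z: "z - bpt a \<noteq> 0" using that by simp
    have e1: "m z = (p * z + q) / (r * (z - bpt a))" by (simp add: pq(2) moebius_def s algebra_simps)
    have "a - cnj a * z = - cnj a * (z - bpt a)" using a by (simp add: bpt_def field_simps)
    hence e2: "hmap a b z = - (b - cnj b * z) / (cnj a * (z - bpt a))" by (simp add: hmap_def divide_simps)
    have e3: "k * (b - cnj b * bpt a) * r = - cnj a * (p * bpt a + q)"
      using bb r by (simp add: k_def)
    have "t * r * cnj a = p * cnj a - k * cnj b * r" using r a by (simp add: t_def field_simps)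
    hence "(p * z + q) * cnj a = - k * (b - cnj b * z) * r + t * r * cnj a * (z - bpt a)"
      using e3 by simp algebra
    hence "(p * z + q) / (r * (z - bpt a)) = (- k * (b - cnj b * z) * r + t * r * cnj a * (z - bpt a)) / (cnj a * (r * (z - bpt a)))"
      using a r z by (simp add: divide_simps mult.commute)
    also have "\<dots> = k * (- (b - cnj b * z) / (cnj a * (z - bpt a))) + t"
      using a r z by (simp add: divide_simps) (simp add: algebra_simps)
    finally show ?thesis using e1 e2 by simp
  qed
  have nb: "z \<noteq> bpt a" if "z \<in> ball 0 1" for z using that norm_bpt[OF a] by auto
  have "p * bpt a + q \<noteq> 0" 
  proof
    assume "p * bpt a + q = 0"
    hence "q = - p * bpt a" by (simp add: add_eq_0_iff2)
    thus False using pq(1) s by (simp add: algebra_simps)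
  qed
  hence k: "k \<noteq> 0" using a r bb by (simp add: k_def)
  have "Im (k * w + t) > 0" if "Im w > 0" for w
  proof -
    have "m (hinv a b w) \<in> {z. Im z > 0}" using im hinv_ball[OF assms(1) that] by blast
    thus ?thesis using main[OF nb[OF hinv_ball[OF assms(1) that]]] hmap_hinv[OF assms(1)] that by simp
  qed
  note ka = half_plane_affine[OF this k]
  have kr: "k = of_real (Re k)" using ka by (simp add: complex_eq_iff)
  \<comment> \<open>A negative imaginary part would push low points out of the half-plane, a
    positive one would leave the height \<open>Im t\<close> unattained.\<close>
  have "Im t = 0"
  proof (rule ccontr)
    assume n: "Im t \<noteq> 0"
    have pos: "Im t > 0 \<or> Im t < 0" using n by linarith
    { assume neg: "Im t < 0"
      let ?w = "Complex 0 (- Im t / Re k / 2)"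
      have iw: "Im ?w > 0" using neg ka by (simp add: divide_neg_pos)
      have "m (hinv a b ?w) \<in> {z. Im z > 0}" using im hinv_ball[OF assms(1) iw] by blast
      hence "Im (k * ?w + t) > 0"
        using main[OF nb[OF hinv_ball[OF assms(1) iw]]] hmap_hinv[OF assms(1)] iw by simp
      hence False using ka neg by simp }
    moreover
    { assume p: "Im t > 0"
      have "Complex 0 (Im t) \<in> m ` ball 0 1" using im p by simp
      then obtain z where z: "z \<in> ball 0 1" "m z = Complex 0 (Im t)" by auto
      have "Im (k * hmap a b z + t) = Im t" using main[OF nb[OF z(1)]] z(2) by (metis complex.sel(2))
      hence "Re k * Im (hmap a b z) = 0" using ka by simp
      hence False using horo_hmap(2)[OF z(1) assms(1)] ka by simp }
    ultimately show False using pos by blast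
  qed
  hence tr: "t = of_real (Re t)" by (simp add: complex_eq_iff)
  show ?thesis
  proof (rule that[OF ka(2), of "Re t"])
    fix z assume "z \<noteq> bpt a"
    thus "m z = of_real (Re k) * hmap a b z + of_real (Re t)" using main kr tr by simp
  next
    show "m (bpt a) = 0" using pq by (simp add: moebius_def)
  qed
qed

lemma hmap_pole: "a \<noteq> 0 \<Longrightarrow> hmap a b (bpt a) = 0"
  by (simp add: hmap_def bpt_def)

lemma chart_eq: assumes "cdet a b = 1"
  shows "chart (bpt a) (bpt b) (bpt (a + b)) = hmap a b"
  unfolding chart_def
proof (rule the_equality)
  have h0: "hmap a b (bpt b) = 0" using hmap_bpt_diff[OF assms, of 0] by simp
  have h1: "hmap a b (bpt (a + b)) = - 1" using hmap_bpt_diff[OF assms, of "-1"] by (simp add: add.commute)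
  show "half_plane_moebius (bpt a) (hmap a b) \<and> hmap a b (bpt b) = 0 \<and> hmap a b (bpt (a + b)) = - 1"
    using half_plane_moebius_hmap[OF assms] h0 h1 by simp
  fix m assume m: "half_plane_moebius (bpt a) m \<and> m (bpt b) = 0 \<and> m (bpt (a + b)) = - 1"
  obtain k x where k: "k > 0" "\<And>z. z \<noteq> bpt a \<Longrightarrow> m z = of_real k * hmap a b z + of_real x" "m (bpt a) = 0"
    using half_plane_moebius_affine[OF assms] m by blast
  have c: "cdet a (a + b) \<noteq> 0" "cdet a b \<noteq> 0" using assms by auto
  have ne: "bpt b \<noteq> bpt a" "bpt (a + b) \<noteq> bpt a"
    using c cdet_nz[OF c(1)] cdet_nz[OF c(2)] by (metis bpt_eq_iff)+
  have "x = 0" using k(2)[OF ne(1)] m h0 by simp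
  moreover have "k = 1" using k(2)[OF ne(2)] m h1 \<open>x = 0\<close> by simp
  ultimately show "m = hmap a b"
    using k(2,3) hmap_pole[OF cdet_nz(1)[OF c(2)]] by (auto simp: fun_eq_iff) (metis)
qed

section \<open>The Farey tessellation\<close>

definition lat :: "complex set" where
  "lat = {z. Re z \<in> \<int> \<and> Im z \<in> \<int>}"

definition ubasis :: "complex \<Rightarrow> complex \<Rightarrow> bool" where
  "ubasis a b \<longleftrightarrow> a \<in> lat \<and> b \<in> lat \<and> cdet a b = 1"

definition prim :: "complex set" where
  "prim = {a. \<exists>b. ubasis a b}"

lemma lat_closed [simp]:
  "a \<in> lat \<Longrightarrow> b \<in> lat \<Longrightarrow> a + b \<in> lat" "a \<in> lat \<Longrightarrow> b \<in> lat \<Longrightarrow> a - b \<in> lat"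
  "a \<in> lat \<Longrightarrow> - a \<in> lat" "a \<in> lat \<Longrightarrow> of_int k * a \<in> lat"
  by (auto simp: lat_def)

lemma lat_cdet: "a \<in> lat \<Longrightarrow> b \<in> lat \<Longrightarrow> cdet a b \<in> \<int>"
  by (auto simp: lat_def cdet_def)

lemma ubasis_det: "ubasis a b \<Longrightarrow> cdet a b = 1"
  by (simp add: ubasis_def)

lemma ubasis_expand: assumes "ubasis a b" "c \<in> lat"
  obtains m n :: int where "c = of_int m * a + of_int n * b" "cdet c b = of_int m" "cdet a c = of_int n"
proof -
  have *: "cdet a b = 1" "a \<in> lat" "b \<in> lat" using assms(1) by (auto simp: ubasis_def)
  obtain m n where "cdet c b = of_int m" "cdet a c = of_int n"
    using lat_cdet * assms(2) by (metis Ints_cases)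
  thus ?thesis using cdet_expand1[OF *(1), of c] that by simp
qed

lemma ubasis_trans:
  assumes "ubasis a b"
  shows "ubasis b (- a)" "ubasis (- a) (- b)" "ubasis (- b) a" "ubasis a (b + of_int n * a)" 
    "ubasis a (b - of_int n * a)" "ubasis a (a + b)" "ubasis a (b - a)" "ubasis b (- (a + b))" "ubasis (- (a + b)) a"
    "ubasis (a + b) b"
  using assms cdet_commute[of b a] by (auto simp: ubasis_def)

lemma ubasis_prim: "ubasis a b \<Longrightarrow> a \<in> prim" "ubasis a b \<Longrightarrow> b \<in> prim"
  using ubasis_trans(1) by (auto simp: prim_def)



lemma prim_lat: "a \<in> prim \<Longrightarrow> a \<in> lat"
  by (auto simp: prim_def ubasis_def)

lemma prim_nz: "a \<in> prim \<Longrightarrow> a \<noteq> 0"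
  by (auto simp: prim_def ubasis_def)

text \<open>c is an integer multiple of a, and pairing it with a partner of determinant 1 shows that
  the factor divides 1.\<close>

lemma prim_cdet0: assumes "a \<in> prim" "c \<in> prim" "cdet a c = 0" shows "c = a \<or> c = - a"
proof -
  obtain b d where b: "ubasis a b" "ubasis c d" using assms by (auto simp: prim_def)
  obtain m n where mn: "c = of_int m * a + of_int n * b" "cdet c b = of_int m" "cdet a c = of_int n"
    using ubasis_expand[OF b(1) prim_lat[OF assms(2)]] by blast
  have "n = 0" using mn(3) assms(3) by simp
  hence c: "c = of_int m * a" using mn by simp
  obtain k :: int where k: "cdet a d = of_int k"
    using lat_cdet b by (metis Ints_cases ubasis_def)
  have "cdet c d = of_int m * of_int k" using k by (simp add: c)
  hence "m * k = 1" using ubasis_det[OF b(2)] by (metis of_int_mult of_int_eq_1_iff)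
  hence "m = 1 \<or> m = -1" using zmult_eq_1_iff by auto
  thus ?thesis using c by auto
qed

lemma bpt_eq_prim: assumes "a \<in> prim" "c \<in> prim" shows "bpt a = bpt c \<longleftrightarrow> c = a \<or> c = - a"
  using prim_cdet0[OF assms] bpt_eq_iff[OF prim_nz[OF assms(1)] prim_nz[OF assms(2)]] by auto

text \<open>A vertex determines its primitive vector up to sign, and determinant 1 couples the two
  signs, so four of the eight signed orderings remain.\<close>

lemma edge_eq:
  assumes "ubasis a b" "ubasis c d" "{bpt a, bpt b} = {bpt c, bpt d}"
  shows "(c, d) \<in> {(a, b), (- a, - b), (b, - a), (- b, a)}"
proof -
  note p = ubasis_prim[OF assms(1)] ubasis_prim[OF assms(2)]
  have "bpt a = bpt c \<and> bpt b = bpt d \<or> bpt a = bpt d \<and> bpt b = bpt c"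
    using assms(3) by (auto simp: doubleton_eq_iff)
  thus ?thesis
    using ubasis_det[OF assms(1)] ubasis_det[OF assms(2)] cdet_commute[of b a] p
    by (auto simp: bpt_eq_prim)
qed

text \<open>The third vertex a + b has chart coordinate -1. The triangle on the other side of the
  edge is \<open>tri b (- a)\<close>, with third vertex b - a at 1.\<close>

definition tri :: "complex \<Rightarrow> complex \<Rightarrow> complex set" where
  "tri a b = {bpt a, bpt b, bpt (a + b)}"

lemma tri_rotate: "tri b (- (a + b)) = tri a b" "tri (- (a + b)) a = tri a b"
  using bpt_minus[of a] bpt_minus[of b] bpt_minus[of "a + b"] unfolding tri_def by (auto simp del: bpt_minus)

lemma tri_minus: "tri (- a) (- b) = tri a b"
  using bpt_minus[of "a + b"] unfolding tri_def by simp

lemma tri_other: "tri b (- a) = {bpt a, bpt b, bpt (b - a)}"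
  unfolding tri_def by auto

lemma tri_distinct: assumes "cdet a b = 1"
  shows "bpt a \<noteq> bpt b" "bpt a \<noteq> bpt (a + b)" "bpt b \<noteq> bpt (a + b)"
proof -
  have c: "cdet a b \<noteq> 0" "cdet a (a + b) \<noteq> 0" "cdet b (a + b) \<noteq> 0"
    using assms cdet_commute[of b a] by auto
  note n = cdet_nz[OF c(1)] cdet_nz[OF c(2)] 
  show "bpt a \<noteq> bpt b" "bpt a \<noteq> bpt (a + b)" "bpt b \<noteq> bpt (a + b)"
    using c n by (simp_all add: bpt_eq_iff)
qed

lemma tri_pair:
  assumes "ubasis a b" "p \<in> tri a b" "q \<in> tri a b" "p \<noteq> q"
  obtains a' b' where "ubasis a' b'" "tri a b = tri a' b'" "{p, q} = {bpt a', bpt b'}"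
proof -
  have "{p, q} = {bpt a, bpt b} \<or> {p, q} = {bpt b, bpt (- (a + b))} \<or> {p, q} = {bpt (- (a + b)), bpt a}"
    unfolding bpt_minus using assms(2-4) by (auto simp: tri_def)
  thus ?thesis using that assms(1) ubasis_trans(8,9)[OF assms(1)] tri_rotate by metis
qed

text \<open>On vectors the reflection in the edge is the linear map that fixes a and negates
  b.\<close>

lemma hyp_reflection_bpt:
  assumes "cdet a b \<noteq> 0" "c = of_real x * a + of_real y * b" "c \<noteq> 0"
  shows "hyp_reflection (bpt a) (bpt b) (bpt c) = bpt (of_real x * a - of_real y * b)"
proof -
  obtain u where u: "u = cnj a * b - a * cnj b" by simp
  have nz: "a \<noteq> 0" "b \<noteq> 0" "u \<noteq> 0" using assms(1) by (auto simp: u cdet_complex)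
  have cc: "cnj c = of_real x * cnj a + of_real y * cnj b" using assms(2) by simp
  have "2 * bpt a * bpt b * cnj (bpt c) - (bpt a + bpt b) = (2 * a * b * cnj c - (a * cnj b + cnj a * b) * c) / (cnj a * cnj b * c)"
    using nz assms(3) by (simp add: bpt_def field_simps)
  also have "2 * a * b * cnj c - (a * cnj b + cnj a * b) * c = u * (of_real x * a - of_real y * b)"
    unfolding cc unfolding assms(2) u by algebra
  finally have 1: "2 * bpt a * bpt b * cnj (bpt c) - (bpt a + bpt b) = u * (of_real x * a - of_real y * b) / (cnj a * cnj b * c)" .
  have "(bpt a + bpt b) * cnj (bpt c) - 2 = ((a * cnj b + cnj a * b) * cnj c - 2 * cnj a * cnj b * c) / (cnj a * cnj b * c)"
    using nz assms(3) by (simp add: bpt_def field_simps)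
  also have "(a * cnj b + cnj a * b) * cnj c - 2 * cnj a * cnj b * c = u * (of_real x * cnj a - of_real y * cnj b)"
    unfolding cc unfolding assms(2) u by algebra
  finally have 2: "(bpt a + bpt b) * cnj (bpt c) - 2 = u * (of_real x * cnj a - of_real y * cnj b) / (cnj a * cnj b * c)" .
  show ?thesis unfolding hyp_reflection_def 1 2 using nz assms(3) by (simp add: bpt_def)
qed

lemma hyp_reflection_tri: assumes "ubasis a b"
  shows "hyp_reflection (bpt a) (bpt b) ` tri a b = tri b (- a)"
proof -
  have c: "cdet a b \<noteq> 0" "cdet a (a + b) \<noteq> 0" using ubasis_det[OF assms] by auto
  note n = cdet_nz[OF c(1)] cdet_nz[OF c(2)]
  have "hyp_reflection (bpt a) (bpt b) (bpt a) = bpt a"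
    using hyp_reflection_bpt[OF c(1), of a 1 0] n by simp
  moreover have "hyp_reflection (bpt a) (bpt b) (bpt b) = bpt b"
    using hyp_reflection_bpt[OF c(1), of b 0 1] n by simp
  moreover have "hyp_reflection (bpt a) (bpt b) (bpt (a + b)) = bpt (b - a)"
    using hyp_reflection_bpt[OF c(1), of "a + b" 1 1] n bpt_minus[of "a - b"] by simp
  ultimately show ?thesis unfolding tri_other by (simp add: tri_def)
qed

lemma hyp_reflection_commute: "hyp_reflection a b = hyp_reflection b a"
  by (simp add: hyp_reflection_def fun_eq_iff mult.commute mult.left_commute add.commute)

lemma bpt_base: "bpt 1 = 1" "bpt \<i> = -1" "bpt (1 + \<i>) = \<i>"
  by (auto simp: bpt_def complex_eq_iff Re_divide Im_divide power2_eq_square)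

text \<open>The size of a triangle for the descent; the base triangle is the only one of minimal size.\<close>
definition qsize :: "complex \<Rightarrow> real" where
  "qsize z = (Re z)\<^sup>2 + (Im z)\<^sup>2 - Re z * Im z"

lemma qsize_minus [simp]: "qsize (- a) = qsize a"
  by (simp add: qsize_def)

lemma qsize_parallelogram: "qsize (b - a) = 2 * qsize a + 2 * qsize b - qsize (a + b)"
  by (simp add: qsize_def power2_eq_square algebra_simps)

lemma qsize_pos: "qsize a \<ge> 0"
proof -
  have "qsize a = (Re a - Im a / 2)\<^sup>2 + 3 / 4 * (Im a)\<^sup>2" by (simp add: qsize_def power2_eq_square algebra_simps)
  thus ?thesis by simp
qed

lemma qsize_int: "a \<in> lat \<Longrightarrow> qsize a \<in> \<int>"
  by (auto simp: lat_def qsize_def)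

text \<open>If one number were 0, the others would be even with product 3. Positive integers with
  this sum of products are all 1.\<close>

lemma int_same_parity_three:
  fixes x y z :: int
  assumes "x \<ge> 0" "y \<ge> 0" "z \<ge> 0" "x * y + y * z + z * x = 3" "even (x + y)" "even (x + z)"
  shows "x = 1" "y = 1" "z = 1"
proof -
  have three: False if "p * q = 3" "even p" for p q :: int
    using that by (metis even_mult_iff odd_numeral)
  have "x \<noteq> 0" using three[of y z] assms by auto
  moreover have "y \<noteq> 0" using three[of z x] assms by auto
  moreover have "z \<noteq> 0" using three[of x y] assms by auto
  ultimately have p: "x \<ge> 1" "y \<ge> 1" "z \<ge> 1" using assms by auto
  have "x * y \<ge> 1" "y * z \<ge> 1" "z * x \<ge> 1"
    using p by (simp_all add: int_one_le_iff_zero_less)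
  hence "x * y = 1" "y * z = 1" using assms(4) by auto
  thus "x = 1" "y = 1" "z = 1" using p by (auto simp: zmult_eq_1_iff)
qed

lemma qsize_one: assumes "a \<in> lat" "qsize a = 1" shows "bpt a \<in> {1, \<i>, -1}"
proof -
  obtain p q :: int where a: "Re a = of_int p" "Im a = of_int q"
    using assms(1) by (auto simp: lat_def elim!: Ints_cases)
  have "of_int (p\<^sup>2 + q\<^sup>2 - p * q) = (1 :: real)" using assms(2) by (simp add: qsize_def a)
  hence eq: "p\<^sup>2 + q\<^sup>2 - p * q = 1" by (metis of_int_eq_1_iff)
  have "(2 * p - q)\<^sup>2 + 3 * q\<^sup>2 = 4" "(2 * q - p)\<^sup>2 + 3 * p\<^sup>2 = 4"
    using eq by (simp_all add: power2_eq_square algebra_simps)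
  hence "3 * q\<^sup>2 \<le> 4" "3 * p\<^sup>2 \<le> 4" using zero_le_power2[of "2 * p - q"] zero_le_power2[of "2 * q - p"] by linarith+
  hence "q\<^sup>2 < 2\<^sup>2" "p\<^sup>2 < 2\<^sup>2" by auto
  moreover have "\<bar>x\<bar> < 2" if "x\<^sup>2 < 2\<^sup>2" for x :: int
    using power2_less_imp_less[of "\<bar>x\<bar>" 2] that by simp
  ultimately have "\<bar>q\<bar> < 2" "\<bar>p\<bar> < 2" by blast+
  hence "p \<in> {-1, 0, 1}" "q \<in> {-1, 0, 1}" by auto
  hence pq: "(p, q) \<in> {(1, 0), (0, 1), (1, 1), (-1, 0), (0, -1), (-1, -1)}" using eq by auto
  have "a = Complex (of_int p) (of_int q)" using a by (simp add: complex_eq_iff)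
  moreover have "Complex 1 0 = 1" "Complex 0 1 = \<i>" "Complex 1 1 = 1 + \<i>" "Complex (-1) 0 = - 1" "Complex 0 (-1) = - \<i>"
    "Complex (-1) (-1) = - (1 + \<i>)" by (simp_all add: complex_eq_iff)
  ultimately have "a \<in> {1, \<i>, 1 + \<i>, - 1, - \<i>, - (1 + \<i>)}" using pq by auto
  thus ?thesis using bpt_base bpt_minus[of 1] bpt_minus[of \<i>] bpt_minus[of "1 + \<i>"]
    by (auto simp del: bpt_minus)
qed

text \<open>The discriminant of \<open>qsize\<close> in a basis of determinant 1 is fixed. Rewritten
  in the three defects of the triangle inequality it says that their pairwise products add up to 3;
  the defects are non-negative integers of equal parity, hence all 1.\<close>

lemma reduced_tri: 
  assumes "ubasis a b" "qsize (a + b) \<le> qsize a + qsize b" "qsize a \<le> qsize b + qsize (a + b)"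
    "qsize b \<le> qsize a + qsize (a + b)"
  shows "tri a b = {1, \<i>, -1}"
proof -
  have l: "a \<in> lat" "b \<in> lat" "a + b \<in> lat" using assms(1) by (auto simp: ubasis_def)
  obtain A B C :: int where q: "qsize a = of_int A" "qsize b = of_int B" "qsize (a + b) = of_int C"
    using qsize_int l by (metis Ints_cases)
  have "4 * qsize a * qsize b - (qsize (a + b) - qsize a - qsize b)\<^sup>2 = 3 * (cdet a b)\<^sup>2"
    by (simp add: qsize_def cdet_def power2_eq_square algebra_simps)
  hence "of_int (4 * A * B - (C - A - B)\<^sup>2) = (3 :: real)" using ubasis_det[OF assms(1)] by (simp add: q)
  hence eq: "4 * A * B - (C - A - B)\<^sup>2 = 3" by linarith
  have le: "C \<le> A + B" "A \<le> B + C" "B \<le> A + C"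
    using assms(2-4) unfolding q by linarith+
  have e: "even ((A + B - C) + (B + C - A))" "even ((A + B - C) + (A + C - B))" by simp_all
  have "(A + B - C) * (B + C - A) + (B + C - A) * (A + C - B) + (A + C - B) * (A + B - C) = 3"
    using eq by (simp add: power2_eq_square algebra_simps)
  note ones = int_same_parity_three[OF _ _ _ this e]
  have "A + B - C = 1" by (rule ones) (use le in linarith)+
  moreover have "B + C - A = 1" by (rule ones) (use le in linarith)+
  moreover have "A + C - B = 1" by (rule ones) (use le in linarith)+
  ultimately have "A = 1" "B = 1" "C = 1" by linarith+
  hence "qsize a = 1" "qsize b = 1" "qsize (a + b) = 1" using q by simp_all
  hence "tri a b \<subseteq> {1, \<i>, -1}" using qsize_one l unfolding tri_def by blast
  moreover have "card (tri a b) = 3" using tri_distinct[OF ubasis_det[OF assms(1)]] by (simp add: tri_def)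
  moreover have "card {1, \<i>, -1} = 3" by (simp add: complex_eq_iff)
  moreover have "finite {1, \<i>, -1}" by simp
  ultimately show ?thesis by (metis card_subset_eq)
qed

text \<open>Descent on the total size. If one vector is longer than the other two together,
  reflecting in the edge opposite to it replaces a + b by b - a, which is shorter by the
  parallelogram law; reflecting back recovers the triangle.\<close>

lemma tri_farey: "ubasis a b \<Longrightarrow> tri a b \<in> farey_triangles"
proof (induction "nat \<lfloor>qsize a + qsize b + qsize (a + b)\<rfloor>" arbitrary: a b rule: less_induct)
  case less
  let ?N = "\<lambda>a b. nat \<lfloor>qsize a + qsize b + qsize (a + b)\<rfloor>"
  \<comment> \<open>Stated for any basis of the same total size, so that it applies after a rotation
    has brought the long vector into third place.\<close>
  have step: "tri c d \<in> farey_triangles"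
    if c: "ubasis c d" "qsize (c + d) > qsize c + qsize d" and N: "?N c d = ?N a b" for c d
  proof -
    have l: "c \<in> lat" "d \<in> lat" using c(1) by (auto simp: ubasis_def)
    obtain A B C D :: int where q: "qsize c = of_int A" "qsize d = of_int B" "qsize (c + d) = of_int C" "qsize (d - c) = of_int D"
      using qsize_int l lat_closed(1)[OF l] lat_closed(2)[OF l(2,1)] by (metis Ints_cases)
    have "D = 2 * A + 2 * B - C" "A \<ge> 0" "B \<ge> 0" "C > A + B" "D \<ge> 0"
      using qsize_parallelogram[of d c] qsize_pos[of c] qsize_pos[of d] qsize_pos[of "d - c"] c(2) unfolding q
      by linarith+
    hence "nat (B + A + D) < nat (A + B + C)" by auto
    hence "?N d (- c) < ?N c d" using q by (simp flip: of_int_add)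
    hence "tri d (- c) \<in> farey_triangles" using less(1)[of d "- c"] ubasis_trans(1)[OF c(1)] N by simp
    from farey_triangles.reflect[OF this, of "bpt d" "bpt (- c)"]
    have "hyp_reflection (bpt d) (bpt (- c)) ` tri d (- c) \<in> farey_triangles"
      using tri_distinct(1)[OF ubasis_det[OF c(1)]] by (auto simp: tri_def)
    thus ?thesis using hyp_reflection_tri[OF ubasis_trans(1)[OF c(1)]] tri_minus[of c d] by simp
  qed
  show ?case
  proof (cases "qsize (a + b) \<le> qsize a + qsize b \<and> qsize a \<le> qsize b + qsize (a + b) \<and> qsize b \<le> qsize a + qsize (a + b)")
    case True
    thus ?thesis using reduced_tri[OF less(2)] farey_triangles.base by simp
  next
    case False
    have qm: "qsize (- a - b) = qsize (a + b)" using qsize_minus[of "a + b"] by (simp add: algebra_simps)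
    consider "qsize (a + b) > qsize a + qsize b" | "qsize a > qsize b + qsize (a + b)" | "qsize b > qsize a + qsize (a + b)"
      using False by linarith
    thus ?thesis
    proof cases
      case 1 thus ?thesis using step[OF less(2)] by simp
    next
      case 2 thus ?thesis using step[OF ubasis_trans(8)[OF less(2)]] tri_rotate(1)[of b a] qm
        by (simp add: add_ac)
    next
      case 3 thus ?thesis using step[OF ubasis_trans(9)[OF less(2)]] tri_rotate(2)[of a b] qm
        by (simp add: add_ac)
    qed
  qed
qed

lemma farey_tri: "T \<in> farey_triangles \<Longrightarrow> \<exists>a b. ubasis a b \<and> T = tri a b"
proof (induction rule: farey_triangles.induct)
  case base
  have "ubasis 1 \<i>" "tri 1 \<i> = {1, \<i>, -1}" using bpt_base by (auto simp: ubasis_def lat_def cdet_def tri_def)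
  thus ?case by metis
next
  case (reflect T p q)
  then obtain a b where T: "ubasis a b" "T = tri a b" by blast
  obtain a' b' where ab: "ubasis a' b'" "tri a b = tri a' b'" "{p, q} = {bpt a', bpt b'}"
    using tri_pair[OF T(1), of p q] reflect(2-4) T(2) by metis
  have "hyp_reflection p q = hyp_reflection (bpt a') (bpt b')"
    using ab(3) hyp_reflection_commute by (metis doubleton_eq_iff)
  hence "hyp_reflection p q ` T = tri b' (- a')" using hyp_reflection_tri[OF ab(1)] ab T by simp
  thus ?case using ubasis_trans(1)[OF ab(1)] by blast
qed

lemma farey_triangles_eq: "farey_triangles = {tri a b |a b. ubasis a b}"
  using farey_tri tri_farey by blast

lemma farey_vertices_eq: "farey_vertices = bpt ` prim"
proof -
  have "\<And>a b. ubasis a b \<Longrightarrow> a + b \<in> prim" using ubasis_trans(6) ubasis_prim(2) by blast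
  hence "farey_vertices \<subseteq> bpt ` prim"
    unfolding farey_vertices_def farey_triangles_eq using ubasis_prim by (auto simp: tri_def)
  moreover have "bpt ` prim \<subseteq> farey_vertices"
    unfolding farey_vertices_def farey_triangles_eq by (auto simp: tri_def prim_def)
  ultimately show ?thesis by blast
qed

lemma farey_edges_eq: "farey_edges = {{bpt a, bpt b} |a b. ubasis a b}"
proof
  show "farey_edges \<subseteq> {{bpt a, bpt b} |a b. ubasis a b}"
  proof
    fix e assume "e \<in> farey_edges"
    then obtain p q a b where e: "e = {p, q}" "p \<noteq> q" "p \<in> tri a b" "q \<in> tri a b" "ubasis a b"
      by (auto simp: farey_edges_def farey_triangles_eq)
    from tri_pair[OF e(5,3,4,2)] show "e \<in> {{bpt a, bpt b} |a b. ubasis a b}" using e(1) by (metis (mono_tags, lifting) mem_Collect_eq)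
  qed
  show "{{bpt a, bpt b} |a b. ubasis a b} \<subseteq> farey_edges"
  proof clarify
    fix a b assume ab: "ubasis a b"
    have "bpt a \<noteq> bpt b" "bpt a \<in> tri a b" "bpt b \<in> tri a b" "tri a b \<in> farey_triangles"
      using tri_distinct[OF ubasis_det[OF ab]] tri_farey[OF ab] by (auto simp: tri_def)
    thus "{bpt a, bpt b} \<in> farey_edges" unfolding farey_edges_def by blast
  qed
qed

section \<open>Edges at a vertex and their indexings\<close>

lemma fan_edge: assumes "ubasis a b" "ubasis a c" obtains n :: int where "c = b - of_int n * a"
proof -
  have "c \<in> lat" using assms(2) by (auto simp: ubasis_def)
  from ubasis_expand[OF assms(1) this] obtain m n where
    mn: "c = of_int m * a + of_int n * b" "cdet a c = of_int n" by blast
  have "n = 1" using mn(2) ubasis_det[OF assms(2)] by simp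
  hence "c = b - of_int (- m) * a" using mn by simp
  thus ?thesis using that by blast
qed

lemma edge_at_vertex: assumes "a \<in> prim" "{bpt a, p} \<in> farey_edges"
  obtains b where "ubasis a b" "p = bpt b"
proof -
  obtain c d where cd: "ubasis c d" "{bpt a, p} = {bpt c, bpt d}" using assms(2) by (auto simp: farey_edges_eq)
  have ne: "bpt c \<noteq> bpt d" using tri_distinct ubasis_det cd by blast
  note pr = ubasis_prim[OF cd(1)]
  have "bpt a = bpt c \<and> p = bpt d \<or> bpt a = bpt d \<and> p = bpt c" using cd(2) by (auto simp: doubleton_eq_iff)
  thus ?thesis
  proof
    assume h: "bpt a = bpt c \<and> p = bpt d"
    hence "c = a \<or> c = - a" using bpt_eq_prim assms(1) pr by blast
    thus ?thesis using that[of d] that[of "- d"] h cd(1) ubasis_trans(2)[OF cd(1)] by auto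
  next
    assume h: "bpt a = bpt d \<and> p = bpt c"
    hence "d = a \<or> d = - a" using bpt_eq_prim assms(1) pr by blast
    thus ?thesis using that[of "- c"] that[of "c"] h ubasis_trans(1)[OF cd(1)] ubasis_trans(3)[OF cd(1)] by auto
  qed
qed

lemma fan_eq: assumes "ubasis a b" shows "fan (bpt a) = range (\<lambda>n::int. {bpt a, bpt (b - of_int n * a)})"
proof
  show "fan (bpt a) \<subseteq> range (\<lambda>n::int. {bpt a, bpt (b - of_int n * a)})"
  proof
    fix e assume e: "e \<in> fan (bpt a)"
    have e': "e \<in> farey_edges" "bpt a \<in> e" using e by (auto simp: fan_def)
    then obtain p q where "e = {p, q}" unfolding farey_edges_def by blast
    hence "e = {bpt a, q} \<or> e = {bpt a, p}" using e'(2) by (auto simp: insert_commute)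
    with e' obtain p where p: "e = {bpt a, p}" "{bpt a, p} \<in> farey_edges" by metis
    obtain c where c: "ubasis a c" "p = bpt c" using edge_at_vertex[OF ubasis_prim(1)[OF assms] p(2)] by blast
    obtain n where "c = b - of_int n * a" using fan_edge[OF assms c(1)] by blast
    hence "e = {bpt a, bpt (b - of_int n * a)}" using c p by simp
    thus "e \<in> range (\<lambda>n::int. {bpt a, bpt (b - of_int n * a)})" by blast
  qed
  show "range (\<lambda>n::int. {bpt a, bpt (b - of_int n * a)}) \<subseteq> fan (bpt a)"
    using ubasis_trans(5)[OF assms] by (auto simp: fan_def farey_edges_eq)
qed

lemma fan_indexing_bpt: assumes "ubasis a b" shows "fan_indexing (bpt a) (\<lambda>n. bpt (b - of_int n * a))"
proof -
  note d = ubasis_det[OF assms]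
  have h: "hmap a b (bpt (b - of_int n * a)) = of_int n" for n :: int
    using hmap_bpt_diff[OF d, of "of_int n"] by simp
  have ne: "bpt a \<noteq> bpt (b - of_int n * a)" for n :: int
    using tri_distinct(1)[OF ubasis_det[OF ubasis_trans(5)[OF assms, of n]]] .
  have "inj (\<lambda>n::int. {bpt a, bpt (b - of_int n * a)})"
  proof (rule injI)
    fix m n :: int assume "{bpt a, bpt (b - of_int m * a)} = {bpt a, bpt (b - of_int n * a)}"
    hence "bpt (b - of_int m * a) = bpt (b - of_int n * a)" using ne by (auto simp: doubleton_eq_iff)
    thus "m = n" using h by (metis of_int_eq_iff)
  qed
  hence "bij_betw (\<lambda>n::int. {bpt a, bpt (b - of_int n * a)}) UNIV (fan (bpt a))"
    unfolding fan_eq[OF assms] bij_betw_def by blast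
  moreover have "\<forall>n. hmap a b (bpt (b - of_int n * a)) = complex_of_real (0 + of_int n * 1)" using h by simp
  ultimately show ?thesis unfolding fan_indexing_def using half_plane_moebius_hmap[OF d] zero_less_one by blast
qed

text \<open>In the chart the fan occupies all integers, so equal spacing makes the position of
  \<open>w n\<close> an affine function \<open>s 0 + n * j\<close>. The orientation gives j > 0, and
  since the neighbour of \<open>w 0\<close> must be reached, j divides 1.\<close>

lemma fan_indexingE: assumes "a \<in> prim" "fan_indexing (bpt a) w"
  obtains b where "ubasis a b" "w = (\<lambda>n. bpt (b - of_int n * a))"
proof -
  obtain b where b: "ubasis a b" using assms(1) by (auto simp: prim_def)
  note d = ubasis_det[OF b]
  have bij: "bij_betw (\<lambda>n. {bpt a, w n}) UNIV (fan (bpt a))" using assms(2) by (simp add: fan_indexing_def)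
  obtain m x \<delta> where m: "half_plane_moebius (bpt a) m" "\<delta> > 0" "\<And>n. m (w n) = complex_of_real (x + of_int n * \<delta>)"
    using assms(2) by (auto simp: fan_indexing_def)
  obtain k t where k: "k > 0" "\<And>z. z \<noteq> bpt a \<Longrightarrow> m z = of_real k * hmap a b z + of_real t"
    using half_plane_moebius_affine[OF d m(1)] by blast
  have "\<exists>s::int. w n = bpt (b - of_int s * a)" for n
  proof -
    have "{bpt a, w n} \<in> farey_edges" using bij by (auto simp: bij_betw_def fan_def)
    then obtain c where "ubasis a c" "w n = bpt c" using edge_at_vertex[OF assms(1)] by blast
    thus ?thesis using fan_edge[OF b] by metis
  qed
  then obtain s :: "int \<Rightarrow> int" where s: "\<And>n. w n = bpt (b - of_int (s n) * a)" by metis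
  have ne: "w n \<noteq> bpt a" for n
    using tri_distinct(1)[OF ubasis_det[OF ubasis_trans(5)[OF b, of "s n"]]] s by simp
  have "hmap a b (w n) = of_int (s n)" for n using hmap_bpt_diff[OF d, of "of_int (s n)"] s by simp
  hence "of_real (x + of_int n * \<delta>) = (of_real (k * of_int (s n) + t) :: complex)" for n
    using m(3)[of n] k(2)[OF ne[of n]] by simp
  hence eq: "x + of_int n * \<delta> = k * of_int (s n) + t" for n by (simp only: of_real_eq_iff)
  have diff: "k * of_int (s n - s 0) = of_int n * \<delta>" for n using eq[of n] eq[of 0] by (simp add: algebra_simps)
  define j where "j = s 1 - s 0"
  have kj: "k * of_int j = \<delta>" using diff[of 1] by (simp add: j_def)
  have sn: "s n = s 0 + n * j" for n
  proof -
    have "k * of_int (s n - s 0) = k * of_int (n * j)" using diff[of n] kj by simp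
    hence "s n - s 0 = n * j" using k(1) by (metis less_irrefl mult_cancel_left of_int_eq_iff)
    thus ?thesis by simp
  qed
  have "\<exists>n. {bpt a, w n} = {bpt a, bpt (b - of_int (s 0 + 1) * a)}"
  proof -
    have "{bpt a, bpt (b - of_int (s 0 + 1) * a)} \<in> fan (bpt a)" unfolding fan_eq[OF b] by blast
    hence "{bpt a, bpt (b - of_int (s 0 + 1) * a)} \<in> range (\<lambda>n. {bpt a, w n})"
      using bij unfolding bij_betw_def by blast
    then obtain n where "{bpt a, bpt (b - of_int (s 0 + 1) * a)} = {bpt a, w n}" by (rule rangeE)
    thus ?thesis by (intro exI[of _ n]) (rule sym)
  qed
  then obtain n where "w n = bpt (b - of_int (s 0 + 1) * a)" using ne by (auto simp: doubleton_eq_iff)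
  hence "of_int (s n) = (of_int (s 0 + 1) :: complex)" 
    using hmap_bpt_diff[OF d, of "of_int (s n)"] hmap_bpt_diff[OF d, of "of_int (s 0 + 1)"] s by simp
  hence "s n = s 0 + 1" by (simp only: of_int_eq_iff)
  hence "n * j = 1" using sn[of n] by simp
  moreover have "j > 0" using kj k(1) m(2) by (metis of_int_0_less_iff zero_less_mult_pos)
  ultimately have "j = 1" by (auto simp: zmult_eq_1_iff)
  hence "w n = bpt ((b - of_int (s 0) * a) - of_int n * a)" for n using s[of n] sn[of n] by (simp add: algebra_simps)
  thus ?thesis using that[OF ubasis_trans(5)[OF b, of "s 0"]] by blast
qed

lemma fan_from_eq: assumes "ubasis a b" shows "fan_from (bpt a) {bpt a, bpt b} = (\<lambda>n. bpt (b - of_int n * a))"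
  unfolding fan_from_def
proof (rule the_equality)
  show "fan_indexing (bpt a) (\<lambda>n. bpt (b - of_int n * a)) \<and> {bpt a, bpt b} = {bpt a, bpt (b - of_int 0 * a)}"
    using fan_indexing_bpt[OF assms] by simp
  fix w assume w: "fan_indexing (bpt a) w \<and> {bpt a, bpt b} = {bpt a, w 0}"
  obtain c where c: "ubasis a c" "w = (\<lambda>n. bpt (c - of_int n * a))"
    using fan_indexingE ubasis_prim(1)[OF assms] w by blast
  have "bpt b = bpt c" using w c(2) tri_distinct(1) ubasis_det[OF assms] ubasis_det[OF c(1)] 
    by (auto simp: doubleton_eq_iff)
  hence "c = b \<or> c = - b" using bpt_eq_prim ubasis_prim(2) assms c(1) by blast
  hence "c = b" using ubasis_det[OF assms] ubasis_det[OF c(1)] by auto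
  thus "w = (\<lambda>n. bpt (b - of_int n * a))" using c by simp
qed

lemma farey_third: assumes "ubasis a b" "{bpt a, bpt b, p} \<in> farey_triangles" "p \<noteq> bpt a" "p \<noteq> bpt b"
  shows "p = bpt (b - a) \<or> p = bpt (a + b)"
proof -
  obtain c d where cd: "ubasis c d" "{bpt a, bpt b, p} = tri c d" using assms(2) farey_tri by blast
  have "bpt a \<in> tri c d" "bpt b \<in> tri c d" unfolding cd(2)[symmetric] by auto
  then obtain a' b' where ab: "ubasis a' b'" "tri c d = tri a' b'" "{bpt a, bpt b} = {bpt a', bpt b'}"
    using tri_pair[OF cd(1)] tri_distinct(1)[OF ubasis_det[OF assms(1)]] by metis
  have "p \<in> tri a' b'" unfolding ab(2)[symmetric] cd(2)[symmetric] by simp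
  moreover have "p \<notin> {bpt a', bpt b'}" using assms(3,4) unfolding ab(3)[symmetric] by simp
  ultimately have p: "p = bpt (a' + b')" by (simp add: tri_def)
  have "bpt (- a - b) = bpt (a + b)" "bpt (a - b) = bpt (b - a)"
    using bpt_minus[of "a + b"] bpt_minus[of "a - b"] by simp_all
  thus ?thesis using edge_eq[OF assms(1) ab(1,3)] p by (auto simp: add.commute)
qed

section \<open>Shears and the gaps of image fans\<close>

lemma cross_ratio_bpt: assumes "a \<noteq> 0" "b \<noteq> 0" "c \<noteq> 0" "d \<noteq> 0"
  shows "cross_ratio (bpt a) (bpt b) (bpt c) (bpt d) = of_real (cdet a b * cdet c d / (cdet b c * cdet a d))"
  using assms by (simp add: cross_ratio_def bpt_diff)

lemma cross_ratio_rotate: "cross_ratio c d a b = cross_ratio a b c d"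
proof -
  have "(a - d) * (b - c) = (c - b) * (d - a)" by (simp add: algebra_simps)
  thus ?thesis by (simp add: cross_ratio_def mult.commute)
qed

lemma ccw_distinct: assumes "ccw a b c" shows "a \<noteq> b" "b \<noteq> c" "a \<noteq> c"
  using assms by (auto simp: ccw_def algebra_simps)

lemma farey_quad_unique: assumes "ubasis a b" "farey_quad e (bpt a) p (bpt b) q"
  shows "p = bpt (a + b)" "q = bpt (b - a)"
proof -
  note d = ubasis_det[OF assms(1)]
  have nz: "a \<noteq> 0" "b \<noteq> 0" "b - a \<noteq> 0" "a + b \<noteq> 0" 
    using d cdet_nz(2)[of a "b - a"] cdet_nz(2)[of a "a + b"] by auto
  have q: "{bpt a, p, bpt b} \<in> farey_triangles" "{bpt a, bpt b, q} \<in> farey_triangles" "ccw (bpt a) p (bpt b)" "ccw (bpt a) (bpt b) q"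
    using assms(2) by (auto simp: farey_quad_def)
  have "{bpt a, bpt b, p} \<in> farey_triangles" using q(1) by (simp add: insert_commute)
  hence "p = bpt (b - a) \<or> p = bpt (a + b)" using farey_third[OF assms(1)] ccw_distinct[OF q(3)] by metis
  moreover have "\<not> ccw (bpt a) (bpt (b - a)) (bpt b)" using nz d by (simp add: ccw_bpt)
  ultimately show "p = bpt (a + b)" using q(3) by auto
  have "q = bpt (b - a) \<or> q = bpt (a + b)" using farey_third[OF assms(1) q(2)] ccw_distinct[OF q(4)] by metis
  moreover have "\<not> ccw (bpt a) (bpt b) (bpt (a + b))" using nz d by (simp add: ccw_bpt cdet_commute[of b a])
  ultimately show "q = bpt (b - a)" using q(4) by auto
qed

lemma farey_quad_bpt: assumes "ubasis a b"
  shows "farey_quad {bpt a, bpt b} (bpt a) (bpt (a + b)) (bpt b) (bpt (b - a))"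
proof -
  note d = ubasis_det[OF assms(1)]
  have nz: "a \<noteq> 0" "b \<noteq> 0" "b - a \<noteq> 0" "a + b \<noteq> 0" 
    using d cdet_nz(2)[of a "b - a"] cdet_nz(2)[of a "a + b"] by auto
  have "{bpt a, bpt (a + b), bpt b} \<in> farey_triangles" "{bpt a, bpt b, bpt (b - a)} \<in> farey_triangles"
    using tri_farey[OF assms] tri_farey[OF ubasis_trans(1)[OF assms]] tri_other
    by (simp_all add: tri_def insert_commute)
  moreover have "ccw (bpt a) (bpt (a + b)) (bpt b)" "ccw (bpt a) (bpt b) (bpt (b - a))" 
    using nz d by (simp_all add: ccw_bpt cdet_commute[of b a])
  ultimately show ?thesis by (simp add: farey_quad_def)
qed

text \<open>In the image chart the quadrilateral has the vertices \<infinity>, -l, 0, r, whose cross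
  ratio is r / l. Both labellings of the quadrilateral have to be checked, because
  \<open>shear\<close> is a definite description.\<close>

lemma shear_eq:
  assumes "ubasis a b" "cdet a' b' = 1" "h (bpt a) = bpt a'" "h (bpt b) = bpt b'"
    "h (bpt (b - a)) = bpt (b' - of_real r * a')" "h (bpt (a + b)) = bpt (b' + of_real l * a')" "l > 0" "r > 0"
  shows "shear h {bpt a, bpt b} = ln (r / l)"
proof -
  have c: "cdet a' (b' - of_real r * a') = 1" "cdet a' (b' + of_real l * a') = 1" "cdet (b' + of_real l * a') b' = l"
    "cdet b' (b' - of_real r * a') = r"
    using assms(2) by (simp_all add: cdet_commute[of b' a'])
  have nz: "a' \<noteq> 0" "b' \<noteq> 0" "b' - of_real r * a' \<noteq> 0" "b' + of_real l * a' \<noteq> 0" 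
    using assms(2) cdet_nz(2)[of a' "b' - of_real r * a'"] cdet_nz(2)[of a' "b' + of_real l * a'"] c by auto
  have cr: "Re (cross_ratio (h (bpt a)) (h (bpt (a + b))) (h (bpt b)) (h (bpt (b - a)))) = r / l"
    unfolding assms(3-6) using nz assms(2) c by (simp add: cross_ratio_bpt cdet_commute[of b' a'])
  show ?thesis unfolding shear_def
  proof (rule the_equality)
    show "\<exists>p q u v. farey_quad {bpt a, bpt b} p q u v \<and> ln (r / l) = ln (Re (cross_ratio (h p) (h q) (h u) (h v)))"
      using farey_quad_bpt[OF assms(1)] cr by metis
    fix x assume "\<exists>p q u v. farey_quad {bpt a, bpt b} p q u v \<and> x = ln (Re (cross_ratio (h p) (h q) (h u) (h v)))"
    then obtain p q u v where x: "farey_quad {bpt a, bpt b} p q u v" "x = ln (Re (cross_ratio (h p) (h q) (h u) (h v)))" by blast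
    have "{p, u} = {bpt a, bpt b}" using x(1) by (simp add: farey_quad_def)
    hence "p = bpt a \<and> u = bpt b \<or> p = bpt b \<and> u = bpt a" by (auto simp: doubleton_eq_iff)
    thus "x = ln (r / l)"
    proof
      assume "p = bpt a \<and> u = bpt b"
      thus ?thesis using farey_quad_unique[OF assms(1)] x cr by metis
    next
      assume pu: "p = bpt b \<and> u = bpt a"
      hence "q = bpt (b - a)" "v = bpt (a + b)"
        using farey_quad_unique[OF ubasis_trans(1)[OF assms(1)]] x(1) bpt_minus[of "a + b"] by force+
      thus ?thesis using x(2) pu cr cross_ratio_rotate by metis
    qed
  qed
qed

section \<open>Shears as alternating sums of Psi\<close>

locale shear_summable =
  fixes s :: "complex set \<Rightarrow> real"
  assumes P: "s \<in> shear_class_P"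
begin

text \<open>The share of the endpoint \<open>bpt a\<close> in four times \<open>Psi\<close> of the
  edge (a, b).\<close>

definition pdiff :: "complex \<Rightarrow> complex \<Rightarrow> real" where
  "pdiff a b = p_minus s (bpt a) {bpt a, bpt b} - p_plus s (bpt a) {bpt a, bpt b}"

lemma convergent_fan: assumes "ubasis a b"
  shows "convergent (\<lambda>n::nat. \<Sum>k = - int n..-1. s {bpt a, bpt (b - of_int k * a)})"
    "convergent (\<lambda>n::nat. \<Sum>k = 0..int n. s {bpt a, bpt (b - of_int k * a)})"
proof -
  have "bpt a \<in> farey_vertices" using farey_vertices_eq ubasis_prim(1)[OF assms] by blast
  thus "convergent (\<lambda>n::nat. \<Sum>k = - int n..-1. s {bpt a, bpt (b - of_int k * a)})"
    "convergent (\<lambda>n::nat. \<Sum>k = 0..int n. s {bpt a, bpt (b - of_int k * a)})"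
    using P fan_indexing_bpt[OF assms] unfolding shear_class_P_def by blast+
qed

text \<open>Passing to the next edge of the fan moves one shear into the sum over smaller indices
  and takes one out of the sum over larger indices.\<close>

lemma pdiff_step: assumes "ubasis a b"
  shows "pdiff a (b - a) - pdiff a b = s {bpt a, bpt b} + s {bpt a, bpt (b - a)}"
proof -
  define g where "g k = s {bpt a, bpt (b - of_int k * a)}" for k :: int
  obtain Lp where Lp: "(\<lambda>n::nat. \<Sum>k = 0..int n. g k) \<longlonglongrightarrow> Lp"
    using convergent_fan(2)[OF assms] unfolding g_def by (auto simp: convergent_def)
  obtain Lm where Lm: "(\<lambda>n::nat. \<Sum>k = - int n..-1. g k) \<longlonglongrightarrow> Lm"
    using convergent_fan(1)[OF assms] unfolding g_def by (auto simp: convergent_def)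
  have sg: "s {bpt a, bpt (b - a - of_int k * a)} = g (k + 1)" for k by (simp add: g_def algebra_simps)
  have "p_plus s (bpt a) {bpt a, bpt b} = Lp - g 0"
    unfolding p_plus_def fan_from_eq[OF assms] g_def[symmetric]
  proof (rule limI)
    have "(\<Sum>k = 1..int n. g k) = (\<Sum>k = 0..int n. g k) - g 0" for n
    proof -
      have "{0..int n} = insert 0 {1..int n}" by auto
      thus ?thesis by simp
    qed
    thus "(\<lambda>n. \<Sum>k = 1..int n. g k) \<longlonglongrightarrow> Lp - g 0" using Lp by (simp add: tendsto_diff)
  qed
  moreover have "p_minus s (bpt a) {bpt a, bpt b} = Lm"
    unfolding p_minus_def fan_from_eq[OF assms] g_def[symmetric] using Lm by (rule limI)
  moreover have "p_plus s (bpt a) {bpt a, bpt (b - a)} = Lp - g 0 - g 1"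
    unfolding p_plus_def fan_from_eq[OF ubasis_trans(7)[OF assms]] sg
  proof (rule limI)
    have "(\<Sum>k = 1..int n. g (k + 1)) = (\<Sum>k = 0..int (Suc n). g k) - g 0 - g 1" for n
    proof -
      have "{0..int (Suc n)} = insert 0 (insert 1 {2..int n + 1})" by auto
      moreover have "(\<Sum>k = 1..int n. g (k + 1)) = (\<Sum>k = 2..int n + 1. g k)"
        by (rule sum.reindex_bij_witness[of _ "\<lambda>k. k - 1" "\<lambda>k. k + 1"]) auto
      ultimately show ?thesis by simp
    qed
    moreover have "(\<lambda>n. \<Sum>k = 0..int (Suc n). g k) \<longlonglongrightarrow> Lp" using LIMSEQ_Suc[OF Lp] by simp
    ultimately show "(\<lambda>n. \<Sum>k = 1..int n. g (k + 1)) \<longlonglongrightarrow> Lp - g 0 - g 1" by (simp only:) (intro tendsto_intros)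
  qed
  moreover have "p_minus s (bpt a) {bpt a, bpt (b - a)} = Lm + g 0"
    unfolding p_minus_def fan_from_eq[OF ubasis_trans(7)[OF assms]] sg
  proof (rule limI)
    have "(\<Sum>k = - int (Suc n)..-1. g (k + 1)) = (\<Sum>k = - int n..-1. g k) + g 0" for n
    proof -
      have "{- int n..0} = insert 0 {- int n..-1}" by auto
      moreover have "(\<Sum>k = - int (Suc n)..-1. g (k + 1)) = (\<Sum>k = - int n..0. g k)"
        by (rule sum.reindex_bij_witness[of _ "\<lambda>k. k - 1" "\<lambda>k. k + 1"]) auto
      ultimately show ?thesis by simp
    qed
    hence "(\<lambda>n. \<Sum>k = - int (Suc n)..-1. g (k + 1)) \<longlonglongrightarrow> Lm + g 0" 
      by (simp only:) (intro tendsto_intros Lm)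
    thus "(\<lambda>n. \<Sum>k = - int n..-1. g (k + 1)) \<longlonglongrightarrow> Lm + g 0" by (rule LIMSEQ_imp_Suc)
  qed
  ultimately show ?thesis by (simp add: pdiff_def g_def)
qed

lemma pdiff_minus: "pdiff (- a) b = pdiff a b" "pdiff a (- b) = pdiff a b"
  by (simp_all add: pdiff_def)

lemma Psi_eq: assumes "ubasis a b" shows "Psi s {bpt a, bpt b} = (pdiff a b + pdiff b a) / 4"
proof -
  have "bpt a \<noteq> bpt b" using tri_distinct(1)[OF ubasis_det[OF assms]] .
  thus ?thesis by (simp add: Psi_def pdiff_def insert_commute)
qed

text \<open>There are two steps of \<open>pdiff_step\<close> at each end of the edge and one at each
  opposite vertex. In the alternating sum the shears of the four sides cancel and the shear of the
  diagonal remains four times.\<close>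

lemma shear_Psi: assumes "ubasis a b"
  shows "s {bpt a, bpt b} = Psi s {bpt a, bpt (b - a)} + Psi s {bpt b, bpt (a + b)}
     - Psi s {bpt a, bpt (a + b)} - Psi s {bpt b, bpt (b - a)}"
proof -
  note t = ubasis_trans
  have c: "ubasis b (b - a)" "ubasis (b - a) (- a)" 
    using assms by (auto simp: ubasis_def cdet_commute[of b a])
  have 1: "Psi s {bpt a, bpt (b - a)} = (pdiff a (b - a) + pdiff (b - a) a) / 4" using Psi_eq[OF t(7)[OF assms]] .
  have 2: "Psi s {bpt b, bpt (a + b)} = (pdiff b (a + b) + pdiff (a + b) b) / 4" 
    using Psi_eq[OF t(10)[OF assms]] by (simp add: insert_commute add.commute)
  have 3: "Psi s {bpt a, bpt (a + b)} = (pdiff a (a + b) + pdiff (a + b) a) / 4" using Psi_eq[OF t(6)[OF assms]] .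
  have 4: "Psi s {bpt b, bpt (b - a)} = (pdiff b (b - a) + pdiff (b - a) b) / 4" using Psi_eq[OF c(1)] .
  have s1: "pdiff a (b - a) - pdiff a b = s {bpt a, bpt b} + s {bpt a, bpt (b - a)}" using pdiff_step[OF assms] .
  have s2: "pdiff a b - pdiff a (a + b) = s {bpt a, bpt (a + b)} + s {bpt a, bpt b}" using pdiff_step[OF t(6)[OF assms]] by simp
  have s3: "pdiff b (a + b) - pdiff b a = s {bpt b, bpt a} + s {bpt b, bpt (a + b)}"
    using pdiff_step[OF t(1)[OF assms]] pdiff_minus(2)[of b "a + b"] bpt_minus[of "a + b"] bpt_minus[of a]
    by (simp add: pdiff_minus del: bpt_minus)
  have s4: "pdiff b a - pdiff b (b - a) = s {bpt b, bpt (b - a)} + s {bpt b, bpt a}"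
    using pdiff_step[OF c(1)] by (simp add: pdiff_minus)
  have s5: "pdiff (a + b) a - pdiff (a + b) b = s {bpt (a + b), bpt b} + s {bpt (a + b), bpt a}"
    using pdiff_step[OF t(10)[OF assms]] by (simp add: pdiff_minus)
  have s6: "pdiff (b - a) b - pdiff (b - a) a = s {bpt (b - a), bpt a} + s {bpt (b - a), bpt b}"
    using pdiff_step[OF c(2)] by (simp add: pdiff_minus)
  have com: "{bpt b, bpt a} = {bpt a, bpt b}" "{bpt (a + b), bpt b} = {bpt b, bpt (a + b)}" "{bpt (a + b), bpt a} = {bpt a, bpt (a + b)}"
   "{bpt (b - a), bpt a} = {bpt a, bpt (b - a)}" "{bpt (b - a), bpt b} = {bpt b, bpt (b - a)}" by auto
  show ?thesis unfolding 1 2 3 4 using s1 s2 s3 s4 s5 s6 unfolding com by (simp add: field_simps)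
qed

text \<open>Summing \<open>shear_Psi\<close> along a fan telescopes: at either end two spokes and
  one rim edge survive, six terms whatever the length.\<close>

lemma fan_sum_Psi: assumes "ubasis a b" "m \<le> n"
  defines "B \<equiv> \<lambda>k::int. bpt (b - of_int k * a)"
  shows "(\<Sum>k = m + 1..n. s {bpt a, B k}) = Psi s {bpt a, B n} + Psi s {bpt a, B (n + 1)} - Psi s {bpt a, B m}
     - Psi s {bpt a, B (m + 1)} + Psi s {B m, B (m + 1)} - Psi s {B n, B (n + 1)}"
  using assms(2)
proof (induction n rule: int_ge_induct)
  case base thus ?case by simp
next
  case (step n)
  have "{m + 1..n + 1} = insert (n + 1) {m + 1..n}" using step(1) by auto
  hence "(\<Sum>k = m + 1..n + 1. s {bpt a, B k}) = (\<Sum>k = m + 1..n. s {bpt a, B k}) + s {bpt a, B (n + 1)}" by simp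
  moreover have "B (n + 1) = bpt (b - of_int (n + 1) * a)" "B (n + 1 + 1) = bpt (b - of_int (n + 1) * a - a)" "B n = bpt (a + (b - of_int (n + 1) * a))"
    by (simp_all add: B_def algebra_simps)
  ultimately show ?case using step(2) shear_Psi[OF ubasis_trans(5)[OF assms(1), of "n + 1"]]
    by (simp add: insert_commute)
qed

lemma fan_sum_bound:
  assumes "ubasis a b" "m \<le> n" and C: "\<And>e. e \<in> farey_edges \<Longrightarrow> \<bar>Psi s e\<bar> \<le> C"
  shows "\<bar>\<Sum>k = m + 1..n. s {bpt a, bpt (b - of_int k * a)}\<bar> \<le> 6 * C"
proof -
  have 1: "\<bar>Psi s {bpt a, bpt (b - of_int k * a)}\<bar> \<le> C" for k
    using ubasis_trans(5)[OF assms(1)] by (intro C) (auto simp: farey_edges_eq)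
  have 2: "\<bar>Psi s {bpt (b - of_int k * a), bpt (b - of_int (k + 1) * a)}\<bar> \<le> C" for k
  proof (rule C)
    have "ubasis (b - of_int k * a) (b - of_int (k + 1) * a)"
      using assms(1) by (simp add: ubasis_def cdet_commute[of b a] distrib_right del: of_int_add)
    thus "{bpt (b - of_int k * a), bpt (b - of_int (k + 1) * a)} \<in> farey_edges" by (auto simp: farey_edges_eq)
  qed
  show ?thesis unfolding fan_sum_Psi[OF assms(1,2)] 
    using 1[of n] 1[of "n + 1"] 1[of m] 1[of "m + 1"] 2[of m] 2[of n] by linarith
qed

end

section \<open>Images of fans and their gaps\<close>

locale circle_map =
  fixes h :: "complex \<Rightarrow> complex"
  assumes circle: "circle_homeo h"
begin

lemma norm_h [simp]: "norm u = 1 \<Longrightarrow> norm (h u) = 1"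
  using circle unfolding circle_homeo_def homeomorphism_def by (force simp: image_iff)

lemma inj_h: "norm u = 1 \<Longrightarrow> norm v = 1 \<Longrightarrow> h u = h v \<Longrightarrow> u = v"
  using circle unfolding circle_homeo_def homeomorphism_def by (metis dist_0_norm mem_sphere)

lemma ccw_h: "norm u = 1 \<Longrightarrow> norm v = 1 \<Longrightarrow> norm w = 1 \<Longrightarrow> ccw u v w \<Longrightarrow> ccw (h u) (h v) (h w)"
  using circle unfolding circle_homeo_def by (metis dist_0_norm mem_sphere)

text \<open>Lifts of three points are determined only up to three scalars. These are used up by
  requiring determinant 1 and that the third lift be the sum of the others.\<close>

lemma image_lifts: assumes "ubasis a b"
  obtains a' b' where "cdet a' b' = 1" "h (bpt a) = bpt a'" "h (bpt b) = bpt b'" "h (bpt (a + b)) = bpt (a' + b')"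
proof -
  note d = ubasis_det[OF assms]
  have nz: "a \<noteq> 0" "b \<noteq> 0" "a + b \<noteq> 0" using d cdet_nz(2)[of a "a + b"] by auto
  obtain p where p: "p \<noteq> 0" "bpt p = h (bpt a)" using bpt_surj[of "h (bpt a)"] nz by auto
  obtain q where q: "q \<noteq> 0" "bpt q = h (bpt b)" using bpt_surj[of "h (bpt b)"] nz by auto
  obtain r where r: "r \<noteq> 0" "bpt r = h (bpt (a + b))" using bpt_surj[of "h (bpt (a + b))"] nz by auto
  have "ccw (bpt a) (bpt (a + b)) (bpt b)" using nz d by (simp add: ccw_bpt)
  hence "ccw (h (bpt a)) (h (bpt (a + b))) (h (bpt b))" using ccw_h nz by simp
  hence pos: "cdet p r * cdet r q * cdet p q > 0"
    unfolding p(2)[symmetric] q(2)[symmetric] r(2)[symmetric] ccw_bpt[OF p(1) r(1) q(1)] .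
  obtain v where v: "v = cdet p r * cdet r q * cdet p q" by simp
  \<comment> \<open>Cramer's rule for r gives the proportions of the new lifts. The common factor t
    makes their determinant 1; it exists because h preserves the orientation, which makes v
    positive.\<close>
  define t where "t = 1 / sqrt v"
  have "t * t * v = 1" "t \<noteq> 0" using pos by (simp_all add: t_def flip: v)
  hence t: "t * t * (cdet p r * cdet r q * cdet p q) = 1" "t \<noteq> 0" unfolding v by blast+
  have "cdet p r * cdet r q * cdet p q \<noteq> 0" using pos by linarith
  hence nz2: "cdet p r \<noteq> 0" "cdet r q \<noteq> 0" "cdet p q \<noteq> 0" by simp_all
  let ?a = "of_real (t * cdet r q) * p" and ?b = "of_real (t * cdet p r) * q"
  have "cdet ?a ?b = 1" using t(1) by (simp only: cdet_linear) (simp add: mult_ac)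
  moreover have "bpt ?a = h (bpt a)" "bpt ?b = h (bpt b)" 
    using p q t nz2 bpt_scale[of "t * cdet r q" p] bpt_scale[of "t * cdet p r" q] by simp_all
  moreover have "?a + ?b = of_real (t * cdet p q) * r"
    using cdet_expand[of p q r] by (simp add: algebra_simps) (metis distrib_left mult.commute mult.left_commute)
  hence "bpt (?a + ?b) = h (bpt (a + b))" using bpt_scale[of "t * cdet p q" r] nz2 t(2) r(2) by simp
  ultimately show ?thesis using that by metis
qed

text \<open>\<open>\<xi> n\<close> is the position of the image of the n-th fan vertex in the image
  chart, normalised like the chart in \<open>cell_map\<close>. It increases because h preserves the
  cyclic order, and the shear is the logarithm of the ratio of consecutive gaps.\<close>

lemma image_fan: assumes "ubasis a b"
  obtains a' b' \<xi> where "cdet a' b' = 1" "h (bpt a) = bpt a'" "\<And>n::int. h (bpt (b - of_int n * a)) = bpt (b' - of_real (\<xi> n) * a')"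
    "\<xi> 0 = 0" "\<xi> (- 1) = - 1" "\<And>n. \<xi> n < \<xi> (n + 1)"
    "\<And>n. shear h {bpt a, bpt (b - of_int n * a)} = ln ((\<xi> (n + 1) - \<xi> n) / (\<xi> n - \<xi> (n - 1)))"
proof -
  obtain a' b' where ab: "cdet a' b' = 1" "h (bpt a) = bpt a'" "h (bpt b) = bpt b'" "h (bpt (a + b)) = bpt (a' + b')"
    using image_lifts[OF assms] by blast
  note d = ubasis_det[OF assms]
  have bn: "cdet a (b - of_int n * a) = 1" "b - of_int n * a \<noteq> 0" for n :: int
  proof -
    show 1: "cdet a (b - of_int n * a) = 1" using d by simp
    show "b - of_int n * a \<noteq> 0" using cdet_nz(2)[of a "b - of_int n * a"] 1 by simp
  qed
  have nz: "a \<noteq> 0" "a' \<noteq> 0" using d ab by auto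
  have "\<exists>x. h (bpt (b - of_int n * a)) = bpt (b' - of_real x * a')" for n :: int
  proof -
    obtain r where r: "r \<noteq> 0" "bpt r = h (bpt (b - of_int n * a))"
      using bpt_surj[of "h (bpt (b - of_int n * a))"] bn by auto
    have "bpt a \<noteq> bpt (b - of_int n * a)" using tri_distinct(1)[OF bn(1)] .
    hence "bpt r \<noteq> bpt a'" using inj_h nz bn(2) r ab(2) by (metis norm_bpt)
    hence c: "cdet a' r \<noteq> 0" using bpt_eq_iff nz r(1) by metis
    let ?s = "of_real (1 / cdet a' r) * r"
    have "cdet a' ?s = 1" using c by (simp only: cdet_linear) simp
    hence "?s = b' - of_real (- cdet ?s b') * a'" using cdet_expand1[OF ab(1), of ?s] by (simp add: add.commute)
    hence "bpt (b' - of_real (- cdet ?s b') * a') = bpt r" using bpt_scale[of "1 / cdet a' r" r] c by simp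
    thus ?thesis using r(2) by metis
  qed
  then obtain \<xi> where \<xi>: "\<And>n::int. h (bpt (b - of_int n * a)) = bpt (b' - of_real (\<xi> n) * a')" by metis
  have inj: "x = y" if "bpt (b' - of_real x * a') = bpt (b' - of_real y * a')" for x y
    using hmap_bpt_diff[OF ab(1), of x] hmap_bpt_diff[OF ab(1), of y] that by (metis of_real_eq_iff)
  have x0: "\<xi> 0 = 0" 
    by (rule inj) (use \<xi>[of 0] ab(3) in simp)
  have x1: "\<xi> (- 1) = - 1"
    by (rule inj) (use \<xi>[of "-1"] ab(4) in \<open>simp add: add.commute\<close>)
  have xc: "cdet a' (b' - of_real x * a') = 1" "b' - of_real x * a' \<noteq> 0" for x
  proof -
    show 1: "cdet a' (b' - of_real x * a') = 1" using ab by simp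
    show "b' - of_real x * a' \<noteq> 0" using cdet_nz(2)[of a' "b' - of_real x * a'"] 1 by simp
  qed
  have mono: "\<xi> n < \<xi> (n + 1)" for n
  proof -
    have "cdet (b - of_int n * a) (b - of_int (n + 1) * a) = 1"
      using d by (simp add: cdet_commute[of b a] distrib_right del: of_int_add)
    hence "ccw (bpt a) (bpt (b - of_int n * a)) (bpt (b - of_int (n + 1) * a))"
      using bn[of n] bn[of "n + 1"] nz by (subst ccw_bpt) auto
    hence "ccw (bpt a') (bpt (b' - of_real (\<xi> n) * a')) (bpt (b' - of_real (\<xi> (n + 1)) * a'))"
      using ccw_h nz bn \<xi> ab(2) by (metis norm_bpt)
    hence "cdet (b' - of_real (\<xi> n) * a') (b' - of_real (\<xi> (n + 1)) * a') > 0"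
      using xc nz by (simp add: ccw_bpt)
    moreover have "cdet (b' - of_real (\<xi> n) * a') (b' - of_real (\<xi> (n + 1)) * a') = \<xi> (n + 1) - \<xi> n"
      using ab(1) by (simp add: cdet_commute[of b' a'])
    ultimately show ?thesis by simp
  qed
  have "shear h {bpt a, bpt (b - of_int n * a)} = ln ((\<xi> (n + 1) - \<xi> n) / (\<xi> n - \<xi> (n - 1)))" for n
  proof (rule shear_eq[OF ubasis_trans(5)[OF assms, of n], of a' "b' - of_real (\<xi> n) * a'"])
    show "cdet a' (b' - of_real (\<xi> n) * a') = 1" by (rule xc)
    show "h (bpt (b - of_int n * a - a)) = bpt (b' - of_real (\<xi> n) * a' - of_real (\<xi> (n + 1) - \<xi> n) * a')"
      using \<xi>[of "n + 1"] by (simp add: algebra_simps)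
    show "h (bpt (a + (b - of_int n * a))) = bpt (b' - of_real (\<xi> n) * a' + of_real (\<xi> n - \<xi> (n - 1)) * a')"
      using \<xi>[of "n - 1"] by (simp add: algebra_simps)
  qed (use ab \<xi> mono[of n] mono[of "n - 1"] in auto)
  thus ?thesis using that ab(1,2) \<xi> x0 x1 mono by blast
qed

end

locale shear_map = circle_map +
  assumes H: "h \<in> homeo_class_H"
begin

sublocale shear_summable "shear h"
  using H by unfold_locales (simp add: homeo_class_H_def)

text \<open>The factor 6 counts the surviving terms of \<open>fan_sum_Psi\<close>; by |x| \<le> 1 +
  x^2 each of them is bounded by one plus the sum of squares.\<close>

definition Kb :: real where
  "Kb = 6 * (1 + infsum (\<lambda>e. (Psi (shear h) e)\<^sup>2) farey_edges)"

lemma Psi_bound: assumes "e \<in> farey_edges"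
  shows "\<bar>Psi (shear h) e\<bar> \<le> 1 + infsum (\<lambda>e. (Psi (shear h) e)\<^sup>2) farey_edges"
proof -
  have "(\<Sum>e\<in>{e}. (Psi (shear h) e)\<^sup>2) \<le> infsum (\<lambda>e. (Psi (shear h) e)\<^sup>2) farey_edges"
    using H assms by (intro finite_sum_le_infsum) (auto simp: homeo_class_H_def)
  moreover have "\<bar>x\<bar> \<le> 1 + x\<^sup>2" for x :: real
    using zero_le_power2[of "\<bar>x\<bar> - 1"] zero_le_power2[of x] by (simp add: power2_diff)
  ultimately show ?thesis by (smt (verit) sum.insert finite.emptyI sum.empty empty_iff)
qed

lemma Kb_pos: "Kb > 0"
  unfolding Kb_def by (smt (verit) infsum_nonneg zero_le_power2)

text \<open>The shears are the differences of the logarithmic gaps G, so partial sums along the fan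
  are differences of values of G, all bounded by \<open>Kb\<close>. Since G vanishes at -1, M is the
  limit of G at plus infinity, and the bound passes to the limit.\<close>

lemma gap_bound: assumes "ubasis a b" 
  and sh: "\<And>n. shear h {bpt a, bpt (b - of_int n * a)} = ln ((\<xi> (n + 1) - \<xi> n) / (\<xi> n - \<xi> (n - 1)))"
  and \<xi>: "\<xi> 0 = 0" "\<xi> (- 1) = - 1" "\<And>n. \<xi> n < \<xi> (n + 1)"
  and M: "M = lim (\<lambda>n::nat. \<Sum>k = 0..int n. shear h {bpt a, bpt (b - of_int k * a)})"
  shows "exp (- Kb) \<le> exp (- M) * (\<xi> (n + 1) - \<xi> n)" "exp (- M) * (\<xi> (n + 1) - \<xi> n) \<le> exp Kb"
proof -
  define G where "G n = ln (\<xi> (n + 1) - \<xi> n)" for n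
  have gp: "\<xi> (n + 1) - \<xi> n > 0" for n using \<xi>(3)[of n] by simp
  have step: "shear h {bpt a, bpt (b - of_int n * a)} = G n - G (n - 1)" for n
    using sh[of n] gp[of n] gp[of "n - 1"] by (simp add: G_def ln_div)
  have sum: "(\<Sum>k = m + 1..n. shear h {bpt a, bpt (b - of_int k * a)}) = G n - G m" if "m \<le> n" for m n
    using that
  proof (induction n rule: int_ge_induct)
    case (step n)
    have "{m + 1..n + 1} = insert (n + 1) {m + 1..n}" using step(1) by auto
    thus ?case using step(2) \<open>\<And>n. shear h {bpt a, bpt (b - of_int n * a)} = G n - G (n - 1)\<close>[of "n + 1"] by simp
  qed simp
  have bound: "\<bar>G n - G m\<bar> \<le> Kb" for m n
  proof (cases "m \<le> n")
    case True thus ?thesis using fan_sum_bound[OF assms(1) True Psi_bound] sum[OF True] by (simp add: Kb_def)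
  next
    case False
    hence "n \<le> m" by simp
    thus ?thesis using fan_sum_bound[OF assms(1) \<open>n \<le> m\<close> Psi_bound] sum[OF \<open>n \<le> m\<close>] by (simp add: Kb_def)
  qed
  have "G (- 1) = 0" using \<xi> by (simp add: G_def)
  hence "(\<Sum>k = 0..int n. shear h {bpt a, bpt (b - of_int k * a)}) = G (int n)" for n using sum[of "-1" "int n"] by simp
  hence "(\<lambda>n. G (int n)) \<longlonglongrightarrow> M"
    using convergent_fan(2)[OF assms(1)] unfolding M by (simp add: convergent_LIMSEQ_iff)
  hence "(\<lambda>k. \<bar>G n - G (int k)\<bar>) \<longlonglongrightarrow> \<bar>G n - M\<bar>" by (intro tendsto_intros)
  hence "\<bar>G n - M\<bar> \<le> Kb" by (rule LIMSEQ_le_const2) (use bound in auto)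
  moreover have "exp (- M) * (\<xi> (n + 1) - \<xi> n) = exp (G n - M)"
    using gp[of n] by (simp add: G_def exp_diff exp_minus field_simps)
  ultimately show "exp (- Kb) \<le> exp (- M) * (\<xi> (n + 1) - \<xi> n)" "exp (- M) * (\<xi> (n + 1) - \<xi> n) \<le> exp Kb" by auto
qed

end

section \<open>Geodesic arcs and centres\<close>

lemma tanh_artanh: assumes "\<bar>x\<bar> < 1" shows "tanh (artanh x) = (x :: real)"
proof -
  let ?y = "(1 + x) / (1 - x)"
  have y: "?y > 0" using assms by simp
  have "artanh x = ln (sqrt ?y)" using y by (simp add: artanh_def ln_sqrt)
  hence "tanh (artanh x) = (?y - 1) / (?y + 1)"
    using y by (simp add: tanh_ln_real del: real_sqrt_divide)
  also have "\<dots> = x" using assms by (simp add: field_simps)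
  finally show ?thesis .
qed

text \<open>The hyperbolic cosine of the distance is rational in the coordinates, and together with
  non-negativity it determines the distance.\<close>

lemma hyp_dist_cosh: assumes "z \<in> ball 0 1" "w \<in> ball 0 1"
  shows "hyp_dist z w \<ge> 0" "cosh (hyp_dist z w) = 1 + 2 * (norm (z - w))\<^sup>2 / ((1 - (norm z)\<^sup>2) * (1 - (norm w)\<^sup>2))"
proof -
  define t where "t = norm (Moebius_function 0 w z)"
  note s = sq_less_one[OF assms(1)] sq_less_one[OF assms(2)]
  have den: "1 - cnj w * z \<noteq> 0"
  proof
    assume "1 - cnj w * z = 0"
    hence "norm (cnj w * z) = 1" by simp
    moreover have "norm (cnj w * z) < 1" using assms mult_strict_mono'[of "norm w" 1 "norm z" 1] by (simp add: norm_mult)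
    ultimately show False by simp
  qed
  have key: "(norm (1 - cnj w * z))\<^sup>2 - (norm (z - w))\<^sup>2 = (1 - (norm z)\<^sup>2) * (1 - (norm w)\<^sup>2)"
    unfolding cmod_power2 by (simp add: power2_eq_square algebra_simps)
  have t2: "t\<^sup>2 = (norm (z - w))\<^sup>2 / (norm (1 - cnj w * z))\<^sup>2"
    by (simp add: t_def Moebius_function_simple norm_divide power_divide)
  have "(1 - (norm z)\<^sup>2) * (1 - (norm w)\<^sup>2) > 0" using s by simp
  hence "(norm (z - w))\<^sup>2 < (norm (1 - cnj w * z))\<^sup>2" using key by linarith
  hence "t\<^sup>2 < 1" using den by (simp add: t2)
  hence t: "0 \<le> t" "t < 1" by (simp_all add: t_def power_less_one_iff abs_square_less_1)
  have h: "hyp_dist z w = ln ((1 + t) / (1 - t))" by (simp add: hyp_dist_def t_def artanh_def)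
  show "hyp_dist z w \<ge> 0" unfolding h using t by (intro ln_ge_zero) (simp add: field_simps)
  have "cosh (hyp_dist z w) = ((1 + t) / (1 - t) + (1 - t) / (1 + t)) / 2"
    unfolding h using t by (subst cosh_ln_real) auto
  also have "\<dots> = 1 + 2 * (t\<^sup>2 / (1 - t\<^sup>2))"
  proof -
    have "1 - t \<noteq> 0" "1 + t \<noteq> 0" "1 - t\<^sup>2 = (1 - t) * (1 + t)" using t by (auto simp: power2_eq_square algebra_simps)
    thus ?thesis by (simp add: divide_simps) (simp add: power2_eq_square algebra_simps)
  qed
  also have "t\<^sup>2 / (1 - t\<^sup>2) = (norm (z - w))\<^sup>2 / ((1 - (norm z)\<^sup>2) * (1 - (norm w)\<^sup>2))"
    unfolding t2 key[symmetric] using den by (simp add: divide_simps)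
  finally show "cosh (hyp_dist z w) = 1 + 2 * (norm (z - w))\<^sup>2 / ((1 - (norm z)\<^sup>2) * (1 - (norm w)\<^sup>2))"
    by simp
qed

lemma hyp_dist_hmap: assumes "z \<in> ball 0 1" "w \<in> ball 0 1" "cdet a b = 1"
  shows "cosh (hyp_dist z w) = 1 + (norm (hmap a b z - hmap a b w))\<^sup>2 / (2 * Im (hmap a b z) * Im (hmap a b w))"
  using hmap_dist[OF assms] hyp_dist_cosh(2)[OF assms(1,2)] by (simp add: mult.assoc)

text \<open>The half-circle with centre \<open>c\<close> and radius \<open>R\<close>, parametrised by hyperbolic arc length.\<close>
definition gpt :: "real \<Rightarrow> real \<Rightarrow> real \<Rightarrow> complex" where
  "gpt c R s = Complex (c + R * tanh s) (R / cosh s)"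

lemma gpt_Im [simp]: "R > 0 \<Longrightarrow> Im (gpt c R s) > 0"
  by (simp add: gpt_def)

lemma gpt_eq_iff: "R > 0 \<Longrightarrow> gpt c R s = gpt c R t \<longleftrightarrow> s = t"
  by (auto simp: gpt_def)

lemma tanh_cosh_square: "(tanh s)\<^sup>2 + (1 / cosh s)\<^sup>2 = (1 :: real)"
proof -
  have "(tanh s)\<^sup>2 + (1 / cosh s)\<^sup>2 = ((sinh s)\<^sup>2 + 1) / (cosh s)\<^sup>2"
    by (simp add: tanh_def power_divide add_divide_distrib)
  thus ?thesis unfolding cosh_square_eq[symmetric] by simp
qed

text \<open>The left side is the cosine hyperbolicus of the distance from w to a point of the
  geodesic. It is a linear combination of cosh s and sinh s, so two of its values fix both
  coefficients.\<close>

lemma gpt_cosh: assumes "R > 0" "Im w > 0"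
  shows "1 + (norm (w - gpt c R s))\<^sup>2 / (2 * Im w * Im (gpt c R s)) =
    ((Re w - c)\<^sup>2 + (Im w)\<^sup>2 + R\<^sup>2) / (2 * R * Im w) * cosh s - (Re w - c) / Im w * sinh s"
proof -
  obtain C S where C: "C = cosh s" "S = sinh s" by simp
  have p: "C > 0" "C\<^sup>2 = S\<^sup>2 + 1" using cosh_square_eq[of s] by (simp_all add: C)
  have n: "(norm (w - gpt c R s))\<^sup>2 = (Re w - c - R * S / C)\<^sup>2 + (Im w - R / C)\<^sup>2"
    by (simp add: gpt_def cmod_power2 tanh_def C algebra_simps)
  have i: "Im (gpt c R s) = R / C" by (simp add: gpt_def C)
  have R2: "(R * S / C)\<^sup>2 + (R / C)\<^sup>2 = R\<^sup>2" 
  proof -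
    have "(R * S / C)\<^sup>2 + (R / C)\<^sup>2 = R\<^sup>2 * (S\<^sup>2 + 1) / C\<^sup>2" by (simp add: power_divide power_mult_distrib add_divide_distrib distrib_left)
    thus ?thesis unfolding p(2)[symmetric] using p(1) by simp
  qed
  have "(x - q)\<^sup>2 + (y - r)\<^sup>2 = x\<^sup>2 + y\<^sup>2 + (q\<^sup>2 + r\<^sup>2) - 2 * x * q - 2 * y * r" for x y q r :: real
    by (simp add: power2_diff)
  hence "(Re w - c - R * S / C)\<^sup>2 + (Im w - R / C)\<^sup>2 =
      (Re w - c)\<^sup>2 + (Im w)\<^sup>2 + R\<^sup>2 - 2 * (Re w - c) * (R * S / C) - 2 * Im w * (R / C)"
    unfolding R2[symmetric] .
  hence "1 + (norm (w - gpt c R s))\<^sup>2 / (2 * Im w * Im (gpt c R s)) = 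
     1 + ((Re w - c)\<^sup>2 + (Im w)\<^sup>2 + R\<^sup>2 - 2 * (Re w - c) * (R * S / C) - 2 * Im w * (R / C)) / (2 * Im w * (R / C))"
    unfolding n i by simp
  also have "\<dots> = ((Re w - c)\<^sup>2 + (Im w)\<^sup>2 + R\<^sup>2) / (2 * R * Im w) * C - (Re w - c) / Im w * S"
    using p assms by (simp add: divide_simps)
  finally show ?thesis by (simp add: C)
qed

lemma gpt_dist: assumes "R > 0" 
  shows "1 + (norm (gpt c R t - gpt c R s))\<^sup>2 / (2 * Im (gpt c R t) * Im (gpt c R s)) = cosh (t - s)"
proof -
  have r: "(tanh t)\<^sup>2 + 1 / (cosh t)\<^sup>2 = 1"
    using tanh_cosh_square[of t] by (simp add: power_divide)
  have "(R * tanh t)\<^sup>2 + (R / cosh t)\<^sup>2 + R\<^sup>2 = R\<^sup>2 * ((tanh t)\<^sup>2 + 1 / (cosh t)\<^sup>2 + 1)"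
    by (simp add: power_mult_distrib power_divide algebra_simps)
  also have "\<dots> = 2 * R\<^sup>2" unfolding r by simp
  finally have "(R * tanh t)\<^sup>2 + (R / cosh t)\<^sup>2 + R\<^sup>2 = 2 * R\<^sup>2" .
  thus ?thesis using assms gpt_cosh[OF assms gpt_Im[OF assms], of c t c s]
    by (simp add: gpt_def cosh_diff tanh_def power2_eq_square)
qed

text \<open>Two distances determine the coefficients U and V of \<open>gpt_cosh\<close>. They equal
  those of the point with parameter \<sigma>, and the remaining condition is that the square of Im w
  cosh \<sigma> - R vanishes.\<close>

lemma gpt_unique:
  assumes "R > 0" "Im w > 0" "s1 \<noteq> s2"
    "1 + (norm (w - gpt c R s1))\<^sup>2 / (2 * Im w * Im (gpt c R s1)) = cosh (\<sigma> - s1)"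
    "1 + (norm (w - gpt c R s2))\<^sup>2 / (2 * Im w * Im (gpt c R s2)) = cosh (\<sigma> - s2)"
  shows "w = gpt c R \<sigma>"
proof -
  define U V where "U = ((Re w - c)\<^sup>2 + (Im w)\<^sup>2 + R\<^sup>2) / (2 * R * Im w)" and "V = (Re w - c) / Im w"
  have e: "(U - cosh \<sigma>) * cosh s = (V - sinh \<sigma>) * sinh s" if "s \<in> {s1, s2}" for s
    using that assms(4,5) gpt_cosh[OF assms(1,2), of c s] by (auto simp: U_def V_def cosh_diff algebra_simps)
  have e1: "(U - cosh \<sigma>) * cosh s1 = (V - sinh \<sigma>) * sinh s1" and e2: "(U - cosh \<sigma>) * cosh s2 = (V - sinh \<sigma>) * sinh s2"
    using e by auto
  have "(U - cosh \<sigma>) * sinh (s1 - s2) = 0" "(V - sinh \<sigma>) * sinh (s1 - s2) = 0"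
    unfolding sinh_diff using e1 e2 by algebra+
  moreover have "sinh (s1 - s2) \<noteq> 0" using assms(3) by simp
  ultimately have UV: "U = cosh \<sigma>" "V = sinh \<sigma>" by auto
  have x: "Re w - c = Im w * sinh \<sigma>" using UV(2) assms(2) by (simp add: V_def field_simps)
  have "(Re w - c)\<^sup>2 + (Im w)\<^sup>2 + R\<^sup>2 = 2 * R * Im w * cosh \<sigma>"
    using UV(1) assms(1,2) by (simp add: U_def field_simps)
  hence "(Im w * cosh \<sigma> - R)\<^sup>2 = 0" unfolding x 
    by (simp add: power2_diff power_mult_distrib cosh_square_eq algebra_simps)
  hence "Im w = R / cosh \<sigma>" by (simp add: field_simps)
  thus ?thesis using x by (simp add: gpt_def complex_eq_iff tanh_def algebra_simps)
qed

lemma gpt_exists: assumes "(Re w - c)\<^sup>2 + (Im w)\<^sup>2 = R\<^sup>2" "Im w > 0" "R > 0"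
  shows "w = gpt c R (artanh ((Re w - c) / R))" "\<bar>(Re w - c) / R\<bar> < 1"
proof -
  let ?x = "(Re w - c) / R"
  have x2: "?x\<^sup>2 + (Im w / R)\<^sup>2 = 1" using assms by (simp add: power_divide add_divide_distrib[symmetric])
  moreover have "(Im w / R)\<^sup>2 > 0" using assms by simp
  ultimately have "?x\<^sup>2 < 1" by linarith
  thus x: "\<bar>?x\<bar> < 1" by (simp add: abs_square_less_1)
  have t: "tanh (artanh ?x) = ?x" using tanh_artanh[OF x] .
  have "(1 / cosh (artanh ?x))\<^sup>2 = (Im w / R)\<^sup>2" using x2 tanh_cosh_square[of "artanh ?x"] unfolding t by linarith
  hence "1 / cosh (artanh ?x) = Im w / R" using assms by (subst (asm) power2_eq_iff_nonneg) auto
  hence "Im w = R / cosh (artanh ?x)" using assms by (simp add: field_simps)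
  thus "w = gpt c R (artanh ?x)" using t assms by (simp add: gpt_def complex_eq_iff)
qed

text \<open>The parameter of \<open>gpt\<close> is arc length, so the dividing point is an affine
  combination of parameters; \<open>gpt_unique\<close> supplies the uniqueness that the definite
  description needs.\<close>

lemma hyp_point_gpt:
  assumes "cdet a b = 1" "p \<in> ball 0 1" "q \<in> ball 0 1" "R > 0" "hmap a b p = gpt c R s1" "hmap a b q = gpt c R s2"
    "s1 \<noteq> s2" "t \<in> {0..1}"
  shows "hyp_point p q t = hinv a b (gpt c R ((1 - t) * s1 + t * s2))"
proof -
  define \<sigma> where "\<sigma> = (1 - t) * s1 + t * s2"
  have dist: "hyp_dist z w = \<bar>u - v\<bar>" if "z \<in> ball 0 1" "w \<in> ball 0 1" "hmap a b z = gpt c R u" "hmap a b w = gpt c R v" for z w u v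
  proof -
    have "cosh (hyp_dist z w) = cosh (u - v)"
      using hyp_dist_hmap[OF that(1,2) assms(1)] gpt_dist[OF assms(4), of c u v] that(3,4) by simp
    thus ?thesis using hyp_dist_cosh(1)[OF that(1,2)] by simp
  qed
  have D: "hyp_dist p q = \<bar>s1 - s2\<bar>" using dist assms by blast
  have s1: "\<bar>s1 - \<sigma>\<bar> = t * \<bar>s1 - s2\<bar>" 
  proof -
    have "s1 - \<sigma> = t * (s1 - s2)" by (simp add: \<sigma>_def algebra_simps)
    thus ?thesis using assms(8) by (simp add: abs_mult)
  qed
  have s2: "\<bar>\<sigma> - s2\<bar> = (1 - t) * \<bar>s1 - s2\<bar>" 
  proof -
    have "\<sigma> - s2 = (1 - t) * (s1 - s2)" by (simp add: \<sigma>_def algebra_simps)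
    thus ?thesis using assms(8) by (simp add: abs_mult)
  qed
  have "hyp_point p q t = hinv a b (gpt c R \<sigma>)"
    unfolding hyp_point_def
  proof (rule the_equality)
    have b: "hinv a b (gpt c R \<sigma>) \<in> ball 0 1" using hinv_ball[OF assms(1) gpt_Im[OF assms(4)]] .
    have m: "hmap a b (hinv a b (gpt c R \<sigma>)) = gpt c R \<sigma>" using hmap_hinv[OF assms(1)] gpt_Im[OF assms(4)] by (simp add: less_imp_le)
    show "hinv a b (gpt c R \<sigma>) \<in> ball 0 1 \<and> hyp_dist p (hinv a b (gpt c R \<sigma>)) = t * hyp_dist p q \<and>
        hyp_dist (hinv a b (gpt c R \<sigma>)) q = (1 - t) * hyp_dist p q"
      using dist[OF assms(2) b assms(5) m] dist[OF b assms(3) m assms(6)] b s1 s2 D by simp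
    fix z assume z: "z \<in> ball 0 1 \<and> hyp_dist p z = t * hyp_dist p q \<and> hyp_dist z q = (1 - t) * hyp_dist p q"
    hence zb: "z \<in> ball 0 1" by simp
    have d1: "cosh (hyp_dist p z) = cosh (\<sigma> - s1)" using z D s1 by (metis cosh_real_abs abs_minus_commute)
    have d2: "cosh (hyp_dist z q) = cosh (\<sigma> - s2)" using z D s2 by (metis cosh_real_abs)
    have "hmap a b z = gpt c R \<sigma>"
    proof (rule gpt_unique[OF assms(4) horo_hmap(2)[OF zb assms(1)] assms(7)])
      show "1 + (norm (hmap a b z - gpt c R s1))\<^sup>2 / (2 * Im (hmap a b z) * Im (gpt c R s1)) = cosh (\<sigma> - s1)"
        using d1 hyp_dist_hmap[OF assms(2) zb assms(1)] assms(5) by (simp add: norm_minus_commute mult_ac)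
      show "1 + (norm (hmap a b z - gpt c R s2))\<^sup>2 / (2 * Im (hmap a b z) * Im (gpt c R s2)) = cosh (\<sigma> - s2)"
        using d2 hyp_dist_hmap[OF zb assms(3) assms(1)] assms(6) by simp
    qed
    thus "z = hinv a b (gpt c R \<sigma>)" using hinv_hmap[OF assms(1) zb] by simp
  qed
  thus ?thesis by (simp add: \<sigma>_def)
qed

text \<open>After z is moved to the origin, chords between ideal points depend only on a determinant
  and two horocyclic distances. The equilateral triangle in the definition of the centre thereby
  becomes a condition on products of horocyclic distances.\<close>

lemma Moebius_bpt_dist: assumes "z \<in> ball 0 1" "a \<noteq> 0" "b \<noteq> 0"
  shows "(norm (Moebius_function t z (bpt a) - Moebius_function t z (bpt b)))\<^sup>2 = 4 * (cdet a b)\<^sup>2 / (horo a z * horo b z)"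
    "norm (Moebius_function t z (bpt a)) = 1"
proof -
  have den: "norm (1 - cnj z * bpt u) = norm (u - cnj u * z) / norm u" "1 - cnj z * bpt u \<noteq> 0" if "u \<noteq> 0" for u
  proof -
    have "1 - cnj z * bpt u = cnj (u - cnj u * z) / cnj u" using that by (simp add: bpt_def field_simps)
    thus "norm (1 - cnj z * bpt u) = norm (u - cnj u * z) / norm u" by (simp add: norm_divide del: complex_cnj_diff)
    thus "1 - cnj z * bpt u \<noteq> 0" using horo_den[OF assms(1) that] that by auto
  qed
  have e: "norm (exp (\<i> * of_real t)) = 1" by simp
  have "Moebius_function t z (bpt a) - Moebius_function t z (bpt b) =
     exp (\<i> * of_real t) * ((bpt a - bpt b) * (1 - z * cnj z) / ((1 - cnj z * bpt a) * (1 - cnj z * bpt b)))"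
    using den(2)[OF assms(2)] den(2)[OF assms(3)] by (simp add: Moebius_function_def divide_simps) (simp add: algebra_simps)
  hence "norm (Moebius_function t z (bpt a) - Moebius_function t z (bpt b)) =
     norm (bpt a - bpt b) * norm (1 - z * cnj z) / (norm (1 - cnj z * bpt a) * norm (1 - cnj z * bpt b))"
    by (simp add: norm_mult norm_divide e)
  moreover have "norm (bpt a - bpt b) = 2 * \<bar>cdet a b\<bar> / (norm a * norm b)"
    unfolding norm_minus_commute[of "bpt a"] bpt_diff[OF assms(2,3)] by (simp add: norm_divide norm_mult)
  moreover have "1 - z * cnj z = of_real (1 - (norm z)\<^sup>2)" unfolding of_real_diff complex_norm_square by simp
  ultimately have "norm (Moebius_function t z (bpt a) - Moebius_function t z (bpt b)) =
     2 * \<bar>cdet a b\<bar> / (norm a * norm b) * \<bar>1 - (norm z)\<^sup>2\<bar> / ((norm (a - cnj a * z) / norm a) * (norm (b - cnj b * z) / norm b))"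
    by (simp only: norm_of_real den(1)[OF assms(2)] den(1)[OF assms(3)])
  also have "\<dots> = 2 * \<bar>cdet a b\<bar> * \<bar>1 - (norm z)\<^sup>2\<bar> / (norm (a - cnj a * z) * norm (b - cnj b * z))"
    using assms by simp
  finally show "(norm (Moebius_function t z (bpt a) - Moebius_function t z (bpt b)))\<^sup>2 = 4 * (cdet a b)\<^sup>2 / (horo a z * horo b z)"
    using sq_less_one[OF assms(1)]
    by (simp add: horo_def power_divide power_mult_distrib power2_eq_square[of "1 - (norm z)\<^sup>2"])
  have "bpt a - z = (a - cnj a * z) / cnj a" using assms(2) by (simp add: bpt_def field_simps)
  hence "norm (bpt a - z) = norm (1 - cnj z * bpt a)" using den(1)[OF assms(2)] by (simp add: norm_divide)
  thus "norm (Moebius_function t z (bpt a)) = 1" using den(2)[OF assms(2)]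
    by (simp add: Moebius_function_def norm_mult norm_divide e)
qed

lemma cis_thirds: "cis (2 * pi / 3) = Complex (- 1 / 2) (sqrt 3 / 2)" "cis (4 * pi / 3) = Complex (- 1 / 2) (- sqrt 3 / 2)"
proof -
  show 1: "cis (2 * pi / 3) = Complex (- 1 / 2) (sqrt 3 / 2)" by (simp add: complex_eq_iff cos_120 sin_120)
  have "cis (4 * pi / 3) = cis (2 * pi / 3) * cis (2 * pi / 3)" by (simp add: cis_mult)
  thus "cis (4 * pi / 3) = Complex (- 1 / 2) (- sqrt 3 / 2)" unfolding 1 by (simp add: complex_eq_iff)
qed

lemma dist_thirds:
  assumes "u \<in> {1, cis (2 * pi / 3), cis (4 * pi / 3)}" "v \<in> {1, cis (2 * pi / 3), cis (4 * pi / 3)}" "u \<noteq> v"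
  shows "(norm (u - v))\<^sup>2 = 3"
  unfolding cmod_power2 using assms unfolding cis_thirds by (auto simp: power2_eq_square)

lemma unit_third: assumes "norm v = 1" "(norm (v - 1))\<^sup>2 = 3" shows "v \<in> {cis (2 * pi / 3), cis (4 * pi / 3)}"
proof -
  have a: "(Re v)\<^sup>2 + (Im v)\<^sup>2 = 1" using assms(1) by (metis cmod_power2 one_power2)
  have "(Re v - 1)\<^sup>2 + (Im v)\<^sup>2 = 3" using assms(2) by (simp add: cmod_power2)
  hence r: "Re v = - 1 / 2" using a by (simp add: power2_diff)
  hence "(Im v)\<^sup>2 = (sqrt 3 / 2)\<^sup>2" using a by (simp add: power_divide)
  hence "Im v = sqrt 3 / 2 \<or> Im v = - (sqrt 3 / 2)" by (simp only: power2_eq_iff)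
  thus ?thesis unfolding cis_thirds using r by (auto simp: complex_eq_iff)
qed

text \<open>The point (1 + i sqrt 3) / 2 is the centre of the ideal triangle \<infinity>, 0, 1. All
  three horocyclic distances are 2 / sqrt 3 there, so the squared chords are 4 / (4/3) = 3 as for
  the cube roots of unity. Conversely, equal products of the distances leave only this
  point.\<close>

lemma center_eq: assumes "cdet a b = 1" 
  defines "z0 \<equiv> hinv a b (Complex (1 / 2) (sqrt 3 / 2))"
  shows "hyp_center {bpt a, bpt b, bpt (b - a)} = z0" "z0 \<in> ball 0 1"
proof -
  have c: "cdet a (b - a) = 1" "cdet b (b - a) = 1" using assms by (simp_all add: cdet_commute[of b a])
  have nz: "a \<noteq> 0" "b \<noteq> 0" "b - a \<noteq> 0" using assms(1) cdet_nz(2)[of a "b - a"] c by auto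
  have im: "Im (Complex (1 / 2) (sqrt 3 / 2)) > 0" by simp
  show z0: "z0 \<in> ball 0 1" unfolding z0_def by (rule hinv_ball[OF assms(1) im])
  have m0: "hmap a b z0 = Complex (1 / 2) (sqrt 3 / 2)" unfolding z0_def using hmap_hinv[OF assms(1)] im by simp
  have hb: "horo b z = (norm (hmap a b z))\<^sup>2 / Im (hmap a b z)" "horo (b - a) z = (norm (hmap a b z - 1))\<^sup>2 / Im (hmap a b z)"
    "horo a z = 1 / Im (hmap a b z)" if "z \<in> ball 0 1" for z
    using horo_comb[OF that assms(1), of 0 1] horo_comb[OF that assms(1), of "-1" 1] horo_hmap(1)[OF that assms(1)] by simp_all
  have s3: "(sqrt 3 / 2)\<^sup>2 = 3 / 4" by (simp add: power_divide)
  have h0: "horo a z0 = 2 / sqrt 3" "horo b z0 = 2 / sqrt 3" "horo (b - a) z0 = 2 / sqrt 3"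
    using hb[OF z0] m0 by (simp_all add: cmod_power2 power_divide)
  have hh: "(2 / sqrt 3) * (2 / sqrt 3) = (4 / 3 :: real)" by simp
  let ?R = "{1, cis (2 * pi / 3), cis (4 * pi / 3)}"
  show "hyp_center {bpt a, bpt b, bpt (b - a)} = z0"
    unfolding hyp_center_def
  proof (rule the_equality)
    define \<theta> where "\<theta> = Arg (Moebius_function 0 z0 (bpt a))"
    have "Moebius_function 0 z0 (bpt a) \<noteq> 0"
      using Moebius_bpt_dist(2)[OF z0 nz(1,1), of 0] by (metis norm_zero zero_neq_one)
    hence \<theta>: "Moebius_function 0 z0 (bpt a) = cis \<theta>"
      using Moebius_bpt_dist(2)[OF z0 nz(1,1), of 0] by (simp add: \<theta>_def cis_Arg sgn_div_norm)
    let ?M = "Moebius_function (- \<theta>) z0"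
    have "?M (bpt a) = exp (\<i> * of_real (- \<theta>)) * Moebius_function 0 z0 (bpt a)"
      by (simp add: Moebius_function_def)
    hence Ma: "?M (bpt a) = 1" unfolding \<theta> by (simp add: cis_conv_exp flip: exp_add)
    have b1: "(norm (?M (bpt b) - 1))\<^sup>2 = 3"
      using Moebius_bpt_dist(1)[OF z0 nz(2,1), of "-\<theta>"] assms(1) cdet_commute[of b a] by (simp add: Ma h0 hh)
    have b2: "(norm (?M (bpt (b - a)) - 1))\<^sup>2 = 3"
      using Moebius_bpt_dist(1)[OF z0 nz(3,1), of "-\<theta>"] c cdet_commute[of "b - a" a] by (simp add: Ma h0 hh cdet_commute[of b a] assms(1))
    have b3: "?M (bpt b) \<noteq> ?M (bpt (b - a))"
      using Moebius_bpt_dist(1)[OF z0 nz(2,3), of "-\<theta>"] c by (auto simp: h0 hh)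
    have "?M (bpt b) \<in> {cis (2 * pi / 3), cis (4 * pi / 3)}" "?M (bpt (b - a)) \<in> {cis (2 * pi / 3), cis (4 * pi / 3)}"
      using unit_third Moebius_bpt_dist(2)[OF z0] nz b1 b2 by blast+
    hence "?M ` {bpt a, bpt b, bpt (b - a)} = ?R" using b3 Ma by auto
    thus "z0 \<in> ball 0 1 \<and> (\<exists>t. Moebius_function t z0 ` {bpt a, bpt b, bpt (b - a)} = ?R)" using z0 by blast
  next
    fix z assume "z \<in> ball 0 1 \<and> (\<exists>t. Moebius_function t z ` {bpt a, bpt b, bpt (b - a)} = ?R)"
    then obtain t where zb: "z \<in> ball 0 1" and t: "Moebius_function t z ` {bpt a, bpt b, bpt (b - a)} = ?R" by blast
    let ?M = "Moebius_function t z"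
    have im: "Im (hmap a b z) > 0" using horo_hmap(2)[OF zb assms(1)] .
    have dist3: "(norm (?M (bpt u) - ?M (bpt v)))\<^sup>2 = 3" if uv: "u \<in> {a, b, b - a}" "v \<in> {a, b, b - a}" "cdet u v \<noteq> 0" for u v
    proof (rule dist_thirds)
      show "?M (bpt u) \<in> ?R" "?M (bpt v) \<in> ?R" using uv t by auto
      have "horo u z > 0" "horo v z > 0" using uv(1,2) nz horo_pos[OF zb] by auto
      hence "(norm (?M (bpt u) - ?M (bpt v)))\<^sup>2 > 0"
        using Moebius_bpt_dist(1)[OF zb cdet_nz(1,2)[OF uv(3)], of t] uv(3) by simp
      thus "?M (bpt u) \<noteq> ?M (bpt v)" by auto
    qed
    have "horo a z * horo b z = 4 / 3" "horo a z * horo (b - a) z = 4 / 3" "horo b z * horo (b - a) z = 4 / 3"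
      using dist3[of a b] dist3[of a "b - a"] dist3[of b "b - a"] Moebius_bpt_dist(1)[OF zb, of _ _ t] nz c assms(1)
        horo_pos[OF zb nz(1)] horo_pos[OF zb nz(2)] horo_pos[OF zb nz(3)] by (simp_all add: field_simps)
    moreover define x y where "x = Re (hmap a b z)" and "y = Im (hmap a b z)"
    ultimately have eq: "3 * (x\<^sup>2 + y\<^sup>2) = 4 * y\<^sup>2" "3 * ((x - 1)\<^sup>2 + y\<^sup>2) = 4 * y\<^sup>2" 
      using im unfolding hb[OF zb] cmod_power2 by (simp_all add: field_simps power2_eq_square)
    have "3 * (2 * x - 1) = 0" using eq by (simp add: power2_diff algebra_simps)
    hence x: "x = 1 / 2" by simp
    have "y\<^sup>2 = (sqrt 3 / 2)\<^sup>2" using eq(1) unfolding x s3 by (simp add: power_divide)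
    hence "y = sqrt 3 / 2" using im by (subst (asm) power2_eq_iff_nonneg) (auto simp: y_def)
    hence "hmap a b z = Complex (1 / 2) (sqrt 3 / 2)" using x by (simp add: complex_eq_iff x_def y_def)
    thus "z = z0" using hinv_hmap[OF assms(1) zb] by (simp add: z0_def)
  qed
qed

lemma center_right: assumes "cdet a b = 1" "r > 0"
  shows "hyp_center {bpt a, bpt b, bpt (b - of_real r * a)} \<in> ball 0 1"
    "hmap a b (hyp_center {bpt a, bpt b, bpt (b - of_real r * a)}) = Complex (r / 2) (sqrt 3 / 2 * r)"
proof -
  \<comment> \<open>This rescaling keeps the determinant and divides the chart by r, which turns the
    gap r into 1.\<close>
  define a' b' where "a' = of_real (sqrt r) * a" and "b' = of_real (1 / sqrt r) * b"
  have s: "sqrt r \<noteq> 0" "1 / sqrt r \<noteq> 0" using assms by auto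
  have d: "cdet a' b' = 1" unfolding a'_def b'_def cdet_linear using assms by simp
  have "of_real (sqrt r) * of_real (sqrt r) = (of_real r :: complex)" using assms by (simp flip: of_real_mult)
  hence "b' - a' = of_real (1 / sqrt r) * (b - of_real r * a)" using s
    by (simp add: a'_def b'_def field_simps)
  hence e: "bpt a' = bpt a" "bpt b' = bpt b" "bpt (b' - a') = bpt (b - of_real r * a)"
    unfolding a'_def b'_def using bpt_scale[OF s(1)] bpt_scale[OF s(2)] by simp_all
  note c = center_eq[OF d, unfolded e]
  show zb: "hyp_center {bpt a, bpt b, bpt (b - of_real r * a)} \<in> ball 0 1" unfolding c(1) by (rule c(2))
  have "hmap a' b' z = of_real (1 / r) * hmap a b z" for z
    unfolding a'_def b'_def hmap_scale[OF s(1)] using assms by (simp add: divide_simps flip: of_real_mult)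
  hence "of_real (1 / r) * hmap a b (hyp_center {bpt a, bpt b, bpt (b - of_real r * a)}) = Complex (1 / 2) (sqrt 3 / 2)"
    unfolding c(1) using hmap_hinv[OF d, of "Complex (1 / 2) (sqrt 3 / 2)"] by simp
  hence "hmap a b (hyp_center {bpt a, bpt b, bpt (b - of_real r * a)}) = of_real r * Complex (1 / 2) (sqrt 3 / 2)"
    using assms by (simp add: field_simps)
  thus "hmap a b (hyp_center {bpt a, bpt b, bpt (b - of_real r * a)}) = Complex (r / 2) (sqrt 3 / 2 * r)"
    by (simp add: complex_eq_iff)
qed

lemma center_left: assumes "cdet a b = 1" "l > 0"
  shows "hyp_center {bpt a, bpt b, bpt (b + of_real l * a)} \<in> ball 0 1"
    "hmap a b (hyp_center {bpt a, bpt b, bpt (b + of_real l * a)}) = Complex (- l / 2) (sqrt 3 / 2 * l)"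
proof -
  have d: "cdet a (b + of_real l * a) = 1" using assms by simp
  have s: "{bpt a, bpt (b + of_real l * a), bpt (b + of_real l * a - of_real l * a)} = {bpt a, bpt b, bpt (b + of_real l * a)}"
    by auto
  note c = center_right[OF d assms(2), unfolded s]
  show zb: "hyp_center {bpt a, bpt b, bpt (b + of_real l * a)} \<in> ball 0 1" by (rule c(1))
  have a: "a \<noteq> 0" using assms by auto
  show "hmap a b (hyp_center {bpt a, bpt b, bpt (b + of_real l * a)}) = Complex (- l / 2) (sqrt 3 / 2 * l)"
    using c(2) unfolding hmap_shift[OF zb a] by (simp add: complex_eq_iff)
qed

text \<open>The centres of the triangles (\<infinity>, -l, 0) and (\<infinity>, 0, r) lie on the
  half-circle with centre r - l and this radius; \<open>arcs1\<close> and \<open>arcs2\<close> are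
  their arc length parameters on it.\<close>

definition arcR :: "real \<Rightarrow> real \<Rightarrow> real" where
  "arcR l r = sqrt (l\<^sup>2 - l * r + r\<^sup>2)"

definition arcs1 :: "real \<Rightarrow> real \<Rightarrow> real" where
  "arcs1 l r = artanh ((l / 2 - r) / arcR l r)"

definition arcs2 :: "real \<Rightarrow> real \<Rightarrow> real" where
  "arcs2 l r = artanh ((l - r / 2) / arcR l r)"

text \<open>The stretching factor: the length of the image dual edge over 2 artanh (1/2), the length
  of a dual edge of the Farey tessellation.\<close>

definition arcA :: "real \<Rightarrow> real \<Rightarrow> real" where
  "arcA l r = (arcs2 l r - arcs1 l r) / (2 * artanh (1 / 2))"

text \<open>The source dual edge lies on the unit half-circle, where the point of abscissa x has arc
  length parameter artanh x. So x serves as the parameter, and stretching is affine in artanh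
  x.\<close>

definition garc :: "real \<Rightarrow> real \<Rightarrow> real \<Rightarrow> complex" where
  "garc l r x = gpt (r - l) (arcR l r) ((arcs1 l r + arcs2 l r) / 2 + arcA l r * artanh x)"

lemma arcR_pos: assumes "l > 0" "r > 0" shows "arcR l r > 0" "(arcR l r)\<^sup>2 = l\<^sup>2 - l * r + r\<^sup>2"
proof -
  have "l\<^sup>2 - l * r + r\<^sup>2 = (l - r / 2)\<^sup>2 + 3 / 4 * r\<^sup>2" by (simp add: power2_diff power_divide algebra_simps)
  moreover have "\<dots> > 0" using assms by (simp add: add_nonneg_pos)
  ultimately show "arcR l r > 0" "(arcR l r)\<^sup>2 = l\<^sup>2 - l * r + r\<^sup>2" by (simp_all add: arcR_def)
qed

lemma arc_ends: assumes "l > 0" "r > 0"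
  shows "Complex (- l / 2) (sqrt 3 / 2 * l) = gpt (r - l) (arcR l r) (arcs1 l r)"
    "Complex (r / 2) (sqrt 3 / 2 * r) = gpt (r - l) (arcR l r) (arcs2 l r)"
    "tanh (arcs1 l r) = (l / 2 - r) / arcR l r" "tanh (arcs2 l r) = (l - r / 2) / arcR l r"
    "arcs1 l r < arcs2 l r"
proof -
  note R = arcR_pos[OF assms]
  let ?p = "Complex (- l / 2) (sqrt 3 / 2 * l)" and ?q = "Complex (r / 2) (sqrt 3 / 2 * r)"
  have 1: "(Re ?p - (r - l))\<^sup>2 + (Im ?p)\<^sup>2 = (arcR l r)\<^sup>2" "(Re ?q - (r - l))\<^sup>2 + (Im ?q)\<^sup>2 = (arcR l r)\<^sup>2"
    unfolding R(2) by (simp_all add: power2_diff power_divide power_mult_distrib field_simps power2_eq_square)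
  have e: "Re ?p - (r - l) = l / 2 - r" "Re ?q - (r - l) = l - r / 2" by simp_all
  note g1 = gpt_exists[OF 1(1) _ R(1), unfolded e] and g2 = gpt_exists[OF 1(2) _ R(1), unfolded e]
  show "?p = gpt (r - l) (arcR l r) (arcs1 l r)" "?q = gpt (r - l) (arcR l r) (arcs2 l r)"
    using g1(1) g2(1) assms by (simp_all add: arcs1_def arcs2_def)
  show t: "tanh (arcs1 l r) = (l / 2 - r) / arcR l r" "tanh (arcs2 l r) = (l - r / 2) / arcR l r"
    unfolding arcs1_def arcs2_def using g1(2) g2(2) assms by (simp_all add: tanh_artanh)
  have "tanh (arcs1 l r) < tanh (arcs2 l r)" unfolding t using assms R by (intro divide_strict_right_mono) auto
  thus "arcs1 l r < arcs2 l r" by simp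
qed

lemma artanh_half_pos: "artanh (1 / 2 :: real) > 0"
  by (simp add: artanh_def)

text \<open>The point of a dual edge with parameter \<open>t\<close>, for the triangles with gaps \<open>l\<close>, \<open>r\<close> on both sides of \<open>(a,b)\<close>.\<close>
lemma dual_edge_point:
  assumes "cdet a b = 1" "l > 0" "r > 0" "t \<in> {0..1}"
  defines "x \<equiv> tanh ((2 * t - 1) * artanh (1 / 2))"
  shows "hyp_point (hyp_center {bpt a, bpt b, bpt (b + of_real l * a)}) (hyp_center {bpt a, bpt b, bpt (b - of_real r * a)}) t
    = hinv a b (garc l r x)"
    "hyp_point (hyp_center {bpt a, bpt b, bpt (b - of_real r * a)}) (hyp_center {bpt a, bpt b, bpt (b + of_real l * a)}) (1 - t)
    = hinv a b (garc l r x)"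
proof -
  note R = arcR_pos[OF assms(2,3)] and e = arc_ends[OF assms(2,3)]
  note cl = center_left[OF assms(1,2)] and cr = center_right[OF assms(1,3)]
  have ax: "artanh x = (2 * t - 1) * artanh (1 / 2)" by (simp add: x_def artanh_tanh_real)
  have "arcA l r * artanh x = (arcs2 l r - arcs1 l r) / 2 * (2 * t - 1)"
    unfolding ax arcA_def using artanh_half_pos by simp
  hence s: "(arcs1 l r + arcs2 l r) / 2 + arcA l r * artanh x = (1 - t) * arcs1 l r + t * arcs2 l r"
    by (simp add: field_simps)
  have s': "(arcs1 l r + arcs2 l r) / 2 + arcA l r * artanh x = (1 - (1 - t)) * arcs2 l r + (1 - t) * arcs1 l r"
    unfolding s by (simp add: algebra_simps)
  show "hyp_point (hyp_center {bpt a, bpt b, bpt (b + of_real l * a)}) (hyp_center {bpt a, bpt b, bpt (b - of_real r * a)}) t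
    = hinv a b (garc l r x)" unfolding garc_def s
    by (rule hyp_point_gpt[OF assms(1) cl(1) cr(1) R(1)]) (use cl(2) cr(2) e assms in auto)
  show "hyp_point (hyp_center {bpt a, bpt b, bpt (b - of_real r * a)}) (hyp_center {bpt a, bpt b, bpt (b + of_real l * a)}) (1 - t)
    = hinv a b (garc l r x)" unfolding garc_def s'
    by (rule hyp_point_gpt[OF assms(1) cr(1) cl(1) R(1)]) (use cl(2) cr(2) e assms in auto)
qed

lemma arc_Im: "l > 0 \<Longrightarrow> r > 0 \<Longrightarrow> Im (garc l r x) > 0"
  unfolding garc_def by (rule gpt_Im[OF arcR_pos(1)])

text \<open>With equal gaps nothing is stretched, so the source dual edge is recovered as a special
  case.\<close>

lemma arc_unit: assumes "\<bar>x\<bar> < 1" shows "garc 1 1 x = Complex x (sqrt (1 - x\<^sup>2))"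
proof -
  have R: "arcR 1 1 = 1" by (simp add: arcR_def)
  have s: "arcs2 1 1 = artanh (1 / 2)" "arcs1 1 1 = - artanh (1 / 2)"
    using artanh_minus_real[of "1 / 2"] by (simp_all add: arcs1_def arcs2_def R)
  have A: "arcA 1 1 = 1" using artanh_half_pos by (simp add: arcA_def s)
  have "(Re (Complex x (sqrt (1 - x\<^sup>2))) - 0)\<^sup>2 + (Im (Complex x (sqrt (1 - x\<^sup>2))))\<^sup>2 = 1\<^sup>2"
     "x\<^sup>2 < 1" using assms by (simp_all add: abs_square_less_1 abs_square_le_1 less_imp_le)
  hence "Complex x (sqrt (1 - x\<^sup>2)) = gpt 0 1 (artanh ((Re (Complex x (sqrt (1 - x\<^sup>2))) - 0) / 1))"
    by (intro gpt_exists) auto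
  thus ?thesis by (simp add: garc_def A s R)
qed

section \<open>The dual tree and its cells\<close>

lemma tri_containing: assumes "ubasis a b" "T \<in> farey_triangles" "bpt a \<in> T" "bpt b \<in> T"
  shows "T = tri a b \<or> T = tri b (- a)"
proof -
  obtain c d where cd: "ubasis c d" "T = tri c d" using assms(2) farey_tri by blast
  obtain a' b' where ab: "ubasis a' b'" "tri c d = tri a' b'" "{bpt a, bpt b} = {bpt a', bpt b'}"
    using tri_pair[OF cd(1)] tri_distinct(1)[OF ubasis_det[OF assms(1)]] assms(3,4) cd(2) by metis
  have "(a', b') \<in> {(a, b), (- a, - b), (b, - a), (- b, a)}" using edge_eq[OF assms(1) ab(1,3)] .
  moreover have "tri (- a) (- b) = tri a b" "tri (- b) a = tri b (- a)"
    using tri_minus[of a b] tri_minus[of b "- a"] by simp_all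
  ultimately show ?thesis using cd(2) ab(2) by auto
qed

lemma adjacent_iff: "adjacent T T' \<longleftrightarrow> (\<exists>a b. ubasis a b \<and> T = tri a b \<and> T' = tri b (- a))"
proof
  assume adj: "adjacent T T'"
  then obtain a b where ab: "ubasis a b" "T \<inter> T' = {bpt a, bpt b}" by (auto simp: adjacent_def farey_edges_eq)
  have T: "T \<in> farey_triangles" "T' \<in> farey_triangles" "T \<noteq> T'" using adj by (auto simp: adjacent_def)
  have "bpt a \<in> T" "bpt a \<in> T'" "bpt b \<in> T" "bpt b \<in> T'" using ab(2) by auto
  hence "T = tri a b \<or> T = tri b (- a)" "T' = tri a b \<or> T' = tri b (- a)"
    using tri_containing[OF ab(1)] T by blast+
  hence "T = tri a b \<and> T' = tri b (- a) \<or> T = tri b (- a) \<and> T' = tri (- a) (- b)"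
    using T(3) tri_minus[of a b] by auto
  thus "\<exists>a b. ubasis a b \<and> T = tri a b \<and> T' = tri b (- a)"
    using ab(1) ubasis_trans(1)[OF ab(1)] by blast
next
  assume "\<exists>a b. ubasis a b \<and> T = tri a b \<and> T' = tri b (- a)"
  then obtain a b where ab: "ubasis a b" "T = tri a b" "T' = tri b (- a)" by blast
  have "cdet (b - a) (a + b) = - 2" using ubasis_det[OF ab(1)] by (simp add: cdet_commute[of b a])
  hence "cdet (b - a) (a + b) \<noteq> 0" by simp
  hence "bpt (b - a) \<noteq> bpt (a + b)" using cdet_nz bpt_eq_iff by metis
  hence i: "T \<inter> T' = {bpt a, bpt b}" "bpt (a + b) \<notin> T'"
    using tri_distinct[OF ubasis_det[OF ab(1)]] tri_distinct[OF ubasis_det[OF ubasis_trans(1)[OF ab(1)]]]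
    unfolding ab(2,3) tri_other by (auto simp: tri_def)
  have "T \<noteq> T'" using i(2) ab(2) by (auto simp: tri_def)
  moreover have "T \<inter> T' \<in> farey_edges" unfolding i(1) farey_edges_eq using ab(1) by blast
  ultimately show "adjacent T T'" using ab tri_farey ubasis_trans(1)[OF ab(1)] by (simp add: adjacent_def)
qed

text \<open>Converts the proportion t of hyperbolic length along a dual edge into the abscissa in
  the chart.\<close>

definition tau :: "real \<Rightarrow> real" where
  "tau t = tanh ((2 * t - 1) * artanh (1 / 2))"

lemma tau_bounds: assumes "t \<in> {0..1}" shows "\<bar>tau t\<bar> \<le> 1 / 2"
proof -
  have "tanh (artanh (1 / 2 :: real)) = 1 / 2" by (rule tanh_artanh) simp
  moreover have "(2 * t - 1) * artanh (1 / 2) \<le> 1 * artanh (1 / 2)" "- 1 * artanh (1 / 2) \<le> (2 * t - 1) * artanh (1 / 2)"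
    using assms artanh_half_pos by (intro mult_right_mono; simp)+
  hence "tau t \<le> tanh (artanh (1 / 2))" "tanh (- artanh (1 / 2)) \<le> tau t"
    unfolding tau_def by (simp_all only: tanh_real_le_iff)
  ultimately show ?thesis by simp
qed

lemma tau_surj: assumes "\<bar>x\<bar> \<le> 1 / 2" obtains t where "t \<in> {0..1}" "x = tau t"
proof
  let ?t = "(artanh x / artanh (1 / 2) + 1) / 2"
  have tx: "tanh (artanh x) = x" using assms by (intro tanh_artanh) auto
  have th: "tanh (artanh (1 / 2 :: real)) = 1 / 2" by (rule tanh_artanh) simp
  have "tanh (artanh x) \<le> tanh (artanh (1 / 2))" "tanh (- artanh (1 / 2)) \<le> tanh (artanh x)"
    unfolding tx tanh_minus th using assms by auto
  hence "artanh x \<le> artanh (1 / 2)" "- artanh (1 / 2) \<le> artanh x" by (simp_all only: tanh_real_le_iff)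
  thus "?t \<in> {0..1}" using artanh_half_pos by (simp add: divide_simps)
  have "2 * ?t - 1 = artanh x / artanh (1 / 2)" by (simp add: field_simps)
  hence "(2 * ?t - 1) * artanh (1 / 2) = artanh x" using artanh_half_pos by simp
  thus "x = tau ?t" unfolding tau_def using tx by simp
qed

lemma tau_eq_iff: "tau s = tau t \<longleftrightarrow> s = t"
  using artanh_half_pos by (simp add: tau_def)

lemma tau_values: "tau 0 = - 1 / 2" "tau 1 = 1 / 2" "tau (1 - t) = - tau t"
proof -
  have th: "tanh (artanh (1 / 2 :: real)) = 1 / 2" by (rule tanh_artanh) simp
  thus "tau 0 = - 1 / 2" "tau 1 = 1 / 2" by (simp_all add: tau_def)
  have "(2 * (1 - t) - 1) * artanh (1 / 2) = - ((2 * t - 1) * artanh (1 / 2))" by (simp add: algebra_simps)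
  thus "tau (1 - t) = - tau t" unfolding tau_def by (simp only: tanh_minus)
qed

definition dual_pt :: "complex \<Rightarrow> complex \<Rightarrow> real \<Rightarrow> complex" where
  "dual_pt a b t = hyp_point (hyp_center (tri a b)) (hyp_center (tri b (- a))) t"

lemma dual_pt_eq: assumes "cdet a b = 1" "t \<in> {0..1}"
  shows "dual_pt a b t = hinv a b (Complex (tau t) (sqrt (1 - (tau t)\<^sup>2)))"
proof -
  have "\<bar>tau t\<bar> < 1" using tau_bounds[OF assms(2)] by simp
  note u = arc_unit[OF this]
  have "tri b (- a) = {bpt a, bpt b, bpt (b - of_real 1 * a)}" "tri a b = {bpt a, bpt b, bpt (b + of_real 1 * a)}"
    unfolding tri_other by (simp_all add: tri_def add.commute)
  thus ?thesis unfolding dual_pt_def using dual_edge_point(1)[OF assms(1) _ _ assms(2), of 1 1] u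
    unfolding tau_def by simp
qed

lemma unit_circle_point: assumes "\<bar>x\<bar> \<le> 1 / 2"
  shows "Im (Complex x (sqrt (1 - x\<^sup>2))) > 0" "norm (Complex x (sqrt (1 - x\<^sup>2))) = 1"
proof -
  have "x\<^sup>2 < 1" using assms by (simp add: abs_square_less_1)
  thus "Im (Complex x (sqrt (1 - x\<^sup>2))) > 0" "norm (Complex x (sqrt (1 - x\<^sup>2))) = 1"
    by (simp_all add: cmod_def)
qed

lemma unit_circle_eq: assumes "norm m = 1" "Im m > 0" shows "m = Complex (Re m) (sqrt (1 - (Re m)\<^sup>2))"
proof -
  have "(Im m)\<^sup>2 = 1 - (Re m)\<^sup>2" using assms(1) cmod_power2[of m] by simp
  hence "Im m = sqrt (1 - (Re m)\<^sup>2)" using assms(2) by (metis less_imp_le real_sqrt_abs abs_of_nonneg)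
  thus ?thesis by (simp add: complex_eq_iff)
qed

text \<open>The dual edge crossing (a, b): in the chart it is the circular side of the fundamental
  domain of the modular group.\<close>

definition arcset :: "complex \<Rightarrow> complex \<Rightarrow> complex set" where
  "arcset a b = {z \<in> ball 0 1. norm (hmap a b z) = 1 \<and> \<bar>Re (hmap a b z)\<bar> \<le> 1 / 2}"

lemma dual_pt_arcset: assumes "cdet a b = 1" "t \<in> {0..1}"
  shows "dual_pt a b t \<in> arcset a b" "Re (hmap a b (dual_pt a b t)) = tau t"
proof -
  note b = tau_bounds[OF assms(2)]
  have m: "hmap a b (dual_pt a b t) = Complex (tau t) (sqrt (1 - (tau t)\<^sup>2))"
    unfolding dual_pt_eq[OF assms] by (rule hmap_hinv[OF assms(1)]) (use unit_circle_point(1)[OF b] in simp)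
  have "dual_pt a b t \<in> ball 0 1" unfolding dual_pt_eq[OF assms] using hinv_ball[OF assms(1) unit_circle_point(1)[OF b]] .
  thus "dual_pt a b t \<in> arcset a b" "Re (hmap a b (dual_pt a b t)) = tau t"
    using m b unit_circle_point(2)[OF b] by (simp_all add: arcset_def)
qed

lemma arcset_dual_pt: assumes "cdet a b = 1" "z \<in> arcset a b"
  obtains t where "t \<in> {0..1}" "z = dual_pt a b t" "Re (hmap a b z) = tau t"
proof -
  have z: "z \<in> ball 0 1" "norm (hmap a b z) = 1" "\<bar>Re (hmap a b z)\<bar> \<le> 1 / 2" using assms(2) by (auto simp: arcset_def)
  obtain t where t: "t \<in> {0..1}" "Re (hmap a b z) = tau t" using tau_surj[OF z(3)] by blast
  have "hmap a b z = Complex (tau t) (sqrt (1 - (tau t)\<^sup>2))"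
    using unit_circle_eq[OF z(2) horo_hmap(2)[OF z(1) assms(1)]] t(2) by simp
  hence "z = dual_pt a b t" using hinv_hmap[OF assms(1) z(1)] dual_pt_eq[OF assms(1) t(1)] by simp
  thus ?thesis using that t by blast
qed

lemma dual_tree_eq: "dual_tree = {z. \<exists>a b. ubasis a b \<and> z \<in> arcset a b}"
proof
  show "dual_tree \<subseteq> {z. \<exists>a b. ubasis a b \<and> z \<in> arcset a b}"
    unfolding dual_tree_def adjacent_iff dual_pt_def[symmetric]
    using dual_pt_arcset(1) ubasis_det unfolding dual_pt_def by blast
  show "{z. \<exists>a b. ubasis a b \<and> z \<in> arcset a b} \<subseteq> dual_tree"
  proof clarify
    fix z a b assume ab: "ubasis a b" "z \<in> arcset a b"
    obtain t where "t \<in> {0..1}" "z = dual_pt a b t" using arcset_dual_pt[OF ubasis_det[OF ab(1)] ab(2)] by blast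
    thus "z \<in> dual_tree" using ab(1) unfolding dual_tree_def adjacent_iff dual_pt_def by blast
  qed
qed

section \<open>Shortest lattice vectors and reduced bases\<close>

lemma horo_lower: assumes "norm z \<le> r" "r < 1" shows "horo a z \<ge> (norm a)\<^sup>2 * (1 - r)\<^sup>2"
proof -
  have "norm a - norm a * norm z \<le> norm (a - cnj a * z)" using norm_triangle_ineq2[of a "cnj a * z"] by (simp add: norm_mult)
  moreover have "norm a * norm z \<le> norm a * r" using assms by (intro mult_left_mono) auto
  ultimately have "norm a * (1 - r) \<le> norm (a - cnj a * z)" by (simp add: algebra_simps)
  hence "(norm a * (1 - r))\<^sup>2 \<le> (norm (a - cnj a * z))\<^sup>2" using assms by (intro power_mono) auto
  moreover have "0 < 1 - (norm z)\<^sup>2" "1 - (norm z)\<^sup>2 \<le> 1" using assms by (auto simp: power_less_one_iff abs_square_less_1)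
  hence "(norm (a - cnj a * z))\<^sup>2 \<le> (norm (a - cnj a * z))\<^sup>2 / (1 - (norm z)\<^sup>2)" by (simp add: le_divide_eq mult_left_le)
  ultimately show ?thesis by (simp add: horo_def power_mult_distrib)
qed

lemma finite_lat: "finite {c \<in> lat. norm c \<le> R}"
proof (rule finite_subset)
  show "{c \<in> lat. norm c \<le> R} \<subseteq> (\<lambda>(p, q). Complex (of_int p) (of_int q)) ` ({- \<lceil>R\<rceil>..\<lceil>R\<rceil>} \<times> {- \<lceil>R\<rceil>..\<lceil>R\<rceil>})"
  proof
    fix c assume "c \<in> {c \<in> lat. norm c \<le> R}"
    then obtain p q :: int where c: "Re c = of_int p" "Im c = of_int q" "norm c \<le> R" by (auto simp: lat_def elim!: Ints_cases)
    have "\<bar>real_of_int p\<bar> \<le> R" "\<bar>real_of_int q\<bar> \<le> R" using abs_Re_le_cmod[of c] abs_Im_le_cmod[of c] c by linarith+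
    hence "p \<in> {- \<lceil>R\<rceil>..\<lceil>R\<rceil>}" "q \<in> {- \<lceil>R\<rceil>..\<lceil>R\<rceil>}" by (simp_all add: abs_le_iff) (linarith+)
    moreover have "c = Complex (of_int p) (of_int q)" using c by (simp add: complex_eq_iff)
    ultimately show "c \<in> (\<lambda>(p, q). Complex (of_int p) (of_int q)) ` ({- \<lceil>R\<rceil>..\<lceil>R\<rceil>} \<times> {- \<lceil>R\<rceil>..\<lceil>R\<rceil>})" by force
  qed
qed simp

text \<open>Over a compact disk \<open>horo c\<close> grows like the squared norm of c. This is the
  source of local finiteness for the cells and the standard pieces in the domain.\<close>

lemma finite_horo: assumes "r < 1" shows "finite {c \<in> lat. \<exists>z. norm z \<le> r \<and> horo c z \<le> B}"
proof (rule finite_subset[OF _ finite_lat[of "sqrt (B / (1 - r)\<^sup>2)"]], safe)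
  fix c z assume "norm z \<le> r" "horo c z \<le> B"
  hence "(norm c)\<^sup>2 * (1 - r)\<^sup>2 \<le> B" using horo_lower[of z r c] assms by simp
  hence "(norm c)\<^sup>2 \<le> B / (1 - r)\<^sup>2" using assms by (simp add: le_divide_eq)
  thus "norm c \<le> sqrt (B / (1 - r)\<^sup>2)" by (rule real_le_rsqrt)
qed

text \<open>The first basis vector of a reduced form is a shortest one. The list of ties matters at
  triangle centres, where three vectors up to sign are shortest.\<close>

lemma reduced_min:
  assumes "ubasis a b" "z \<in> ball 0 1" "\<bar>Re (hmap a b z)\<bar> \<le> 1 / 2" "norm (hmap a b z) \<ge> 1" "c \<in> prim"
  shows "horo a z \<le> horo c z"
    "horo c z = horo a z \<Longrightarrow> c = a \<or> c = - a \<or> (norm (hmap a b z) = 1 \<and> (c = b \<or> c = - b \<or>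
       Re (hmap a b z) = 1 / 2 \<and> (c = b - a \<or> c = a - b) \<or> Re (hmap a b z) = - 1 / 2 \<and> (c = a + b \<or> c = - (a + b))))"
proof -
  note d = ubasis_det[OF assms(1)]
  define m where "m = hmap a b z"
  define R n where "R = Re m" and "n = (norm m)\<^sup>2"
  have n1: "n \<ge> 1" using assms(4) by (simp add: n_def m_def)
  have im: "Im m > 0" using horo_hmap(2)[OF assms(2) d] by (simp add: m_def)
  obtain x y :: int where xy: "c = of_int x * a + of_int y * b" "cdet a c = of_int y"
    using ubasis_expand[OF assms(1) prim_lat[OF assms(5)]] by metis
  have "horo c z = (norm (of_real (of_int x) + of_real (of_int y) * m))\<^sup>2 / Im m"
    using horo_comb[OF assms(2) d, of "of_int x" "of_int y"] xy by (simp add: m_def)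
  moreover define N where "N = (of_int x)\<^sup>2 + 2 * of_int x * of_int y * R + (of_int y)\<^sup>2 * n"
  moreover have "n = (Re m)\<^sup>2 + (Im m)\<^sup>2" by (simp add: n_def cmod_power2)
  hence "(norm (of_real (of_int x) + of_real (of_int y) * m))\<^sup>2 = N"
    unfolding cmod_power2 by (simp add: N_def R_def power2_eq_square algebra_simps)
  ultimately have hc: "horo c z = N / Im m" by simp
  have ha: "horo a z = 1 / Im m" using horo_hmap(1)[OF assms(2) d] by (simp add: m_def)
  have R2: "\<bar>R\<bar> \<le> 1 / 2" using assms(3) by (simp add: R_def m_def)
  have cross: "2 * of_int x * of_int y * R \<ge> - \<bar>of_int x * of_int y\<bar>"
  proof -
    have "\<bar>2 * (of_int x * of_int y) * R\<bar> = 2 * \<bar>of_int x * of_int y\<bar> * \<bar>R\<bar>" by (simp add: abs_mult)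
    also have "\<dots> \<le> 2 * \<bar>of_int x * of_int y\<bar> * (1 / 2)" using R2 by (intro mult_left_mono) auto
    finally show ?thesis by (simp add: abs_le_iff mult.assoc)
  qed
  \<comment> \<open>N is the value at c of the form scaled to be 1 at a. For |y| \<ge> 2 completing
    the square gives N \<ge> 4 n - 1 \<ge> 3, so ties need |y| = 1, and then x can only be 0 or 1 in
    absolute value.\<close>
  have main: "N \<ge> 1 \<and> (N = 1 \<longrightarrow> n = 1 \<and> \<bar>y\<bar> = 1 \<and> (x = 0 \<or> \<bar>x\<bar> = 1 \<and> 2 * of_int (x * y) * R = - 1))" if y: "y \<noteq> 0"
  proof (cases "\<bar>y\<bar> \<ge> 2")
    case True
    have "N \<ge> (\<bar>of_int x\<bar> - \<bar>of_int y\<bar> / 2)\<^sup>2 + (of_int y)\<^sup>2 * (n - 1 / 4)"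
      using cross by (simp add: N_def power2_diff abs_mult power_divide algebra_simps)
    moreover have "(of_int y)\<^sup>2 * (n - 1 / 4) \<ge> 2\<^sup>2 * (n - 1 / 4)"
    proof (rule mult_right_mono)
      have "(2::real) \<le> \<bar>of_int y\<bar>" using True by linarith
      hence "2\<^sup>2 \<le> \<bar>real_of_int y\<bar>\<^sup>2" by (intro power_mono) auto
      thus "2\<^sup>2 \<le> (real_of_int y)\<^sup>2" by simp
    qed (use n1 in simp)
    ultimately have "N \<ge> 2\<^sup>2 * (n - 1 / 4)" using zero_le_power2[of "\<bar>real_of_int x\<bar> - \<bar>of_int y\<bar> / 2"] by linarith
    hence "N \<ge> 4 * n - 1" by simp
    thus ?thesis using n1 by simp
  next
    case False
    hence y1: "\<bar>y\<bar> = 1" using y by simp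
    hence y2: "(real_of_int y)\<^sup>2 = 1" "\<bar>real_of_int y\<bar> = 1" by (auto simp: abs_if split: if_splits)
    have x2: "(real_of_int x)\<^sup>2 \<ge> \<bar>of_int x\<bar>" "(real_of_int x)\<^sup>2 = \<bar>of_int x\<bar> \<longrightarrow> x = 0 \<or> \<bar>x\<bar> = 1"
    proof -
      have "x\<^sup>2 \<ge> \<bar>x\<bar>" "x\<^sup>2 = \<bar>x\<bar> \<longrightarrow> x = 0 \<or> \<bar>x\<bar> = 1"
      proof -
        have sq: "x\<^sup>2 = \<bar>x\<bar> * \<bar>x\<bar>" by (simp add: power2_eq_square)
        have "\<bar>x\<bar> * \<bar>x\<bar> \<ge> \<bar>x\<bar> * 1" if "x \<noteq> 0" using that by (intro mult_left_mono) auto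
        thus "x\<^sup>2 \<ge> \<bar>x\<bar>" unfolding sq by (cases "x = 0") simp_all
        show "x\<^sup>2 = \<bar>x\<bar> \<longrightarrow> x = 0 \<or> \<bar>x\<bar> = 1"
        proof
          assume "x\<^sup>2 = \<bar>x\<bar>"
          hence "\<bar>x\<bar> * \<bar>x\<bar> = \<bar>x\<bar> * 1" unfolding sq by simp
          hence "\<bar>x\<bar> = 0 \<or> \<bar>x\<bar> = 1" by (metis mult_left_cancel)
          thus "x = 0 \<or> \<bar>x\<bar> = 1" by simp
        qed
      qed
      moreover have "real_of_int (x\<^sup>2) \<ge> real_of_int \<bar>x\<bar> \<longleftrightarrow> x\<^sup>2 \<ge> \<bar>x\<bar>" "real_of_int (x\<^sup>2) = real_of_int \<bar>x\<bar> \<longleftrightarrow> x\<^sup>2 = \<bar>x\<bar>"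
        by (simp_all only: of_int_le_iff of_int_eq_iff)
      ultimately show "(real_of_int x)\<^sup>2 \<ge> \<bar>of_int x\<bar>" "(real_of_int x)\<^sup>2 = \<bar>of_int x\<bar> \<longrightarrow> x = 0 \<or> \<bar>x\<bar> = 1"
        by simp_all
    qed
    have N: "N = (of_int x)\<^sup>2 + 2 * of_int (x * y) * R + n" by (simp add: N_def y2 mult.assoc)
    have cr: "2 * of_int (x * y) * R \<ge> - \<bar>of_int x\<bar>" using cross y2 by (simp add: abs_mult mult.assoc)
    have ge: "N \<ge> n" using N cr x2(1) by linarith
    show ?thesis
    proof (intro conjI impI)
      show "N \<ge> 1" using ge n1 by simp
      assume N1: "N = 1"
      show "n = 1" using ge n1 N1 by simp
      show "\<bar>y\<bar> = 1" by fact
      have "(real_of_int x)\<^sup>2 = \<bar>of_int x\<bar>" "2 * of_int (x * y) * R = - \<bar>of_int x\<bar>"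
        using N N1 n1 cr x2(1) by linarith+
      thus "x = 0 \<or> \<bar>x\<bar> = 1 \<and> 2 * of_int (x * y) * R = - 1" using x2(2) by auto
    qed
  qed
  have y0: "c = a \<or> c = - a" if "y = 0" using prim_cdet0[OF ubasis_prim(1)[OF assms(1)] assms(5)] xy(2) that by simp
  show "horo a z \<le> horo c z"
  proof (cases "y = 0")
    case True thus ?thesis using y0 by auto
  next
    case False thus ?thesis using main im by (simp add: ha hc divide_right_mono)
  qed
  assume eq: "horo c z = horo a z"
  show "c = a \<or> c = - a \<or> (norm (hmap a b z) = 1 \<and> (c = b \<or> c = - b \<or>
       Re (hmap a b z) = 1 / 2 \<and> (c = b - a \<or> c = a - b) \<or> Re (hmap a b z) = - 1 / 2 \<and> (c = a + b \<or> c = - (a + b))))"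
  proof (cases "y = 0")
    case True thus ?thesis using y0 by auto
  next
    case False
    have "N = 1" using eq im by (simp add: ha hc)
    hence k: "n = 1" "\<bar>y\<bar> = 1" "x = 0 \<or> \<bar>x\<bar> = 1 \<and> 2 * of_int (x * y) * R = - 1" using main[OF False] by auto
    have "norm m = 1 \<or> norm m = - 1" using k(1) by (simp add: n_def power2_eq_1_iff)
    hence nm: "norm m = 1" using norm_ge_zero[of m] by linarith
    have yy: "y = 1 \<or> y = - 1" using k(2) by linarith
    from k(3) show ?thesis
    proof
      assume "x = 0" thus ?thesis using yy xy(1) nm by (auto simp: m_def)
    next
      assume h: "\<bar>x\<bar> = 1 \<and> 2 * of_int (x * y) * R = - 1"
      hence xx: "x = 1 \<or> x = - 1" by linarith
      show ?thesis using xx yy h nm xy(1) by (auto simp: m_def R_def)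
    qed
  qed
qed

text \<open>Gauss reduction: a is a shortest primitive vector, which exists by finiteness, and b is
  shifted by the nearest integer multiple of a. That a is no longer than the shifted b is the
  condition |m| \<ge> 1.\<close>

lemma reduced_exists: assumes "z \<in> ball 0 1"
  obtains a b where "ubasis a b" "\<bar>Re (hmap a b z)\<bar> \<le> 1 / 2" "norm (hmap a b z) \<ge> 1"
proof -
  have "ubasis 1 \<i>" by (simp add: ubasis_def lat_def cdet_def)
  hence p1: "1 \<in> prim" by (rule ubasis_prim)
  let ?S = "{c \<in> prim. horo c z \<le> horo 1 z}"
  have "finite ?S"
    by (rule finite_subset[OF _ finite_horo[of "norm z" "horo 1 z"]]) (use assms prim_lat in auto)
  moreover have "?S \<noteq> {}" using p1 by auto
  ultimately obtain a where "is_arg_min (\<lambda>c. horo c z) (\<lambda>c. c \<in> ?S) a"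
    using ex_is_arg_min_if_finite by blast
  hence a: "a \<in> ?S" "\<And>c. c \<in> ?S \<Longrightarrow> horo a z \<le> horo c z" unfolding is_arg_min_linorder by blast+
  have amin: "horo a z \<le> horo c z" if "c \<in> prim" for c
    using a that by (cases "horo c z \<le> horo 1 z") auto
  obtain b where b: "ubasis a b" using a(1) by (auto simp: prim_def)
  define n where "n = round (Re (hmap a b z))"
  let ?b = "b - of_int n * a"
  have ub: "ubasis a ?b" by (rule ubasis_trans(5)[OF b])
  note d = ubasis_det[OF ub]
  have "hmap a ?b z = hmap a b z - of_int n"
    using hmap_shift_diff[OF assms cdet_nz(1)[of a b], of b "of_int n"] ubasis_det[OF b] by simp
  hence re: "\<bar>Re (hmap a ?b z)\<bar> \<le> 1 / 2"
    using of_int_round_abs_le[of "Re (hmap a b z)"] by (simp add: n_def abs_minus_commute)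
  have im: "Im (hmap a ?b z) > 0" using horo_hmap(2)[OF assms d] .
  have "horo ?b z = (norm (hmap a ?b z))\<^sup>2 / Im (hmap a ?b z)"
    using horo_comb[OF assms d, of 0 1] by simp
  moreover have "horo a z \<le> horo ?b z" using amin ubasis_prim(2)[OF ub] by blast
  ultimately have "1 \<le> (norm (hmap a ?b z))\<^sup>2" using horo_hmap(1)[OF assms d] im by (simp add: divide_le_cancel)
  hence "1 \<le> norm (hmap a ?b z)" by (metis abs_norm_cancel one_power2 abs_le_square_iff abs_one)
  thus ?thesis using that ub re by blast
qed

text \<open>A Voronoi cell for the horocyclic distances. It turns out to be the component of the
  complement of the tree that belongs to \<open>bpt a\<close>.\<close>

definition reg :: "complex \<Rightarrow> complex set" where
  "reg a = {z \<in> ball 0 1. \<forall>c\<in>prim. c \<noteq> a \<and> c \<noteq> - a \<longrightarrow> horo a z < horo c z}"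

text \<open>It suffices to compare a with the vectors b - n a: the n nearest to the abscissa gives a
  reduced basis with strict inequality, and \<open>reduced_min\<close> handles all other
  vectors.\<close>

lemma reg_chart: assumes "ubasis a b" "z \<in> ball 0 1"
  shows "z \<in> reg a \<longleftrightarrow> (\<forall>n::int. norm (hmap a b z - of_int n) > 1)"
proof
  note d = ubasis_det[OF assms(1)]
  have im: "Im (hmap a b z) > 0" using horo_hmap(2)[OF assms(2) d] .
  have ha: "horo a z = 1 / Im (hmap a b z)" using horo_hmap(1)[OF assms(2) d] .
  { assume z: "z \<in> reg a"
    show "\<forall>n::int. norm (hmap a b z - of_int n) > 1"
    proof
      fix n :: int
      let ?c = "b - of_int n * a"
      have c: "?c \<in> prim" using ubasis_prim(2) ubasis_trans(5)[OF assms(1)] by blast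
      have "cdet a ?c = 1" using d by simp
      hence "?c \<noteq> a \<and> ?c \<noteq> - a" by (metis cdet_linear(6) cdet_self neg_equal_0_iff_equal zero_neq_one)
      hence "horo a z < horo ?c z" using z c by (auto simp: reg_def)
      moreover have "horo ?c z = (norm (hmap a b z - of_int n))\<^sup>2 / Im (hmap a b z)"
        using horo_comb[OF assms(2) d, of "- of_int n" 1] by simp
      ultimately have "(norm (hmap a b z - of_int n))\<^sup>2 > 1" using im ha by (simp add: divide_less_cancel)
      thus "norm (hmap a b z - of_int n) > 1" by (metis abs_norm_cancel one_power2 abs_le_square_iff abs_one not_le)
    qed }
  { assume *: "\<forall>n::int. norm (hmap a b z - of_int n) > 1"
    define n where "n = round (Re (hmap a b z))"
    let ?b = "b - of_int n * a"
    have ub: "ubasis a ?b" by (rule ubasis_trans(5)[OF assms(1)])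
    have hm: "hmap a ?b z = hmap a b z - of_int n"
      using hmap_shift_diff[OF assms(2) cdet_nz(1)[of a b], of b "of_int n"] d by simp
    have re: "\<bar>Re (hmap a ?b z)\<bar> \<le> 1 / 2" unfolding hm
      using of_int_round_abs_le[of "Re (hmap a b z)"] by (simp add: n_def abs_minus_commute)
    have no: "norm (hmap a ?b z) > 1" using * hm by simp
    show "z \<in> reg a" unfolding reg_def
      using reduced_min[OF ub assms(2) re less_imp_le[OF no]] no assms(2) by (force simp: order_less_le) }
qed

lemma reg_minus: "reg (- a) = reg a"
  unfolding reg_def by (auto simp: minus_equation_iff[of _ a]) 

lemma reg_disjoint: assumes "a \<in> prim" "c \<in> prim" "c \<noteq> a" "c \<noteq> - a" shows "reg a \<inter> reg c = {}"
proof (rule ccontr)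
  assume "reg a \<inter> reg c \<noteq> {}"
  then obtain z where z: "z \<in> reg a" "z \<in> reg c" by blast
  have "horo a z < horo c z" using z(1) assms by (auto simp: reg_def)
  moreover have "horo c z < horo a z" using z(2) assms minus_equation_iff[of a c] by (auto simp: reg_def)
  ultimately show False by simp
qed

lemma arcset_horo: assumes "ubasis a b" "z \<in> arcset a b" "c \<in> prim"
  shows "horo a z \<le> horo c z" "horo b z = horo a z"
proof -
  have z: "z \<in> ball 0 1" "norm (hmap a b z) = 1" "\<bar>Re (hmap a b z)\<bar> \<le> 1 / 2" using assms(2) by (auto simp: arcset_def)
  show "horo a z \<le> horo c z" using reduced_min(1)[OF assms(1) z(1,3) _ assms(3)] z(2) by simp
  show "horo b z = horo a z" using horo_comb[OF z(1) ubasis_det[OF assms(1)], of 0 1] horo_hmap(1)[OF z(1) ubasis_det[OF assms(1)]] z(2)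
    by simp
qed

text \<open>Off the tree a reduced basis has |m| > 1, so its first vector is the only shortest one;
  on the dual edge crossing (a, b) the vectors a and b tie.\<close>

lemma ball_diff_dual_tree: "ball 0 1 - dual_tree = (\<Union>a\<in>prim. reg a)"
proof
  show "ball 0 1 - dual_tree \<subseteq> (\<Union>a\<in>prim. reg a)"
  proof
    fix z :: complex assume z: "z \<in> ball 0 1 - dual_tree"
    obtain a b where ab: "ubasis a b" "\<bar>Re (hmap a b z)\<bar> \<le> 1 / 2" "norm (hmap a b z) \<ge> 1"
      using reduced_exists z by blast
    have "norm (hmap a b z) \<noteq> 1" using z ab by (auto simp: dual_tree_eq arcset_def)
    hence "z \<in> reg a" unfolding reg_def using reduced_min[OF ab(1) _ ab(2,3)] z by (force simp: order_less_le)
    thus "z \<in> (\<Union>a\<in>prim. reg a)" using ubasis_prim(1)[OF ab(1)] by blast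
  qed
  show "(\<Union>a\<in>prim. reg a) \<subseteq> ball 0 1 - dual_tree"
  proof
    fix z assume "z \<in> (\<Union>a\<in>prim. reg a)"
    then obtain c where c: "c \<in> prim" "z \<in> reg c" by blast
    have "z \<notin> dual_tree"
    proof
      assume "z \<in> dual_tree"
      then obtain a b where ab: "ubasis a b" "z \<in> arcset a b" by (auto simp: dual_tree_eq)
      note p = ubasis_prim[OF ab(1)]
      have "\<not> ((c = a \<or> c = - a) \<and> (c = b \<or> c = - b))" using ubasis_det[OF ab(1)] by auto
      hence "horo c z < horo a z \<or> horo c z < horo b z"
        using c(2) p unfolding reg_def by (auto simp: minus_equation_iff[of c])
      thus False using arcset_horo[OF ab c(1)] by auto
    qed
    thus "z \<in> ball 0 1 - dual_tree" using c by (auto simp: reg_def)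
  qed
qed

lemma open_reg: assumes "a \<in> prim" shows "open (reg a)"
proof (rule Topological_Spaces.openI)
  fix z assume z: "z \<in> reg a"
  hence zb: "norm z < 1" by (auto simp: reg_def)
  define r where "r = (1 + norm z) / 2"
  have r: "norm z < r" "r < 1" using zb by (auto simp: r_def)
  have cont: "continuous_on (cball 0 r) (horo c)" for c
    unfolding horo_def using r by (intro continuous_intros) (auto simp: abs_square_eq_1 abs_if)
  have "bounded (horo a ` cball 0 r)" by (intro compact_imp_bounded compact_continuous_image cont) auto
  then obtain B where "\<forall>w\<in>cball 0 r. \<bar>horo a w\<bar> \<le> B" by (auto simp: bounded_iff)
  hence B: "\<And>w. w \<in> cball 0 r \<Longrightarrow> horo a w \<le> B" using abs_le_D1 by blast
  define F where "F = {c \<in> prim. c \<noteq> a \<and> c \<noteq> - a \<and> (\<exists>w. norm w \<le> r \<and> horo c w \<le> B)}"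
  have fin: "finite F"
    by (rule finite_subset[OF _ finite_horo[OF r(2), of B]]) (auto simp: F_def prim_lat)
  have op: "open {w \<in> ball 0 r. horo a w < horo c w}" for c
  proof -
    have c': "continuous_on (ball 0 r) (horo c)" for c by (rule continuous_on_subset[OF cont]) auto
    have "open (ball 0 r \<inter> (\<lambda>w. horo c w - horo a w) -` {0<..})"
      by (intro continuous_open_preimage continuous_intros c') auto
    moreover have "ball 0 r \<inter> (\<lambda>w. horo c w - horo a w) -` {0<..} = {w \<in> ball 0 r. horo a w < horo c w}" by auto
    ultimately show ?thesis by simp
  qed
  define T where "T = ball 0 r \<inter> (\<Inter>c\<in>F. {w \<in> ball 0 r. horo a w < horo c w})"
  have "open T" unfolding T_def using fin op by auto
  moreover have "z \<in> T" using z r by (auto simp: T_def F_def reg_def)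
  moreover have "T \<subseteq> reg a"
  proof
    fix w assume w: "w \<in> T"
    have wr: "norm w < r" using w by (auto simp: T_def)
    have "horo a w < horo c w" if "c \<in> prim" "c \<noteq> a \<and> c \<noteq> - a" for c
    proof (cases "horo c w \<le> B")
      case True
      hence "c \<in> F" using that wr by (auto simp: F_def intro: less_imp_le)
      thus ?thesis using w by (auto simp: T_def)
    next
      case False thus ?thesis using B[of w] wr by auto
    qed
    thus "w \<in> reg a" using wr r by (auto simp: reg_def)
  qed
  ultimately show "\<exists>T. open T \<and> z \<in> T \<and> T \<subseteq> reg a" by blast
qed

text \<open>In the chart the cell is the region above all unit half-circles centred at integers.
  From each of its points a vertical segment leads inside it to the half-plane Im > 1.\<close>

lemma connected_reg: assumes "a \<in> prim" shows "connected (reg a)" "reg a \<noteq> {}"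
proof -
  obtain b where b: "ubasis a b" using assms by (auto simp: prim_def)
  note d = ubasis_det[OF b]
  define W where "W = {w. Im w > 0 \<and> (\<forall>n::int. norm (w - of_int n) > 1)}"
  have eq: "reg a = hinv a b ` W"
  proof
    show "reg a \<subseteq> hinv a b ` W"
    proof
      fix z assume z: "z \<in> reg a"
      hence zb: "z \<in> ball 0 1" by (auto simp: reg_def)
      have "hmap a b z \<in> W" using reg_chart[OF b zb] z horo_hmap(2)[OF zb d] by (simp add: W_def)
      thus "z \<in> hinv a b ` W" using hinv_hmap[OF d zb] by force
    qed
    show "hinv a b ` W \<subseteq> reg a"
    proof clarify
      fix w assume w: "w \<in> W"
      hence "Im w > 0" by (simp add: W_def)
      note h = hinv_ball[OF d this] hmap_hinv[OF d less_imp_le[OF this]]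
      show "hinv a b w \<in> reg a" unfolding reg_chart[OF b h(1)] h(2) using w by (simp add: W_def)
    qed
  qed
  have up: "w + \<i> * of_real s \<in> W" if "w \<in> W" "s \<ge> 0" for w s
  proof -
    have "norm (w + \<i> * of_real s - of_int n) > 1" for n :: int
    proof -
      have "(norm (w + \<i> * of_real s - of_int n))\<^sup>2 \<ge> (norm (w - of_int n))\<^sup>2"
        unfolding cmod_power2 using that by (simp add: W_def power_mono)
      hence "norm (w + \<i> * of_real s - of_int n) \<ge> norm (w - of_int n)" by (rule power2_le_imp_le) simp
      thus ?thesis using that(1) by (force simp: W_def intro: less_le_trans)
    qed
    thus ?thesis using that by (simp add: W_def)
  qed
  have half: "{w. Im w > 1} \<subseteq> W"
  proof
    fix w :: complex assume w: "w \<in> {w. Im w > 1}"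
    have "norm (w - of_int n) > 1" for n :: int using abs_Im_le_cmod[of "w - of_int n"] w by simp
    thus "w \<in> W" using w by (simp add: W_def)
  qed
  let ?S = "\<lambda>w. {w. Im w > 1} \<union> closed_segment w (w + \<i> * 2)"
  have "W = (\<Union>w\<in>W. ?S w)"
  proof
    show "W \<subseteq> (\<Union>w\<in>W. ?S w)" by auto
    have "closed_segment w (w + \<i> * 2) \<subseteq> W" if "w \<in> W" for w
    proof
      fix v assume "v \<in> closed_segment w (w + \<i> * 2)"
      then obtain u where u: "0 \<le> u" "v = (1 - u) *\<^sub>R w + u *\<^sub>R (w + \<i> * 2)" by (auto simp: closed_segment_def)
      hence "v = w + \<i> * of_real (2 * u)" by (simp add: scaleR_conv_of_real algebra_simps)
      thus "v \<in> W" using up[OF that, of "2 * u"] u by simp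
    qed
    thus "(\<Union>w\<in>W. ?S w) \<subseteq> W" using half by blast
  qed
  moreover have "connected (\<Union>w\<in>W. ?S w)"
  proof (rule connected_Union)
    fix S assume "S \<in> ?S ` W"
    then obtain w where w: "w \<in> W" "S = ?S w" by blast
    have "w + \<i> * 2 \<in> {w. Im w > 1} \<inter> closed_segment w (w + \<i> * 2)" using w by (auto simp: W_def)
    hence "{w. Im w > 1} \<inter> closed_segment w (w + \<i> * 2) \<noteq> {}" by blast
    moreover have "connected {w. Im w > 1}" by (intro convex_connected convex_halfspace_Im_gt)
    ultimately show "connected S" unfolding w(2) using connected_Un connected_segment by blast
  next
    have "2 * \<i> \<in> \<Inter> (?S ` W)" by auto
    thus "\<Inter> (?S ` W) \<noteq> {}" by blast
  qed
  ultimately have cW: "connected W" by simp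
  have "continuous_on W (hinv a b)"
    unfolding hinv_def using hinv_den(2)[OF d] by (intro continuous_intros) (auto simp: W_def less_imp_le)
  thus "connected (reg a)" unfolding eq using cW connected_continuous_image by blast
  have "2 * \<i> \<in> W" using half by auto
  thus "reg a \<noteq> {}" unfolding eq by blast
qed

text \<open>The cells are open, connected, disjoint for different vertices, and they cover the
  complement of the tree.\<close>

lemma components_eq: "components (ball 0 1 - dual_tree) = reg ` prim"
proof -
  have comp: "C = reg a" if C: "C \<in> components (ball 0 1 - dual_tree)" and a: "a \<in> prim" "z \<in> reg a" "z \<in> C" for C a z
  proof
    have sub: "reg a \<subseteq> ball 0 1 - dual_tree" unfolding ball_diff_dual_tree using a by blast
    show "reg a \<subseteq> C" using components_maximal[OF C connected_reg(1)[OF a(1)] sub] a by blast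
    show "C \<subseteq> reg a"
    proof (rule ccontr)
      assume "\<not> C \<subseteq> reg a"
      let ?O = "\<Union>c\<in>{c\<in>prim. c \<noteq> a \<and> c \<noteq> - a}. reg c"
      have "C \<subseteq> ball 0 1 - dual_tree" using in_components_subset[OF C] .
      hence cov: "C \<subseteq> reg a \<union> ?O" unfolding ball_diff_dual_tree using reg_minus[of a] by (auto simp: minus_equation_iff)
      have dis: "reg a \<inter> ?O = {}" using reg_disjoint a(1) by blast
      have "connected C" using in_components_connected[OF C] .
      moreover have "open (reg a)" "open ?O" using open_reg a(1) by auto
      moreover have "reg a \<inter> C \<noteq> {}" using a by blast
      moreover have "?O \<inter> C \<noteq> {}" using \<open>\<not> C \<subseteq> reg a\<close> cov by blast
      ultimately show False using cov dis connectedD[of C "reg a" ?O] by blast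
    qed
  qed
  show ?thesis
  proof
    show "components (ball 0 1 - dual_tree) \<subseteq> reg ` prim"
    proof
      fix C assume C: "C \<in> components (ball 0 1 - dual_tree)"
      then obtain z where z: "z \<in> C" using in_components_nonempty by blast
      then obtain a where "a \<in> prim" "z \<in> reg a" using in_components_subset[OF C] unfolding ball_diff_dual_tree by blast
      thus "C \<in> reg ` prim" using comp[OF C _ _ z] by blast
    qed
    show "reg ` prim \<subseteq> components (ball 0 1 - dual_tree)"
    proof clarify
      fix a assume a: "a \<in> prim"
      obtain z where z: "z \<in> reg a" using connected_reg(2)[OF a] by blast
      have "z \<in> ball 0 1 - dual_tree" unfolding ball_diff_dual_tree using a z by blast
      then obtain C where "C \<in> components (ball 0 1 - dual_tree)" "z \<in> C" by (metis UnionE Union_components)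
      thus "reg a \<in> components (ball 0 1 - dual_tree)" using comp a z by metis
    qed
  qed
qed

text \<open>For lattice vectors this makes \<open>bpt a\<close> the nearest vertex on the horoball \<open>horo a z < 1\<close>.\<close>
lemma horo_mult_ge: assumes "z \<in> ball 0 1" "a \<noteq> 0" "c \<noteq> 0"
  shows "horo a z * horo c z \<ge> (cdet a c)\<^sup>2"
proof -
  have s: "1 - (norm z)\<^sup>2 > 0" using sq_less_one[OF assms(1)] by simp
  have "Im (cnj (a - cnj a * z) * (c - cnj c * z)) = cdet a c * (1 - (norm z)\<^sup>2)"
    unfolding cmod_power2 by (simp add: cdet_def algebra_simps power2_eq_square)
  hence "(cdet a c * (1 - (norm z)\<^sup>2))\<^sup>2 \<le> (norm (cnj (a - cnj a * z) * (c - cnj c * z)))\<^sup>2"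
    using abs_Im_le_cmod[of "cnj (a - cnj a * z) * (c - cnj c * z)"] by (metis abs_le_square_iff abs_norm_cancel)
  hence "(cdet a c)\<^sup>2 * (1 - (norm z)\<^sup>2)\<^sup>2 \<le> (norm (a - cnj a * z))\<^sup>2 * (norm (c - cnj c * z))\<^sup>2"
    by (simp add: norm_mult power_mult_distrib del: complex_cnj_diff)
  thus ?thesis using s by (simp add: horo_def power2_eq_square[of "1 - (norm z)\<^sup>2"] le_divide_eq)
qed

text \<open>If c has the shorter distance on its cell, the inequality with cleared denominators
  passes to the closure and at \<open>bpt a\<close> forces the numerator of c to vanish. Conversely,
  along the radius to \<open>bpt a\<close> the distance of a tends to 0; once it is below 1, all
  others exceed 1 by \<open>horo_mult_ge\<close>.\<close>

lemma vertex_frontier: assumes "a \<in> prim" "c \<in> prim" shows "bpt a \<in> frontier (reg c) \<longleftrightarrow> c = a \<or> c = - a"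
proof
  have an: "a \<noteq> 0" "c \<noteq> 0" using prim_nz assms by auto
  assume f: "bpt a \<in> frontier (reg c)"
  show "c = a \<or> c = - a"
  proof (rule ccontr)
    assume n: "\<not> (c = a \<or> c = - a)"
    have "reg c \<subseteq> {w. (norm (c - cnj c * w))\<^sup>2 \<le> (norm (a - cnj a * w))\<^sup>2}"
    proof
      fix w assume w: "w \<in> reg c"
      hence "horo c w < horo a w" using assms n minus_equation_iff[of a c] by (auto simp: reg_def)
      moreover have "(norm w)\<^sup>2 < 1" using w by (auto simp: reg_def power_less_one_iff abs_square_less_1)
      ultimately have "(norm (c - cnj c * w))\<^sup>2 < (norm (a - cnj a * w))\<^sup>2"
        by (simp add: horo_def divide_less_cancel)
      thus "w \<in> {w. (norm (c - cnj c * w))\<^sup>2 \<le> (norm (a - cnj a * w))\<^sup>2}"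
        by (simp only: mem_Collect_eq less_imp_le)
    qed
    moreover have "closed {w. (norm (c - cnj c * w))\<^sup>2 \<le> (norm (a - cnj a * w))\<^sup>2}"
      by (intro closed_Collect_le continuous_intros)
    ultimately have "bpt a \<in> {w. (norm (c - cnj c * w))\<^sup>2 \<le> (norm (a - cnj a * w))\<^sup>2}"
      using f closure_minimal unfolding frontier_def by blast
    moreover have "a - cnj a * bpt a = 0" using an by (simp add: bpt_def)
    ultimately have "c - cnj c * bpt a = 0" by simp
    hence "bpt a = bpt c" using an by (simp add: bpt_def field_simps)
    thus False using bpt_eq_prim[OF assms] n by auto
  qed
next
  assume "c = a \<or> c = - a"
  hence rc: "reg c = reg a" using reg_minus by auto
  have an: "a \<noteq> 0" using prim_nz assms by auto
  have nb: "bpt a \<notin> reg a" using norm_bpt[OF an] by (auto simp: reg_def)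
  have "bpt a \<in> closure (reg a)"
  proof (rule Lim_in_closed_set[OF closed_closure])
    let ?g = "\<lambda>t. of_real t * bpt a"
    have lim: "((\<lambda>t. (norm a)\<^sup>2 * (1 - t) / (1 + t)) \<longlongrightarrow> 0) (at_left 1)"
      by (rule tendsto_eq_intros refl | simp)+
    have "\<forall>\<^sub>F t in at_left 1. (norm a)\<^sup>2 * (1 - t) / (1 + t) < 1" using order_tendstoD(2)[OF lim, of 1] by simp
    moreover have "\<forall>\<^sub>F t :: real in at_left 1. 0 < t \<and> t < 1"
      by (subst eventually_at_left[of 0]) (auto intro: exI[of _ 0])
    ultimately show "\<forall>\<^sub>F t in at_left 1. ?g t \<in> closure (reg a)"
    proof eventually_elim
      case (elim t)
      have "norm (?g t) < 1" using elim an by (simp add: norm_mult)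
      hence zb: "?g t \<in> ball 0 1" by simp
      have "a - cnj a * ?g t = of_real (1 - t) * a" using an by (simp add: bpt_def field_simps)
      hence "norm (a - cnj a * ?g t) = (1 - t) * norm a" using elim by (simp add: norm_mult del: of_real_diff)
      moreover have "1 - (norm (?g t))\<^sup>2 = (1 - t) * (1 + t)" using elim an by (simp add: norm_mult power2_eq_square algebra_simps)
      ultimately have "horo a (?g t) = (norm a)\<^sup>2 * (1 - t) / (1 + t)"
        using elim by (simp add: horo_def power_mult_distrib power2_eq_square)
      hence h1: "horo a (?g t) < 1" using elim by simp
      have "horo a (?g t) < horo c (?g t)" if "c \<in> prim" "c \<noteq> a \<and> c \<noteq> - a" for c
      proof -
        have ck: "cdet a c \<in> \<int>" using lat_cdet[OF prim_lat[OF assms(1)] prim_lat[OF that(1)]] .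
        have "cdet a c \<noteq> 0" using prim_cdet0[OF assms(1) that(1)] that(2) by auto
        moreover obtain k :: int where k: "cdet a c = of_int k"
          using ck by (rule Ints_cases)
        ultimately have "\<bar>k\<bar> \<ge> 1" by auto
        hence "(1::real) \<le> \<bar>cdet a c\<bar>" using k by simp
        hence "1 \<le> (cdet a c)\<^sup>2" by (simp add: abs_le_square_iff[of 1, simplified])
        hence ge: "1 \<le> horo a (?g t) * horo c (?g t)" using horo_mult_ge[OF zb an prim_nz[OF that(1)]] by simp
        show ?thesis
        proof (rule ccontr)
          assume "\<not> horo a (?g t) < horo c (?g t)"
          hence "horo c (?g t) < 1" using h1 by simp
          hence "horo a (?g t) * horo c (?g t) < 1 * 1"
            using h1 horo_pos[OF zb an] horo_pos[OF zb prim_nz[OF that(1)]] by (intro mult_strict_mono) auto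
          thus False using ge by simp
        qed
      qed
      hence "?g t \<in> reg a" using zb by (auto simp: reg_def)
      thus ?case using closure_subset by blast
    qed
    show "(?g \<longlongrightarrow> bpt a) (at_left 1)" by (rule tendsto_eq_intros refl | simp)+
  qed simp
  thus "bpt a \<in> frontier (reg c)" unfolding rc frontier_def interior_open[OF open_reg[OF assms(1)]] using nb by blast
qed

lemma cell_eq: assumes "a \<in> prim" shows "cell (bpt a) = reg a"
  unfolding cell_def components_eq using vertex_frontier assms reg_minus by (intro the_equality) auto

section \<open>The stretching map and the extension in charts\<close>

lemma arc_tau: "garc l r (tau t) = gpt (r - l) (arcR l r) ((1 - t) * arcs1 l r + t * arcs2 l r)"
proof -
  have "artanh (tau t) = (2 * t - 1) * artanh (1 / 2)" by (simp add: tau_def artanh_tanh_real)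
  hence "arcA l r * artanh (tau t) = (arcs2 l r - arcs1 l r) / 2 * (2 * t - 1)"
    unfolding arcA_def using artanh_half_pos by simp
  hence "(arcs1 l r + arcs2 l r) / 2 + arcA l r * artanh (tau t) = (1 - t) * arcs1 l r + t * arcs2 l r"
    by (simp add: field_simps)
  thus ?thesis by (simp add: garc_def)
qed

lemma arc_half: assumes "l > 0" "r > 0"
  shows "garc l r (- 1 / 2) = Complex (- l / 2) (sqrt 3 / 2 * l)" "garc l r (1 / 2) = Complex (r / 2) (sqrt 3 / 2 * r)"
  using arc_tau[of l r 0] arc_tau[of l r 1] arc_ends(1,2)[OF assms] by (simp_all add: tau_values)

lemma hyp_center_arc: assumes "cdet a b = 1" "l > 0" "r > 0"
  shows "hyp_center {bpt a, bpt b, bpt (b + of_real l * a)} = hinv a b (garc l r (tau 0))"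
    "hyp_center {bpt a, bpt b, bpt (b - of_real r * a)} = hinv a b (garc l r (tau 1))"
  using hinv_hmap[OF assms(1) center_left(1)[OF assms(1,2)]] hinv_hmap[OF assms(1) center_right(1)[OF assms(1,3)]]
    center_left(2)[OF assms(1,2)] center_right(2)[OF assms(1,3)] arc_half[OF assms(2,3)]
  by (simp_all add: tau_values)

lemma tri_shift: "tri a b = {bpt a, bpt b, bpt (b + of_real 1 * a)}" "tri b (- a) = {bpt a, bpt b, bpt (b - of_real 1 * a)}"
  unfolding tri_other by (simp_all add: tri_def add.commute)

lemma dual_pt_arc: assumes "cdet a b = 1" "t \<in> {0..1}" shows "dual_pt a b t = hinv a b (garc 1 1 (tau t))"
  unfolding dual_pt_def tri_shift(2) unfolding tri_shift(1)
  using dual_edge_point(1)[OF assms(1) _ _ assms(2), of 1 1] by (simp add: tau_def)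

lemma dual_pt_ends: assumes "cdet a b = 1" 
  shows "dual_pt a b 0 = hyp_center (tri a b)" "dual_pt a b 1 = hyp_center (tri b (- a))"
  using dual_pt_arc[OF assms, of 0] dual_pt_arc[OF assms, of 1] hyp_center_arc[OF assms, of 1 1]
  unfolding tri_shift(2) unfolding tri_shift(1) by simp_all

lemma dual_pt_inj: assumes "cdet a b = 1" "s \<in> {0..1}" "t \<in> {0..1}" "dual_pt a b s = dual_pt a b t" shows "s = t"
  using dual_pt_arcset(2)[OF assms(1,2)] dual_pt_arcset(2)[OF assms(1,3)] assms(4) tau_eq_iff by metis

section \<open>The stretching map is well defined\<close>

context circle_map
begin

text \<open>Lifts of the image quadrilateral whose chart puts its vertices at \<infinity>, -l, 0, r.
  The common scale of l and r is left free, since the ratio alone is determined by h.\<close>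

definition quad_lift :: "complex \<Rightarrow> complex \<Rightarrow> complex \<Rightarrow> complex \<Rightarrow> real \<Rightarrow> real \<Rightarrow> bool" where
  "quad_lift a b a' b' l r \<longleftrightarrow> cdet a' b' = 1 \<and> l > 0 \<and> r > 0 \<and> h (bpt a) = bpt a' \<and> h (bpt b) = bpt b' \<and>
     h (bpt (a + b)) = bpt (b' + of_real l * a') \<and> h (bpt (b - a)) = bpt (b' - of_real r * a')"

lemma quad_lift_exists: assumes "ubasis a b" obtains a' b' l r where "quad_lift a b a' b' l r"
proof -
  obtain a' b' \<xi> where x: "cdet a' b' = 1" "h (bpt a) = bpt a'" "\<And>n::int. h (bpt (b - of_int n * a)) = bpt (b' - of_real (\<xi> n) * a')"
    "\<xi> 0 = 0" "\<xi> (- 1) = - 1" "\<And>n. \<xi> n < \<xi> (n + 1)"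
    "\<And>n. shear h {bpt a, bpt (b - of_int n * a)} = ln ((\<xi> (n + 1) - \<xi> n) / (\<xi> n - \<xi> (n - 1)))"
    using image_fan[OF assms] by metis
  have "\<xi> 1 > 0" using x(6)[of 0] x(4) by simp
  hence "quad_lift a b a' b' 1 (\<xi> 1)"
    unfolding quad_lift_def using x(1,2) x(3)[of 0] x(3)[of 1] x(3)[of "-1"] x(4,5) by (simp add: add.commute)
  thus ?thesis using that by blast
qed

definition img_pt :: "complex \<Rightarrow> complex \<Rightarrow> real \<Rightarrow> complex" where
  "img_pt a b t = hyp_point (hyp_center (h ` tri a b)) (hyp_center (h ` tri b (- a))) t"

lemma quad_lift_tri: assumes "quad_lift a b a' b' l r"
  shows "h ` tri a b = {bpt a', bpt b', bpt (b' + of_real l * a')}" "h ` tri b (- a) = {bpt a', bpt b', bpt (b' - of_real r * a')}"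
  using assms unfolding tri_other by (auto simp: quad_lift_def tri_def)

lemma img_pt_eq: assumes "quad_lift a b a' b' l r" "t \<in> {0..1}"
  shows "img_pt a b t = hinv a' b' (garc l r (tau t))" "img_pt b (- a) (1 - t) = hinv a' b' (garc l r (tau t))"
  using dual_edge_point[of a' b' l r t] assms tri_minus[of a b] 
  unfolding img_pt_def quad_lift_tri[OF assms(1)] tau_def[symmetric] by (simp_all add: quad_lift_def quad_lift_tri[OF assms(1)])

lemma img_pt_swap: assumes "ubasis a b" "t \<in> {0..1}"
  shows "img_pt b (- a) (1 - t) = img_pt a b t" "img_pt (- a) (- b) t = img_pt a b t"
proof -
  obtain a' b' l r where "quad_lift a b a' b' l r" using quad_lift_exists[OF assms(1)] by blast
  from img_pt_eq[OF this assms(2)] show "img_pt b (- a) (1 - t) = img_pt a b t" by simp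
  show "img_pt (- a) (- b) t = img_pt a b t" unfolding img_pt_def tri_minus[of b "- a"] tri_minus[of a b] ..
qed

lemma img_pt_ends: assumes "ubasis a b"
  shows "img_pt a b 0 = hyp_center (h ` tri a b)" "img_pt a b 1 = hyp_center (h ` tri b (- a))"
proof -
  obtain a' b' l r where q: "quad_lift a b a' b' l r" using quad_lift_exists[OF assms(1)] by blast
  show "img_pt a b 0 = hyp_center (h ` tri a b)" "img_pt a b 1 = hyp_center (h ` tri b (- a))"
    unfolding quad_lift_tri[OF q] using img_pt_eq(1)[OF q, of 0] img_pt_eq(1)[OF q, of 1] hyp_center_arc[of a' b' l r] q
    by (simp_all add: quad_lift_def)
qed

lemma img_pt_center:
  assumes "ubasis c d" "s \<in> {0..1}" "T \<in> farey_triangles" "bpt c \<in> T" "bpt d \<in> T" "dual_pt c d s = hyp_center T"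
  shows "img_pt c d s = hyp_center (h ` T)"
proof -
  note e = dual_pt_ends[OF ubasis_det[OF assms(1)]]
  have "T = tri c d \<or> T = tri d (- c)" using tri_containing assms by blast
  thus ?thesis
  proof
    assume T: "T = tri c d"
    hence "s = 0" using dual_pt_inj[OF ubasis_det[OF assms(1)] assms(2), of 0] assms(6) e by simp
    thus ?thesis using img_pt_ends(1)[OF assms(1)] T by simp
  next
    assume T: "T = tri d (- c)"
    hence "s = 1" using dual_pt_inj[OF ubasis_det[OF assms(1)] assms(2), of 1] assms(6) e by simp
    thus ?thesis using img_pt_ends(2)[OF assms(1)] T by simp
  qed
qed

text \<open>\<open>stretch_map\<close> is a definite description, so a point shared by several dual
  edges must receive one image. An inner point of a dual edge lies on no other one, except with
  reversed direction; a shared endpoint is a triangle centre, and both images are the centre of the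
  image triangle.\<close>

lemma img_pt_unique:
  assumes ab: "ubasis a b" "t \<in> {0..1}" and cd: "ubasis c d" "s \<in> {0..1}" and eq: "dual_pt a b t = dual_pt c d s"
  shows "img_pt a b t = img_pt c d s"
proof -
  define z where "z = dual_pt a b t"
  note da = ubasis_det[OF ab(1)] and dc = ubasis_det[OF cd(1)]
  have za: "z \<in> arcset a b" "Re (hmap a b z) = tau t" using dual_pt_arcset[OF da ab(2)] by (simp_all add: z_def)
  have zc: "z \<in> arcset c d" "Re (hmap c d z) = tau s" using dual_pt_arcset[OF dc cd(2)] eq by (simp_all add: z_def)
  have z: "z \<in> ball 0 1" "norm (hmap a b z) = 1" "\<bar>Re (hmap a b z)\<bar> \<le> 1 / 2" "norm (hmap a b z) \<ge> 1" using za by (auto simp: arcset_def)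
  note pa = ubasis_prim[OF ab(1)] and pc = ubasis_prim[OF cd(1)]
  have "horo c z = horo a z" using arcset_horo(1)[OF ab(1) za(1) pc(1)] arcset_horo(1)[OF cd(1) zc(1) pa(1)] by simp
  moreover have "horo d z = horo a z" using calculation arcset_horo(2)[OF cd(1) zc(1) pc(1)] by simp
  \<comment> \<open>c and d are shortest vectors at z too, so they occur in the list of ties of
    \<open>reduced_min\<close> for the basis (a, b).\<close>
  ultimately have mc: "c \<in> {a, - a, b, - b} \<or> tau t = 1 / 2 \<and> (c = b - a \<or> c = a - b) \<or> tau t = - 1 / 2 \<and> (c = a + b \<or> c = - (a + b))"
    and md: "d \<in> {a, - a, b, - b} \<or> tau t = 1 / 2 \<and> (d = b - a \<or> d = a - b) \<or> tau t = - 1 / 2 \<and> (d = a + b \<or> d = - (a + b))"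
    using reduced_min(2)[OF ab(1) z(1,3,4) pc(1)] reduced_min(2)[OF ab(1) z(1,3,4) pc(2)] unfolding za(2) by blast+
  have bm: "bpt (a - b) = bpt (b - a)" "bpt (- a - b) = bpt (a + b)" using bpt_minus[of "a - b"] bpt_minus[of "a + b"] by simp_all
  consider "tau t = 1 / 2" | "tau t = - 1 / 2" | "tau t \<noteq> 1 / 2" "tau t \<noteq> - 1 / 2" by blast
  thus ?thesis
  proof cases
    case 1
    hence t: "t = 1" using tau_values(2) tau_eq_iff by metis
    have "bpt c \<in> tri b (- a)" "bpt d \<in> tri b (- a)" using mc md 1 bm unfolding tri_other by auto
    hence "img_pt c d s = hyp_center (h ` tri b (- a))"
      using img_pt_center[OF cd tri_farey[OF ubasis_trans(1)[OF ab(1)]]] eq dual_pt_ends(2)[OF da] t by simp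
    thus ?thesis using img_pt_ends(2)[OF ab(1)] t by simp
  next
    case 2
    hence t: "t = 0" using tau_values(1) tau_eq_iff by metis
    have "bpt c \<in> tri a b" "bpt d \<in> tri a b" using mc md 2 bm unfolding tri_def by auto
    hence "img_pt c d s = hyp_center (h ` tri a b)"
      using img_pt_center[OF cd tri_farey[OF ab(1)]] eq dual_pt_ends(1)[OF da] t by simp
    thus ?thesis using img_pt_ends(1)[OF ab(1)] t by simp
  next
    case 3
    have "c \<in> {a, - a, b, - b}" "d \<in> {a, - a, b, - b}" using mc md 3 by auto
    hence "(c, d) = (a, b) \<or> (c, d) = (- a, - b) \<or> (c, d) = (b, - a) \<or> (c, d) = (- b, a)"
      using dc da cdet_commute[of b a] by auto
    moreover have "(Re (hmap a b z))\<^sup>2 + (Im (hmap a b z))\<^sup>2 = 1" using z(2) cmod_power2[of "hmap a b z"] by simp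
    hence re: "Re (- 1 / hmap a b z) = - tau t" unfolding za(2)[symmetric] by (simp add: Re_divide)
    have "s = t" if "c = a \<and> d = b \<or> c = - a \<and> d = - b" using that za(2) zc(2) tau_eq_iff by auto
    moreover have "s = 1 - t" if "c = b \<and> d = - a \<or> c = - b \<and> d = a"
    proof -
      have "hmap c d z = - 1 / hmap a b z" using that hmap_swap[of b a z] hmap_minus[of b "- a" z] by auto
      hence "tau s = tau (1 - t)" using re zc(2) tau_values(3) by simp
      thus ?thesis by (simp add: tau_eq_iff)
    qed
    moreover have "img_pt (- b) a (1 - t) = img_pt b (- a) (1 - t)"
      using img_pt_swap(2)[OF ubasis_trans(1)[OF ab(1)], of "1 - t"] ab(2) by simp
    ultimately show ?thesis using img_pt_swap[OF ab] by auto
  qed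
qed

lemma stretch_map_dual_pt: assumes "ubasis a b" "t \<in> {0..1}" shows "stretch_map h (dual_pt a b t) = img_pt a b t"
  unfolding stretch_map_def
proof (rule the_equality)
  show "\<exists>T T' s. adjacent T T' \<and> s \<in> {0..1} \<and> dual_pt a b t = hyp_point (hyp_center T) (hyp_center T') s \<and>
      img_pt a b t = hyp_point (hyp_center (h ` T)) (hyp_center (h ` T')) s"
    using assms unfolding adjacent_iff img_pt_def dual_pt_def by blast
  fix w assume "\<exists>T T' s. adjacent T T' \<and> s \<in> {0..1} \<and> dual_pt a b t = hyp_point (hyp_center T) (hyp_center T') s \<and>
      w = hyp_point (hyp_center (h ` T)) (hyp_center (h ` T')) s"
  then obtain c d s where cd: "ubasis c d" "s \<in> {0..1}" "dual_pt a b t = dual_pt c d s" "w = img_pt c d s"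
    unfolding adjacent_iff dual_pt_def img_pt_def by blast
  show "w = img_pt a b t" using img_pt_unique[OF assms cd(1-3)] cd(4) by simp
qed

lemma stretch_map_arcset: assumes "ubasis a b" "z \<in> arcset a b" "quad_lift a b a' b' l r"
  shows "stretch_map h z = hinv a' b' (garc l r (Re (hmap a b z)))"
proof -
  obtain t where t: "t \<in> {0..1}" "z = dual_pt a b t" "Re (hmap a b z) = tau t"
    using arcset_dual_pt[OF ubasis_det[OF assms(1)] assms(2)] by blast
  show ?thesis using stretch_map_dual_pt[OF assms(1) t(1)] img_pt_eq(1)[OF assms(3) t(1)] t by simp
qed

end

section \<open>The extension in half-plane charts\<close>

lemma gpt_scale: "gpt (k * c) (k * R) s = of_real k * gpt c R s"
  by (simp add: gpt_def complex_eq_iff algebra_simps)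

lemma arc_scale: assumes "k > 0" shows "garc (k * l) (k * r) x = of_real k * garc l r x"
proof -
  have "(k * l)\<^sup>2 - k * l * (k * r) + (k * r)\<^sup>2 = k\<^sup>2 * (l\<^sup>2 - l * r + r\<^sup>2)" by (simp add: power2_eq_square algebra_simps)
  hence R: "arcR (k * l) (k * r) = k * arcR l r" using assms by (simp add: arcR_def real_sqrt_mult)
  have "(k * l / 2 - k * r) / (k * arcR l r) = (l / 2 - r) / arcR l r" "(k * l - k * r / 2) / (k * arcR l r) = (l - r / 2) / arcR l r"
  proof -
    have "k * l / 2 - k * r = k * (l / 2 - r)" "k * l - k * r / 2 = k * (l - r / 2)" by (simp_all add: algebra_simps)
    thus "(k * l / 2 - k * r) / (k * arcR l r) = (l / 2 - r) / arcR l r" "(k * l - k * r / 2) / (k * arcR l r) = (l - r / 2) / arcR l r"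
      using assms by simp_all
  qed
  hence s: "arcs1 (k * l) (k * r) = arcs1 l r" "arcs2 (k * l) (k * r) = arcs2 l r"
    unfolding arcs1_def arcs2_def R by simp_all
  have "k * r - k * l = k * (r - l)" by (simp add: algebra_simps)
  thus ?thesis unfolding garc_def arcA_def R s by (simp add: gpt_scale)
qed

text \<open>The extension near one edge in the charts: the abscissa moves as on the tree, the height
  above the tree is kept.\<close>

definition kap :: "real \<Rightarrow> real \<Rightarrow> complex \<Rightarrow> complex" where
  "kap l r m = garc l r (Re m) + \<i> * of_real (Im m - sqrt (1 - (Re m)\<^sup>2))"

lemma kap_scale: "k > 0 \<Longrightarrow> kap (k * l) (k * r) m = of_real k * garc l r (Re m) + \<i> * of_real (Im m - sqrt (1 - (Re m)\<^sup>2))"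
  by (simp add: kap_def arc_scale)

text \<open>On the common vertical side of two neighbouring pieces both formulas translate the same
  triangle centre vertically.\<close>

lemma kap_glue: assumes "l > 0" "r > 0" "r' > 0" "Re m = 1 / 2"
  shows "kap l r m = of_real r + kap r r' (m - 1)"
proof -
  have "Re (m - 1) = - 1 / 2" using assms(4) by simp
  thus ?thesis unfolding kap_def assms(4) using arc_half(2)[OF assms(1,2)] arc_half(1)[OF assms(2,3)] by (simp add: complex_eq_iff)
qed

lemma farey_extension_tree: "z \<in> dual_tree \<Longrightarrow> farey_extension h z = stretch_map h z"
  by (simp add: farey_extension_def)

lemma farey_extension_reg: assumes "a \<in> prim" "z \<in> reg a"
  shows "farey_extension h z = cell_map h (bpt a) (SOME w. fan_indexing (bpt a) w) z"
proof -
  have "z \<notin> dual_tree" using assms ball_diff_dual_tree by blast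
  moreover have "(THE v. v \<in> farey_vertices \<and> z \<in> cell v) = bpt a"
  proof (rule the_equality)
    show "bpt a \<in> farey_vertices \<and> z \<in> cell (bpt a)" using assms cell_eq farey_vertices_eq by auto
    fix v assume "v \<in> farey_vertices \<and> z \<in> cell v"
    moreover from this obtain c where "c \<in> prim" "v = bpt c" by (auto simp: farey_vertices_eq)
    ultimately have c: "c \<in> prim" "v = bpt c" "z \<in> reg c" using cell_eq by auto
    hence "c = a \<or> c = - a" using reg_disjoint[OF assms(1) c(1)] assms(2) by blast
    thus "v = bpt a" using c(2) by auto
  qed
  ultimately show ?thesis by (simp add: farey_extension_def Let_def)
qed

lemma scallop_int: assumes "k = round x" shows "scallop x = sqrt (1 - (x - of_int k)\<^sup>2)"
  using assms by (simp add: scallop_def)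

context shear_map
begin

abbreviation f :: "complex \<Rightarrow> complex" where "f \<equiv> farey_extension h"

text \<open>The normal form of the extension on the closed cell of the vertex \<open>bpt a\<close>; the chart
  \<open>hmap a' b'\<close> of the image is \<open>exp (- M)\<close> times the one in the definition of \<^const>\<open>cell_map\<close>.\<close>
lemma piece: assumes "a \<in> prim"
  obtains b a' b' \<xi> where "ubasis a b" "cdet a' b' = 1" "h (bpt a) = bpt a'"
    "\<And>n::int. h (bpt (b - of_int n * a)) = bpt (b' - of_real (\<xi> n) * a')"
    "\<And>n. exp (- Kb) \<le> \<xi> (n + 1) - \<xi> n" "\<And>n. \<xi> (n + 1) - \<xi> n \<le> exp Kb"
    "\<And>n. shear h {bpt a, bpt (b - of_int n * a)} = ln ((\<xi> (n + 1) - \<xi> n) / (\<xi> n - \<xi> (n - 1)))"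
    "\<And>n z. z \<in> ball 0 1 \<Longrightarrow> \<bar>Re (hmap a b z - of_int n)\<bar> \<le> 1 / 2 \<Longrightarrow> norm (hmap a b z - of_int n) \<ge> 1 \<Longrightarrow>
       f z \<in> ball 0 1 \<and> hmap a' b' (f z) = of_real (\<xi> n) + kap (\<xi> n - \<xi> (n - 1)) (\<xi> (n + 1) - \<xi> n) (hmap a b z - of_int n)"
proof -
  define w where "w = (SOME w. fan_indexing (bpt a) w)"
  have "\<exists>w. fan_indexing (bpt a) w" using assms fan_indexing_bpt by (auto simp: prim_def)
  hence "fan_indexing (bpt a) w" unfolding w_def by (rule someI_ex)
  then obtain b where b: "ubasis a b" "w = (\<lambda>n. bpt (b - of_int n * a))" using fan_indexingE[OF assms] by blast
  note d = ubasis_det[OF b(1)]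
  obtain \<alpha> \<beta> \<xi> where x: "cdet \<alpha> \<beta> = 1" "h (bpt a) = bpt \<alpha>" "\<And>n::int. h (bpt (b - of_int n * a)) = bpt (\<beta> - of_real (\<xi> n) * \<alpha>)"
    "\<xi> 0 = 0" "\<xi> (- 1) = - 1" "\<And>n. \<xi> n < \<xi> (n + 1)"
    "\<And>n. shear h {bpt a, bpt (b - of_int n * a)} = ln ((\<xi> (n + 1) - \<xi> n) / (\<xi> n - \<xi> (n - 1)))"
    using image_fan[OF b(1)] by metis
  have a0: "a \<noteq> 0" "\<alpha> \<noteq> 0" using d x(1) by auto
  define M where "M = lim (\<lambda>n::nat. \<Sum>k = 0..int n. shear h {bpt a, bpt (b - of_int k * a)})"
  define a' b' where "a' = of_real (exp (M / 2)) * \<alpha>" and "b' = of_real (exp (- M / 2)) * \<beta>"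
  have ee: "exp (M / 2) * exp (- M / 2) = 1" "exp (- M / 2) / exp (M / 2) = exp (- M)" "exp (- M / 2) = exp (- M) * exp (M / 2)"
    by (simp_all flip: exp_add exp_diff) 
  have d': "cdet a' b' = 1" unfolding a'_def b'_def cdet_linear x(1) using ee(1) by (simp add: mult.commute)
  have hm: "hmap a' b' z = of_real (exp (- M)) * hmap \<alpha> \<beta> z" for z
    unfolding a'_def b'_def hmap_scale[OF exp_not_eq_zero] ee(2) ..
  have gp: "\<xi> (n + 1) - \<xi> n > 0" "\<xi> n - \<xi> (n - 1) > 0" for n using x(6)[of n] x(6)[of "n - 1"] by simp_all
  define \<eta> where "\<eta> n = exp (- M) * \<xi> n" for n
  have \<eta>d: "\<eta> (n + 1) - \<eta> n = exp (- M) * (\<xi> (n + 1) - \<xi> n)" "\<eta> n - \<eta> (n - 1) = exp (- M) * (\<xi> n - \<xi> (n - 1))" for n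
    by (simp_all add: \<eta>_def algebra_simps)
  have \<eta>p: "\<eta> (n + 1) - \<eta> n > 0" "\<eta> n - \<eta> (n - 1) > 0" for n unfolding \<eta>d using gp by simp_all
  have q: "quad_lift a (b - of_int n * a) \<alpha> (\<beta> - of_real (\<xi> n) * \<alpha>) (\<xi> n - \<xi> (n - 1)) (\<xi> (n + 1) - \<xi> n)" for n :: int
  proof -
    have "h (bpt (a + (b - of_int n * a))) = bpt (\<beta> - of_real (\<xi> n) * \<alpha> + of_real (\<xi> n - \<xi> (n - 1)) * \<alpha>)"
      using x(3)[of "n - 1"] by (simp add: algebra_simps)
    moreover have "h (bpt (b - of_int n * a - a)) = bpt (\<beta> - of_real (\<xi> n) * \<alpha> - of_real (\<xi> (n + 1) - \<xi> n) * \<alpha>)"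
      using x(3)[of "n + 1"] by (simp add: algebra_simps)
    ultimately show ?thesis unfolding quad_lift_def using gp[of n] x(2) x(3)[of n] x(1) by simp
  qed
  have bn: "ubasis a (b - of_int n * a)" for n :: int using ubasis_trans(5)[OF b(1)] .
  have hmn: "hmap a (b - of_int n * a) z = hmap a b z - of_int n" if "z \<in> ball 0 1" for n :: int and z
    using hmap_shift_diff[OF that a0(1), of b "of_int n"] by simp
  have tree: "stretch_map h z \<in> ball 0 1 \<and> hmap \<alpha> \<beta> (stretch_map h z) = of_real (\<xi> n) + garc (\<xi> n - \<xi> (n - 1)) (\<xi> (n + 1) - \<xi> n) (Re (hmap a b z - of_int n))"
    if z: "z \<in> ball 0 1" "\<bar>Re (hmap a b z - of_int n)\<bar> \<le> 1 / 2" "norm (hmap a b z - of_int n) = 1" for n :: int and z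
  proof -
    have zz: "z \<in> arcset a (b - of_int n * a)" using z hmn by (simp add: arcset_def)
    let ?A = "garc (\<xi> n - \<xi> (n - 1)) (\<xi> (n + 1) - \<xi> n) (Re (hmap a b z - of_int n))"
    have s: "stretch_map h z = hinv \<alpha> (\<beta> - of_real (\<xi> n) * \<alpha>) ?A"
      using stretch_map_arcset[OF bn zz q] hmn[OF z(1)] by simp
    have im: "Im ?A > 0" using arc_Im gp by simp
    have dd: "cdet \<alpha> (\<beta> - of_real (\<xi> n) * \<alpha>) = 1" using x(1) by simp
    have sb: "stretch_map h z \<in> ball 0 1" unfolding s by (rule hinv_ball[OF dd im])
    have "hmap \<alpha> (\<beta> - of_real (\<xi> n) * \<alpha>) (stretch_map h z) = ?A" unfolding s by (rule hmap_hinv[OF dd less_imp_le[OF im]])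
    hence "hmap \<alpha> \<beta> (stretch_map h z) - of_real (\<xi> n) = ?A" using hmap_shift_diff[OF sb a0(2)] by simp
    hence "hmap \<alpha> \<beta> (stretch_map h z) = of_real (\<xi> n) + ?A" by (simp add: algebra_simps)
    thus ?thesis using sb by blast
  qed
  have c1: "chart (bpt a) (w 0) (w (- 1)) = hmap a b" using chart_eq[OF d] by (simp add: b(2) add.commute)
  have c2: "chart (h (bpt a)) (h (w 0)) (h (w (- 1))) = hmap \<alpha> \<beta>"
    using chart_eq[OF x(1)] x(2) x(3)[of 0] x(3)[of "-1"] x(4,5) by (simp add: b(2) add.commute)
  \<comment> \<open>Inside the cell the definition is evaluated with the nearest integer k, as
    \<open>scallop\<close> does.\<close>
  have cell: "f z \<in> ball 0 1 \<and> hmap a' b' (f z) = of_real (\<eta> k) + kap (\<eta> k - \<eta> (k - 1)) (\<eta> (k + 1) - \<eta> k) (hmap a b z - of_int k)"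
    if z: "z \<in> reg a" and k: "k = round (Re (hmap a b z))" for z k
  proof -
    have zb: "z \<in> ball 0 1" using z by (auto simp: reg_def)
    define m where "m = hmap a b z"
    define u where "u = sqrt (1 - (Re m - of_int k)\<^sup>2)"
    have us: "scallop (Re m) = u" using scallop_int[OF k] by (simp add: u_def m_def)
    have xk: "\<bar>Re m - of_int k\<bar> \<le> 1 / 2" using of_int_round_abs_le[of "Re m"] by (simp add: k m_def abs_minus_commute)
    define p where "p = Complex (Re m) u"
    have pk: "p - of_int k = Complex (Re m - of_int k) (sqrt (1 - (Re m - of_int k)\<^sup>2))" by (simp add: p_def u_def complex_eq_iff)
    have ip: "Im p > 0" "norm (p - of_int k) = 1" using unit_circle_point[OF xk] unfolding pk by (simp_all add: p_def u_def)
    have m1: "hmap a b (hinv a b p) = p" "hinv a b p \<in> ball 0 1" using hmap_hinv[OF d] hinv_ball[OF d] ip by simp_all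
    define A where "A = garc (\<xi> k - \<xi> (k - 1)) (\<xi> (k + 1) - \<xi> k) (Re m - of_int k)"
    have st: "hmap \<alpha> \<beta> (stretch_map h (hinv a b p)) = of_real (\<xi> k) + A"
      using tree[OF m1(2), of k] m1(1) ip xk by (simp add: A_def p_def)
    define \<Psi> where "\<Psi> = of_real (exp (- M)) * (of_real (\<xi> k) + A) + \<i> * of_real (Im m - u)"
    have "f z = cell_map h (bpt a) w z" using farey_extension_reg[OF assms z] by (simp add: w_def)
    also have "\<dots> = inv_into (ball 0 1) (hmap \<alpha> \<beta>) (of_real (exp M) * \<Psi>)"
    proof -
      have M': "M = lim (\<lambda>n::nat. \<Sum>k = 0..int n. shear h {bpt a, w k})" by (simp add: M_def b(2))
      have "Complex (Re (of_real (exp (- M)) * (of_real (\<xi> k) + A))) (Im (of_real (exp (- M)) * (of_real (\<xi> k) + A)) - u + Im m) = \<Psi>"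
        by (simp add: \<Psi>_def complex_eq_iff)
      thus ?thesis unfolding cell_map_def Let_def c1 c2 M'[symmetric] m_def[symmetric] us p_def[symmetric] inv_into_hmap[OF d ip(1)] st by simp
    qed
    finally have fz: "f z = inv_into (ball 0 1) (hmap \<alpha> \<beta>) (of_real (exp M) * \<Psi>)" .
    have "norm (m - of_int k) > 1" using reg_chart[OF b(1) zb] z by (simp add: m_def)
    hence "1 < (norm (m - of_int k))\<^sup>2" by (intro one_less_power) simp_all
    hence "(Re m - of_int k)\<^sup>2 + (Im m)\<^sup>2 > 1" using cmod_power2[of "m - of_int k"] by simp
    moreover have imm: "Im m > 0" using horo_hmap(2)[OF zb d] by (simp add: m_def)
    ultimately have "Im m \<ge> u" unfolding u_def by (intro real_le_lsqrt) auto
    moreover have "Im A > 0" unfolding A_def using arc_Im gp by simp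
    ultimately have "Im \<Psi> > 0" by (simp add: \<Psi>_def add_pos_nonneg)
    hence im: "Im (of_real (exp M) * \<Psi>) > 0" by simp
    have fz': "f z = hinv \<alpha> \<beta> (of_real (exp M) * \<Psi>)" unfolding fz by (rule inv_into_hmap[OF x(1) im])
    have fb: "f z \<in> ball 0 1" unfolding fz' by (rule hinv_ball[OF x(1) im])
    have "hmap \<alpha> \<beta> (f z) = of_real (exp M) * \<Psi>" unfolding fz' by (rule hmap_hinv[OF x(1) less_imp_le[OF im]])
    hence "hmap a' b' (f z) = of_real (exp (- M)) * (of_real (exp M) * \<Psi>)" unfolding hm by simp
    also have "\<dots> = \<Psi>" by (simp add: exp_minus field_simps)
    also have "\<dots> = of_real (\<eta> k) + kap (\<eta> k - \<eta> (k - 1)) (\<eta> (k + 1) - \<eta> k) (m - of_int k)"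
      unfolding \<eta>d by (subst kap_scale) (simp_all add: \<Psi>_def \<eta>_def A_def u_def algebra_simps)
    finally show ?thesis using fb by (simp add: m_def)
  qed
  \<comment> \<open>n may be either neighbour of a half-integer abscissa and need not be the rounded
    value; \<open>kap_glue\<close> shows that the choice does not matter. On the arc itself the tree
    formula applies.\<close>
  have main: "f z \<in> ball 0 1 \<and> hmap a' b' (f z) = of_real (\<eta> n) + kap (\<eta> n - \<eta> (n - 1)) (\<eta> (n + 1) - \<eta> n) (hmap a b z - of_int n)"
    if z: "z \<in> ball 0 1" "\<bar>Re (hmap a b z - of_int n)\<bar> \<le> 1 / 2" "norm (hmap a b z - of_int n) \<ge> 1" for n :: int and z
  proof (cases "norm (hmap a b z - of_int n) = 1")
    case True
    have zz: "z \<in> arcset a (b - of_int n * a)" using z True hmn by (simp add: arcset_def)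
    hence "z \<in> dual_tree" using bn by (auto simp: dual_tree_eq)
    hence fz: "f z = stretch_map h z" by (rule farey_extension_tree)
    have im: "Im (hmap a b z - of_int n) > 0" using horo_hmap(2)[OF z(1) d] by simp
    have u: "Im (hmap a b z - of_int n) - sqrt (1 - (Re (hmap a b z - of_int n))\<^sup>2) = 0"
      using unit_circle_eq[OF True im] by (metis complex.sel(2) diff_self)
    show ?thesis unfolding \<eta>d using tree[OF z(1,2) True] 
      by (subst kap_scale) (simp_all only: fz hm u, simp_all add: \<eta>_def algebra_simps)
  next
    case False
    have zr: "z \<in> reg a"
      unfolding reg_def using reduced_min[OF bn z(1), of n] z hmn[OF z(1)] False by (force simp: order_less_le)
    define k where "k = round (Re (hmap a b z))"
    note ck = cell[OF zr k_def]
    have xk: "\<bar>Re (hmap a b z) - of_int k\<bar> \<le> 1 / 2" using of_int_round_abs_le[of "Re (hmap a b z)"] by (simp add: k_def abs_minus_commute)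
    have xn: "\<bar>Re (hmap a b z) - of_int n\<bar> \<le> 1 / 2" using z(2) by simp
    have "\<bar>real_of_int n - of_int k\<bar> \<le> 1" using xk xn by linarith
    hence "\<bar>real_of_int (n - k)\<bar> \<le> of_int 1" by simp
    hence "\<bar>n - k\<bar> \<le> 1" by linarith
    hence "n = k \<or> k = n + 1 \<or> n = k + 1" by linarith
    thus ?thesis
    proof (elim disjE)
      assume "n = k" thus ?thesis using ck by simp
    next
      assume kn: "k = n + 1"
      hence "Re (hmap a b z - of_int n) = 1 / 2" using xk xn by (simp add: abs_le_iff)
      from kap_glue[OF \<eta>p(2)[of n] \<eta>p(1)[of n] \<eta>p(1)[of "n + 1"] this] show ?thesis using ck by (simp add: kn algebra_simps)
    next
      assume kn: "n = k + 1"
      hence "Re (hmap a b z - of_int k) = 1 / 2" using xk xn by (simp add: abs_le_iff)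
      from kap_glue[OF \<eta>p(2)[of k] \<eta>p(1)[of k] \<eta>p(1)[of "k + 1"] this] show ?thesis using ck by (simp add: kn algebra_simps)
    qed
  qed
  show ?thesis
  proof (rule that[OF b(1) d', of \<eta>])
    show "h (bpt a) = bpt a'" using x(2) bpt_scale[of "exp (M / 2)" \<alpha>] by (simp add: a'_def)
    fix n :: int
    have "b' - of_real (\<eta> n) * a' = of_real (exp (- M / 2)) * \<beta> - of_real (\<xi> n) * (of_real (exp (- M) * exp (M / 2)) * \<alpha>)"
      by (simp add: a'_def b'_def \<eta>_def algebra_simps)
    also have "\<dots> = of_real (exp (- M / 2)) * (\<beta> - of_real (\<xi> n) * \<alpha>)" unfolding ee(3)[symmetric] by (simp add: algebra_simps)
    finally show "h (bpt (b - of_int n * a)) = bpt (b' - of_real (\<eta> n) * a')" using x(3) bpt_scale[of "exp (- M / 2)"] by simp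
    note g = gap_bound[OF b(1) x(7) x(4,5,6) M_def]
    show "exp (- Kb) \<le> \<eta> (n + 1) - \<eta> n" "\<eta> (n + 1) - \<eta> n \<le> exp Kb" unfolding \<eta>d using g by blast+
    show "shear h {bpt a, bpt (b - of_int n * a)} = ln ((\<eta> (n + 1) - \<eta> n) / (\<eta> n - \<eta> (n - 1)))"
      unfolding \<eta>d x(7) by simp
  qed (use main in blast)
qed

end

section \<open>The map on a standard piece\<close>

text \<open>The half-circle meets the imaginary axis at i sqrt (l r), and the distance from there to
  either centre has the hyperbolic cosine (l + r) / sqrt (3 l r). So this is the midpoint of the
  arc, and points of the edge are sent to points of the image edge.\<close>

lemma arc_mid: assumes "l > 0" "r > 0"
  shows "(arcs1 l r + arcs2 l r) / 2 = artanh ((l - r) / arcR l r)" "garc l r 0 = Complex 0 (sqrt (l * r))"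
proof -
  note R = arcR_pos[OF assms] and e = arc_ends[OF assms]
  define g where "g = sqrt (l * r)"
  have g: "g > 0" "g\<^sup>2 = l * r" using assms by (simp_all add: g_def)
  define \<sigma> where "\<sigma> = artanh ((l - r) / arcR l r)"
  have "(Re (Complex 0 g) - (r - l))\<^sup>2 + (Im (Complex 0 g))\<^sup>2 = (arcR l r)\<^sup>2"
    unfolding R(2) by (simp add: g(2) power2_diff)
  from gpt_exists(1)[OF this _ R(1)] have G: "Complex 0 g = gpt (r - l) (arcR l r) \<sigma>" using g by (simp add: \<sigma>_def)
  have s3: "(sqrt 3 / 2 * x)\<^sup>2 = 3 / 4 * x\<^sup>2" for x by (simp add: power_mult_distrib power_divide)
  have side: "1 + (norm (Complex y (sqrt 3 / 2 * x) - Complex 0 g))\<^sup>2 / (2 * Im (Complex y (sqrt 3 / 2 * x)) * Im (Complex 0 g)) = (x\<^sup>2 + g\<^sup>2) / (sqrt 3 * x * g)"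
    if "x > 0" "y\<^sup>2 = x\<^sup>2 / 4" for x y
  proof -
    have "(norm (Complex y (sqrt 3 / 2 * x) - Complex 0 g))\<^sup>2 = x\<^sup>2 / 4 + 3 / 4 * x\<^sup>2 - 2 * (sqrt 3 / 2 * x) * g + g\<^sup>2"
      unfolding cmod_power2 using that(2) s3[of x] by (simp add: power2_diff)
    also have "\<dots> = x\<^sup>2 + g\<^sup>2 - sqrt 3 * x * g" by simp
    finally have n: "(norm (Complex y (sqrt 3 / 2 * x) - Complex 0 g))\<^sup>2 = x\<^sup>2 + g\<^sup>2 - sqrt 3 * x * g" .
    have i: "2 * Im (Complex y (sqrt 3 / 2 * x)) * Im (Complex 0 g) = sqrt 3 * x * g" by simp
    have "sqrt 3 * x * g \<noteq> 0" using that(1) g by simp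
    thus ?thesis unfolding n i by (simp add: diff_divide_distrib)
  qed
  have "cosh (arcs1 l r - \<sigma>) = (l\<^sup>2 + g\<^sup>2) / (sqrt 3 * l * g)"
    using gpt_dist[OF R(1), of "r - l" "arcs1 l r" \<sigma>] side[of l "- l / 2"] assms
    unfolding G[symmetric] e(1)[symmetric] by (simp add: power_divide)
  moreover have "cosh (arcs2 l r - \<sigma>) = (r\<^sup>2 + g\<^sup>2) / (sqrt 3 * r * g)"
    using gpt_dist[OF R(1), of "r - l" "arcs2 l r" \<sigma>] side[of r "r / 2"] assms
    unfolding G[symmetric] e(2)[symmetric] by (simp add: power_divide)
  moreover have "(l\<^sup>2 + g\<^sup>2) / (sqrt 3 * l * g) = (r\<^sup>2 + g\<^sup>2) / (sqrt 3 * r * g)"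
  proof -
    have "l\<^sup>2 + g\<^sup>2 = l * (l + r)" "r\<^sup>2 + g\<^sup>2 = r * (l + r)" unfolding g(2) by (simp_all add: power2_eq_square algebra_simps)
    thus ?thesis using assms g by simp
  qed
  ultimately have "\<bar>arcs1 l r - \<sigma>\<bar> = \<bar>arcs2 l r - \<sigma>\<bar>" by (metis cosh_real_eq_iff)
  hence "arcs1 l r - \<sigma> = arcs2 l r - \<sigma> \<or> arcs1 l r - \<sigma> = - (arcs2 l r - \<sigma>)" by (simp only: abs_eq_iff)
  thus mid: "(arcs1 l r + arcs2 l r) / 2 = artanh ((l - r) / arcR l r)"
    using e(5) unfolding \<sigma>_def by auto
  show "garc l r 0 = Complex 0 (sqrt (l * r))" unfolding garc_def mid \<sigma>_def[symmetric] g_def[symmetric] G by simp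
qed

lemma arcA_pos: assumes "l > 0" "r > 0" shows "arcA l r > 0"
  using arc_ends(5)[OF assms] artanh_half_pos by (simp add: arcA_def)

lemma artanh_less: assumes "\<bar>x\<bar> < 1" "\<bar>y\<bar> < 1" "x < y" shows "artanh x < artanh (y :: real)"
  using assms tanh_artanh[OF assms(1)] tanh_artanh[OF assms(2)] tanh_real_less_iff by metis

lemma garc_Re_mono: assumes "l > 0" "r > 0" "\<bar>x\<bar> < 1" "\<bar>y\<bar> < 1" "x < y" shows "Re (garc l r x) < Re (garc l r y)"
  using artanh_less[OF assms(3-5)] arcA_pos[OF assms(1,2)] arcR_pos(1)[OF assms(1,2)] by (simp add: garc_def gpt_def)

lemma garc_Re_inj: assumes "l > 0" "r > 0" "\<bar>x\<bar> < 1" "\<bar>y\<bar> < 1" "Re (garc l r x) = Re (garc l r y)" shows "x = y"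
  using garc_Re_mono[OF assms(1-4)] garc_Re_mono[OF assms(1,2,4,3)] assms(5) by (metis less_irrefl linorder_neqE_linordered_idom)

lemma garc_circle: assumes "l > 0" "r > 0"
  shows "(Re (garc l r x) - (r - l))\<^sup>2 + (Im (garc l r x))\<^sup>2 = (arcR l r)\<^sup>2"
proof -
  obtain s where s: "garc l r x = gpt (r - l) (arcR l r) s" by (simp add: garc_def)
  have "(arcR l r * tanh s)\<^sup>2 + (arcR l r / cosh s)\<^sup>2 = (arcR l r)\<^sup>2 * ((tanh s)\<^sup>2 + (1 / cosh s)\<^sup>2)"
    by (simp add: power_mult_distrib power_divide algebra_simps)
  thus ?thesis unfolding s tanh_cosh_square by (simp add: gpt_def)
qed

lemma garc_Re_bounds: assumes "l > 0" "r > 0" "\<bar>x\<bar> \<le> 1 / 2"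
  shows "- l / 2 \<le> Re (garc l r x)" "Re (garc l r x) \<le> r / 2"
    "x \<ge> 0 \<Longrightarrow> Re (garc l r x) \<ge> 0" "x \<le> 0 \<Longrightarrow> Re (garc l r x) \<le> 0"
proof -
  have m: "Re (garc l r x) \<le> Re (garc l r y)" if "\<bar>x\<bar> \<le> 1 / 2" "\<bar>y\<bar> \<le> 1 / 2" "x \<le> y" for x y
    using garc_Re_mono[OF assms(1,2), of x y] that by (cases "x = y") auto
  show "- l / 2 \<le> Re (garc l r x)" using m[of "- 1 / 2" x] assms arc_half(1)[OF assms(1,2)] by auto
  show "Re (garc l r x) \<le> r / 2" using m[of x "1 / 2"] assms arc_half(2)[OF assms(1,2)] by auto
  show "x \<ge> 0 \<Longrightarrow> Re (garc l r x) \<ge> 0" using m[of 0 x] assms arc_mid(2)[OF assms(1,2)] by auto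
  show "x \<le> 0 \<Longrightarrow> Re (garc l r x) \<le> 0" using m[of x 0] assms arc_mid(2)[OF assms(1,2)] by auto
qed

lemma garc_deriv: fixes l r x :: real assumes "\<bar>x\<bar> < 1"
  defines "s \<equiv> (arcs1 l r + arcs2 l r) / 2 + arcA l r * artanh x"
  shows "((\<lambda>x. Re (garc l r x)) has_real_derivative arcR l r * arcA l r / ((cosh s)\<^sup>2 * (1 - x\<^sup>2))) (at x)"
    "((\<lambda>x. Im (garc l r x)) has_real_derivative - (arcR l r * arcA l r * tanh s / (cosh s * (1 - x\<^sup>2)))) (at x)"
proof -
  have x: "x\<^sup>2 < 1" using assms by (simp add: abs_square_less_1)
  have ds: "((\<lambda>x. (arcs1 l r + arcs2 l r) / 2 + arcA l r * artanh x) has_real_derivative arcA l r / (1 - x\<^sup>2)) (at x)"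
    using assms(1) by (auto intro!: derivative_eq_intros)
  have t2: "1 - (tanh s)\<^sup>2 = 1 / (cosh s)\<^sup>2" using tanh_cosh_square[of s] by (simp add: power_divide)
  have "((\<lambda>x. tanh x) has_real_derivative 1 - (tanh s)\<^sup>2) (at s)" by (auto intro!: derivative_eq_intros)
  hence dt: "(tanh has_real_derivative 1 / (cosh s)\<^sup>2) (at s)" unfolding t2 .
  have dc: "((\<lambda>s. 1 / cosh s) has_real_derivative - (tanh s / cosh s)) (at s)"
    by (auto intro!: derivative_eq_intros simp: tanh_def)
  have "((\<lambda>x. (r - l) + arcR l r * tanh ((arcs1 l r + arcs2 l r) / 2 + arcA l r * artanh x)) has_real_derivative 
      0 + arcR l r * (1 / (cosh s)\<^sup>2 * (arcA l r / (1 - x\<^sup>2)))) (at x)"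
    by (intro DERIV_add DERIV_const DERIV_cmult DERIV_chain2[OF _ ds]) (use dt in \<open>simp add: s_def\<close>)
  thus "((\<lambda>x. Re (garc l r x)) has_real_derivative arcR l r * arcA l r / ((cosh s)\<^sup>2 * (1 - x\<^sup>2))) (at x)"
    by (simp add: garc_def gpt_def)
  have "((\<lambda>x. arcR l r * (1 / cosh ((arcs1 l r + arcs2 l r) / 2 + arcA l r * artanh x))) has_real_derivative 
      arcR l r * (- (tanh s / cosh s) * (arcA l r / (1 - x\<^sup>2)))) (at x)"
    by (intro DERIV_cmult DERIV_chain2[OF _ ds]) (use dc in \<open>simp add: s_def\<close>)
  thus "((\<lambda>x. Im (garc l r x)) has_real_derivative - (arcR l r * arcA l r * tanh s / (cosh s * (1 - x\<^sup>2)))) (at x)"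
    by (simp add: garc_def gpt_def mult_ac)
qed

text \<open>All bounds depend on E alone, with E later set to exp \<open>Kb\<close>. This uniformity
  gives a single dilatation bound for all pieces.\<close>

lemma garc_bounds:
  fixes E :: real assumes "E \<ge> 1"
  obtains c C where "0 < c" "c \<le> 1" "1 \<le> C" 
    "\<And>l r x. 1 / E \<le> l \<Longrightarrow> l \<le> E \<Longrightarrow> 1 / E \<le> r \<Longrightarrow> r \<le> E \<Longrightarrow> \<bar>x\<bar> \<le> 1 / 2 \<Longrightarrow>
      c \<le> Im (garc l r x) \<and> Im (garc l r x) \<le> C \<and>
      (\<exists>X Y. ((\<lambda>x. Re (garc l r x)) has_real_derivative X) (at x) \<and> ((\<lambda>x. Im (garc l r x)) has_real_derivative Y) (at x) \<and>
         c \<le> X \<and> X \<le> C \<and> \<bar>Y\<bar> \<le> C)"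
proof -
  define A0 where "A0 = artanh (1 / 2 :: real)"
  have A0: "A0 > 0" using artanh_half_pos by (simp add: A0_def)
  \<comment> \<open>Lower bound for 1 / cosh s on the arc: the height R / cosh s is at least 1 / (2
    E) at both ends, hence in between, and R is at most 2 E.\<close>
  define \<delta> where "\<delta> = 1 / (4 * E\<^sup>2)"
  \<comment> \<open>Bounds for the stretching factor \<open>arcA\<close>, from bounds for the arc
    length L.\<close>
  define Am AM where "Am = 1 / (2 * E\<^sup>2) / (2 * A0)" and "AM = E\<^sup>2 / \<delta>\<^sup>2 / (2 * A0)"
  define c where "c = min 1 (min (1 / (2 * E)) (1 / E * Am * \<delta>\<^sup>2))"
  define C where "C = max 1 (max (2 * E) (2 * E * AM * (4 / 3)))"
  have d0: "\<delta> > 0" "Am > 0" "AM > 0" using assms A0 by (simp_all add: \<delta>_def Am_def AM_def)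
  have "0 < c" "c \<le> 1" "1 \<le> C" using assms d0 by (auto simp: c_def C_def)
  moreover have "c \<le> Im (garc l r x) \<and> Im (garc l r x) \<le> C \<and>
      (\<exists>X Y. ((\<lambda>x. Re (garc l r x)) has_real_derivative X) (at x) \<and> ((\<lambda>x. Im (garc l r x)) has_real_derivative Y) (at x) \<and>
         c \<le> X \<and> X \<le> C \<and> \<bar>Y\<bar> \<le> C)"
    if lr: "1 / E \<le> l" "l \<le> E" "1 / E \<le> r" "r \<le> E" and x: "\<bar>x\<bar> \<le> 1 / 2" for l r x
  proof -
    have E0: "1 / E > 0" using assms by simp
    have p: "l > 0" "r > 0" using lr E0 by linarith+
    define R where "R = arcR l r"
    note R = arcR_pos[OF p, folded R_def] and e = arc_ends[OF p, folded R_def]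
    have R_lo: "1 / E \<le> R"
    proof -
      have "R\<^sup>2 = ((l + r) / 2)\<^sup>2 + 3 * ((l - r) / 2)\<^sup>2" unfolding R(2) by (simp add: power2_eq_square field_simps)
      hence "((l + r) / 2)\<^sup>2 \<le> R\<^sup>2" by simp
      hence "(l + r) / 2 \<le> R" using R(1) by (meson power2_le_imp_le less_imp_le)
      moreover have "(1 / E + 1 / E) / 2 \<le> (l + r) / 2" using lr by (intro divide_right_mono add_mono) auto
      ultimately show ?thesis by simp
    qed
    have R_hi: "R \<le> 2 * E"
    proof (rule power2_le_imp_le)
      have "R\<^sup>2 \<le> l\<^sup>2 + r\<^sup>2" unfolding R(2) using p by simp
      also have "\<dots> \<le> E\<^sup>2 + E\<^sup>2" using lr p by (intro add_mono power_mono) auto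
      also have "\<dots> \<le> (2 * E)\<^sup>2" by (simp add: power_mult_distrib)
      finally show "R\<^sup>2 \<le> (2 * E)\<^sup>2" .
    qed (use assms in simp)
    have half: "sqrt 3 / 2 \<ge> 1 / (2 :: real)" by simp
    have ends: "R / cosh (arcs1 l r) \<ge> 1 / (2 * E)" "R / cosh (arcs2 l r) \<ge> 1 / (2 * E)"
    proof -
      have q: "R / cosh (arcs1 l r) = sqrt 3 / 2 * l" "R / cosh (arcs2 l r) = sqrt 3 / 2 * r" 
        using arg_cong[OF e(1), of Im] arg_cong[OF e(2), of Im] by (simp_all add: gpt_def R_def)
      have i: "sqrt 3 / 2 * l \<ge> 1 / 2 * (1 / E)" "sqrt 3 / 2 * r \<ge> 1 / 2 * (1 / E)"
        using half lr E0 by (intro mult_mono; simp)+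
      have e: "1 / (2 * E) = 1 / 2 * (1 / E)" by simp
      show "R / cosh (arcs1 l r) \<ge> 1 / (2 * E)" "R / cosh (arcs2 l r) \<ge> 1 / (2 * E)" unfolding q e by (rule i)+
    qed
    have lo: "R / cosh s \<ge> 1 / (2 * E)" if "arcs1 l r \<le> s" "s \<le> arcs2 l r" for s
    proof -
      have "\<bar>s\<bar> \<le> \<bar>arcs1 l r\<bar> \<or> \<bar>s\<bar> \<le> \<bar>arcs2 l r\<bar>" using that by linarith
      hence "cosh \<bar>s\<bar> \<le> cosh \<bar>arcs1 l r\<bar> \<or> cosh \<bar>s\<bar> \<le> cosh \<bar>arcs2 l r\<bar>"
        by (subst (1 2) cosh_real_nonneg_le_iff) auto
      hence "cosh s \<le> cosh (arcs1 l r) \<or> cosh s \<le> cosh (arcs2 l r)" by simp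
      hence "R / cosh s \<ge> R / cosh (arcs1 l r) \<or> R / cosh s \<ge> R / cosh (arcs2 l r)"
        using R(1) by (auto intro: divide_left_mono)
      thus ?thesis using ends by linarith
    qed
    have sech: "\<delta> \<le> 1 / cosh s" "1 / cosh s \<le> 1" if "arcs1 l r \<le> s" "s \<le> arcs2 l r" for s
    proof -
      have "1 / (2 * E) \<le> R * (1 / cosh s)" using lo[OF that] by simp
      also have "\<dots> \<le> 2 * E * (1 / cosh s)" using R_hi by (intro mult_right_mono) auto
      finally have "1 / (2 * E) \<le> 2 * E * (1 / cosh s)" .
      thus "\<delta> \<le> 1 / cosh s" using assms by (simp add: \<delta>_def field_simps power2_eq_square)
      show "1 / cosh s \<le> 1" using cosh_real_ge_1[of s] by simp
    qed
    define L where "L = arcs2 l r - arcs1 l r"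
    have L0: "L > 0" using e(5) by (simp add: L_def)
    \<comment> \<open>The mean value theorem for tanh relates L to (l + r) / (2 R), since the
      abscissas of both ends are known.\<close>
    have "\<exists>\<zeta>>arcs1 l r. \<zeta> < arcs2 l r \<and> tanh (arcs2 l r) - tanh (arcs1 l r) = (arcs2 l r - arcs1 l r) * (1 - (tanh \<zeta>)\<^sup>2)"
      using e(5) by (intro MVT2) (auto intro!: derivative_eq_intros)
    then obtain \<zeta> where \<zeta>: "arcs1 l r < \<zeta>" "\<zeta> < arcs2 l r" "tanh (arcs2 l r) - tanh (arcs1 l r) = L * (1 - (tanh \<zeta>)\<^sup>2)"
      by (auto simp: L_def)
    have "1 - (tanh \<zeta>)\<^sup>2 = (1 / cosh \<zeta>)\<^sup>2" using tanh_cosh_square[of \<zeta>] by simp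
    moreover have "tanh (arcs2 l r) - tanh (arcs1 l r) = (l + r) / (2 * R)"
      unfolding e(3,4) using R(1) by (simp add: field_simps)
    ultimately have MV: "(l + r) / (2 * R) = L * (1 / cosh \<zeta>)\<^sup>2" using \<zeta>(3) by simp
    have z1: "\<delta>\<^sup>2 \<le> (1 / cosh \<zeta>)\<^sup>2" "(1 / cosh \<zeta>)\<^sup>2 \<le> 1\<^sup>2"
      using sech[of \<zeta>] \<zeta>(1,2) d0 by (intro power_mono; simp)+
    have "1 / (2 * E\<^sup>2) \<le> (l + r) / (2 * R)"
    proof -
      have "1 / (2 * E\<^sup>2) = (1 / E + 1 / E) / (2 * (2 * E))" using assms by (simp add: field_simps power2_eq_square)
      also have "\<dots> \<le> (l + r) / (2 * R)" using lr R_hi R(1) p by (intro frac_le add_mono) auto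
      finally show ?thesis .
    qed
    also have "\<dots> \<le> L * 1" unfolding MV using z1(2) L0 by (intro mult_left_mono) auto
    finally have L_lo: "1 / (2 * E\<^sup>2) \<le> L" by simp
    have "L * \<delta>\<^sup>2 \<le> (l + r) / (2 * R)" unfolding MV using z1(1) L0 by (intro mult_left_mono) auto
    also have "\<dots> \<le> (E + E) / (2 * (1 / E))" using lr R_lo p assms by (intro frac_le add_mono) auto
    also have "\<dots> = E\<^sup>2" by (simp add: power2_eq_square)
    finally have L_hi: "L \<le> E\<^sup>2 / \<delta>\<^sup>2" using d0 by (simp add: le_divide_eq)
    have A: "arcA l r = L / (2 * A0)" by (simp add: arcA_def L_def A0_def)
    have A_lo: "Am \<le> arcA l r" and A_hi: "arcA l r \<le> AM"
      unfolding A Am_def AM_def using L_lo L_hi A0 by (intro divide_right_mono; simp)+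
    obtain t where t: "t \<in> {0..1}" "x = tau t" using tau_surj[OF x] by blast
    define s where "s = (arcs1 l r + arcs2 l r) / 2 + arcA l r * artanh x"
    have "garc l r x = gpt (r - l) R s" by (simp add: garc_def s_def R_def)
    moreover have "garc l r x = gpt (r - l) R ((1 - t) * arcs1 l r + t * arcs2 l r)" using arc_tau t(2) by (simp add: R_def)
    ultimately have "s = (1 - t) * arcs1 l r + t * arcs2 l r" using gpt_eq_iff[OF R(1)] by metis
    hence "s = arcs1 l r + t * L" "s = arcs2 l r - (1 - t) * L" by (simp_all add: L_def algebra_simps)
    moreover have "t * L \<ge> 0" "(1 - t) * L \<ge> 0" using t(1) L0 by simp_all
    ultimately have ss: "arcs1 l r \<le> s" "s \<le> arcs2 l r" by linarith+
    have im: "Im (garc l r x) = R / cosh s" by (simp add: garc_def gpt_def s_def R_def)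
    have "c \<le> 1 / (2 * E)" "2 * E \<le> C" by (auto simp: c_def C_def)
    moreover have "R / cosh s \<le> R" using cosh_real_ge_1[of s] R(1) by (simp add: divide_le_eq)
    ultimately have 1: "c \<le> Im (garc l r x)" "Im (garc l r x) \<le> C" unfolding im using lo[OF ss] R_hi by linarith+
    have "\<bar>x\<bar>\<^sup>2 \<le> (1 / 2)\<^sup>2" using x by (intro power_mono) auto
    hence x2: "x\<^sup>2 \<le> 1 / 4" by (simp add: power_divide)
    have x3: "1 \<le> 1 / (1 - x\<^sup>2)" "1 / (1 - x\<^sup>2) \<le> 4 / 3" using x2 by (simp_all add: divide_simps)
    define X where "X = R * arcA l r / ((cosh s)\<^sup>2 * (1 - x\<^sup>2))"
    define Y where "Y = - (R * arcA l r * tanh s / (cosh s * (1 - x\<^sup>2)))"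
    have X: "X = R * arcA l r * (1 / cosh s)\<^sup>2 * (1 / (1 - x\<^sup>2))" by (simp add: X_def power_divide)
    have s2: "\<delta>\<^sup>2 \<le> (1 / cosh s)\<^sup>2" "(1 / cosh s)\<^sup>2 \<le> 1" using sech[OF ss] d0 power_mono[of "1 / cosh s" 1 2] by (auto intro: power_mono)
    have "c \<le> 1 / E * Am * \<delta>\<^sup>2" by (simp add: c_def)
    also have "\<dots> = 1 / E * Am * \<delta>\<^sup>2 * 1" by simp
    also have "\<dots> \<le> X" unfolding X using R_lo A_lo s2 x3 d0 E0 R(1) by (intro mult_mono) auto
    finally have 2: "c \<le> X" .
    have "X \<le> 2 * E * AM * 1 * (4 / 3)" unfolding X using R_hi A_hi s2 x2 x3 R(1) arcA_pos[OF p] assms d0 by (intro mult_mono) auto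
    also have "\<dots> \<le> C" by (simp add: C_def)
    finally have 3: "X \<le> C" .
    have "\<bar>Y\<bar> = R * arcA l r * (\<bar>tanh s\<bar> * (1 / cosh s)) * (1 / (1 - x\<^sup>2))"
      unfolding Y_def using R(1) arcA_pos[OF p] x2 by (simp add: abs_mult abs_divide)
    also have "\<dots> \<le> 2 * E * AM * (1 * 1) * (4 / 3)"
    proof -
      have "\<bar>tanh s\<bar> \<le> 1" using tanh_real_bounds[of s] by auto
      thus ?thesis using R_hi A_hi sech(2)[OF ss] x2 x3 R(1) arcA_pos[OF p] assms d0 by (intro mult_mono) auto
    qed
    also have "\<dots> \<le> C" by (simp add: C_def)
    finally have 4: "\<bar>Y\<bar> \<le> C" .
    have "\<bar>x\<bar> < 1" using x by simp
    from garc_deriv[OF this, of l r] have "((\<lambda>x. Re (garc l r x)) has_real_derivative X) (at x)" "((\<lambda>x. Im (garc l r x)) has_real_derivative Y) (at x)"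
      by (simp_all add: X_def Y_def s_def R_def)
    thus ?thesis using 1 2 3 4 by blast
  qed
  ultimately show ?thesis using that by blast
qed

lemma kap_sel: "Re (kap l r m) = Re (garc l r (Re m))" "Im (kap l r m) = Im (garc l r (Re m)) + (Im m - sqrt (1 - (Re m)\<^sup>2))"
  by (simp_all add: kap_def)

lemma above_unit_circle: assumes "norm m \<ge> 1" "Im m > 0" "\<bar>Re m\<bar> \<le> 1 / 2"
  shows "Im m \<ge> sqrt (1 - (Re m)\<^sup>2)" "Im m = sqrt (1 - (Re m)\<^sup>2) \<longleftrightarrow> norm m = 1"
proof -
  have "1\<^sup>2 \<le> (norm m)\<^sup>2" using assms(1) by (intro power_mono) auto
  hence "1 - (Re m)\<^sup>2 \<le> (Im m)\<^sup>2" using cmod_power2[of m] by simp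
  thus "Im m \<ge> sqrt (1 - (Re m)\<^sup>2)" using assms by (intro real_le_lsqrt) auto
  have u: "1 - (Re m)\<^sup>2 > 0" using assms(3) by (simp add: abs_square_less_1)
  show "Im m = sqrt (1 - (Re m)\<^sup>2) \<longleftrightarrow> norm m = 1"
  proof
    assume "Im m = sqrt (1 - (Re m)\<^sup>2)"
    hence "(Im m)\<^sup>2 = 1 - (Re m)\<^sup>2" using u by simp
    hence "(norm m)\<^sup>2 = 1" by (simp add: cmod_power2)
    thus "norm m = 1" by (simp add: power2_eq_1_iff) (metis norm_ge_zero neg_0_le_iff_le not_one_le_zero)
  next
    assume "norm m = 1"
    thus "Im m = sqrt (1 - (Re m)\<^sup>2)" using unit_circle_eq[OF _ assms(2)] by (metis complex.sel(2))
  qed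
qed

text \<open>The closed fundamental domain of the modular group; under \<open>hmap a b\<close> it is
  the part of the closed cell of \<open>bpt a\<close> next to the edge (a, b).\<close>

definition stdpiece :: "complex set" where
  "stdpiece = {m. Im m > 0 \<and> \<bar>Re m\<bar> \<le> 1 / 2 \<and> norm m \<ge> 1}"

text \<open>The quadratic expression is the power of the image point with respect to the circle
  carrying the image arc. It equals the increase of the squared height over the arc, so its sign
  tells on which side of the arc the point lies.\<close>

lemma kap_region: assumes "l > 0" "r > 0" "m \<in> stdpiece"
  shows "Im (kap l r m) > 0" "- l / 2 \<le> Re (kap l r m)" "Re (kap l r m) \<le> r / 2"
    "(norm (kap l r m))\<^sup>2 - 2 * (r - l) * Re (kap l r m) - l * r \<ge> 0"
    "(norm (kap l r m))\<^sup>2 - 2 * (r - l) * Re (kap l r m) - l * r = 0 \<longleftrightarrow> norm m = 1"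
proof -
  have m: "Im m > 0" "\<bar>Re m\<bar> \<le> 1 / 2" "norm m \<ge> 1" using assms(3) by (auto simp: stdpiece_def)
  note u = above_unit_circle[OF m(3,1,2)]
  have g: "Im (garc l r (Re m)) > 0" using arc_Im assms by simp
  show i: "Im (kap l r m) > 0" using g u(1) by (simp add: kap_sel)
  show "- l / 2 \<le> Re (kap l r m)" "Re (kap l r m) \<le> r / 2" using garc_Re_bounds(1,2)[OF assms(1,2) m(2)] by (simp_all add: kap_sel)
  define \<Delta> where "\<Delta> = Im m - sqrt (1 - (Re m)\<^sup>2)"
  define Y where "Y = Im (garc l r (Re m))"
  have "(norm (kap l r m))\<^sup>2 - 2 * (r - l) * Re (kap l r m) - l * r = (Re (garc l r (Re m)) - (r - l))\<^sup>2 + (Y + \<Delta>)\<^sup>2 - (arcR l r)\<^sup>2"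
    unfolding arcR_pos(2)[OF assms(1,2)] cmod_power2 kap_sel \<Delta>_def Y_def by (simp add: power2_eq_square algebra_simps)
  also have "\<dots> = (Y + \<Delta>)\<^sup>2 - Y\<^sup>2" using garc_circle[OF assms(1,2), of "Re m"] by (simp add: Y_def)
  also have "\<dots> = \<Delta> * (2 * Y + \<Delta>)" by (simp add: power2_eq_square algebra_simps)
  finally have eq: "(norm (kap l r m))\<^sup>2 - 2 * (r - l) * Re (kap l r m) - l * r = \<Delta> * (2 * Y + \<Delta>)" .
  have D: "\<Delta> \<ge> 0" "2 * Y + \<Delta> > 0" using u(1) g by (auto simp: \<Delta>_def Y_def)
  show "(norm (kap l r m))\<^sup>2 - 2 * (r - l) * Re (kap l r m) - l * r \<ge> 0" unfolding eq using D by simp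
  show "(norm (kap l r m))\<^sup>2 - 2 * (r - l) * Re (kap l r m) - l * r = 0 \<longleftrightarrow> norm m = 1"
    unfolding eq using D u(2) by (auto simp: \<Delta>_def)
qed

lemma kap_inj: assumes "l > 0" "r > 0" "\<bar>Re m\<bar> < 1" "\<bar>Re m'\<bar> < 1" "kap l r m = kap l r m'" shows "m = m'"
proof -
  have "Re m = Re m'" using garc_Re_inj[OF assms(1-4)] arg_cong[OF assms(5), of Re] by (simp add: kap_sel)
  thus ?thesis using arg_cong[OF assms(5), of Im] by (simp add: kap_sel complex_eq_iff)
qed

text \<open>The intermediate value theorem finds the abscissa. A height of at least the radius lies
  above the image arc everywhere.\<close>

lemma kap_surj: assumes "l > 0" "r > 0" "- l / 2 \<le> Re w" "Re w \<le> r / 2" "Im w \<ge> arcR l r"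
  obtains m where "m \<in> stdpiece" "kap l r m = w" "Im m \<ge> sqrt (1 - (Re m)\<^sup>2) + (Im w - arcR l r)"
proof -
  have cont: "continuous_on {- 1 / 2..1 / 2} (\<lambda>x. Re (garc l r x))"
    by (rule DERIV_continuous_on, rule has_field_derivative_at_within, rule garc_deriv(1)) auto
  have "\<exists>x\<ge>- 1 / 2. x \<le> 1 / 2 \<and> Re (garc l r x) = Re w"
    by (rule IVT') (use assms cont arc_half[OF assms(1,2)] in auto)
  then obtain x where "- 1 / 2 \<le> x" "x \<le> 1 / 2" "Re (garc l r x) = Re w" by blast
  hence x: "\<bar>x\<bar> \<le> 1 / 2" "Re (garc l r x) = Re w" by auto
  define y where "y = Im w - Im (garc l r x) + sqrt (1 - x\<^sup>2)"
  have x2: "x\<^sup>2 < 1" using x(1) by (simp add: abs_square_less_1)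
  have "(Im (garc l r x))\<^sup>2 \<le> (arcR l r)\<^sup>2" using garc_circle[OF assms(1,2), of x] by (smt (verit) zero_le_power2)
  hence g: "Im (garc l r x) \<le> arcR l r" using arcR_pos(1)[OF assms(1,2)] by (meson power2_le_imp_le less_imp_le)
  hence y: "y \<ge> sqrt (1 - x\<^sup>2) + (Im w - arcR l r)" "y \<ge> sqrt (1 - x\<^sup>2)" "y > 0" using assms(5) x2 by (auto simp: y_def add_nonneg_pos)
  have "(sqrt (1 - x\<^sup>2))\<^sup>2 \<le> y\<^sup>2" using y(2) x2 by (intro power_mono) auto
  hence "1 \<le> (norm (Complex x y))\<^sup>2" unfolding cmod_power2 using x2 by simp
  hence "1 \<le> norm (Complex x y)" by (metis abs_norm_cancel one_power2 abs_le_square_iff abs_one)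
  hence "Complex x y \<in> stdpiece" using x(1) y(3) by (simp add: stdpiece_def)
  moreover have "kap l r (Complex x y) = w" using x(2) by (simp add: kap_def y_def complex_eq_iff)
  ultimately show ?thesis using that y(1) by simp
qed

section \<open>Injectivity\<close>

text \<open>Horocyclic distance of \<open>z\<close> to the ideal vertex \<open>p\<close> of the ideal triangle \<open>(p,q,r)\<close>, normalised
  so that the three horocycles at level \<open>1\<close> are pairwise tangent.\<close>
definition tdist :: "complex \<Rightarrow> complex \<Rightarrow> complex \<Rightarrow> complex \<Rightarrow> real" where
  "tdist p q r z = 2 * norm (q - r) / (norm (p - q) * norm (p - r)) * (norm (z - p))\<^sup>2 / (1 - (norm z)\<^sup>2)"

lemma tdist_commute: "tdist p q r = tdist p r q"
  by (simp add: tdist_def norm_minus_commute mult.commute fun_eq_iff)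

lemma tdist_bpt: assumes "a \<noteq> 0" "b \<noteq> 0" "c \<noteq> 0" "z \<in> ball 0 1"
  shows "tdist (bpt a) (bpt b) (bpt c) z = \<bar>cdet b c\<bar> / (\<bar>cdet a b\<bar> * \<bar>cdet a c\<bar>) * horo a z"
proof -
  have n: "norm (bpt u - bpt v) = 2 * \<bar>cdet u v\<bar> / (norm u * norm v)" if "u \<noteq> 0" "v \<noteq> 0" for u v
    unfolding norm_minus_commute[of "bpt u"] bpt_diff[OF that] by (simp add: norm_divide norm_mult)
  have "z - bpt a = - (a - cnj a * z) / cnj a" using assms(1) by (simp add: bpt_def field_simps)
  hence "norm (z - bpt a) = norm (a - cnj a * z) / norm a" by (simp add: norm_divide norm_minus_commute)
  hence z: "(norm (z - bpt a))\<^sup>2 / (1 - (norm z)\<^sup>2) = horo a z / (norm a)\<^sup>2" by (simp add: horo_def power_divide)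
  have "2 * norm (bpt b - bpt c) / (norm (bpt a - bpt b) * norm (bpt a - bpt c)) = \<bar>cdet b c\<bar> / (\<bar>cdet a b\<bar> * \<bar>cdet a c\<bar>) * (norm a)\<^sup>2"
    unfolding n[OF assms(2,3)] n[OF assms(1,2)] n[OF assms(1,3)] using assms by (simp add: divide_simps power2_eq_square)
  thus ?thesis unfolding tdist_def times_divide_eq_right[symmetric] z using assms(1) by simp
qed

lemma tdist_chart: assumes "cdet a b = 1" "t \<noteq> 0" "z \<in> ball 0 1"
  shows "tdist (bpt a) (bpt b) (bpt (b - of_real t * a)) z = \<bar>t\<bar> / Im (hmap a b z)"
    "tdist (bpt b) (bpt a) (bpt (b - of_real t * a)) z = (norm (hmap a b z))\<^sup>2 / (\<bar>t\<bar> * Im (hmap a b z))"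
    "tdist (bpt (b - of_real t * a)) (bpt a) (bpt b) z = (norm (hmap a b z - of_real t))\<^sup>2 / (\<bar>t\<bar> * Im (hmap a b z))"
proof -
  let ?c = "b - of_real t * a"
  have c: "cdet a ?c = 1" "cdet b ?c = t" "cdet b a = - 1" using assms(1) by (simp_all add: cdet_commute[of b a])
  have c': "cdet ?c a = - 1" "cdet ?c b = - t" 
    using c cdet_commute[of ?c a] cdet_commute[of ?c b] by linarith+
  have nz: "a \<noteq> 0" "b \<noteq> 0" "?c \<noteq> 0" using assms(1) cdet_nz(2)[of a ?c] c(1) by auto
  show "tdist (bpt a) (bpt b) (bpt ?c) z = \<bar>t\<bar> / Im (hmap a b z)"
    unfolding tdist_bpt[OF nz assms(3)] c assms(1) horo_hmap(1)[OF assms(3,1)] by simp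
  show "tdist (bpt b) (bpt a) (bpt ?c) z = (norm (hmap a b z))\<^sup>2 / (\<bar>t\<bar> * Im (hmap a b z))"
    unfolding tdist_bpt[OF nz(2,1,3) assms(3)] c using horo_comb[OF assms(3,1), of 0 1] by simp
  show "tdist (bpt ?c) (bpt a) (bpt b) z = (norm (hmap a b z - of_real t))\<^sup>2 / (\<bar>t\<bar> * Im (hmap a b z))"
    unfolding tdist_bpt[OF nz(3,1,2) assms(3)] c' assms(1) using horo_comb[OF assms(3,1), of "- t" 1] by (simp add: add.commute)
qed

section \<open>Sectors of triangles\<close>

definition farey_flag :: "complex \<Rightarrow> complex \<Rightarrow> complex \<Rightarrow> bool" where
  "farey_flag p q r \<longleftrightarrow> p \<noteq> q \<and> q \<noteq> r \<and> p \<noteq> r \<and> {p, q, r} \<in> farey_triangles"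

lemma farey_flag_perm: assumes "farey_flag p q r"
  shows "farey_flag p r q" "farey_flag q p r" "farey_flag q r p" "farey_flag r p q" "farey_flag r q p"
  using assms by (auto simp: farey_flag_def insert_commute)

text \<open>The sign t is the chart coordinate of r, so that both sides of the edge (p, q) can be
  treated at once.\<close>

lemma farey_flag_lifts: assumes "farey_flag p q r"
  obtains a b and t :: real where "ubasis a b" "p = bpt a" "q = bpt b" "r = bpt (b - of_real t * a)" "t = 1 \<or> t = - 1"
proof -
  have "{p, q} \<in> farey_edges" using assms unfolding farey_edges_def farey_flag_def by blast
  moreover have "p \<in> bpt ` prim" using assms unfolding farey_vertices_eq[symmetric] farey_vertices_def farey_flag_def by blast
  ultimately obtain a b where ab: "ubasis a b" "p = bpt a" "q = bpt b" using edge_at_vertex by (metis imageE)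
  have "r = bpt (b - a) \<or> r = bpt (a + b)" using farey_third[OF ab(1), of r] assms ab by (auto simp: farey_flag_def)
  thus ?thesis using that[OF ab, of 1] that[OF ab, of "-1"] by (auto simp: add.commute)
qed

text \<open>One of six sectors of the triangle, one for each ordering of its vertices. The first
  inequality is a side of the dual edge crossing (p, q), the second a side of the geodesic from the
  centre to p, the third the side of the edge (p, q) on which the triangle lies.\<close>

definition kite :: "complex \<Rightarrow> complex \<Rightarrow> complex \<Rightarrow> complex \<Rightarrow> bool" where
  "kite p q r z \<longleftrightarrow> tdist p q r z \<le> tdist q p r z \<and> tdist q p r z \<le> tdist r p q z \<and> tdist r p q z \<le> tdist p q r z + tdist q p r z"

text \<open>The chart \<open>hmap a b\<close> identifies a kite with the half of \<^const>\<open>stdpiece\<close> on the side of the third vertex;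
  \<open>A\<close>, \<open>B\<close>, \<open>C\<close> are the three horocyclic distances in that chart.\<close>
lemma chart_coords:
  fixes w :: complex and t :: real
  assumes "Im w > 0" "t \<noteq> 0"
  defines "A \<equiv> \<bar>t\<bar> / Im w" and "B \<equiv> (norm w)\<^sup>2 / (\<bar>t\<bar> * Im w)" and "C \<equiv> (norm (w - of_real t))\<^sup>2 / (\<bar>t\<bar> * Im w)"
  shows "A \<le> B \<longleftrightarrow> t\<^sup>2 \<le> (norm w)\<^sup>2" "A = B \<longleftrightarrow> t\<^sup>2 = (norm w)\<^sup>2" "B \<le> C \<longleftrightarrow> 2 * t * Re w \<le> t\<^sup>2" "B = C \<longleftrightarrow> 2 * t * Re w = t\<^sup>2"
    "C \<le> A + B \<longleftrightarrow> t * Re w \<ge> 0" "C = A + B \<longleftrightarrow> t * Re w = 0"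
    "\<bar>t\<bar> * Im w * (C - A) = (norm w)\<^sup>2 - 2 * t * Re w" "\<bar>t\<bar> * Im w * (C - B) = t\<^sup>2 - 2 * t * Re w"
proof -
  define D where "D = \<bar>t\<bar> * Im w"
  have D: "D > 0" using assms by (simp add: D_def)
  have A: "A = t\<^sup>2 / D" using assms(1,2) by (simp add: A_def D_def power2_eq_square divide_simps)
  have B: "B = (norm w)\<^sup>2 / D" by (simp add: B_def D_def)
  have "(norm (w - of_real t))\<^sup>2 = (norm w)\<^sup>2 - 2 * t * Re w + t\<^sup>2" unfolding cmod_power2 by (simp add: power2_eq_square algebra_simps)
  hence C: "C = ((norm w)\<^sup>2 - 2 * t * Re w + t\<^sup>2) / D" by (simp add: C_def D_def)
  show "A \<le> B \<longleftrightarrow> t\<^sup>2 \<le> (norm w)\<^sup>2" "A = B \<longleftrightarrow> t\<^sup>2 = (norm w)\<^sup>2" "B \<le> C \<longleftrightarrow> 2 * t * Re w \<le> t\<^sup>2" "B = C \<longleftrightarrow> 2 * t * Re w = t\<^sup>2"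
    unfolding A B C using D by (auto simp: divide_le_cancel)
  have AB: "A + B = (t\<^sup>2 + (norm w)\<^sup>2) / D" unfolding A B by (simp add: add_divide_distrib)
  show "C \<le> A + B \<longleftrightarrow> t * Re w \<ge> 0" "C = A + B \<longleftrightarrow> t * Re w = 0"
    unfolding AB C using D by (auto simp: divide_le_cancel)
  show "\<bar>t\<bar> * Im w * (C - A) = (norm w)\<^sup>2 - 2 * t * Re w" "\<bar>t\<bar> * Im w * (C - B) = t\<^sup>2 - 2 * t * Re w"
    unfolding D_def[symmetric] A B C using D by (simp_all add: right_diff_distrib)
qed

lemma kite_chart: assumes "ubasis a b" "z \<in> ball 0 1" "t = 1 \<or> t = - 1"
  shows "kite (bpt a) (bpt b) (bpt (b - of_real t * a)) z \<longleftrightarrow> hmap a b z \<in> stdpiece \<and> t * Re (hmap a b z) \<ge> 0"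
proof -
  note d = ubasis_det[OF assms(1)]
  have t: "t \<noteq> 0" "\<bar>t\<bar> = 1" "t\<^sup>2 = 1" using assms(3) by auto
  have im: "Im (hmap a b z) > 0" using horo_hmap(2)[OF assms(2) d] .
  have "kite (bpt a) (bpt b) (bpt (b - of_real t * a)) z \<longleftrightarrow> 1 \<le> (norm (hmap a b z))\<^sup>2 \<and> 2 * t * Re (hmap a b z) \<le> 1 \<and> t * Re (hmap a b z) \<ge> 0"
    unfolding kite_def tdist_chart[OF d t(1) assms(2)] using chart_coords[OF im t(1)] t(3) by simp
  moreover have "1 \<le> (norm (hmap a b z))\<^sup>2 \<longleftrightarrow> norm (hmap a b z) \<ge> 1"
    using abs_le_square_iff[of 1 "norm (hmap a b z)"] by simp
  moreover have "2 * t * Re (hmap a b z) \<le> 1 \<and> t * Re (hmap a b z) \<ge> 0 \<longleftrightarrow> \<bar>Re (hmap a b z)\<bar> \<le> 1 / 2 \<and> t * Re (hmap a b z) \<ge> 0"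
    using assms(3) by auto
  ultimately show ?thesis using im by (auto simp: stdpiece_def)
qed

lemma kite_exists: assumes "z \<in> ball 0 1" obtains p q r where "farey_flag p q r" "kite p q r z"
proof -
  obtain a b where ab: "ubasis a b" "\<bar>Re (hmap a b z)\<bar> \<le> 1 / 2" "norm (hmap a b z) \<ge> 1" using reduced_exists[OF assms] by blast
  have std: "hmap a b z \<in> stdpiece" using ab horo_hmap(2)[OF assms ubasis_det[OF ab(1)]] by (simp add: stdpiece_def)
  define t :: real where "t = (if Re (hmap a b z) \<ge> 0 then 1 else - 1)"
  have t: "t = 1 \<or> t = - 1" "t * Re (hmap a b z) \<ge> 0" by (auto simp: t_def)
  have fl: "farey_flag (bpt a) (bpt b) (bpt (b - of_real t * a))"
  proof -
    have "{bpt a, bpt b, bpt (b - of_real t * a)} \<in> farey_triangles"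
      using t(1) tri_farey[OF ab(1)] tri_farey[OF ubasis_trans(1)[OF ab(1)]] unfolding tri_shift(2) unfolding tri_shift(1) by auto
    moreover have "bpt a \<noteq> bpt b" using tri_distinct(1)[OF ubasis_det[OF ab(1)]] .
    moreover have "cdet a (b - of_real t * a) \<noteq> 0" "cdet b (b - of_real t * a) \<noteq> 0" 
      using ubasis_det[OF ab(1)] t(1) by (auto simp: cdet_commute[of b a])
    hence "bpt a \<noteq> bpt (b - of_real t * a)" "bpt b \<noteq> bpt (b - of_real t * a)" using bpt_eq_iff cdet_nz by metis+
    ultimately show ?thesis by (simp add: farey_flag_def)
  qed
  show ?thesis using that[OF fl] kite_chart[OF ab(1) assms t(1)] std t(2) by blast
qed

text \<open>Expresses \<open>z\<close> in the hyperboloid model as a combination of the three ideal vertices of a triangle.\<close>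
lemma horo_hull:
  assumes "z \<in> ball 0 1" "cdet c1 c2 = 1" "c3 = of_real \<epsilon> * c1 + c2" "\<epsilon>\<^sup>2 = 1"
  defines "C \<equiv> \<lambda>c. horo c z"
  shows "C (a + b) - C a - C b = (C c2 + C c3 - C c1) * (cdet a c1 * cdet b c1) + (C c1 + C c3 - C c2) * (cdet a c2 * cdet b c2)
     + (C c1 + C c2 - C c3) * (cdet a c3 * cdet b c3)"
proof -
  define m where "m = hmap c1 c2 z"
  have im: "Im m > 0" unfolding m_def by (rule horo_hmap(2)[OF assms(1,2)])
  define F where "F = Re m / Im m"
  have q: "C (of_real x * c1 + of_real y * c2) = x\<^sup>2 * C c1 + y\<^sup>2 * C c2 + 2 * x * y * F" for x y
  proof -
    have "C c1 = 1 / Im m" "C c2 = (norm m)\<^sup>2 / Im m"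
      using horo_hmap(1)[OF assms(1,2)] horo_comb[OF assms(1,2), of 0 1] by (simp_all add: C_def m_def)
    moreover have "C (of_real x * c1 + of_real y * c2) = (norm (of_real x + of_real y * m))\<^sup>2 / Im m"
      using horo_comb[OF assms(1,2), of x y] by (simp add: C_def m_def)
    moreover have "(norm (of_real x + of_real y * m))\<^sup>2 = x\<^sup>2 + y\<^sup>2 * (norm m)\<^sup>2 + 2 * x * y * Re m"
      unfolding cmod_power2 by (simp add: power2_eq_square algebra_simps)
    ultimately show ?thesis by (simp add: F_def add_divide_distrib)
  qed
  obtain x1 y1 where a: "a = of_real x1 * c1 + of_real y1 * c2" "x1 = cdet a c2" "y1 = cdet c1 a" using cdet_expand1[OF assms(2), of a] by blast
  obtain x2 y2 where b: "b = of_real x2 * c1 + of_real y2 * c2" "x2 = cdet b c2" "y2 = cdet c1 b" using cdet_expand1[OF assms(2), of b] by blast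
  have c3: "C c3 = C c1 + C c2 + 2 * \<epsilon> * F" using q[of \<epsilon> 1] assms(3,4) by simp
  have "a + b = of_real (x1 + x2) * c1 + of_real (y1 + y2) * c2" by (simp add: a(1) b(1) algebra_simps)
  hence ab: "C (a + b) = (x1 + x2)\<^sup>2 * C c1 + (y1 + y2)\<^sup>2 * C c2 + 2 * (x1 + x2) * (y1 + y2) * F" by (simp only: q)
  have dd: "cdet a c1 = - y1" "cdet b c1 = - y2" "cdet a c2 = x1" "cdet b c2 = x2" "cdet a c3 = x1 - \<epsilon> * y1" "cdet b c3 = x2 - \<epsilon> * y2"
    using a(2,3) b(2,3) cdet_commute[of c1 a] cdet_commute[of c1 b] by (simp_all add: assms(3))
  have Ca: "C a = x1\<^sup>2 * C c1 + y1\<^sup>2 * C c2 + 2 * x1 * y1 * F" and Cb: "C b = x2\<^sup>2 * C c1 + y2\<^sup>2 * C c2 + 2 * x2 * y2 * F"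
    using q a(1) b(1) by simp_all
  have e: "\<epsilon> * (\<epsilon> * x) = x" for x using assms(4) by (simp add: power2_eq_square flip: mult.assoc)
  have "(x1 - \<epsilon> * y1) * (x2 - \<epsilon> * y2) = x1 * x2 + y1 * y2 - \<epsilon> * (x1 * y2 + x2 * y1)"
    using e[of "y1 * y2"] by (simp add: algebra_simps)
  moreover have "C c2 + C c3 - C c1 = 2 * C c2 + 2 * \<epsilon> * F" "C c1 + C c3 - C c2 = 2 * C c1 + 2 * \<epsilon> * F" "C c1 + C c2 - C c3 = - 2 * \<epsilon> * F"
    unfolding c3 by simp_all
  moreover have "- 2 * \<epsilon> * F * (x1 * x2 + y1 * y2 - \<epsilon> * (x1 * y2 + x2 * y1)) = - 2 * \<epsilon> * F * (x1 * x2 + y1 * y2) + 2 * F * (x1 * y2 + x2 * y1)"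
    using e[of "2 * F * (x1 * y2 + x2 * y1)"] by (simp add: algebra_simps)
  ultimately show ?thesis unfolding ab Ca Cb dd by (simp add: power2_eq_square algebra_simps)
qed

text \<open>Polarisation: the mixed term of the quadratic form tells the side of the edge (a,
  b).\<close>

lemma hmap_Re_horo: assumes "z \<in> ball 0 1" "cdet a b = 1"
  shows "horo (a + b) z - horo a z - horo b z = 2 * Re (hmap a b z) / Im (hmap a b z)"
proof -
  have "horo (a + b) z = (norm (1 + hmap a b z))\<^sup>2 / Im (hmap a b z)" "horo b z = (norm (hmap a b z))\<^sup>2 / Im (hmap a b z)"
    using horo_comb[OF assms, of 1 1] horo_comb[OF assms, of 0 1] by simp_all
  moreover have "(norm (1 + hmap a b z))\<^sup>2 = 1 + 2 * Re (hmap a b z) + (norm (hmap a b z))\<^sup>2"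
    unfolding cmod_power2 by (simp add: power2_eq_square algebra_simps)
  ultimately show ?thesis unfolding horo_hmap(1)[OF assms] by (simp add: add_divide_distrib)
qed

lemma side_cases: assumes "cdet a b = 1" "c \<noteq> 0"
  shows "cdet a c * cdet b c > 0 \<longleftrightarrow> ccw (bpt a) (bpt b) (bpt c)" "cdet a c * cdet b c < 0 \<longleftrightarrow> ccw (bpt b) (bpt a) (bpt c)"
    "cdet a c * cdet b c = 0 \<longleftrightarrow> bpt c = bpt a \<or> bpt c = bpt b"
proof -
  have nz: "a \<noteq> 0" "b \<noteq> 0" using assms by auto
  show "cdet a c * cdet b c > 0 \<longleftrightarrow> ccw (bpt a) (bpt b) (bpt c)" unfolding ccw_bpt[OF nz assms(2)] assms(1) by (simp add: mult.commute)
  have "cdet b a = - 1" using assms(1) cdet_commute[of b a] by simp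
  thus "cdet a c * cdet b c < 0 \<longleftrightarrow> ccw (bpt b) (bpt a) (bpt c)" unfolding ccw_bpt[OF nz(2,1) assms(2)] by simp
  show "cdet a c * cdet b c = 0 \<longleftrightarrow> bpt c = bpt a \<or> bpt c = bpt b"
    using bpt_eq_iff[OF assms(2) nz(1)] bpt_eq_iff[OF assms(2) nz(2)] cdet_commute[of a c] cdet_commute[of b c] by auto
qed

context shear_map
begin

text \<open>\<open>piece\<close> for a single edge: the index of b is shifted to 0 and
  \<open>\<xi> n\<close> is absorbed into the second lift of the image.\<close>

lemma edge_piece: assumes "ubasis a b"
  obtains a' b' l r where "quad_lift a b a' b' l r" "exp (- Kb) \<le> l" "l \<le> exp Kb" "exp (- Kb) \<le> r" "r \<le> exp Kb"
    "shear h {bpt a, bpt b} = ln (r / l)"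
    "\<And>z. z \<in> ball 0 1 \<Longrightarrow> hmap a b z \<in> stdpiece \<Longrightarrow> f z \<in> ball 0 1 \<and> hmap a' b' (f z) = kap l r (hmap a b z)"
proof -
  obtain b0 a' b' \<xi> where p: "ubasis a b0" "cdet a' b' = 1" "h (bpt a) = bpt a'"
    "\<And>n::int. h (bpt (b0 - of_int n * a)) = bpt (b' - of_real (\<xi> n) * a')"
    "\<And>n. exp (- Kb) \<le> \<xi> (n + 1) - \<xi> n" "\<And>n. \<xi> (n + 1) - \<xi> n \<le> exp Kb"
    "\<And>n. shear h {bpt a, bpt (b0 - of_int n * a)} = ln ((\<xi> (n + 1) - \<xi> n) / (\<xi> n - \<xi> (n - 1)))"
    "\<And>n z. z \<in> ball 0 1 \<Longrightarrow> \<bar>Re (hmap a b0 z - of_int n)\<bar> \<le> 1 / 2 \<Longrightarrow> norm (hmap a b0 z - of_int n) \<ge> 1 \<Longrightarrow>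
       f z \<in> ball 0 1 \<and> hmap a' b' (f z) = of_real (\<xi> n) + kap (\<xi> n - \<xi> (n - 1)) (\<xi> (n + 1) - \<xi> n) (hmap a b0 z - of_int n)"
    using piece[OF ubasis_prim(1)[OF assms]] by metis
  obtain n where n: "b = b0 - of_int n * a" using fan_edge[OF p(1) assms] by blast
  define l r where "l = \<xi> n - \<xi> (n - 1)" and "r = \<xi> (n + 1) - \<xi> n"
  have lr: "exp (- Kb) \<le> l" "l \<le> exp Kb" "exp (- Kb) \<le> r" "r \<le> exp Kb" using p(5,6)[of "n - 1"] p(5,6)[of n] by (simp_all add: l_def r_def)
  have pos: "l > 0" "r > 0" using lr(1,3) exp_gt_zero[of "- Kb"] by linarith+
  have nz: "a \<noteq> 0" "a' \<noteq> 0" using ubasis_det[OF assms] p(2) by auto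
  have q: "quad_lift a b a' (b' - of_real (\<xi> n) * a') l r"
  proof -
    have "h (bpt (a + b)) = bpt (b' - of_real (\<xi> n) * a' + of_real l * a')"
      using p(4)[of "n - 1"] by (simp add: n l_def algebra_simps)
    moreover have "h (bpt (b - a)) = bpt (b' - of_real (\<xi> n) * a' - of_real r * a')"
      using p(4)[of "n + 1"] by (simp add: n r_def algebra_simps)
    ultimately show ?thesis unfolding quad_lift_def using pos p(2,3) p(4)[of n] n by simp
  qed
  show ?thesis
  proof (rule that[OF q lr])
    show "shear h {bpt a, bpt b} = ln (r / l)" using p(7)[of n] by (simp add: n l_def r_def)
    fix z assume z: "z \<in> ball 0 1" "hmap a b z \<in> stdpiece"
    have hm: "hmap a b z = hmap a b0 z - of_int n" using hmap_shift_diff[OF z(1) nz(1), of b0 "of_int n"] by (simp add: n)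
    have "f z \<in> ball 0 1 \<and> hmap a' b' (f z) = of_real (\<xi> n) + kap l r (hmap a b z)"
      unfolding hm l_def r_def by (rule p(8)[OF z(1)]) (use z(2) hm in \<open>auto simp: stdpiece_def\<close>)
    thus "f z \<in> ball 0 1 \<and> hmap a' (b' - of_real (\<xi> n) * a') (f z) = kap l r (hmap a b z)"
      using hmap_shift_diff[OF _ nz(2)] by auto
  qed
qed

lemma f_ball: assumes "z \<in> ball 0 1" shows "f z \<in> ball 0 1"
proof -
  obtain a b where ab: "ubasis a b" "\<bar>Re (hmap a b z)\<bar> \<le> 1 / 2" "norm (hmap a b z) \<ge> 1" using reduced_exists[OF assms] by blast
  have "hmap a b z \<in> stdpiece" using ab horo_hmap(2)[OF assms ubasis_det[OF ab(1)]] by (simp add: stdpiece_def)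
  thus ?thesis using edge_piece[OF ab(1)] assms by metis
qed

text \<open>With A, B, C the horocyclic distances in the image triangle, the image arc crossing the
  edge (h p, h q) satisfies \<lambda> (C - B) = C - A. Here \<lambda> is the gap on the far side of
  the edge over the gap of the triangle, hence the dependence on orientation.\<close>

definition lamr :: "complex \<Rightarrow> complex \<Rightarrow> complex \<Rightarrow> real" where
  "lamr p q r = (if ccw p q r then exp (- shear h {p, q}) else exp (shear h {p, q}))"

lemma lamr_pos: "lamr p q r > 0"
  by (simp add: lamr_def)

text \<open>Exchanging p and q reverses the orientation. The sectors of p and q next to the same
  edge are therefore given by opposite inequalities in the image.\<close>

lemma lamr_swap: assumes "farey_flag p q r" shows "lamr q p r * lamr p q r = 1"
proof -
  obtain a b t where ab: "ubasis a b" "p = bpt a" "q = bpt b" "r = bpt (b - of_real t * a)" "t = 1 \<or> t = - 1"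
    using farey_flag_lifts[OF assms] by blast
  note d = ubasis_det[OF ab(1)]
  let ?c = "b - of_real t * a"
  have c: "cdet a ?c * cdet b ?c = t" using d by (simp add: cdet_commute[of b a])
  hence "?c \<noteq> 0" using ab(5) by auto
  note s = side_cases[OF d this]
  have "ccw p q r \<longleftrightarrow> \<not> ccw q p r" using s(1,2) c ab(5) unfolding ab(2-4) by auto
  thus ?thesis by (auto simp: lamr_def insert_commute simp flip: exp_add)
qed

text \<open>Two of the inequalities of a sector survive in the image, while the one for the dual
  edge becomes the side of the image arc. Equality in the image implies equality in the source, so
  that only boundary points can be sent to the boundary.\<close>

lemma kite_image:
  assumes "farey_flag p q r" "z \<in> ball 0 1" "kite p q r z"
  defines "A \<equiv> tdist (h p) (h q) (h r) (f z)" and "B \<equiv> tdist (h q) (h p) (h r) (f z)" and "C \<equiv> tdist (h r) (h p) (h q) (f z)"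
  shows "B \<le> C" "C \<le> A + B" "lamr p q r * (C - B) \<le> C - A" 
    "B = C \<Longrightarrow> tdist q p r z = tdist r p q z" "C = A + B \<Longrightarrow> tdist r p q z = tdist p q r z + tdist q p r z"
    "lamr p q r * (C - B) = C - A \<Longrightarrow> tdist p q r z = tdist q p r z"
    "\<And>z'. z' \<in> ball 0 1 \<Longrightarrow> kite p q r z' \<Longrightarrow> f z' = f z \<Longrightarrow> z' = z"
proof -
  obtain a b t where ab: "ubasis a b" "p = bpt a" "q = bpt b" "r = bpt (b - of_real t * a)" "t = 1 \<or> t = - 1"
    using farey_flag_lifts[OF assms(1)] by blast
  note d = ubasis_det[OF ab(1)]
  define m where "m = hmap a b z"
  have im: "Im m > 0" unfolding m_def by (rule horo_hmap(2)[OF assms(2) d])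
  have m: "m \<in> stdpiece" "t * Re m \<ge> 0" using assms(3) kite_chart[OF ab(1) assms(2) ab(5)] by (simp_all add: ab m_def)
  have mr: "\<bar>Re m\<bar> \<le> 1 / 2" using m(1) by (simp add: stdpiece_def)
  obtain a' b' l \<rho> where e: "quad_lift a b a' b' l \<rho>" "shear h {bpt a, bpt b} = ln (\<rho> / l)"
    "\<And>z. z \<in> ball 0 1 \<Longrightarrow> hmap a b z \<in> stdpiece \<Longrightarrow> f z \<in> ball 0 1 \<and> hmap a' b' (f z) = kap l \<rho> (hmap a b z)"
    using edge_piece[OF ab(1)] by metis
  have q: "cdet a' b' = 1" "l > 0" "\<rho> > 0" "h p = bpt a'" "h q = bpt b'" using e(1) by (simp_all add: quad_lift_def ab)
  define w where "w = kap l \<rho> m"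
  have fz: "f z \<in> ball 0 1" "hmap a' b' (f z) = w" using e(3)[OF assms(2)] m(1) by (simp_all add: w_def m_def)
  note rg = kap_region[OF q(2,3) m(1), folded w_def]
  define s where "s = (if t = 1 then \<rho> else - l)"
  have s: "s \<noteq> 0" using q by (simp add: s_def)
  have hr: "h r = bpt (b' - of_real s * a')" using e(1) ab(4,5) by (auto simp: quad_lift_def s_def add.commute)
  have A: "A = \<bar>s\<bar> / Im w" and B: "B = (norm w)\<^sup>2 / (\<bar>s\<bar> * Im w)" and C: "C = (norm (w - of_real s))\<^sup>2 / (\<bar>s\<bar> * Im w)"
    unfolding A_def B_def C_def q(4,5) hr tdist_chart[OF q(1) s fz(1)] fz(2) by simp_all
  note cc = chart_coords[OF rg(1) s, folded A B C]
  have t0: "t \<noteq> 0" using ab(5) by auto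
  note src = chart_coords[OF im t0] and tc = tdist_chart[OF d t0 assms(2), folded ab(2-4) m_def]
  have g: "Re w = Re (garc l \<rho> (Re m))" by (simp add: w_def kap_sel)
  have gb: "Re m \<ge> 0 \<Longrightarrow> Re w \<ge> 0" "Re m \<le> 0 \<Longrightarrow> Re w \<le> 0" unfolding g using garc_Re_bounds(3,4)[OF q(2,3) mr] by simp_all
  have ginj: "Re m = x" if "Re w = Re (garc l \<rho> x)" "\<bar>x\<bar> \<le> 1 / 2" for x
    by (rule garc_Re_inj[OF q(2,3)]) (use that mr g in auto)
  have lam: "lamr p q r = (if t = 1 then l / \<rho> else \<rho> / l)"
  proof -
    let ?c = "b - of_real t * a"
    have c: "cdet a ?c * cdet b ?c = t" using d by (simp add: cdet_commute[of b a])
    hence "?c \<noteq> 0" using t0 by auto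
    hence "ccw p q r \<longleftrightarrow> t = 1" using side_cases(1)[OF d, of ?c] c ab(5) unfolding ab(2-4) by auto
    moreover have "exp (- ln (\<rho> / l)) = l / \<rho>" "exp (ln (\<rho> / l)) = \<rho> / l" using q by (simp_all add: exp_minus)
    ultimately show ?thesis using e(2) by (simp add: lamr_def ab(2,3))
  qed
  show "B \<le> C" unfolding cc(3)
  proof (cases "t = 1")
    case True
    hence "2 * s * Re w \<le> 2 * s * (s / 2)" using rg(3) q by (intro mult_left_mono) (auto simp: s_def)
    thus "2 * s * Re w \<le> s\<^sup>2" by (simp add: power2_eq_square)
  next
    case False
    hence "2 * l * (- Re w) \<le> 2 * l * (l / 2)" using rg(2) q by (intro mult_left_mono) auto
    thus "2 * s * Re w \<le> s\<^sup>2" using False by (simp add: s_def power2_eq_square)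
  qed
  show "C \<le> A + B" unfolding cc(5)
  proof (cases "t = 1")
    case True thus "0 \<le> s * Re w" using m(2) gb(1) q by (simp add: s_def)
  next
    case False
    hence "Re m \<le> 0" using m(2) ab(5) by auto
    thus "0 \<le> s * Re w" using gb(2) q False by (simp add: s_def mult_nonneg_nonpos)
  qed
  \<comment> \<open>Up to a positive factor the third inequality is the sign of the power in
    \<open>kap_region\<close>.\<close>
  have diff: "\<bar>s\<bar> * Im w * (C - A - lamr p q r * (C - B)) = (norm w)\<^sup>2 - 2 * (\<rho> - l) * Re w - l * \<rho>"
  proof -
    have "\<bar>s\<bar> * Im w * (C - A - lamr p q r * (C - B)) = \<bar>s\<bar> * Im w * (C - A) - lamr p q r * (\<bar>s\<bar> * Im w * (C - B))"
      by (simp add: algebra_simps)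
    also have "\<dots> = (norm w)\<^sup>2 - 2 * s * Re w - lamr p q r * (s\<^sup>2 - 2 * s * Re w)" unfolding cc(7,8) ..
    also have "\<dots> = (norm w)\<^sup>2 - 2 * (\<rho> - l) * Re w - l * \<rho>"
      unfolding lam s_def using q by (simp add: field_simps power2_eq_square)
    finally show ?thesis .
  qed
  have sI: "\<bar>s\<bar> * Im w > 0" using s rg(1) by simp
  have "C - A - lamr p q r * (C - B) \<ge> 0" using rg(4) sI unfolding diff[symmetric] by (simp add: zero_le_mult_iff)
  thus "lamr p q r * (C - B) \<le> C - A" by simp
  show "tdist q p r z = tdist r p q z" if "B = C"
    unfolding tc(2,3) src(4)
  proof -
    have eq: "2 * s * Re w = s\<^sup>2" using that cc(4) by simp
    hence "Re w = s / 2" using s by (simp add: power2_eq_square)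
    hence "Re m = t / 2"
      using ginj[of "1 / 2"] ginj[of "- 1 / 2"] arc_half[OF q(2,3)] ab(5) by (auto simp: s_def)
    thus "2 * t * Re m = t\<^sup>2" by (simp add: power2_eq_square)
  qed
  show "tdist r p q z = tdist p q r z + tdist q p r z" if "C = A + B"
    unfolding tc src(6)
  proof -
    have "Re w = 0" using that cc(6) s by simp
    hence "Re m = 0" using ginj[of 0] arc_mid(2)[OF q(2,3)] by simp
    thus "t * Re m = 0" by simp
  qed
  show "tdist p q r z = tdist q p r z" if "lamr p q r * (C - B) = C - A"
    unfolding tc(1,2) src(2)
  proof -
    have "norm m = 1" using diff that rg(5) by simp
    thus "t\<^sup>2 = (norm m)\<^sup>2" using ab(5) by auto
  qed
  show "z' = z" if z': "z' \<in> ball 0 1" "kite p q r z'" "f z' = f z" for z'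
  proof -
  have m': "hmap a b z' \<in> stdpiece" using z'(2) kite_chart[OF ab(1) z'(1) ab(5)] by (simp add: ab)
  have r: "\<bar>Re (hmap a b z')\<bar> < 1" "\<bar>Re m\<bar> < 1" using m' mr by (simp_all add: stdpiece_def)
  have "hmap a' b' (f z') = kap l \<rho> (hmap a b z')" using e(3)[OF z'(1) m'] by (rule conjunct2)
  hence "kap l \<rho> (hmap a b z') = kap l \<rho> m" unfolding z'(3) fz(2) w_def by (rule sym)
  hence "hmap a b z' = m" by (rule kap_inj[OF q(2,3) r])
  hence "hinv a b (hmap a b z') = hinv a b (hmap a b z)" unfolding m_def by (rule arg_cong)
  thus "z' = z" unfolding hinv_hmap[OF d z'(1)] hinv_hmap[OF d assms(2)] .
  qed
qed

text \<open>If the sectors of z and z' have a common image point, the inequalities of both hold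
  there and force equalities. These pull back to z' and put it into the sector of z, where
  injectivity is known.\<close>

lemma inj_kite: assumes fl: "farey_flag p q r" and z: "z \<in> ball 0 1" "kite p q r z" and z': "z' \<in> ball 0 1" and eq: "f z' = f z"
  and z'k: "kite p q r z' \<or> kite p r q z' \<or> kite q p r z' \<or> kite q r p z' \<or> kite r p q z' \<or> kite r q p z'"
  shows "z' = z"
proof -
  define A B C where "A = tdist (h p) (h q) (h r) (f z)" and "B = tdist (h q) (h p) (h r) (f z)" and "C = tdist (h r) (h p) (h q) (f z)"
  note k = kite_image[OF fl z, folded A_def B_def C_def]
  note com = tdist_commute[of p r q] tdist_commute[of q r p] tdist_commute[of r q p]
  note hcom = tdist_commute[of "h p" "h r" "h q"] tdist_commute[of "h q" "h r" "h p"] tdist_commute[of "h r" "h q" "h p"]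
  have lp: "lamr p q r > 0" by (rule lamr_pos)
  have "kite p q r z'"
    using z'k
  proof (elim disjE)
    assume *: "kite p r q z'"
    note k' = kite_image[OF farey_flag_perm(1)[OF fl] z' *, unfolded eq hcom, folded A_def B_def C_def]
    have "tdist r p q z' = tdist q p r z'" using k'(1,4) k(1) by (simp add: com)
    thus ?thesis using * by (simp add: kite_def com add.commute)
  next
    assume *: "kite q p r z'"
    note k' = kite_image[OF farey_flag_perm(2)[OF fl] z' *, unfolded eq hcom, folded A_def B_def C_def]
    have sw: "lamr q p r * lamr p q r = 1" by (rule lamr_swap[OF fl])
    have "lamr q p r * (lamr p q r * (C - B)) \<le> lamr q p r * (C - A)" using k(3) lamr_pos[of q p r] by (intro mult_left_mono) auto
    hence "C - B \<le> lamr q p r * (C - A)" using sw by (simp flip: mult.assoc)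
    hence "lamr q p r * (C - A) = C - B" using k'(3) by simp
    hence "tdist q p r z' = tdist p q r z'" using k'(6) by simp
    thus ?thesis using * by (simp add: kite_def com add.commute)
  next
    assume *: "kite q r p z'"
    note k' = kite_image[OF farey_flag_perm(3)[OF fl] z' *, unfolded eq hcom, folded A_def B_def C_def]
    have "0 \<le> lamr p q r * (C - B)" using k(1) lp by simp
    hence "A = C" using k(3) k'(1) by simp
    hence "lamr p q r * (C - B) \<le> 0" using k(3) by simp
    hence "B = C" using k(1) lp by (simp add: mult_le_0_iff)
    have "tdist r q p z' = tdist p q r z'" "tdist q r p z' = tdist r q p z'" using k'(4,6) \<open>A = C\<close> \<open>B = C\<close> by simp_all
    thus ?thesis using * by (simp add: kite_def com add.commute)
  next
    assume *: "kite r p q z'"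
    note k' = kite_image[OF farey_flag_perm(4)[OF fl] z' *, unfolded eq hcom, folded A_def B_def C_def]
    have "0 \<le> lamr r p q * (B - A)" using k'(1) lamr_pos[of r p q] by simp
    hence "B = C" using k'(3) k(1) by simp
    hence "lamr r p q * (B - A) \<le> 0" using k'(3) by simp
    hence "A = B" using k'(1) lamr_pos[of r p q] by (simp add: mult_le_0_iff)
    have "tdist p r q z' = tdist q r p z'" "tdist r p q z' = tdist p r q z'" using k'(4,6) \<open>A = B\<close> \<open>B = C\<close> by (simp_all add: com)
    thus ?thesis using * by (simp add: kite_def com add.commute)
  next
    assume *: "kite r q p z'"
    note k' = kite_image[OF farey_flag_perm(5)[OF fl] z' *, unfolded eq hcom, folded A_def B_def C_def]
    have "0 \<le> lamr p q r * (C - B)" using k(1) lp by simp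
    moreover have "0 \<le> lamr r q p * (A - B)" using k'(1) lamr_pos[of r q p] by simp
    ultimately have "A = C" using k(3) k'(3) by simp
    hence "lamr p q r * (C - B) \<le> 0" using k(3) by simp
    hence "B = C" using k(1) lp by (simp add: mult_le_0_iff)
    have "tdist q r p z' = tdist p r q z'" "tdist r q p z' = tdist q r p z'" using k'(4,6) \<open>A = C\<close> \<open>B = C\<close> by (simp_all add: com)
    thus ?thesis using * by (simp add: kite_def com add.commute)
  qed
  thus ?thesis using k(7)[OF z' _ eq] by blast
qed

end

section \<open>Points keep their side of every edge\<close>

lemma parallel_bpt: assumes "a \<noteq> 0" "c \<noteq> 0" "bpt a = bpt c" obtains x :: real where "x \<noteq> 0" "a = of_real x * c"
proof -
  have "cdet a c = 0" using bpt_eq_iff[OF assms(1,2)] assms(3) by simp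
  hence im: "a * cnj c = of_real (Re (a * cnj c))" by (simp add: complex_eq_iff cdet_def algebra_simps)
  define x where "x = Re (a * cnj c) / (norm c)\<^sup>2"
  have "of_real x * c = of_real (Re (a * cnj c)) * c / of_real ((norm c)\<^sup>2)" by (simp add: x_def)
  also have "\<dots> = a * cnj c * c / (c * cnj c)" unfolding im[symmetric] complex_norm_square ..
  also have "\<dots> = a" using assms(2) by simp
  finally have ax: "a = of_real x * c" by simp
  hence "x \<noteq> 0" using assms(1) by auto
  thus ?thesis using that ax by blast
qed

text \<open>If c and d were strictly separated by the edge, X1 Y2 and Y1 X2 would be nonzero
  integers of opposite sign, and their difference \<open>cdet c d\<close> would be at least 2 in
  absolute value.\<close>

lemma edges_noncrossing:
  assumes "ubasis a b" "c \<in> lat" "d \<in> lat" "\<bar>cdet c d\<bar> = 1" "cdet a c * cdet b c < 0"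
  shows "cdet a d * cdet b d \<le> 0"
proof (rule ccontr)
  assume "\<not> cdet a d * cdet b d \<le> 0"
  have l: "a \<in> lat" "b \<in> lat" using assms(1) by (auto simp: ubasis_def)
  obtain X1 Y1 X2 Y2 :: int where i: "cdet a c = of_int X1" "cdet b c = of_int Y1" "cdet a d = of_int X2" "cdet b d = of_int Y2"
    using lat_cdet[OF l(1) assms(2)] lat_cdet[OF l(2) assms(2)] lat_cdet[OF l(1) assms(3)] lat_cdet[OF l(2) assms(3)]
    by (auto elim!: Ints_cases)
  have c: "c = of_real (cdet c b) * a + of_real (cdet a c) * b" using cdet_expand1[OF ubasis_det[OF assms(1)]] .
  have "cdet c d = cdet (of_real (cdet c b) * a + of_real (cdet a c) * b) d" using c by simp
  also have "\<dots> = cdet c b * cdet a d + cdet a c * cdet b d" by (simp only: cdet_linear)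
  finally have "cdet c d = of_int (X1 * Y2 - Y1 * X2)" using cdet_commute[of b c] by (simp add: i)
  hence "of_int \<bar>X1 * Y2 - Y1 * X2\<bar> = (1 :: real)" using assms(4) by simp
  hence one: "\<bar>X1 * Y2 - Y1 * X2\<bar> = 1" by (simp only: of_int_eq_1_iff)
  have "of_int (X1 * Y1) < (0 :: real)" "of_int (X2 * Y2) > (0 :: real)" using assms(5) \<open>\<not> cdet a d * cdet b d \<le> 0\<close> by (simp_all add: i)
  hence "X1 * Y1 < 0" "X2 * Y2 > 0" by (simp_all only: of_int_less_0_iff of_int_0_less_iff)
  hence "(X1 * Y1) * (X2 * Y2) < 0" by (rule mult_neg_pos)
  hence "(X1 * Y2) * (Y1 * X2) < 0" by (simp add: mult_ac)
  hence "X1 * Y2 > 0 \<and> Y1 * X2 < 0 \<or> X1 * Y2 < 0 \<and> Y1 * X2 > 0" by (simp only: mult_less_0_iff)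
  thus False using one by linarith
qed

context shear_map
begin

text \<open>By \<open>horo_hull\<close> the side of z is a combination, with non-negative
  coefficients, of the sides \<sigma> of the vertices of a triangle containing z. Some \<sigma> is
  then negative, so by \<open>edges_noncrossing\<close> none is positive; h carries this over to the
  image triangle, and the hull formula is applied there again.\<close>

lemma side_neg:
  assumes "ubasis a b" "cdet a' b' = 1" "h (bpt a) = bpt a'" "h (bpt b) = bpt b'" "z \<in> ball 0 1" "Re (hmap a b z) < 0"
  shows "Re (hmap a' b' (f z)) < 0"
proof (rule ccontr)
  assume neg: "\<not> Re (hmap a' b' (f z)) < 0"
  note d = ubasis_det[OF assms(1)]
  have fz: "f z \<in> ball 0 1" by (rule f_ball[OF assms(5)])
  obtain p q r where fl: "farey_flag p q r" "kite p q r z" using kite_exists[OF assms(5)] by blast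
  obtain c1 c2 t where c: "ubasis c1 c2" "p = bpt c1" "q = bpt c2" "r = bpt (c2 - of_real t * c1)" "t = 1 \<or> t = - 1"
    using farey_flag_lifts[OF fl(1)] by blast
  define c3 where "c3 = c2 - of_real t * c1"
  note dc = ubasis_det[OF c(1)]
  have cl: "c1 \<in> lat" "c2 \<in> lat" "c3 \<in> lat" using c(1,5) by (auto simp: ubasis_def c3_def)
  have dd: "cdet c1 c3 = 1" "cdet c2 c3 = t" "cdet c2 c1 = - 1" "cdet c3 c1 = - 1" "cdet c3 c2 = - t" 
    using dc cdet_commute[of c2 c1] by (simp_all add: c3_def)
  have cnz: "c1 \<noteq> 0" "c2 \<noteq> 0" "c3 \<noteq> 0" using cdet_nz[of c1 c2] cdet_nz[of c1 c3] dc dd by auto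
  have t1: "\<bar>t\<bar> = 1" using c(5) by auto
  have td: "tdist p q r z = horo c1 z" "tdist q p r z = horo c2 z" "tdist r p q z = horo c3 z"
    unfolding c(2-4) c3_def[symmetric] tdist_bpt[OF cnz assms(5)] tdist_bpt[OF cnz(2,1,3) assms(5)] tdist_bpt[OF cnz(3,1,2) assms(5)]
    using dd dc t1 by simp_all
  define \<sigma> where "\<sigma> x = cdet a x * cdet b x" for x
  have c3': "c3 = of_real (- t) * c1 + c2" by (simp add: c3_def)
  have hull: "2 * Re (hmap a b z) / Im (hmap a b z) = (horo c2 z + horo c3 z - horo c1 z) * \<sigma> c1 + (horo c1 z + horo c3 z - horo c2 z) * \<sigma> c2
     + (horo c1 z + horo c2 z - horo c3 z) * \<sigma> c3"
    unfolding \<sigma>_def hmap_Re_horo[OF assms(5) d, symmetric] by (rule horo_hull[OF assms(5) dc c3']) (use c(5) in auto)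
  have hp: "horo c1 z > 0" "horo c2 z > 0" "horo c3 z > 0" using horo_pos[OF assms(5)] cnz by auto
  have k: "horo c1 z \<le> horo c2 z" "horo c2 z \<le> horo c3 z" "horo c3 z \<le> horo c1 z + horo c2 z"
    using fl(2) unfolding kite_def td by auto
  have lhs: "2 * Re (hmap a b z) / Im (hmap a b z) < 0" using assms(6) horo_hmap(2)[OF assms(5) d] by (simp add: divide_neg_pos)
  have "\<sigma> c1 < 0 \<or> \<sigma> c2 < 0 \<or> \<sigma> c3 < 0"
  proof (rule ccontr)
    assume "\<not> ?thesis"
    hence "0 \<le> (horo c2 z + horo c3 z - horo c1 z) * \<sigma> c1" "0 \<le> (horo c1 z + horo c3 z - horo c2 z) * \<sigma> c2" "0 \<le> (horo c1 z + horo c2 z - horo c3 z) * \<sigma> c3"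
      using k hp by simp_all
    thus False using hull lhs by linarith
  qed
  moreover have nc: "\<sigma> y \<le> 0" if "\<sigma> x < 0" "x \<in> {c1, c2, c3}" "y \<in> {c1, c2, c3}" for x y
  proof (cases "x = y")
    case False
    hence "\<bar>cdet x y\<bar> = 1" using that dd dc t1 by auto
    thus ?thesis using edges_noncrossing[OF assms(1), of x y] that cl unfolding \<sigma>_def by auto
  qed (use that in simp)
  ultimately have \<sigma>n: "\<sigma> c1 \<le> 0" "\<sigma> c2 \<le> 0" "\<sigma> c3 \<le> 0" by blast+
  obtain \<alpha> \<beta> l \<rho> where q: "quad_lift c1 c2 \<alpha> \<beta> l \<rho>" using quad_lift_exists[OF c(1)] by blast
  define s where "s = (if t = 1 then \<rho> else - l)"
  have qs: "cdet \<alpha> \<beta> = 1" "h p = bpt \<alpha>" "h q = bpt \<beta>" "h r = bpt (\<beta> - of_real s * \<alpha>)" "s \<noteq> 0"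
    using q c(5) by (cases "t = 1"; auto simp: quad_lift_def c(2-4) s_def add.commute)+
  \<comment> \<open>This scaling gives the three lifts pairwise determinants of absolute value 1, so
    that \<open>tdist\<close> is \<open>horo\<close> and \<open>horo_hull\<close> applies.\<close>
  define g where "g = sqrt \<bar>s\<bar>"
  have g: "g > 0" "g * g = \<bar>s\<bar>" using qs(5) by (simp_all add: g_def)
  define \<gamma>1 \<gamma>2 \<gamma>3 where "\<gamma>1 = of_real g * \<alpha>" and "\<gamma>2 = of_real (1 / g) * \<beta>" and "\<gamma>3 = of_real (- sgn s) * \<gamma>1 + \<gamma>2"
  have dg: "cdet \<gamma>1 \<gamma>2 = 1" unfolding \<gamma>1_def \<gamma>2_def cdet_linear qs(1) using g by simp
  have sg: "\<bar>sgn s\<bar> = 1" "(sgn s)\<^sup>2 = 1" using qs(5) by (auto simp: sgn_if)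
  have gd: "cdet \<gamma>1 \<gamma>3 = 1" "cdet \<gamma>2 \<gamma>3 = sgn s" "cdet \<gamma>2 \<gamma>1 = - 1" "cdet \<gamma>3 \<gamma>1 = - 1" "cdet \<gamma>3 \<gamma>2 = - sgn s"
    using dg cdet_commute[of \<gamma>2 \<gamma>1] by (simp_all add: \<gamma>3_def del: of_real_minus)
  have gnz: "\<gamma>1 \<noteq> 0" "\<gamma>2 \<noteq> 0" "\<gamma>3 \<noteq> 0" using cdet_nz[of \<gamma>1 \<gamma>2] cdet_nz[of \<gamma>1 \<gamma>3] dg gd by auto
  have "sgn s * g * g = s" using g(2) by (simp add: sgn_mult_abs mult.assoc)
  hence "sgn s * g = s * (1 / g)" using g(1) by (simp add: field_simps)
  hence "of_real (sgn s) * of_real g = (of_real s * of_real (1 / g) :: complex)" unfolding of_real_mult[symmetric] by (rule arg_cong)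
  hence "\<gamma>3 = of_real (1 / g) * (\<beta> - of_real s * \<alpha>)"
    by (simp add: \<gamma>3_def \<gamma>1_def \<gamma>2_def algebra_simps) 
  hence hb: "h p = bpt \<gamma>1" "h q = bpt \<gamma>2" "h r = bpt \<gamma>3"
    using qs(2-4) bpt_scale[of g \<alpha>] bpt_scale[of "1 / g" \<beta>] bpt_scale[of "1 / g" "\<beta> - of_real s * \<alpha>"] g(1)
    by (simp_all add: \<gamma>1_def \<gamma>2_def)
  have tdi: "tdist (h p) (h q) (h r) (f z) = horo \<gamma>1 (f z)" "tdist (h q) (h p) (h r) (f z) = horo \<gamma>2 (f z)" "tdist (h r) (h p) (h q) (f z) = horo \<gamma>3 (f z)"
    unfolding hb tdist_bpt[OF gnz fz] tdist_bpt[OF gnz(2,1,3) fz] tdist_bpt[OF gnz(3,1,2) fz]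
    using dg gd sg by simp_all
  note ki = kite_image[OF fl(1) assms(5) fl(2), unfolded tdi td]
  have "0 \<le> lamr p q r * (horo \<gamma>3 (f z) - horo \<gamma>2 (f z))" using ki(1) lamr_pos[of p q r] by simp
  hence AC: "horo \<gamma>1 (f z) \<le> horo \<gamma>3 (f z)" using ki(3) by linarith
  have hp': "horo \<gamma>1 (f z) > 0" "horo \<gamma>2 (f z) > 0" using horo_pos[OF fz] gnz by auto
  define \<tau> where "\<tau> x = cdet a' x * cdet b' x" for x
  have hull': "2 * Re (hmap a' b' (f z)) / Im (hmap a' b' (f z)) = (horo \<gamma>2 (f z) + horo \<gamma>3 (f z) - horo \<gamma>1 (f z)) * \<tau> \<gamma>1
     + (horo \<gamma>1 (f z) + horo \<gamma>3 (f z) - horo \<gamma>2 (f z)) * \<tau> \<gamma>2 + (horo \<gamma>1 (f z) + horo \<gamma>2 (f z) - horo \<gamma>3 (f z)) * \<tau> \<gamma>3"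
    unfolding \<tau>_def hmap_Re_horo[OF fz assms(2), symmetric] by (rule horo_hull[OF fz dg \<gamma>3_def]) (simp add: sg)
  have lhs': "2 * Re (hmap a' b' (f z)) / Im (hmap a' b' (f z)) \<ge> 0" using neg horo_hmap(2)[OF fz assms(2)] by simp
  have nz: "a \<noteq> 0" "b \<noteq> 0" "a' \<noteq> 0" "b' \<noteq> 0" using d assms(2) by auto
  have tr: "\<sigma> x < 0 \<Longrightarrow> \<tau> y < 0" "\<sigma> x = 0 \<longleftrightarrow> \<tau> y = 0" if "x \<noteq> 0" "y \<noteq> 0" "h (bpt x) = bpt y" for x y
  proof -
    show "\<tau> y < 0" if "\<sigma> x < 0"
    proof -
      have "ccw (bpt b) (bpt a) (bpt x)" using that side_cases(2)[OF d \<open>x \<noteq> 0\<close>] by (simp add: \<sigma>_def)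
      hence "ccw (bpt b') (bpt a') (bpt y)" using ccw_h[of "bpt b" "bpt a" "bpt x"] nz \<open>x \<noteq> 0\<close> assms(3,4) \<open>h (bpt x) = bpt y\<close> by simp
      thus ?thesis using side_cases(2)[OF assms(2) \<open>y \<noteq> 0\<close>] by (simp add: \<tau>_def)
    qed
    have "bpt x = bpt a \<longleftrightarrow> bpt y = bpt a'" "bpt x = bpt b \<longleftrightarrow> bpt y = bpt b'"
      using inj_h[of "bpt x" "bpt a"] inj_h[of "bpt x" "bpt b"] nz that assms(3,4) by auto
    thus "\<sigma> x = 0 \<longleftrightarrow> \<tau> y = 0" unfolding \<sigma>_def \<tau>_def side_cases(3)[OF d \<open>x \<noteq> 0\<close>] side_cases(3)[OF assms(2) \<open>y \<noteq> 0\<close>] by simp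
  qed
  have h1: "h (bpt c1) = bpt \<gamma>1" "h (bpt c2) = bpt \<gamma>2" "h (bpt c3) = bpt \<gamma>3" using hb by (simp_all add: c(2-4) c3_def)
  note t1 = tr[OF cnz(1) gnz(1) h1(1)] and t2 = tr[OF cnz(2) gnz(2) h1(2)] and t3 = tr[OF cnz(3) gnz(3) h1(3)]
  have \<tau>n: "\<tau> \<gamma>1 \<le> 0" "\<tau> \<gamma>2 \<le> 0" "\<tau> \<gamma>3 \<le> 0" using t1 t2 t3 \<sigma>n by (force simp: le_less)+
  have co: "horo \<gamma>2 (f z) + horo \<gamma>3 (f z) - horo \<gamma>1 (f z) > 0" "horo \<gamma>1 (f z) + horo \<gamma>3 (f z) - horo \<gamma>2 (f z) > 0"
    "horo \<gamma>1 (f z) + horo \<gamma>2 (f z) - horo \<gamma>3 (f z) \<ge> 0" using ki(1,2) AC hp' by linarith+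
  have terms: "(horo \<gamma>2 (f z) + horo \<gamma>3 (f z) - horo \<gamma>1 (f z)) * \<tau> \<gamma>1 \<le> 0" "(horo \<gamma>1 (f z) + horo \<gamma>3 (f z) - horo \<gamma>2 (f z)) * \<tau> \<gamma>2 \<le> 0"
     "(horo \<gamma>1 (f z) + horo \<gamma>2 (f z) - horo \<gamma>3 (f z)) * \<tau> \<gamma>3 \<le> 0"
    using co \<tau>n by (simp_all add: mult_nonneg_nonpos)
  hence z1: "(horo \<gamma>2 (f z) + horo \<gamma>3 (f z) - horo \<gamma>1 (f z)) * \<tau> \<gamma>1 = 0" and z2: "(horo \<gamma>1 (f z) + horo \<gamma>3 (f z) - horo \<gamma>2 (f z)) * \<tau> \<gamma>2 = 0"
     and z3: "(horo \<gamma>1 (f z) + horo \<gamma>2 (f z) - horo \<gamma>3 (f z)) * \<tau> \<gamma>3 = 0"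
    using hull' lhs' by linarith+
  \<comment> \<open>All terms in the image vanish. The first two coefficients are positive, so c1
    and c2 are ends of the edge (a, b); the image lies on the image edge, and by the equality case
    of \<open>kite_image\<close> z lies on the edge itself.\<close>
  have "\<sigma> c1 = 0" "\<sigma> c2 = 0" using z1 z2 co(1,2) t1(2) t2(2) by auto
  hence lt: "(horo c1 z + horo c2 z - horo c3 z) * \<sigma> c3 < 0" using hull lhs by simp
  hence "\<sigma> c3 < 0" using k(3) by (auto simp: mult_less_0_iff)
  hence "\<tau> \<gamma>3 < 0" by (rule t3(1))
  hence "horo \<gamma>3 (f z) = horo \<gamma>1 (f z) + horo \<gamma>2 (f z)" using z3 by simp
  hence "horo c3 z = horo c1 z + horo c2 z" by (rule ki(5))
  thus False using lt by simp
qed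

text \<open>The part of the edge above the unit circle is seen in the chart at a, the rest in the
  chart at b; in both the point with x = 0 stays on the axis by \<open>arc_mid\<close>.\<close>

lemma side_zero:
  assumes "ubasis a b" "cdet a' b' = 1" "h (bpt a) = bpt a'" "h (bpt b) = bpt b'" "z \<in> ball 0 1" "Re (hmap a b z) = 0"
  shows "Re (hmap a' b' (f z)) = 0"
proof -
  have piece0: "Re (hmap \<alpha> \<beta> (f z)) = 0" 
    if ub: "ubasis c e" and l: "cdet \<alpha> \<beta> = 1" "h (bpt c) = bpt \<alpha>" "h (bpt e) = bpt \<beta>" and m: "Re (hmap c e z) = 0" "norm (hmap c e z) \<ge> 1" for c e \<alpha> \<beta>
  proof -
    obtain \<alpha>' \<beta>' l \<rho> where e: "quad_lift c e \<alpha>' \<beta>' l \<rho>"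
      "\<And>z. z \<in> ball 0 1 \<Longrightarrow> hmap c e z \<in> stdpiece \<Longrightarrow> f z \<in> ball 0 1 \<and> hmap \<alpha>' \<beta>' (f z) = kap l \<rho> (hmap c e z)"
      using edge_piece[OF ub] by metis
    have q: "cdet \<alpha>' \<beta>' = 1" "l > 0" "\<rho> > 0" "bpt \<alpha> = bpt \<alpha>'" "bpt \<beta> = bpt \<beta>'" using e(1) l by (simp_all add: quad_lift_def)
    have "hmap c e z \<in> stdpiece" using m horo_hmap(2)[OF assms(5) ubasis_det[OF ub]] by (simp add: stdpiece_def)
    hence "Re (hmap \<alpha>' \<beta>' (f z)) = 0" using e(2)[OF assms(5)] arc_mid(2)[OF q(2,3)] m(1) by (simp add: kap_sel)
    moreover obtain x y where "\<alpha> = of_real x * \<alpha>'" "\<beta> = of_real y * \<beta>'" "x \<noteq> 0"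
      using parallel_bpt[of \<alpha> \<alpha>'] parallel_bpt[of \<beta> \<beta>'] q cdet_nz[of \<alpha> \<beta>] cdet_nz[of \<alpha>' \<beta>'] l(1) by (metis zero_neq_one)
    ultimately show ?thesis by (simp add: hmap_scale)
  qed
  show ?thesis
  proof (cases "norm (hmap a b z) \<ge> 1")
    case True thus ?thesis using piece0[OF assms(1-4,6)] by simp
  next
    case False
    have sw: "hmap b (- a) z = - 1 / hmap a b z" by (rule hmap_swap)
    have nz: "hmap a b z \<noteq> 0" using horo_hmap(2)[OF assms(5) ubasis_det[OF assms(1)]] by auto
    have "Re (hmap b (- a) z) = 0" unfolding sw using assms(6) by (simp add: Re_divide)
    moreover have "norm (hmap b (- a) z) \<ge> 1" unfolding sw using False nz by (simp add: norm_divide divide_simps)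
    ultimately have "Re (hmap b' (- a') (f z)) = 0"
      using piece0[OF ubasis_trans(1)[OF assms(1)], of b' "- a'"] assms(2-4) cdet_commute[of b' a'] by simp
    hence "Re (hmap a' b' (f z)) / ((Re (hmap a' b' (f z)))\<^sup>2 + (Im (hmap a' b' (f z)))\<^sup>2) = 0"
      unfolding hmap_swap by (simp add: Re_divide)
    moreover have "(Re (hmap a' b' (f z)))\<^sup>2 + (Im (hmap a' b' (f z)))\<^sup>2 > 0"
      using horo_hmap(2)[OF f_ball[OF assms(5)] assms(2)] by (simp add: add_nonneg_pos)
    ultimately show ?thesis by auto
  qed
qed

lemma side_sgn:
  assumes "ubasis a b" "cdet a' b' = 1" "h (bpt a) = bpt a'" "h (bpt b) = bpt b'" "z \<in> ball 0 1"
  shows "sgn (Re (hmap a' b' (f z))) = sgn (Re (hmap a b z))"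
proof -
  note d = ubasis_det[OF assms(1)]
  have sw: "Re (- 1 / w) = - Re w / (norm w)\<^sup>2" for w by (simp add: Re_divide cmod_power2)
  consider "Re (hmap a b z) < 0" | "Re (hmap a b z) = 0" | "Re (hmap a b z) > 0" by linarith
  thus ?thesis
  proof cases
    case 1 thus ?thesis using side_neg[OF assms(1-5)] by simp
  next
    case 2 thus ?thesis using side_zero[OF assms(1-5)] by simp
  next
    case 3
    have im: "Im (hmap a b z) > 0" "Im (hmap a' b' (f z)) > 0"
      using horo_hmap(2)[OF assms(5) d] horo_hmap(2)[OF f_ball[OF assms(5)] assms(2)] by simp_all
    have n: "(norm (hmap a b z))\<^sup>2 > 0" "(norm (hmap a' b' (f z)))\<^sup>2 > 0" using im by auto
    have "Re (hmap b (- a) z) < 0" unfolding hmap_swap sw using 3 n(1) by (simp add: divide_neg_pos)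
    hence "Re (hmap b' (- a') (f z)) < 0"
      using side_neg[OF ubasis_trans(1)[OF assms(1)], of b' "- a'" z] assms cdet_commute[of b' a'] by simp
    hence "Re (hmap a' b' (f z)) > 0" unfolding hmap_swap sw using n(2) by (simp add: zero_less_divide_iff)
    thus ?thesis using 3 by simp
  qed
qed

text \<open>The side of an edge is an inequality between horocyclic distances, so
  \<open>side_sgn\<close> transfers it between points with the same image.\<close>

lemma side_tdist:
  assumes "farey_flag p q r" "z \<in> ball 0 1" "z' \<in> ball 0 1" "f z' = f z" "tdist r p q z \<le> tdist p q r z + tdist q p r z"
  shows "tdist r p q z' \<le> tdist p q r z' + tdist q p r z'"
proof -
  obtain a b t where ab: "ubasis a b" "p = bpt a" "q = bpt b" "r = bpt (b - of_real t * a)" "t = 1 \<or> t = - 1"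
    using farey_flag_lifts[OF assms(1)] by blast
  note d = ubasis_det[OF ab(1)]
  have t: "t \<noteq> 0" using ab(5) by auto
  obtain a' b' l \<rho> where "quad_lift a b a' b' l \<rho>" using quad_lift_exists[OF ab(1)] by blast
  hence q: "cdet a' b' = 1" "h (bpt a) = bpt a'" "h (bpt b) = bpt b'" by (simp_all add: quad_lift_def)
  have "sgn (Re (hmap a b z')) = sgn (Re (hmap a b z))"
    using side_sgn[OF ab(1) q assms(2)] side_sgn[OF ab(1) q assms(3)] assms(4) by simp
  hence iff: "t * Re (hmap a b z') \<ge> 0 \<longleftrightarrow> t * Re (hmap a b z) \<ge> 0" using ab(5) by (auto simp: sgn_if split: if_splits)
  have c: "tdist r p q w \<le> tdist p q r w + tdist q p r w \<longleftrightarrow> t * Re (hmap a b w) \<ge> 0" if "w \<in> ball 0 1" for w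
    unfolding ab(2-4) tdist_chart[OF d t that] by (rule chart_coords(5)[OF horo_hmap(2)[OF that d] t])
  show ?thesis using assms(5) iff unfolding c[OF assms(2)] c[OF assms(3)] by simp
qed

text \<open>The three side conditions confine z' to the triangle of z. Ordering its three distances
  puts z' into one of the six sectors, and \<open>inj_kite\<close> applies.\<close>

lemma inj_f: "inj_on f (ball 0 1)"
proof (rule inj_onI)
  fix z' z assume z': "z' \<in> ball 0 1" and z: "z \<in> ball 0 1" and eq: "f z' = f z"
  obtain p q r where fl: "farey_flag p q r" "kite p q r z" using kite_exists[OF z] by blast
  have dist: "p \<noteq> q" "q \<noteq> r" "p \<noteq> r" using fl(1) by (auto simp: farey_flag_def)
  have pos: "tdist p q r z \<ge> 0" "tdist q p r z \<ge> 0" using sq_less_one[OF z] by (simp_all add: tdist_def)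
  note com = tdist_commute[of p r q] tdist_commute[of q r p] tdist_commute[of r q p]
  have k: "tdist p q r z \<le> tdist q p r z" "tdist q p r z \<le> tdist r p q z" "tdist r p q z \<le> tdist p q r z + tdist q p r z"
    using fl(2) by (auto simp: kite_def)
  have 1: "tdist r p q z' \<le> tdist p q r z' + tdist q p r z'" by (rule side_tdist[OF fl(1) z z' eq k(3)])
  have 2: "tdist q p r z' \<le> tdist p q r z' + tdist r p q z'"
    using side_tdist[OF farey_flag_perm(1)[OF fl(1)] z z' eq] k pos unfolding com by linarith
  have 3: "tdist p q r z' \<le> tdist q p r z' + tdist r p q z'"
    using side_tdist[OF farey_flag_perm(3)[OF fl(1)] z z' eq] k pos unfolding com by linarith
  have "kite p q r z' \<or> kite p r q z' \<or> kite q p r z' \<or> kite q r p z' \<or> kite r p q z' \<or> kite r q p z'"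
    unfolding kite_def com using 1 2 3 by linarith
  from inj_kite[OF fl(1) z fl(2) z' eq this] show "z' = z" .
qed

end

section \<open>Lipschitz bounds\<close>

lemma sqrt_deriv: assumes "\<bar>x\<bar> \<le> 1 / 2"
  shows "((\<lambda>x. sqrt (1 - x\<^sup>2)) has_real_derivative - x / sqrt (1 - x\<^sup>2)) (at x)" "\<bar>- x / sqrt (1 - x\<^sup>2)\<bar> \<le> 1"
proof -
  have x2: "x\<^sup>2 \<le> 1 / 4" using power_mono[of "\<bar>x\<bar>" "1 / 2" 2] assms by (simp add: power_divide)
  have pos: "1 - x\<^sup>2 > 0" using x2 by simp
  show "((\<lambda>x. sqrt (1 - x\<^sup>2)) has_real_derivative - x / sqrt (1 - x\<^sup>2)) (at x)"
    using pos by (auto intro!: derivative_eq_intros simp: divide_simps)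
  have "\<bar>x\<bar> \<le> sqrt (1 - x\<^sup>2)" using x2 by (intro real_le_rsqrt) simp
  thus "\<bar>- x / sqrt (1 - x\<^sup>2)\<bar> \<le> 1" using pos by (simp add: divide_le_eq)
qed

lemma hmap_lipschitz: assumes "cdet a b = 1" "r < 1"
  shows "(2 / ((norm a)\<^sup>2 * (1 - r)\<^sup>2))-lipschitz_on (cball 0 r) (hmap a b)"
proof (rule lipschitz_onI)
  fix z w :: complex assume zw: "z \<in> cball 0 r" "w \<in> cball 0 r"
  have a: "a \<noteq> 0" using assms by auto
  have b: "z \<in> ball 0 1" "w \<in> ball 0 1" using zw assms by auto
  have lo: "norm a * (1 - r) \<le> norm (a - cnj a * x)" if "x \<in> cball 0 r" for x
  proof -
    have "norm a - norm a * norm x \<le> norm (a - cnj a * x)" using norm_triangle_ineq2[of a "cnj a * x"] by (simp add: norm_mult)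
    moreover have "norm a * norm x \<le> norm a * r" using that by (intro mult_left_mono) auto
    ultimately show ?thesis by (simp add: algebra_simps)
  qed
  have p: "norm a * (1 - r) > 0" using a assms(2) by simp
  have q: "norm (a - cnj a * z) > 0" "norm (a - cnj a * w) > 0" using lo[OF zw(1)] lo[OF zw(2)] p by linarith+
  have "norm (hmap a b z - hmap a b w) = 2 * norm (z - w) / (norm (a - cnj a * z) * norm (a - cnj a * w))"
    unfolding hmap_diff[OF b assms(1)] by (simp add: norm_divide norm_mult)
  also have "\<dots> \<le> 2 * norm (z - w) / ((norm a * (1 - r)) * (norm a * (1 - r)))"
    using lo[OF zw(1)] lo[OF zw(2)] p q a assms(2) by (intro divide_left_mono mult_mono mult_pos_pos) auto
  also have "\<dots> = 2 / ((norm a)\<^sup>2 * (1 - r)\<^sup>2) * norm (z - w)" by (simp add: power2_eq_square mult_ac)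
  finally show "dist (hmap a b z) (hmap a b w) \<le> 2 / ((norm a)\<^sup>2 * (1 - r)\<^sup>2) * dist z w" by (simp add: dist_norm)
qed simp

lemma hinv_lipschitz: assumes "cdet a b = 1"
  shows "(2 * (norm a)\<^sup>2)-lipschitz_on {w. Im w \<ge> 0} (hinv a b)"
proof (rule lipschitz_onI)
  fix w v assume wv: "w \<in> {w. Im w \<ge> 0}" "v \<in> {w. Im w \<ge> 0}"
  have a: "norm a > 0" using assms by auto
  have lo: "1 / norm a \<le> norm (cnj b - cnj a * x)" if "Im x \<ge> 0" for x
  proof -
    have "1 \<le> norm (cnj b - cnj a * x) * norm a" using hinv_den(1)[OF assms that] that by (smt (verit) mult_nonneg_nonneg zero_le_power2)
    thus ?thesis using a by (simp add: divide_le_eq)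
  qed
  have "norm (hinv a b w - hinv a b v) = 2 * norm (w - v) / (norm (cnj b - cnj a * w) * norm (cnj b - cnj a * v))"
    using wv by (subst hinv_diff[OF _ _ assms]) (auto simp: norm_divide norm_mult)
  also have "\<dots> \<le> 2 * norm (w - v) / ((1 / norm a) * (1 / norm a))"
    using lo[of w] lo[of v] wv a by (intro divide_left_mono mult_mono mult_pos_pos) (auto intro: less_le_trans[of _ "1 / norm a"])
  also have "\<dots> = 2 * (norm a)\<^sup>2 * norm (w - v)" by (simp add: power2_eq_square)
  finally show "dist (hinv a b w) (hinv a b v) \<le> 2 * (norm a)\<^sup>2 * dist w v" by (simp add: dist_norm)
qed simp

lemma continuous_on_hmap: assumes "a \<noteq> 0" "S \<subseteq> ball 0 1" shows "continuous_on S (hmap a b)"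
  unfolding hmap_def using horo_den assms by (intro continuous_intros) auto

lemma lipschitz_absolutely_continuous: assumes "L-lipschitz_on {a..b} g" shows "absolutely_continuous_path a b g"
  unfolding absolutely_continuous_path_def
proof (intro allI impI)
  fix \<epsilon> :: real assume \<epsilon>: "\<epsilon> > 0"
  have L: "L \<ge> 0" using assms lipschitz_on_nonneg by blast
  show "\<exists>\<delta>>0. \<forall>I. finite I \<and> (\<forall>(s, t)\<in>I. a \<le> s \<and> s \<le> t \<and> t \<le> b) \<and> disjoint_family_on (\<lambda>(s, t). {s<..<t}) I \<and> (\<Sum>(s, t)\<in>I. t - s) < \<delta> \<longrightarrow>
        (\<Sum>(s, t)\<in>I. norm (g t - g s)) < \<epsilon>"
  proof (intro exI[of _ "\<epsilon> / (L + 1)"] conjI allI impI)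
    show "\<epsilon> / (L + 1) > 0" using \<epsilon> L by simp
    fix I :: "(real \<times> real) set" assume I: "finite I \<and> (\<forall>(s, t)\<in>I. a \<le> s \<and> s \<le> t \<and> t \<le> b) \<and> disjoint_family_on (\<lambda>(s, t). {s<..<t}) I \<and> (\<Sum>(s, t)\<in>I. t - s) < \<epsilon> / (L + 1)"
    have "(\<Sum>(s, t)\<in>I. norm (g t - g s)) \<le> (\<Sum>(s, t)\<in>I. L * (t - s))"
    proof (rule sum_mono, clarify)
      fix s t assume "(s, t) \<in> I"
      hence "s \<in> {a..b}" "t \<in> {a..b}" "s \<le> t" using I by auto
      thus "norm (g t - g s) \<le> L * (t - s)" using lipschitz_onD[OF assms, of t s] by (simp add: dist_norm)
    qed
    also have "\<dots> = L * (\<Sum>(s, t)\<in>I. t - s)" by (simp add: sum_distrib_left case_prod_beta)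
    also have "\<dots> \<le> L * (\<epsilon> / (L + 1))" using I L by (intro mult_left_mono) auto
    also have "\<dots> < \<epsilon>" using \<epsilon> L by (simp add: field_simps)
    finally show "(\<Sum>(s, t)\<in>I. norm (g t - g s)) < \<epsilon>" .
  qed
qed

text \<open>A Lipschitz bound on compact disks gives absolute continuity on every horizontal and
  vertical segment, not only on almost all.\<close>

lemma ACL_on_lipschitz:
  assumes "\<And>r. r < 1 \<Longrightarrow> \<exists>L. L-lipschitz_on (cball 0 r) F"
  shows "ACL_on (ball 0 1) F"
proof -
  have main: "\<exists>L. L-lipschitz_on (cbox (Complex a c) (Complex b d)) F" if sub: "cbox (Complex a c) (Complex b d) \<subseteq> ball 0 1" for a b c d
  proof (cases "cbox (Complex a c) (Complex b d) = {}")
    case True thus ?thesis by (auto intro: exI[of _ 0])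
  next
    case False
    have "continuous_on (cbox (Complex a c) (Complex b d)) norm" by (intro continuous_intros)
    then obtain z where z: "z \<in> cbox (Complex a c) (Complex b d)" "\<And>w. w \<in> cbox (Complex a c) (Complex b d) \<Longrightarrow> norm w \<le> norm z"
      using continuous_attains_sup[OF compact_cbox False] by blast
    have "norm z < 1" using z(1) sub by auto
    then obtain L where "L-lipschitz_on (cball 0 (norm z)) F" using assms by blast
    hence "L-lipschitz_on (cbox (Complex a c) (Complex b d)) F" using z(2) by (auto intro: lipschitz_on_subset)
    thus ?thesis by blast
  qed
  show ?thesis unfolding ACL_on_def
  proof (intro allI impI conjI AE_I2)
    fix a b c d assume sub: "cbox (Complex a c) (Complex b d) \<subseteq> ball 0 1"
    obtain L where L: "L-lipschitz_on (cbox (Complex a c) (Complex b d)) F" using main[OF sub] by blast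
    { fix y assume y: "y \<in> {c..d}"
      have "L-lipschitz_on {a..b} (\<lambda>x. F (Complex x y))"
      proof (rule lipschitz_onI)
        fix s t assume st: "s \<in> {a..b}" "t \<in> {a..b}"
        have "Complex s y \<in> cbox (Complex a c) (Complex b d)" "Complex t y \<in> cbox (Complex a c) (Complex b d)"
          using y st by (auto simp: in_cbox_complex_iff)
        hence "dist (F (Complex s y)) (F (Complex t y)) \<le> L * dist (Complex s y) (Complex t y)" using L by (rule lipschitz_onD[rotated])
        thus "dist (F (Complex s y)) (F (Complex t y)) \<le> L * dist s t" by (simp add: dist_norm complex_diff cmod_def)
      qed (use L lipschitz_on_nonneg in blast)
      thus "absolutely_continuous_path a b (\<lambda>x. F (Complex x y))" by (rule lipschitz_absolutely_continuous) }
    { fix x assume x: "x \<in> {a..b}"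
      have "L-lipschitz_on {c..d} (\<lambda>y. F (Complex x y))"
      proof (rule lipschitz_onI)
        fix s t assume st: "s \<in> {c..d}" "t \<in> {c..d}"
        have "Complex x s \<in> cbox (Complex a c) (Complex b d)" "Complex x t \<in> cbox (Complex a c) (Complex b d)"
          using x st by (auto simp: in_cbox_complex_iff)
        hence "dist (F (Complex x s)) (F (Complex x t)) \<le> L * dist (Complex x s) (Complex x t)" using L by (rule lipschitz_onD[rotated])
        thus "dist (F (Complex x s)) (F (Complex x t)) \<le> L * dist s t" by (simp add: dist_norm complex_diff cmod_def)
      qed (use L lipschitz_on_nonneg in blast)
      thus "absolutely_continuous_path c d (\<lambda>y. F (Complex x y))" by (rule lipschitz_absolutely_continuous) }
  qed
qed

lemma finite_pieces: assumes "r < 1"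
  shows "finite {(a, b). ubasis a b \<and> (\<exists>z\<in>cball 0 r. hmap a b z \<in> stdpiece)}"
proof -
  \<comment> \<open>In the chart the two values are 1 / y and (x^2 + y^2) / y. As y \<ge> 1/2 they
    are at most 2 and 1 + y, and \<open>horo_lower\<close> bounds y by 1 / (1 - r)^2.\<close>
  let ?B = "3 + 1 / (1 - r)\<^sup>2"
  let ?F = "{c \<in> lat. \<exists>z. norm z \<le> r \<and> horo c z \<le> ?B}"
  have "{(a, b). ubasis a b \<and> (\<exists>z\<in>cball 0 r. hmap a b z \<in> stdpiece)} \<subseteq> ?F \<times> ?F"
  proof clarify
    fix a b z assume ab: "ubasis a b" and z: "z \<in> cball 0 r" and m: "hmap a b z \<in> stdpiece"
    note d = ubasis_det[OF ab]
    have zb: "z \<in> ball 0 1" "norm z \<le> r" using z assms by auto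
    define x y where "x = Re (hmap a b z)" and "y = Im (hmap a b z)"
    have n2: "(norm (hmap a b z))\<^sup>2 = x\<^sup>2 + y\<^sup>2" by (simp add: cmod_power2 x_def y_def)
    have s: "\<bar>x\<bar> \<le> 1 / 2" "y > 0" "norm (hmap a b z) \<ge> 1" using m by (auto simp: stdpiece_def x_def y_def)
    have x2: "x\<^sup>2 \<le> 1 / 4" using power_mono[of "\<bar>x\<bar>" "1 / 2" 2] s(1) by (simp add: power_divide)
    have "1\<^sup>2 \<le> (norm (hmap a b z))\<^sup>2" using s(3) by (intro power_mono) auto
    hence "(1 / 2)\<^sup>2 \<le> y\<^sup>2" using x2 unfolding n2 by (simp add: power_divide)
    hence y: "y \<ge> 1 / 2" using s(2) by (meson power2_le_imp_le less_imp_le)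
    have ha: "horo a z = 1 / y" "horo b z = (x\<^sup>2 + y\<^sup>2) / y"
      using horo_hmap(1)[OF zb(1) d] horo_comb[OF zb(1) d, of 0 1] n2 by (simp_all add: y_def)
    have a: "a \<in> lat" "b \<in> lat" "a \<noteq> 0" using ab d by (auto simp: ubasis_def)
    have "1 \<le> (norm a)\<^sup>2"
    proof -
      obtain p q :: int where pq: "Re a = of_int p" "Im a = of_int q" using a(1) by (auto simp: lat_def elim!: Ints_cases)
      have "p\<^sup>2 + q\<^sup>2 \<noteq> 0" using a(3) pq by (auto simp: complex_eq_iff sum_power2_eq_zero_iff)
      hence "p\<^sup>2 + q\<^sup>2 \<ge> 1" using zero_le_power2[of p] zero_le_power2[of q] by linarith
      hence "real_of_int (p\<^sup>2 + q\<^sup>2) \<ge> 1" by linarith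
      thus ?thesis by (simp add: cmod_power2 pq)
    qed
    hence "1 * (1 - r)\<^sup>2 \<le> (norm a)\<^sup>2 * (1 - r)\<^sup>2" by (intro mult_right_mono) auto
    also have "\<dots> \<le> 1 / y" using horo_lower[OF zb(2) assms, of a] ha(1) by simp
    finally have yu: "y \<le> 1 / (1 - r)\<^sup>2" using s(2) assms by (simp add: field_simps)
    have h1: "1 / y \<le> 2" using y s(2) by (simp add: divide_le_eq)
    have "(x\<^sup>2 + y\<^sup>2) / y = x\<^sup>2 * (1 / y) + y" using s(2) by (simp add: add_divide_distrib power2_eq_square)
    also have "\<dots> \<le> 1 / 4 * 2 + y" using x2 h1 s(2) by (intro add_mono mult_mono) auto
    finally have "(x\<^sup>2 + y\<^sup>2) / y \<le> 1 + y" by simp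
    hence "horo a z \<le> ?B" "horo b z \<le> ?B" unfolding ha using h1 yu zero_le_power2[of "1 - r"] by (auto simp: add_increasing2)
    thus "a \<in> ?F \<and> b \<in> ?F" using a zb(2) by blast
  qed
  thus ?thesis using finite_horo[OF assms, of ?B] finite_subset by blast
qed

section \<open>Local Lipschitz continuity of the extension\<close>

context shear_map
begin

definition Eb :: real where "Eb = exp Kb"

lemma Eb: "Eb \<ge> 1" "exp (- Kb) = 1 / Eb"
  using Kb_pos by (simp_all add: Eb_def exp_minus inverse_eq_divide)

lemma kap_lipschitz:
  obtains L where "\<And>l r. 1 / Eb \<le> l \<Longrightarrow> l \<le> Eb \<Longrightarrow> 1 / Eb \<le> r \<Longrightarrow> r \<le> Eb \<Longrightarrow> L-lipschitz_on {m. \<bar>Re m\<bar> \<le> 1 / 2} (kap l r)"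
proof -
  obtain c C where cC: "0 < c" "c \<le> 1" "1 \<le> C" 
    "\<And>l r x. 1 / Eb \<le> l \<Longrightarrow> l \<le> Eb \<Longrightarrow> 1 / Eb \<le> r \<Longrightarrow> r \<le> Eb \<Longrightarrow> \<bar>x\<bar> \<le> 1 / 2 \<Longrightarrow>
      c \<le> Im (garc l r x) \<and> Im (garc l r x) \<le> C \<and>
      (\<exists>X Y. ((\<lambda>x. Re (garc l r x)) has_real_derivative X) (at x) \<and> ((\<lambda>x. Im (garc l r x)) has_real_derivative Y) (at x) \<and>
         c \<le> X \<and> X \<le> C \<and> \<bar>Y\<bar> \<le> C)"
    using garc_bounds[OF Eb(1)] by metis
  have "(2 * C + 2)-lipschitz_on {m. \<bar>Re m\<bar> \<le> 1 / 2} (kap l r)" if lr: "1 / Eb \<le> l" "l \<le> Eb" "1 / Eb \<le> r" "r \<le> Eb" for l r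
  proof (rule lipschitz_onI)
    let ?S = "{- 1 / 2..1 / 2 :: real}"
    fix m m' assume m: "m \<in> {m. \<bar>Re m\<bar> \<le> 1 / 2}" "m' \<in> {m. \<bar>Re m\<bar> \<le> 1 / 2}"
    hence S: "Re m \<in> ?S" "Re m' \<in> ?S" by (auto simp: abs_le_iff)
    have abs: "\<bar>x\<bar> \<le> 1 / 2" if "x \<in> ?S" for x using that by (auto simp: abs_le_iff)
    have "\<forall>x\<in>?S. \<exists>X Y. ((\<lambda>x. Re (garc l r x)) has_real_derivative X) (at x) \<and> ((\<lambda>x. Im (garc l r x)) has_real_derivative Y) (at x) \<and>
         c \<le> X \<and> X \<le> C \<and> \<bar>Y\<bar> \<le> C" using cC(4)[OF lr abs] by blast
    then obtain X Y where XY: "\<And>x. x \<in> ?S \<Longrightarrow> ((\<lambda>x. Re (garc l r x)) has_real_derivative X x) (at x)"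
      "\<And>x. x \<in> ?S \<Longrightarrow> ((\<lambda>x. Im (garc l r x)) has_real_derivative Y x) (at x)" "\<And>x. x \<in> ?S \<Longrightarrow> c \<le> X x \<and> X x \<le> C \<and> \<bar>Y x\<bar> \<le> C"
      by metis
    have 1: "norm (Re (garc l r (Re m)) - Re (garc l r (Re m'))) \<le> C * norm (Re m - Re m')"
      by (rule field_differentiable_bound[where f' = X, OF _ _ _ S]) (use XY cC(1) in \<open>force intro: has_field_derivative_at_within\<close>)+
    have 2: "norm (Im (garc l r (Re m)) - Im (garc l r (Re m'))) \<le> C * norm (Re m - Re m')"
      by (rule field_differentiable_bound[where f' = Y, OF _ _ _ S]) (use XY in \<open>force intro: has_field_derivative_at_within\<close>)+
    have 3: "norm (sqrt (1 - (Re m)\<^sup>2) - sqrt (1 - (Re m')\<^sup>2)) \<le> 1 * norm (Re m - Re m')"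
      by (rule field_differentiable_bound[where f' = "\<lambda>x. - x / sqrt (1 - x\<^sup>2)", OF _ _ _ S])
        (use sqrt_deriv abs in \<open>force intro: has_field_derivative_at_within\<close>)+
    have re: "\<bar>Re m - Re m'\<bar> \<le> norm (m - m')" "\<bar>Im m - Im m'\<bar> \<le> norm (m - m')" using abs_Re_le_cmod[of "m - m'"] abs_Im_le_cmod[of "m - m'"] by simp_all
    have "norm (kap l r m - kap l r m') \<le> \<bar>Re (kap l r m - kap l r m')\<bar> + \<bar>Im (kap l r m - kap l r m')\<bar>" by (rule cmod_le)
    also have "\<dots> \<le> (C * \<bar>Re m - Re m'\<bar>) + (C * \<bar>Re m - Re m'\<bar> + \<bar>Im m - Im m'\<bar> + 1 * \<bar>Re m - Re m'\<bar>)"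
      using 1 2 3 unfolding kap_sel minus_complex.sel real_norm_def by linarith
    also have "\<dots> \<le> C * norm (m - m') + (C * norm (m - m') + norm (m - m') + 1 * norm (m - m'))"
      using re cC by (intro add_mono mult_left_mono) auto
    also have "\<dots> = (2 * C + 2) * norm (m - m')" by (simp add: algebra_simps)
    finally show "dist (kap l r m) (kap l r m') \<le> (2 * C + 2) * dist m m'" by (simp add: dist_norm)
  qed (use cC in simp)
  thus ?thesis using that by blast
qed

lemma f_piece_lipschitz: assumes "ubasis a b" "r < 1"
  shows "\<exists>L. L-lipschitz_on {z \<in> cball 0 r. hmap a b z \<in> stdpiece} f"
proof -
  obtain a' b' l \<rho> where e: "quad_lift a b a' b' l \<rho>" "exp (- Kb) \<le> l" "l \<le> exp Kb" "exp (- Kb) \<le> \<rho>" "\<rho> \<le> exp Kb"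
    "\<And>z. z \<in> ball 0 1 \<Longrightarrow> hmap a b z \<in> stdpiece \<Longrightarrow> f z \<in> ball 0 1 \<and> hmap a' b' (f z) = kap l \<rho> (hmap a b z)"
    using edge_piece[OF assms(1)] by metis
  obtain L where L: "\<And>l r. 1 / Eb \<le> l \<Longrightarrow> l \<le> Eb \<Longrightarrow> 1 / Eb \<le> r \<Longrightarrow> r \<le> Eb \<Longrightarrow> L-lipschitz_on {m. \<bar>Re m\<bar> \<le> 1 / 2} (kap l r)"
    using kap_lipschitz by blast
  have q: "cdet a' b' = 1" "l > 0" "\<rho> > 0" using e(1) by (simp_all add: quad_lift_def)
  let ?P = "{z \<in> cball 0 r. hmap a b z \<in> stdpiece}"
  have Lk: "L-lipschitz_on {m. \<bar>Re m\<bar> \<le> 1 / 2} (kap l \<rho>)" by (rule L) (use e(2-5) in \<open>simp_all only: Eb(2) Eb_def\<close>)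
  have 1: "(2 / ((norm a)\<^sup>2 * (1 - r)\<^sup>2))-lipschitz_on ?P (hmap a b)"
    by (rule lipschitz_on_subset[OF hmap_lipschitz[OF ubasis_det[OF assms(1)] assms(2)]]) auto
  have 2: "L-lipschitz_on (hmap a b ` ?P) (kap l \<rho>)" by (rule lipschitz_on_subset[OF Lk]) (auto simp: stdpiece_def)
  have 3: "(2 * (norm a')\<^sup>2)-lipschitz_on ((\<lambda>z. kap l \<rho> (hmap a b z)) ` ?P) (hinv a' b')"
    by (rule lipschitz_on_subset[OF hinv_lipschitz[OF q(1)]]) (use kap_region(1)[OF q(2,3)] in \<open>auto intro: less_imp_le\<close>)
  have "\<exists>K. K-lipschitz_on ?P (\<lambda>z. hinv a' b' (kap l \<rho> (hmap a b z)))"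
    using lipschitz_on_compose2[OF lipschitz_on_compose2[OF 1 2] 3] by blast
  then obtain K where K: "K-lipschitz_on ?P (\<lambda>z. hinv a' b' (kap l \<rho> (hmap a b z)))" by blast
  have "hinv a' b' (kap l \<rho> (hmap a b z)) = f z" if "z \<in> ?P" for z
  proof -
    have zb: "z \<in> ball 0 1" "hmap a b z \<in> stdpiece" using that assms(2) by auto
    show ?thesis using e(6)[OF zb] hinv_hmap[OF q(1)] by metis
  qed
  hence "K-lipschitz_on ?P f" using K unfolding lipschitz_on_def by simp
  thus ?thesis by blast
qed

text \<open>On each of finitely many closed pieces the map is a composition of two Moebius charts
  and \<open>kap\<close>, all Lipschitz there.\<close>

lemma f_lipschitz: assumes "r < 1" shows "\<exists>L. L-lipschitz_on (cball 0 r) f"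
proof -
  define F where "F = {(a, b). ubasis a b \<and> (\<exists>z\<in>cball 0 r. hmap a b z \<in> stdpiece)}"
  define P where "P = (\<lambda>(a, b). {z \<in> cball 0 r. hmap a b z \<in> stdpiece})"
  have fin: "finite F" unfolding F_def by (rule finite_pieces[OF assms])
  have cov: "cball 0 r \<subseteq> (\<Union>i\<in>F. P i)"
  proof
    fix z :: complex assume z: "z \<in> cball 0 r"
    hence zb: "z \<in> ball 0 1" using assms by auto
    obtain a b where ab: "ubasis a b" "\<bar>Re (hmap a b z)\<bar> \<le> 1 / 2" "norm (hmap a b z) \<ge> 1" using reduced_exists[OF zb] by blast
    hence "hmap a b z \<in> stdpiece" using horo_hmap(2)[OF zb ubasis_det[OF ab(1)]] by (simp add: stdpiece_def)
    hence "(a, b) \<in> F" "z \<in> P (a, b)" using ab(1) z by (auto simp: F_def P_def)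
    thus "z \<in> (\<Union>i\<in>F. P i)" by blast
  qed
  have clo: "closed (P i)" if "i \<in> F" for i
  proof -
    obtain a b where ia: "i = (a, b)" by (cases i)
    hence i: "i = (a, b)" "ubasis a b" using that by (simp_all add: F_def)
    note d = ubasis_det[OF i(2)]
    have sub: "cball 0 r \<subseteq> ball (0 :: complex) 1" using assms by auto
    have "P i = cball 0 r \<inter> hmap a b -` {m. \<bar>Re m\<bar> \<le> 1 / 2 \<and> norm m \<ge> 1}"
      using horo_hmap(2)[OF _ d] sub by (auto simp: P_def i stdpiece_def)
    moreover have "closed {m. \<bar>Re m\<bar> \<le> 1 / 2 \<and> norm m \<ge> (1 :: real)}"
      by (intro closed_Collect_conj closed_Collect_le continuous_intros)
    moreover have "continuous_on (cball 0 r) (hmap a b)" by (rule continuous_on_hmap[OF _ sub]) (use d in auto)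
    ultimately show ?thesis by (simp only: continuous_closed_preimage[OF _ closed_cball])
  qed
  have "\<forall>i\<in>F. \<exists>L. L-lipschitz_on (P i) f" using f_piece_lipschitz[OF _ assms] by (auto simp: F_def P_def)
  then obtain L where L: "\<And>i. i \<in> F \<Longrightarrow> (L i)-lipschitz_on (P i) f" by metis
  define K where "K = (\<Sum>i\<in>F. \<bar>L i\<bar>)"
  have K0: "K \<ge> 0" by (simp add: K_def sum_nonneg)
  have LK: "K-lipschitz_on (P i) f" if "i \<in> F" for i
  proof (rule lipschitz_on_le[OF L[OF that]])
    have "\<bar>L i\<bar> \<le> K" unfolding K_def by (rule member_le_sum) (use that fin in auto)
    thus "L i \<le> K" by simp
  qed
  have "K-lipschitz_on (cball 0 r) f"
  proof (rule lipschitz_onI)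
    fix z w :: complex assume zw: "z \<in> cball 0 r" "w \<in> cball 0 r"
    \<comment> \<open>Lipschitz bounds on closed pieces patch together on an interval but not on a
      general union, hence the restriction to segments.\<close>
    define \<gamma> where "\<gamma> t = (1 - t) *\<^sub>R z + t *\<^sub>R w" for t :: real
    have \<gamma>d: "dist (\<gamma> s) (\<gamma> t) = dist s t * dist z w" for s t
    proof -
      have "\<gamma> s - \<gamma> t = (t - s) *\<^sub>R (z - w)" by (simp add: \<gamma>_def algebra_simps)
      thus ?thesis by (simp add: dist_norm abs_minus_commute)
    qed
    have \<gamma>in: "\<gamma> t \<in> cball 0 r" if "t \<in> {0..1}" for t
      unfolding \<gamma>_def using convex_cball[of 0 r] zw that by (intro convexD) auto
    let ?U = "\<lambda>i. {0..1} \<inter> \<gamma> -` P i"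
    have "(K * dist z w)-lipschitz_on {0..1} (\<lambda>t. f (\<gamma> t))"
    proof (rule lipschitz_on_closed_Union[of F _ ?U])
      fix i assume i: "i \<in> F"
      show "closed (?U i)" by (intro continuous_closed_preimage clo i) (auto simp: \<gamma>_def intro!: continuous_intros)
      show "(K * dist z w)-lipschitz_on (?U i) (\<lambda>t. f (\<gamma> t))"
      proof (rule lipschitz_onI)
        fix s t assume "s \<in> ?U i" "t \<in> ?U i"
        hence "dist (f (\<gamma> s)) (f (\<gamma> t)) \<le> K * dist (\<gamma> s) (\<gamma> t)" using lipschitz_onD[OF LK[OF i]] by auto
        thus "dist (f (\<gamma> s)) (f (\<gamma> t)) \<le> K * dist z w * dist s t" by (simp add: \<gamma>d mult_ac)
      qed (use K0 in simp)
    next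
      show "{0..1} \<subseteq> (\<Union>i\<in>F. ?U i)" using \<gamma>in cov by blast
    qed (use fin K0 in auto)
    hence "dist (f (\<gamma> 0)) (f (\<gamma> 1)) \<le> K * dist z w * dist 0 (1 :: real)" by (rule lipschitz_onD) auto
    thus "dist (f z) (f w) \<le> K * dist z w" by (simp add: \<gamma>_def)
  qed (rule K0)
  thus ?thesis by blast
qed

lemma continuous_f: "continuous_on (ball 0 1) f"
proof (rule continuous_at_imp_continuous_on, rule ballI)
  fix z :: complex assume z: "z \<in> ball 0 1"
  define r where "r = (1 + norm z) / 2"
  have r: "norm z < r" "r < 1" using z by (auto simp: r_def)
  obtain L where "L-lipschitz_on (cball 0 r) f" using f_lipschitz[OF r(2)] by blast
  hence "continuous_on (ball 0 r) f" using lipschitz_on_continuous_on continuous_on_subset ball_subset_cball by blast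
  thus "isCont f z" using r(1) by (simp add: continuous_on_eq_continuous_at)
qed

definition clreg :: "complex \<Rightarrow> complex set" where
  "clreg a = {z \<in> ball 0 1. \<forall>c\<in>prim. horo a z \<le> horo c z}"

lemma clreg_exists: assumes "z \<in> ball 0 1" shows "\<exists>a\<in>prim. z \<in> clreg a"
proof -
  obtain a b where ab: "ubasis a b" "\<bar>Re (hmap a b z)\<bar> \<le> 1 / 2" "norm (hmap a b z) \<ge> 1" using reduced_exists[OF assms] by blast
  have "z \<in> clreg a" using reduced_min(1)[OF ab(1) assms ab(2,3)] assms by (simp add: clreg_def)
  thus ?thesis using ubasis_prim(1)[OF ab(1)] by blast
qed

lemma clreg_chart: assumes "ubasis a b" "z \<in> clreg a"
  obtains n :: int where "\<bar>Re (hmap a b z - of_int n)\<bar> \<le> 1 / 2" "norm (hmap a b z - of_int n) \<ge> 1"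
proof -
  note d = ubasis_det[OF assms(1)]
  have zb: "z \<in> ball 0 1" using assms(2) by (simp add: clreg_def)
  have im: "Im (hmap a b z) > 0" using horo_hmap(2)[OF zb d] .
  define n where "n = round (Re (hmap a b z))"
  let ?c = "b - of_int n * a"
  have c: "?c \<in> prim" using ubasis_prim(2) ubasis_trans(5)[OF assms(1)] by blast
  have "horo a z \<le> horo ?c z" using assms(2) c by (simp add: clreg_def)
  moreover have "horo ?c z = (norm (hmap a b z - of_int n))\<^sup>2 / Im (hmap a b z)"
    using horo_comb[OF zb d, of "- of_int n" 1] by simp
  ultimately have "1 \<le> (norm (hmap a b z - of_int n))\<^sup>2" using im horo_hmap(1)[OF zb d] by (simp add: divide_le_cancel)
  hence "norm (hmap a b z - of_int n) \<ge> 1" using abs_le_square_iff[of 1 "norm (hmap a b z - of_int n)"] by simp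
  moreover have "\<bar>Re (hmap a b z - of_int n)\<bar> \<le> 1 / 2"
    using of_int_round_abs_le[of "Re (hmap a b z)"] by (simp add: n_def abs_minus_commute)
  ultimately show ?thesis using that by blast
qed

end

lemma int_step_bounds:
  fixes \<xi> :: "int \<Rightarrow> real" assumes "\<And>n. e \<le> \<xi> (n + 1) - \<xi> n"
  shows "n \<ge> 0 \<Longrightarrow> \<xi> n \<ge> \<xi> 0 + of_int n * e" "n \<le> 0 \<Longrightarrow> \<xi> n \<le> \<xi> 0 + of_int n * e"
proof -
  show "n \<ge> 0 \<Longrightarrow> \<xi> n \<ge> \<xi> 0 + of_int n * e"
  proof (induction n rule: int_ge_induct)
    case (step i) thus ?case using assms[of i] by (simp add: distrib_right)
  qed simp
  show "n \<le> 0 \<Longrightarrow> \<xi> n \<le> \<xi> 0 + of_int n * e"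
  proof (induction n rule: int_le_induct)
    case (step i) thus ?case using assms[of "i - 1"] by (simp add: left_diff_distrib)
  qed simp
qed

lemma int_partition:
  fixes \<mu> :: "int \<Rightarrow> real" assumes "e > 0" "\<And>n. e \<le> \<mu> (n + 1) - \<mu> n"
  obtains n where "\<mu> (n - 1) \<le> x" "x \<le> \<mu> n"
proof -
  obtain N :: nat where N: "\<bar>x - \<mu> 0\<bar> / e < real N" using reals_Archimedean2 by blast
  hence N': "\<bar>x - \<mu> 0\<bar> < real N * e" using assms(1) by (simp add: divide_less_eq)
  have lo: "\<mu> (- int N) \<le> x" using int_step_bounds(2)[where \<xi> = \<mu> and e = e, OF assms(2), of "- int N"] N' by (simp add: abs_less_iff)
  have hi: "x \<le> \<mu> (int N)" using int_step_bounds(1)[where \<xi> = \<mu> and e = e, OF assms(2), of "int N"] N' by (simp add: abs_less_iff)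
  have "n \<ge> - int N \<Longrightarrow> x \<le> \<mu> n \<Longrightarrow> \<exists>m. \<mu> (m - 1) \<le> x \<and> x \<le> \<mu> m" for n
  proof (induction n rule: int_ge_induct)
    case base
    hence "x = \<mu> (- int N)" using lo by simp
    thus ?case using assms(1) assms(2)[of "- int N"] by (intro exI[of _ "- int N + 1"]) auto
  next
    case (step i)
    show ?case
    proof (cases "x \<le> \<mu> i")
      case True thus ?thesis using step by blast
    next
      case False thus ?thesis using step by (intro exI[of _ "i + 1"]) auto
    qed
  qed
  from this[of "int N"] hi that show ?thesis by auto
qed

section \<open>Properness\<close>

lemma compact_in_ball: assumes "compact K" "K \<subseteq> ball (0 :: complex) 1" obtains r where "r < 1" "\<And>z. z \<in> K \<Longrightarrow> norm z \<le> r"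
proof (cases "K = {}")
  case True thus ?thesis using that[of 0] by simp
next
  case False
  have "continuous_on K norm" by (intro continuous_intros)
  then obtain z where z: "z \<in> K" "\<And>w. w \<in> K \<Longrightarrow> norm w \<le> norm z"
    using continuous_attains_sup[OF assms(1) False] by blast
  thus ?thesis using that[of "norm z"] assms(2) by auto
qed

lemma horo_alt: assumes "a \<noteq> 0" shows "horo a z = (norm a)\<^sup>2 * (norm (z - bpt a))\<^sup>2 / (1 - (norm z)\<^sup>2)"
proof -
  have "a - cnj a * z = - cnj a * (z - bpt a)" using assms by (simp add: bpt_def field_simps)
  thus ?thesis by (simp add: horo_def norm_mult power_mult_distrib)
qed

lemma arcR_le: assumes "l > 0" "r > 0" shows "arcR l r \<le> l + r"
proof (rule power2_le_imp_le)
  have "l * r > 0" using assms by simp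
  thus "(arcR l r)\<^sup>2 \<le> (l + r)\<^sup>2" unfolding arcR_pos(2)[OF assms] by (simp add: power2_sum)
qed (use assms in simp)

context shear_map
begin

text \<open>In the normalised image chart the lower boundary of the image cell has height at least
  c, and every height above 2 \<open>Eb\<close> exceeds the radii of all arcs. Both levels are the
  same for all vertices; the radius r' of the last part may depend on the vertex.\<close>

lemma horoball_data:
  obtains c where "c > 0" "\<And>a. a \<in> prim \<Longrightarrow> \<exists>a'. a' \<noteq> 0 \<and> h (bpt a) = bpt a' \<and> (\<forall>z\<in>clreg a. horo a' (f z) \<le> 1 / c) \<and>
    (\<forall>q\<in>ball 0 1. horo a' q < 1 / (2 * Eb) \<longrightarrow> (\<exists>z\<in>reg a. f z = q)) \<and>
    (\<forall>r<1. \<exists>r'<1. \<forall>z\<in>clreg a. norm (f z) \<le> r \<longrightarrow> norm z \<le> r')"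
proof -
  obtain c C where cC: "0 < c" "c \<le> 1" "1 \<le> C" 
    "\<And>l r x. 1 / Eb \<le> l \<Longrightarrow> l \<le> Eb \<Longrightarrow> 1 / Eb \<le> r \<Longrightarrow> r \<le> Eb \<Longrightarrow> \<bar>x\<bar> \<le> 1 / 2 \<Longrightarrow>
      c \<le> Im (garc l r x) \<and> Im (garc l r x) \<le> C \<and>
      (\<exists>X Y. ((\<lambda>x. Re (garc l r x)) has_real_derivative X) (at x) \<and> ((\<lambda>x. Im (garc l r x)) has_real_derivative Y) (at x) \<and>
         c \<le> X \<and> X \<le> C \<and> \<bar>Y\<bar> \<le> C)"
    using garc_bounds[OF Eb(1)] by metis
  have "\<exists>a'. a' \<noteq> 0 \<and> h (bpt a) = bpt a' \<and> (\<forall>z\<in>clreg a. horo a' (f z) \<le> 1 / c) \<and>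
    (\<forall>q\<in>ball 0 1. horo a' q < 1 / (2 * Eb) \<longrightarrow> (\<exists>z\<in>reg a. f z = q)) \<and>
    (\<forall>r<1. \<exists>r'<1. \<forall>z\<in>clreg a. norm (f z) \<le> r \<longrightarrow> norm z \<le> r')" if a: "a \<in> prim" for a
  proof -
    obtain b a' b' \<xi> where p: "ubasis a b" "cdet a' b' = 1" "h (bpt a) = bpt a'"
      "\<And>n::int. h (bpt (b - of_int n * a)) = bpt (b' - of_real (\<xi> n) * a')"
      "\<And>n. exp (- Kb) \<le> \<xi> (n + 1) - \<xi> n" "\<And>n. \<xi> (n + 1) - \<xi> n \<le> exp Kb"
      "\<And>n. shear h {bpt a, bpt (b - of_int n * a)} = ln ((\<xi> (n + 1) - \<xi> n) / (\<xi> n - \<xi> (n - 1)))"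
      "\<And>n z. z \<in> ball 0 1 \<Longrightarrow> \<bar>Re (hmap a b z - of_int n)\<bar> \<le> 1 / 2 \<Longrightarrow> norm (hmap a b z - of_int n) \<ge> 1 \<Longrightarrow>
         f z \<in> ball 0 1 \<and> hmap a' b' (f z) = of_real (\<xi> n) + kap (\<xi> n - \<xi> (n - 1)) (\<xi> (n + 1) - \<xi> n) (hmap a b z - of_int n)"
      using piece[OF a] by metis
    note d = ubasis_det[OF p(1)]
    have a'0: "a' \<noteq> 0" "a \<noteq> 0" using p(2) d by auto
    have E0: "1 / Eb > 0" using Eb(1) by simp
    have gap: "1 / Eb \<le> \<xi> (n + 1) - \<xi> n" "\<xi> (n + 1) - \<xi> n \<le> Eb" for n
      using p(5,6)[of n] unfolding Eb(2) by (simp_all add: Eb_def)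
    have gap': "1 / Eb \<le> \<xi> n - \<xi> (n - 1)" "\<xi> n - \<xi> (n - 1) \<le> Eb" for n using gap[of "n - 1"] by simp_all
    have gp: "\<xi> (n + 1) - \<xi> n > 0" "\<xi> n - \<xi> (n - 1) > 0" for n using gap[of n] gap'[of n] E0 by linarith+
    have ev: "\<exists>n m. m \<in> stdpiece \<and> m = hmap a b z - of_int n \<and> hmap a' b' (f z) = of_real (\<xi> n) + kap (\<xi> n - \<xi> (n - 1)) (\<xi> (n + 1) - \<xi> n) m"
      if z: "z \<in> clreg a" for z
    proof -
      have zb: "z \<in> ball 0 1" using z by (simp add: clreg_def)
      obtain n where n: "\<bar>Re (hmap a b z - of_int n)\<bar> \<le> 1 / 2" "norm (hmap a b z - of_int n) \<ge> 1" using clreg_chart[OF p(1) z] by blast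
      have "hmap a b z - of_int n \<in> stdpiece" using n horo_hmap(2)[OF zb d] by (simp add: stdpiece_def)
      thus ?thesis using p(8)[OF zb n] by blast
    qed
    have 1: "horo a' (f z) \<le> 1 / c" if z: "z \<in> clreg a" for z
    proof -
      have fb: "f z \<in> ball 0 1" using z by (intro f_ball) (simp add: clreg_def)
      obtain n m where m: "m \<in> stdpiece" "hmap a' b' (f z) = of_real (\<xi> n) + kap (\<xi> n - \<xi> (n - 1)) (\<xi> (n + 1) - \<xi> n) m"
        using ev[OF z] by blast
      have ms: "Im m > 0" "\<bar>Re m\<bar> \<le> 1 / 2" "norm m \<ge> 1" using m(1) by (auto simp: stdpiece_def)
      have "c \<le> Im (hmap a' b' (f z))"
        using cC(4)[OF gap'(1)[of n] gap'(2)[of n] gap(1)[of n] gap(2)[of n] ms(2)] above_unit_circle(1)[OF ms(3,1,2)] by (simp add: m(2) kap_sel)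
      thus ?thesis unfolding horo_hmap(1)[OF fb p(2)] using cC(1) by (simp add: frac_le)
    qed
    have 2: "\<exists>z\<in>reg a. f z = q" if q: "q \<in> ball 0 1" "horo a' q < 1 / (2 * Eb)" for q
    proof -
      define w where "w = hmap a' b' q"
      have im: "Im w > 0" unfolding w_def by (rule horo_hmap(2)[OF q(1) p(2)])
      have wE: "Im w > 2 * Eb" using q(2) im Eb(1) unfolding horo_hmap(1)[OF q(1) p(2)] w_def[symmetric] by (simp add: divide_simps)
      \<comment> \<open>The image of the n-th piece occupies the abscissas between the midpoints
        \<open>\<mu> (n - 1)\<close> and \<open>\<mu> n\<close>.\<close>
      define \<mu> where "\<mu> n = (\<xi> n + \<xi> (n + 1)) / 2" for n
      have "1 / Eb \<le> \<mu> (n + 1) - \<mu> n" for n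
      proof -
        have "\<mu> (n + 1) - \<mu> n = (\<xi> (n + 1 + 1) - \<xi> (n + 1)) / 2 + (\<xi> (n + 1) - \<xi> n) / 2" by (simp add: \<mu>_def field_simps)
        moreover have "1 / Eb / 2 \<le> (\<xi> (n + 1 + 1) - \<xi> (n + 1)) / 2" "1 / Eb / 2 \<le> (\<xi> (n + 1) - \<xi> n) / 2"
          using gap(1)[of "n + 1"] gap(1)[of n] by (intro divide_right_mono; simp)+
        ultimately show ?thesis by linarith
      qed
      then obtain n where n: "\<mu> (n - 1) \<le> Re w" "Re w \<le> \<mu> n" using int_partition[OF E0, of \<mu>] by blast
      define l r where "l = \<xi> n - \<xi> (n - 1)" and "r = \<xi> (n + 1) - \<xi> n"
      have lr: "l > 0" "r > 0" "l \<le> Eb" "r \<le> Eb" using gp[of n] gap(2)[of n] gap'(2)[of n] by (simp_all add: l_def r_def)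
      have "- l / 2 \<le> Re (w - of_real (\<xi> n))" "Re (w - of_real (\<xi> n)) \<le> r / 2" using n by (simp_all add: \<mu>_def l_def r_def field_simps)
      moreover have aR: "arcR l r < Im w" using arcR_le[OF lr(1,2)] lr wE by linarith
      ultimately obtain m where m: "m \<in> stdpiece" "kap l r m = w - of_real (\<xi> n)" "Im m \<ge> sqrt (1 - (Re m)\<^sup>2) + (Im w - arcR l r)"
        using kap_surj[OF lr(1,2), of "w - of_real (\<xi> n)"] by auto
      have ms: "Im m > 0" "\<bar>Re m\<bar> \<le> 1 / 2" "norm m \<ge> 1" using m(1) by (auto simp: stdpiece_def)
      have nm: "norm m \<noteq> 1" using above_unit_circle(2)[OF ms(3,1,2)] m(3) aR by auto
      define z where "z = hinv a b (m + of_int n)"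
      have imn: "Im (m + of_int n) > 0" using ms by simp
      have zb: "z \<in> ball 0 1" unfolding z_def by (rule hinv_ball[OF d imn])
      have hz: "hmap a b z = m + of_int n" unfolding z_def by (rule hmap_hinv[OF d less_imp_le[OF imn]])
      have ub: "ubasis a (b - of_int n * a)" by (rule ubasis_trans(5)[OF p(1)])
      have hzn: "hmap a (b - of_int n * a) z = m" using hmap_shift_diff[OF zb a'0(2), of b "of_int n"] hz by simp
      have zr: "z \<in> reg a" unfolding reg_def
        using reduced_min[OF ub zb, unfolded hzn, OF ms(2,3)] nm zb by (force simp: order_less_le)
      have "hmap a' b' (f z) = of_real (\<xi> n) + kap l r m"
        using p(8)[OF zb, of n] ms by (simp add: hz l_def r_def)
      hence "hmap a' b' (f z) = hmap a' b' q" using m(2) by (simp add: w_def)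
      hence "f z = q" using hinv_hmap[OF p(2) f_ball[OF zb]] hinv_hmap[OF p(2) q(1)] by metis
      thus ?thesis using zr by blast
    qed
    have 3: "\<exists>r'<1. \<forall>z\<in>clreg a. norm (f z) \<le> r \<longrightarrow> norm z \<le> r'" if r: "r < 1" for r
    proof -
      have sub: "cball 0 r \<subseteq> ball (0 :: complex) 1" using r by auto
      have "bounded (hmap a' b' ` cball 0 r)"
        by (intro compact_imp_bounded compact_continuous_image continuous_on_hmap[OF a'0(1) sub] compact_cball)
      then obtain W where "\<forall>q\<in>cball 0 r. norm (hmap a' b' q) \<le> W" by (auto simp: bounded_iff)
      hence W: "\<And>q. q \<in> cball 0 r \<Longrightarrow> norm (hmap a' b' q) \<le> W" by blast
      \<comment> \<open>Bounds the index of the piece: \<open>\<xi> n\<close> is at most |W| +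
        \<open>Eb\<close> in absolute value, and consecutive gaps are at least 1 /
        \<open>Eb\<close>.\<close>
      define N where "N = (\<bar>W\<bar> + Eb + \<bar>\<xi> 0\<bar>) * Eb"
      \<comment> \<open>Standard pieces have height at least 1/2, and lifting to the tree changes
        the height by at most 1, so the preimage lies in this compact box.\<close>
      define Q where "Q = cbox (Complex (- N - 1) (1 / 2)) (Complex (N + 1) (W + 1))"
      have Qim: "w \<in> Q \<Longrightarrow> Im w > 0" for w by (auto simp: Q_def in_cbox_complex_iff)
      have "continuous_on Q (hinv a b)"
        unfolding hinv_def using hinv_den(2)[OF d] Qim by (intro continuous_intros) (auto simp: less_imp_le)
      hence "compact (hinv a b ` Q)" by (intro compact_continuous_image) (simp_all add: Q_def)
      moreover have "hinv a b ` Q \<subseteq> ball 0 1" using hinv_ball[OF d Qim] by blast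
      ultimately obtain r' where r': "r' < 1" "\<And>z. z \<in> hinv a b ` Q \<Longrightarrow> norm z \<le> r'" using compact_in_ball by blast
      have "norm z \<le> r'" if z: "z \<in> clreg a" "norm (f z) \<le> r" for z
      proof -
        have zb: "z \<in> ball 0 1" using z by (simp add: clreg_def)
        obtain n m where m: "m \<in> stdpiece" "m = hmap a b z - of_int n" "hmap a' b' (f z) = of_real (\<xi> n) + kap (\<xi> n - \<xi> (n - 1)) (\<xi> (n + 1) - \<xi> n) m"
          using ev[OF z(1)] by blast
        define w where "w = hmap a' b' (f z)"
        have wW: "norm w \<le> W" unfolding w_def using z(2) by (intro W) simp
        have w: "\<bar>Re w\<bar> \<le> \<bar>W\<bar>" "Im w \<le> W" using abs_Re_le_cmod[of w] abs_Im_le_cmod[of w] wW by linarith+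
        have ms: "Im m > 0" "\<bar>Re m\<bar> \<le> 1 / 2" "norm m \<ge> 1" using m(1) by (auto simp: stdpiece_def)
        have x2: "(Re m)\<^sup>2 \<le> 1 / 4" using power_mono[of "\<bar>Re m\<bar>" "1 / 2" 2] ms(2) by (simp add: power_divide)
        have u: "sqrt (1 - (Re m)\<^sup>2) \<le> 1" by simp
        have "(1 / 2 :: real)\<^sup>2 \<le> 1 - (Re m)\<^sup>2" using x2 by (simp add: power_divide)
        hence u': "1 / 2 \<le> sqrt (1 - (Re m)\<^sup>2)" by (rule real_le_rsqrt)
        have "Im (garc (\<xi> n - \<xi> (n - 1)) (\<xi> (n + 1) - \<xi> n) (Re m)) > 0" by (rule arc_Im) (use gp in auto)
        moreover have "Im (garc (\<xi> n - \<xi> (n - 1)) (\<xi> (n + 1) - \<xi> n) (Re m)) + (Im m - sqrt (1 - (Re m)\<^sup>2)) \<le> W"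
          using w(2) unfolding w_def m(3) by (simp add: kap_sel)
        ultimately have y: "Im m \<le> W + 1" "Im m \<ge> 1 / 2" using u u' above_unit_circle(1)[OF ms(3,1,2)] by linarith+
        note gr = garc_Re_bounds(1,2)[OF gp(2)[of n] gp(1)[of n] ms(2)]
        have "Re w = \<xi> n + Re (garc (\<xi> n - \<xi> (n - 1)) (\<xi> (n + 1) - \<xi> n) (Re m))" unfolding w_def m(3) by (simp add: kap_sel)
        hence xn: "\<bar>\<xi> n\<bar> \<le> \<bar>W\<bar> + Eb" using gr w(1) gap(2)[of n] gap'(2)[of n] Eb(1) by (auto simp: abs_le_iff)
        have "\<bar>of_int n\<bar> * (1 / Eb) \<le> \<bar>W\<bar> + Eb + \<bar>\<xi> 0\<bar>"
        proof (cases "n \<ge> 0")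
          case True
          have "\<xi> n \<ge> \<xi> 0 + of_int n * (1 / Eb)" by (rule int_step_bounds(1)[where \<xi> = \<xi> and e = "1 / Eb" and n = n, OF gap(1) True])
          moreover have "\<bar>real_of_int n\<bar> = of_int n" using True by simp
          ultimately show ?thesis using xn by (simp only:; linarith)
        next
          case False
          have "\<xi> n \<le> \<xi> 0 + of_int n * (1 / Eb)" by (rule int_step_bounds(2)[where \<xi> = \<xi> and e = "1 / Eb" and n = n, OF gap(1)]) (use False in simp)
          moreover have "\<bar>real_of_int n\<bar> = - of_int n" using False by simp
          ultimately show ?thesis using xn by (simp only: mult_minus_left; linarith)
        qed
        hence "\<bar>real_of_int n\<bar> \<le> N" using Eb(1) by (simp add: N_def divide_le_eq)
        hence "\<bar>Re (hmap a b z)\<bar> \<le> N + 1" using ms(2) unfolding m(2) minus_complex.sel complex_Re_of_int by linarith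
        hence "hmap a b z \<in> Q" using y unfolding m(2) by (simp add: Q_def in_cbox_complex_iff abs_le_iff)
        hence "hinv a b (hmap a b z) \<in> hinv a b ` Q" by blast
        thus ?thesis using r'(2) hinv_hmap[OF d zb] by metis
      qed
      thus ?thesis using r'(1) by blast
    qed
    show ?thesis using a'0(1) p(3) 1 2 3 by blast
  qed
  thus ?thesis using that cC(1) by blast
qed

lemma clreg_minus: "clreg (- a) = clreg a"
  by (simp add: clreg_def)

text \<open>The images of the horoballs of distinct vertices are disjoint, hence only finitely many cells
  have an image that meets a given compact set.\<close>
lemma f_proper: assumes "r < 1" shows "\<exists>r'<1. \<forall>z\<in>ball 0 1. norm (f z) \<le> r \<longrightarrow> norm z \<le> r'"
proof -
  obtain c where c: "c > 0" "\<And>a. a \<in> prim \<Longrightarrow> \<exists>a'. a' \<noteq> 0 \<and> h (bpt a) = bpt a' \<and> (\<forall>z\<in>clreg a. horo a' (f z) \<le> 1 / c) \<and>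
    (\<forall>q\<in>ball 0 1. horo a' q < 1 / (2 * Eb) \<longrightarrow> (\<exists>z\<in>reg a. f z = q)) \<and>
    (\<forall>r<1. \<exists>r'<1. \<forall>z\<in>clreg a. norm (f z) \<le> r \<longrightarrow> norm z \<le> r')"
    using horoball_data by blast
  then obtain A where A: "\<And>a. a \<in> prim \<Longrightarrow> A a \<noteq> 0 \<and> h (bpt a) = bpt (A a) \<and> (\<forall>z\<in>clreg a. horo (A a) (f z) \<le> 1 / c) \<and>
    (\<forall>q\<in>ball 0 1. horo (A a) q < 1 / (2 * Eb) \<longrightarrow> (\<exists>z\<in>reg a. f z = q))" by metis
  have "\<forall>a\<in>prim. \<exists>r'<1. \<forall>z\<in>clreg a. norm (f z) \<le> r \<longrightarrow> norm z \<le> r'" using c(2) assms by blast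
  then obtain \<rho> where \<rho>: "\<And>a. a \<in> prim \<Longrightarrow> \<rho> a < 1" "\<And>a z. a \<in> prim \<Longrightarrow> z \<in> clreg a \<Longrightarrow> norm (f z) \<le> r \<Longrightarrow> norm z \<le> \<rho> a"
    by metis
  define PA where "PA = {a \<in> prim. \<exists>z\<in>clreg a. norm (f z) \<le> r}"
  \<comment> \<open>If the image of the closed cell meets the disk of radius r, the bound 1 / c and
    \<open>horo_lower\<close> give this bound for the squared norm of the lift.\<close>
  define \<Lambda> where "\<Lambda> = 1 / (c * (1 - r)\<^sup>2)"
  have \<Lambda>: "\<Lambda> > 0" using c(1) assms by (simp add: \<Lambda>_def)
  have AL: "(norm (A a))\<^sup>2 \<le> \<Lambda>" if a: "a \<in> PA" for a
  proof -
    obtain z where z: "a \<in> prim" "z \<in> clreg a" "norm (f z) \<le> r" using a by (auto simp: PA_def)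
    have "(norm (A a))\<^sup>2 * (1 - r)\<^sup>2 \<le> horo (A a) (f z)" by (rule horo_lower[OF z(3) assms])
    also have "\<dots> \<le> 1 / c" using A[OF z(1)] z(2) by blast
    finally have "(norm (A a))\<^sup>2 * (1 - r)\<^sup>2 \<le> 1 / c" .
    hence "(norm (A a))\<^sup>2 \<le> 1 / c / (1 - r)\<^sup>2" using assms by (subst le_divide_eq) auto
    thus ?thesis by (simp add: \<Lambda>_def)
  qed
  \<comment> \<open>At depth s \<le> 1/2 below a point of the circle and within 2 s of the ideal
    point, the horocyclic distance is at most 4 \<Lambda> s. The choice of s makes this smaller than
    1 / (2 \<open>Eb\<close>).\<close>
  define s where "s = min (1 / 2) (1 / (16 * \<Lambda> * Eb))"
  have s: "0 < s" "s \<le> 1 / 2" "s \<le> 1 / (16 * \<Lambda> * Eb)" using \<Lambda> Eb(1) by (auto simp: s_def)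
  have small: "4 * \<Lambda> * s < 1 / (2 * Eb)"
  proof -
    have "4 * \<Lambda> * s \<le> 4 * \<Lambda> * (1 / (16 * \<Lambda> * Eb))" using s(3) \<Lambda> by (intro mult_left_mono) auto
    also have "\<dots> = 1 / (4 * Eb)" using \<Lambda> by simp
    also have "\<dots> < 1 / (2 * Eb)" using Eb(1) by (simp add: divide_simps)
    finally show ?thesis .
  qed
  have sep: "bpt a1 = bpt a2" if a: "a1 \<in> PA" "a2 \<in> PA" "dist (h (bpt a1)) (h (bpt a2)) < s" for a1 a2
  proof (rule ccontr)
    assume ne: "bpt a1 \<noteq> bpt a2"
    have pr: "a1 \<in> prim" "a2 \<in> prim" using a by (auto simp: PA_def)
    note A1 = A[OF pr(1)] and A2 = A[OF pr(2)]
    \<comment> \<open>If the two image vertices are closer than s, q lies in the small horoballs of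
      both, so it has preimages in two disjoint cells.\<close>
    define q where "q = of_real (1 - s) * bpt (A a1)"
    have nq: "norm q = 1 - s" using s A1 by (simp add: q_def norm_mult del: of_real_diff)
    have qb: "q \<in> ball 0 1" using nq s by simp
    have den: "1 - (norm q)\<^sup>2 = s * (2 - s)" unfolding nq by (simp add: power2_eq_square algebra_simps)
    have "q - bpt (A a1) = - of_real s * bpt (A a1)" by (simp add: q_def algebra_simps)
    hence d1: "norm (q - bpt (A a1)) = s" using s A1 by (simp add: norm_mult)
    have "norm (q - bpt (A a2)) \<le> norm (q - bpt (A a1)) + norm (bpt (A a1) - bpt (A a2))"
      using norm_triangle_ineq[of "q - bpt (A a1)" "bpt (A a1) - bpt (A a2)"] by simp
    hence d2: "norm (q - bpt (A a2)) \<le> 2 * s" using a(3) A1 A2 d1 by (simp add: dist_norm)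
    have hq: "horo (A x) q < 1 / (2 * Eb)" if x: "A x \<noteq> 0" "(norm (A x))\<^sup>2 \<le> \<Lambda>" "norm (q - bpt (A x)) \<le> 2 * s" for x
    proof -
      have "horo (A x) q \<le> \<Lambda> * (2 * s)\<^sup>2 / (s * 1)" unfolding horo_alt[OF x(1)] den
        using x s \<Lambda> by (intro frac_le mult_mono power_mono) auto
      also have "\<dots> = 4 * \<Lambda> * s" using s by (simp add: power2_eq_square)
      finally show ?thesis using small by simp
    qed
    obtain z1 where z1: "z1 \<in> reg a1" "f z1 = q" using A1 hq[of a1] AL[OF a(1)] d1 s qb by auto
    obtain z2 where z2: "z2 \<in> reg a2" "f z2 = q" using A2 hq[of a2] AL[OF a(2)] d2 qb by auto
    have "z1 = z2" using inj_onD[OF inj_f, of z1 z2] z1 z2 by (auto simp: reg_def)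
    thus False using reg_disjoint[OF pr] z1 z2 ne by (metis bpt_minus disjoint_iff)
  qed
  have "finite (h ` bpt ` PA)"
  proof -
    have "bounded (h ` bpt ` PA)"
    proof (rule boundedI)
      fix x assume "x \<in> h ` bpt ` PA"
      then obtain a where "a \<in> prim" "x = h (bpt a)" by (auto simp: PA_def)
      thus "norm x \<le> 1" using prim_nz by simp
    qed
    moreover have "uniform_discrete (h ` bpt ` PA)"
      unfolding uniform_discrete_def
    proof (intro exI[of _ s] conjI ballI impI s(1))
      fix x y assume "x \<in> h ` bpt ` PA" "y \<in> h ` bpt ` PA" and d: "dist x y < s"
      then obtain a1 a2 where a: "a1 \<in> PA" "x = h (bpt a1)" "a2 \<in> PA" "y = h (bpt a2)" by blast
      thus "x = y" using sep[OF a(1,3)] d by simp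
    qed
    ultimately show ?thesis using uniform_discrete_finite_iff by blast
  qed
  moreover have "inj_on h (bpt ` PA)" using inj_h prim_nz by (auto simp: inj_on_def PA_def)
  ultimately have finV: "finite (bpt ` PA)" using finite_imageD by blast
  have "\<forall>v\<in>bpt ` PA. \<exists>a\<in>PA. bpt a = v" by blast
  then obtain g where g: "\<And>v. v \<in> bpt ` PA \<Longrightarrow> g v \<in> PA \<and> bpt (g v) = v" by metis
  define r' where "r' = Max (insert 0 ((\<lambda>v. \<rho> (g v)) ` bpt ` PA))"
  have "r' < 1" unfolding r'_def using finV g \<rho>(1) by (subst Max_less_iff) (auto simp: PA_def)
  moreover have "norm z \<le> r'" if z: "z \<in> ball 0 1" "norm (f z) \<le> r" for z
  proof -
    obtain a where a: "a \<in> prim" "z \<in> clreg a" using clreg_exists[OF z(1)] by blast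
    have aP: "a \<in> PA" using a z(2) by (auto simp: PA_def)
    hence gv: "g (bpt a) \<in> PA" "bpt (g (bpt a)) = bpt a" using g by auto
    hence "g (bpt a) = a \<or> g (bpt a) = - a" using bpt_eq_prim[OF a(1), of "g (bpt a)"] by (auto simp: PA_def)
    hence "z \<in> clreg (g (bpt a))" using a(2) clreg_minus by auto
    hence "norm z \<le> \<rho> (g (bpt a))" using \<rho>(2) gv z(2) by (auto simp: PA_def)
    also have "\<dots> \<le> r'" unfolding r'_def using finV aP by (intro Max_ge) auto
    finally show ?thesis .
  qed
  ultimately show ?thesis by (intro exI[of _ r'] conjI ballI impI) auto
qed

text \<open>The image is open by invariance of domain; by properness it is relatively closed in the
  connected disk.\<close>

lemma surj_f: "f ` ball 0 1 = ball 0 1"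
proof
  show "f ` ball 0 1 \<subseteq> ball 0 1" using f_ball by blast
  have op: "open (f ` ball 0 1)" by (rule invariance_of_domain[OF continuous_f open_ball inj_f])
  have cl: "q \<in> f ` ball 0 1" if q: "q \<in> ball 0 1" "q \<in> closure (f ` ball 0 1)" for q
  proof -
    define r where "r = (1 + norm q) / 2"
    have r: "norm q < r" "r < 1" using q by (auto simp: r_def)
    obtain r' where r': "r' < 1" "\<And>z. z \<in> ball 0 1 \<Longrightarrow> norm (f z) \<le> r \<Longrightarrow> norm z \<le> r'" using f_proper[OF r(2)] by blast
    have sub: "cball 0 r' \<subseteq> ball (0 :: complex) 1" using r' by auto
    have "compact (f ` cball 0 r')"
      by (intro compact_continuous_image continuous_on_subset[OF continuous_f sub] compact_cball)
    hence "closed (f ` cball 0 r')" by (rule compact_imp_closed)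
    moreover have "ball 0 r \<inter> f ` ball 0 1 \<subseteq> f ` cball 0 r'" using r'(2) by fastforce
    ultimately have "closure (ball 0 r \<inter> f ` ball 0 1) \<subseteq> f ` cball 0 r'" by (simp add: closure_minimal)
    moreover have "q \<in> closure (ball 0 r \<inter> f ` ball 0 1)"
      using open_Int_closure_subset[OF open_ball, of 0 r "f ` ball 0 1"] q r by auto
    ultimately show ?thesis using sub by blast
  qed
  have "ball 0 1 \<subseteq> f ` ball 0 1 \<union> - closure (f ` ball 0 1)" using cl by blast
  moreover have "f ` ball 0 1 \<inter> - closure (f ` ball 0 1) \<inter> ball 0 1 = {}" using closure_subset[of "f ` ball 0 1"] by blast
  ultimately have "f ` ball 0 1 \<inter> ball 0 1 = {} \<or> - closure (f ` ball 0 1) \<inter> ball 0 1 = {}"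
    by (intro connectedD[OF _ op]) (simp_all add: open_Compl)
  moreover have "f 0 \<in> f ` ball 0 1 \<inter> ball 0 1" using f_ball[of 0] by simp
  ultimately have "- closure (f ` ball 0 1) \<inter> ball 0 1 = {}" by (elim disjE) simp_all
  thus "ball 0 1 \<subseteq> f ` ball 0 1" using cl by blast
qed

lemma homeomorphism_f: "\<exists>g. homeomorphism (ball 0 1) (ball 0 1) f g"
proof -
  obtain g where "homeomorphism (ball 0 1) (f ` ball 0 1) f g"
    by (rule invariance_of_domain_homeomorphism[OF open_ball continuous_f _ inj_f]) simp_all
  thus ?thesis unfolding surj_f by blast
qed

end

section \<open>Dilatation\<close>

text \<open>With denominators cleared the equation reads e (1 + |z|^2) = 2 k \<bullet> z, a line or
  a circle; k = c^2 - d^2 is nonzero since c and d are not equal up to sign.\<close>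

lemma negligible_equidistant: assumes "c \<noteq> d" "c \<noteq> - d" shows "negligible {z \<in> ball 0 1. horo c z = horo d z}"
proof -
  define e k where "e = (norm c)\<^sup>2 - (norm d)\<^sup>2" and "k = c\<^sup>2 - d\<^sup>2"
  have "k = (c - d) * (c + d)" by (simp add: k_def power2_eq_square algebra_simps)
  hence k: "k \<noteq> 0" using assms by (auto simp: add_eq_0_iff2)
  have sq: "(norm (a - cnj a * z))\<^sup>2 = (norm a)\<^sup>2 * (1 + (norm z)\<^sup>2) - 2 * (a\<^sup>2 \<bullet> z)" for a z
    unfolding cmod_power2 inner_complex_def by (simp add: power2_eq_square algebra_simps)
  have eq: "e * (1 + (norm z)\<^sup>2) = 2 * (k \<bullet> z)" if "z \<in> ball 0 1" "horo c z = horo d z" for z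
  proof -
    have "1 - (norm z)\<^sup>2 > 0" using that(1) sq_less_one[of z] by simp
    hence "(norm (c - cnj c * z))\<^sup>2 = (norm (d - cnj d * z))\<^sup>2" using that(2) by (simp add: horo_def)
    thus ?thesis unfolding sq e_def k_def by (simp add: inner_diff_left algebra_simps)
  qed
  show ?thesis
  proof (cases "e = 0")
    case True
    have "{z \<in> ball 0 1. horo c z = horo d z} \<subseteq> {z. k \<bullet> z = 0}" using eq True by auto
    thus ?thesis using negligible_subset negligible_hyperplane k by blast
  next
    case False
    define p where "p = k /\<^sub>R e"
    have "z \<in> sphere p (sqrt ((norm p)\<^sup>2 - 1))" if z: "z \<in> ball 0 1" "horo c z = horo d z" for z
    proof -
      have "2 * (p \<bullet> z) = 2 * (k \<bullet> z) / e" by (simp add: p_def divide_inverse)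
      also have "\<dots> = 1 + (norm z)\<^sup>2" using eq[OF z] False by (simp add: divide_eq_eq mult.commute)
      finally have "(dist p z)\<^sup>2 = (norm p)\<^sup>2 - 1"
        by (simp add: dist_norm power2_norm_eq_inner inner_diff_left inner_diff_right inner_commute)
      hence "dist p z = sqrt ((norm p)\<^sup>2 - 1)" by (metis real_sqrt_unique zero_le_dist)
      thus ?thesis by simp
    qed
    hence "{z \<in> ball 0 1. horo c z = horo d z} \<subseteq> sphere p (sqrt ((norm p)\<^sup>2 - 1))" by blast
    thus ?thesis using negligible_subset negligible_sphere by blast
  qed
qed

lemma countable_prim: "countable prim"
proof -
  have "prim \<subseteq> (\<lambda>(m, n). Complex (of_int m) (of_int n)) ` UNIV"
  proof
    fix z assume "z \<in> prim"
    then obtain m n :: int where "Re z = of_int m" "Im z = of_int n"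
      using prim_lat[of z] unfolding lat_def by (auto elim!: Ints_cases)
    hence "z = (\<lambda>(m, n). Complex (of_int m) (of_int n)) (m, n)" by (simp add: complex_eq_iff)
    thus "z \<in> (\<lambda>(m, n). Complex (of_int m) (of_int n)) ` UNIV" by blast
  qed
  thus ?thesis by (rule countable_subset) simp
qed

text \<open>Contains the boundaries of all standard pieces, not only the dual tree but also the
  geodesics from triangle centres to vertices.\<close>

definition equidistant :: "complex set" where
  "equidistant = {z \<in> ball 0 1. \<exists>c\<in>prim. \<exists>d\<in>prim. c \<noteq> d \<and> c \<noteq> - d \<and> horo c z = horo d z}"

lemma equidistant_null: "equidistant \<in> null_sets lebesgue"
proof -
  define I where "I = {(c, d). c \<in> prim \<and> d \<in> prim \<and> c \<noteq> d \<and> c \<noteq> - d}"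
  have "I \<subseteq> prim \<times> prim" by (auto simp: I_def)
  hence "countable I" by (rule countable_subset) (intro countable_SIGMA countable_prim)
  hence "negligible (\<Union>((\<lambda>(c, d). {z \<in> ball 0 1. horo c z = horo d z}) ` I))"
    by (intro negligible_countable_Union countable_image) (auto simp: I_def intro: negligible_equidistant[simplified])
  moreover have "equidistant = (\<Union>((\<lambda>(c, d). {z \<in> ball 0 1. horo c z = horo d z}) ` I))"
    by (auto simp: equidistant_def I_def)
  ultimately show ?thesis by (simp add: negligible_iff_null_sets)
qed

text \<open>These are the two complex derivatives of a linear map with Jacobian X. Their squared
  norms differ by X \<ge> c, and the larger one is at most (C + 1)^2.\<close>

lemma norm_Beltrami_le: 
  assumes "0 < c" "1 \<le> C" "c \<le> X" "X \<le> C" "\<bar>B\<bar> \<le> C + 1"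
  shows "norm (Complex ((X - 1) / 2) (B / 2)) \<le> sqrt (1 - c / (C + 1)\<^sup>2) * norm (Complex ((X + 1) / 2) (B / 2))"
proof -
  define P where "P = ((X + 1) / 2)\<^sup>2 + (B / 2)\<^sup>2"
  have C: "C + 1 > 0" using assms by simp
  have "(X + 1)\<^sup>2 \<le> (C + 1)\<^sup>2" "\<bar>B\<bar>\<^sup>2 \<le> (C + 1)\<^sup>2" using assms by (intro power_mono; simp)+
  hence "P \<le> (C + 1)\<^sup>2" unfolding P_def power_divide power2_abs using zero_le_power2[of "C + 1"] by (simp; linarith)
  hence "c / (C + 1)\<^sup>2 * P \<le> c / (C + 1)\<^sup>2 * (C + 1)\<^sup>2" using assms by (intro mult_left_mono) auto
  also have "\<dots> = c" using C by simp
  finally have "c / (C + 1)\<^sup>2 * P \<le> X" using assms by simp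
  moreover have "((X - 1) / 2)\<^sup>2 + (B / 2)\<^sup>2 = P - X" by (simp add: P_def power2_eq_square field_simps)
  ultimately have "((X - 1) / 2)\<^sup>2 + (B / 2)\<^sup>2 \<le> (1 - c / (C + 1)\<^sup>2) * P" by (simp add: algebra_simps)
  thus ?thesis by (simp add: cmod_def P_def flip: real_sqrt_mult)
qed

lemma kap_has_derivative:
  assumes "\<bar>Re m\<bar> \<le> 1 / 2" "((\<lambda>x. Re (garc l r x)) has_real_derivative X) (at (Re m))"
    "((\<lambda>x. Im (garc l r x)) has_real_derivative Y) (at (Re m))"
  shows "(kap l r has_derivative (\<lambda>v. Complex (X * Re v) ((Y - - Re m / sqrt (1 - (Re m)\<^sup>2)) * Re v + Im v))) (at m)"
proof -
  have re: "(Re has_derivative Re) (at m)" "(Im has_derivative Im) (at m)"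
    by (simp_all add: bounded_linear_imp_has_derivative bounded_linear_Re bounded_linear_Im)
  note d = DERIV_compose_FDERIV[OF assms(2) re(1)] DERIV_compose_FDERIV[OF assms(3) re(1)] DERIV_compose_FDERIV[OF sqrt_deriv(1)[OF assms(1)] re(1)]
  have "((\<lambda>m. of_real (Re (garc l r (Re m))) + \<i> * of_real (Im (garc l r (Re m)) + (Im m - sqrt (1 - (Re m)\<^sup>2)))) has_derivative
     (\<lambda>v. Complex (X * Re v) ((Y - - Re m / sqrt (1 - (Re m)\<^sup>2)) * Re v + Im v))) (at m)"
    by (rule has_derivative_eq_rhs, (rule derivative_intros d re)+) (simp add: fun_eq_iff complex_eq_iff algebra_simps)
  moreover have "(\<lambda>m. of_real (Re (garc l r (Re m))) + \<i> * of_real (Im (garc l r (Re m)) + (Im m - sqrt (1 - (Re m)\<^sup>2)))) = kap l r"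
    by (simp add: fun_eq_iff kap_def complex_eq_iff)
  ultimately show ?thesis by simp
qed

lemma hmap_has_derivative: assumes "cdet a b = 1" "z \<in> ball 0 1"
  shows "\<exists>g. (hmap a b has_derivative (\<lambda>v. g * v)) (at z)"
proof -
  have "a \<noteq> 0" using assms(1) by auto
  hence "a - cnj a * z \<noteq> 0" by (rule horo_den[OF assms(2)])
  hence "hmap a b field_differentiable at z" unfolding hmap_def by (intro derivative_intros) auto
  thus ?thesis by (auto simp: field_differentiable_def has_field_derivative_def)
qed

lemma hinv_has_derivative: assumes "cdet a b = 1" "Im w \<ge> 0"
  shows "\<exists>g. (hinv a b has_derivative (\<lambda>v. g * v)) (at w)"
proof -
  have "hinv a b field_differentiable at w" unfolding hinv_def using hinv_den[OF assms] by (intro derivative_intros) auto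
  thus ?thesis by (auto simp: field_differentiable_def has_field_derivative_def)
qed

context shear_map
begin

text \<open>Equality in a reduction inequality is a tie: |m| = 1 between a and b, Re m = 1/2 between
  b and b - a, Re m = -1/2 between b and a + b.\<close>

lemma standard_position: assumes "z \<in> ball 0 1 - equidistant"
  obtains a b where "ubasis a b" "\<bar>Re (hmap a b z)\<bar> < 1 / 2" "norm (hmap a b z) > 1"
proof -
  have zb: "z \<in> ball 0 1" using assms by simp
  obtain a b where m: "ubasis a b" "\<bar>Re (hmap a b z)\<bar> \<le> 1 / 2" "norm (hmap a b z) \<ge> 1" using reduced_exists[OF zb] by blast
  have d: "cdet a b = 1" by (rule ubasis_det[OF m(1)])
  define w where "w = hmap a b z"
  have pr: "a \<in> prim" "b \<in> prim" "b - a \<in> prim" "a + b \<in> prim"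
    using ubasis_prim ubasis_trans(5)[OF m(1), of 1] ubasis_trans(6)[OF m(1)] m(1) by auto
  have ne: "c \<noteq> d' \<and> c \<noteq> - d'" if "cdet c d' \<noteq> 0" for c d' using that by (auto simp: cdet_def)
  have no: "horo c z \<noteq> horo d' z" if "c \<in> prim" "d' \<in> prim" "cdet c d' \<noteq> 0" for c d'
    using assms zb that ne[OF that(3)] by (auto simp: equidistant_def)
  have hc: "horo (of_real x * a + of_real y * b) z = (norm (of_real x + of_real y * w))\<^sup>2 / Im w" for x y
    unfolding w_def by (rule horo_comb[OF zb d])
  have h: "horo a z = 1 / Im w" "horo b z = (norm w)\<^sup>2 / Im w" "horo (b - a) z = (norm (w - 1))\<^sup>2 / Im w" "horo (a + b) z = (norm (w + 1))\<^sup>2 / Im w"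
    using hc[of 1 0] hc[of 0 1] hc[of "-1" 1] hc[of 1 1] by (simp_all add: algebra_simps)
  have w1: "norm w \<noteq> 1" using no[OF pr(1,2)] h(1,2) d by auto
  have "(norm (w - 1))\<^sup>2 \<noteq> (norm w)\<^sup>2" "(norm (w + 1))\<^sup>2 \<noteq> (norm w)\<^sup>2"
    using no[OF pr(3,2)] no[OF pr(4,2)] h(2-4) d by (auto simp: cdet_def algebra_simps)
  hence "\<bar>Re w\<bar> \<noteq> 1 / 2" unfolding cmod_power2 by (auto simp: power2_eq_square algebra_simps abs_if split: if_splits)
  thus ?thesis using that[OF m(1)] m(2,3) w1 unfolding w_def by linarith
qed

lemma dilatation_f:
  obtains k where "0 \<le> k" "k < 1" 
    "\<And>z. z \<in> ball 0 1 - equidistant \<Longrightarrow> \<exists>fx fy. ((\<lambda>x. f (Complex x (Im z))) has_vector_derivative fx) (at (Re z)) \<and>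
                  ((\<lambda>y. f (Complex (Re z) y)) has_vector_derivative fy) (at (Im z)) \<and>
                  norm ((fx + \<i> * fy) / 2) \<le> k * norm ((fx - \<i> * fy) / 2)"
proof -
  obtain c C where cC: "0 < c" "c \<le> 1" "1 \<le> C" 
    "\<And>l r x. 1 / Eb \<le> l \<Longrightarrow> l \<le> Eb \<Longrightarrow> 1 / Eb \<le> r \<Longrightarrow> r \<le> Eb \<Longrightarrow> \<bar>x\<bar> \<le> 1 / 2 \<Longrightarrow>
      c \<le> Im (garc l r x) \<and> Im (garc l r x) \<le> C \<and>
      (\<exists>X Y. ((\<lambda>x. Re (garc l r x)) has_real_derivative X) (at x) \<and> ((\<lambda>x. Im (garc l r x)) has_real_derivative Y) (at x) \<and>
         c \<le> X \<and> X \<le> C \<and> \<bar>Y\<bar> \<le> C)"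
    using garc_bounds[OF Eb(1)] by blast
  define k where "k = sqrt (1 - c / (C + 1)\<^sup>2)"
  have C1: "1 \<le> (C + 1)\<^sup>2" using cC(3) by (intro one_le_power) simp
  hence "0 < c / (C + 1)\<^sup>2" by (intro divide_pos_pos cC(1)) linarith
  moreover have "c / (C + 1)\<^sup>2 \<le> 1" using C1 cC(2) by (subst divide_le_eq_1_pos) linarith+
  ultimately have k: "0 \<le> k" "k < 1" by (simp_all add: k_def)
  have "\<exists>fx fy. ((\<lambda>x. f (Complex x (Im z))) has_vector_derivative fx) (at (Re z)) \<and>
                  ((\<lambda>y. f (Complex (Re z) y)) has_vector_derivative fy) (at (Im z)) \<and>
                  norm ((fx + \<i> * fy) / 2) \<le> k * norm ((fx - \<i> * fy) / 2)" if z: "z \<in> ball 0 1 - equidistant" for z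
  proof -
    have zb: "z \<in> ball 0 1" using z by simp
    obtain a b where m: "ubasis a b" "\<bar>Re (hmap a b z)\<bar> < 1 / 2" "norm (hmap a b z) > 1" by (rule standard_position[OF z])
    obtain a' b' l r where q: "quad_lift a b a' b' l r" "exp (- Kb) \<le> l" "l \<le> exp Kb" "exp (- Kb) \<le> r" "r \<le> exp Kb"
      "\<And>z. z \<in> ball 0 1 \<Longrightarrow> hmap a b z \<in> stdpiece \<Longrightarrow> f z \<in> ball 0 1 \<and> hmap a' b' (f z) = kap l r (hmap a b z)"
      using edge_piece[OF m(1)] by metis
    have d: "cdet a b = 1" "cdet a' b' = 1" "l > 0" "r > 0" using ubasis_det[OF m(1)] q(1) by (auto simp: quad_lift_def)
    have anz: "a \<noteq> 0" using d by auto
    define w where "w = hmap a b z"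
    have w: "Im w > 0" "\<bar>Re w\<bar> \<le> 1 / 2" "norm w > 1" using horo_hmap(2)[OF zb d(1)] m by (simp_all add: w_def)
    obtain X Y where XY: "((\<lambda>x. Re (garc l r x)) has_real_derivative X) (at (Re w))" "((\<lambda>x. Im (garc l r x)) has_real_derivative Y) (at (Re w))"
      "c \<le> X" "X \<le> C" "\<bar>Y\<bar> \<le> C" using cC(4)[OF q(2-5)[folded Eb_def, unfolded Eb(2)] w(2)] by blast
    define B where "B = Y - - Re w / sqrt (1 - (Re w)\<^sup>2)"
    have B: "\<bar>B\<bar> \<le> C + 1" using sqrt_deriv(2)[OF w(2)] XY(5) unfolding B_def by linarith
    have kw: "Im (kap l r w) > 0" by (rule kap_region(1)[OF d(3,4)]) (use w in \<open>simp add: stdpiece_def\<close>)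
    obtain g0 where g0: "(hmap a b has_derivative (\<lambda>v. g0 * v)) (at z)" using hmap_has_derivative[OF d(1) zb] by blast
    obtain g1 where g1: "(hinv a' b' has_derivative (\<lambda>v. g1 * v)) (at (kap l r w))" using hinv_has_derivative[OF d(2)] kw by force
    have dk: "(kap l r has_derivative (\<lambda>v. Complex (X * Re v) (B * Re v + Im v))) (at w)"
      unfolding B_def by (rule kap_has_derivative[OF w(2) XY(1,2)])
    have "(hinv a' b' \<circ> (kap l r \<circ> hmap a b) has_derivative (\<lambda>v. g1 * v) \<circ> ((\<lambda>v. Complex (X * Re v) (B * Re v + Im v)) \<circ> (\<lambda>v. g0 * v))) (at z)"
      using dk g1 unfolding w_def by (intro diff_chain_at g0) (simp_all add: o_def)
    moreover have "\<exists>S. open S \<and> z \<in> S \<and> (\<forall>x\<in>S. (hinv a' b' \<circ> (kap l r \<circ> hmap a b)) x = f x)"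
    proof (intro exI conjI ballI)
      show "open (ball 0 1 \<inter> hmap a b -` ({w. \<bar>Re w\<bar> < 1 / 2} \<inter> {w. 1 < norm w}))"
        by (intro continuous_open_preimage continuous_on_hmap[OF anz] open_ball open_Int open_Collect_less continuous_intros) simp
      show "z \<in> ball 0 1 \<inter> hmap a b -` ({w. \<bar>Re w\<bar> < 1 / 2} \<inter> {w. 1 < norm w})" using zb m by simp
      fix x assume x: "x \<in> ball 0 1 \<inter> hmap a b -` ({w. \<bar>Re w\<bar> < 1 / 2} \<inter> {w. 1 < norm w})"
      hence "hmap a b x \<in> stdpiece" using horo_hmap(2)[OF _ d(1), of x] by (simp add: stdpiece_def)
      hence "f x \<in> ball 0 1" "hmap a' b' (f x) = kap l r (hmap a b x)" using q(6)[of x] x by auto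
      thus "(hinv a' b' \<circ> (kap l r \<circ> hmap a b)) x = f x" using hinv_hmap[OF d(2)] by (metis comp_apply)
    qed
    ultimately have df: "(f has_derivative (\<lambda>v. g1 * v) \<circ> ((\<lambda>v. Complex (X * Re v) (B * Re v + Im v)) \<circ> (\<lambda>v. g0 * v))) (at z)"
      (is "(_ has_derivative ?D) _") by (blast intro: has_derivative_transform_within_open)
    have dx: "((\<lambda>x. Complex x (Im z)) has_vector_derivative 1) (at (Re z))"
      unfolding Complex_eq by (auto intro!: derivative_eq_intros simp: has_vector_derivative_def scaleR_conv_of_real)
    have dy: "((\<lambda>y. Complex (Re z) y) has_vector_derivative \<i>) (at (Im z))"
      unfolding Complex_eq by (auto intro!: derivative_eq_intros simp: has_vector_derivative_def scaleR_conv_of_real)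
    have "((\<lambda>x. f (Complex x (Im z))) has_vector_derivative ?D 1) (at (Re z))"
      using vector_derivative_diff_chain_within[OF dx, of f ?D] df by (simp add: o_def has_derivative_at_withinI)
    moreover have "((\<lambda>y. f (Complex (Re z) y)) has_vector_derivative ?D \<i>) (at (Im z))"
      using vector_derivative_diff_chain_within[OF dy, of f ?D] df by (simp add: o_def has_derivative_at_withinI)
    moreover have "norm ((?D 1 + \<i> * ?D \<i>) / 2) \<le> k * norm ((?D 1 - \<i> * ?D \<i>) / 2)"
    proof -
      \<comment> \<open>The holomorphic charts multiply both complex derivatives by factors of the
        same modulus, so the ratio is that of \<open>kap\<close>.\<close>
      have 1: "(?D 1 + \<i> * ?D \<i>) / 2 = g1 * Complex ((X - 1) / 2) (B / 2) * cnj g0"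
        "(?D 1 - \<i> * ?D \<i>) / 2 = g1 * Complex ((X + 1) / 2) (B / 2) * g0"
        by (simp_all add: complex_eq_iff algebra_simps add_divide_distrib diff_divide_distrib)
      show ?thesis unfolding 1 norm_mult complex_mod_cnj
        using mult_left_mono[OF norm_Beltrami_le[OF cC(1,3) XY(3,4) B], of "norm g1 * norm g0"] by (simp add: k_def mult_ac)
    qed
    ultimately show ?thesis by blast
  qed
  thus ?thesis using that k by blast
qed

end

theorem theorem5p3:
  fixes h :: "complex \<Rightarrow> complex"
  assumes "h \<in> homeo_class_H"
  shows "quasiconformal (ball 0 1) (ball 0 1) (farey_extension h)"
proof -
  interpret shear_map h
    using assms by unfold_locales (simp_all add: homeo_class_H_def)
  obtain k where k: "0 \<le> k" "k < 1" 
    "\<And>z. z \<in> ball 0 1 - equidistant \<Longrightarrow> \<exists>fx fy. ((\<lambda>x. farey_extension h (Complex x (Im z))) has_vector_derivative fx) (at (Re z)) \<and>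
                  ((\<lambda>y. farey_extension h (Complex (Re z) y)) has_vector_derivative fy) (at (Im z)) \<and>
                  norm ((fx + \<i> * fy) / 2) \<le> k * norm ((fx - \<i> * fy) / 2)"
    using dilatation_f by metis
  show ?thesis
    unfolding quasiconformal_def
  proof (intro conjI exI[of _ k] k(1,2))
    show "\<exists>g. homeomorphism (ball 0 1) (ball 0 1) (farey_extension h) g" by (rule homeomorphism_f)
    show "ACL_on (ball 0 1) (farey_extension h)" by (rule ACL_on_lipschitz[OF f_lipschitz])
    show "AE z in lebesgue. z \<in> ball 0 1 \<longrightarrow> (\<exists>fx fy. ((\<lambda>x. farey_extension h (Complex x (Im z))) has_vector_derivative fx) (at (Re z)) \<and>
                  ((\<lambda>y. farey_extension h (Complex (Re z) y)) has_vector_derivative fy) (at (Im z)) \<and>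
                  norm ((fx + \<i> * fy) / 2) \<le> k * norm ((fx - \<i> * fy) / 2))"
      by (rule AE_mp[OF AE_not_in[OF equidistant_null]], rule AE_I2) (use k(3) in blast)
  qed
qed

end
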